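(* For $0<\varepsilon<1$, $0\le\delta\le\frac12$ and $F\in L^2(\mathbb R^3)$ let $U_{\varepsilon,\delta}\in H^1(\mathbb R^3)$ solve $$\int_{\mathbb R^3}\nabla U_{\varepsilon,\delta}\cdot\overline{\nabla\Phi}+\varepsilon^{-2}\delta^{-1}\sum_{j\in\mathbb Z^3}\int_{B_{\delta\varepsilon}(\varepsilon j)}U_{\varepsilon,\delta}\overline\Phi+\int_{\mathbb R^3}U_{\varepsilon,\delta}\overline\Phi=\int_{\mathbb R^3}F\overline\Phi\qquad\forall\Phi\in H^1(\mathbb R^3),$$ where for $\delta=0$ the second term is regarded as absent, and for each $\alpha\in[0,\infty)$ let $U_\alpha\in H^1(\mathbb R^3)$ solve $$\Big(-\Delta+\frac43\pi\alpha^2+1\Big)U_\alpha=F\quad\text{in }\mathbb R^3 .$$ Then there exists a positive constant $c$ independent of $\varepsilon$, $\delta$ and $F$ such that $$\|U_{\varepsilon,\delta}-U_{\delta/\varepsilon}\|_{H^1(\mathbb R^3)}\le c\,\varepsilon^{1/2}\|F\|_{L^2(\mathbb R^3)},\qquad\|U_{\varepsilon,\delta}-U_{\delta/\varepsilon}\|_{L^2(\mathbb R^3)}\le c\,\varepsilon\,\|F\|_{L^2(\mathbb R^3)}$$ for all $0<\varepsilon<1$, $0\le\delta\le\frac12$ and $F\in L^2(\mathbb R^3)$.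
   Context: $B_r(x)$ denotes the ball of radius $r$ in $\mathbb R^3$ centred at $x$. $L^2$ and $H^1$ are spaces of complex-valued functions. *)

theory Defs
  imports "HOL-Analysis.Analysis"
begin

text \<open>
  Elements of the Lebesgue and Sobolev spaces are represented by functions rather than by classes
  modulo null sets; every notion below depends only on the almost-everywhere class of its arguments.
\<close>

definition L2 :: "(real^3 \<Rightarrow> complex) set" where
  "L2 = {u \<in> borel_measurable lebesgue. integrable lebesgue (\<lambda>x. (cmod (u x))\<^sup>2)}"

definition L2_norm :: "(real^3 \<Rightarrow> complex) \<Rightarrow> real" where
  "L2_norm u = sqrt (LINT x|lebesgue. (cmod (u x))\<^sup>2)"

definition partial_deriv :: "3 \<Rightarrow> (real^3 \<Rightarrow> complex) \<Rightarrow> real^3 \<Rightarrow> complex" where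
  "partial_deriv i f x = frechet_derivative f (at x) (axis i 1)"

primrec C_k :: "nat \<Rightarrow> (real^3 \<Rightarrow> complex) \<Rightarrow> bool" where
  "C_k 0 f \<longleftrightarrow> continuous_on UNIV f"
| "C_k (Suc k) f \<longleftrightarrow> (\<forall>x. f differentiable at x) \<and> (\<forall>i. C_k k (partial_deriv i f))"

definition test_functions :: "(real^3 \<Rightarrow> complex) set" where
  "test_functions = {\<phi>. (\<forall>k. C_k k \<phi>) \<and> compact (closure {x. \<phi> x \<noteq> 0})}"

definition laplacian :: "(real^3 \<Rightarrow> complex) \<Rightarrow> real^3 \<Rightarrow> complex" where
  "laplacian f x = (\<Sum>i\<in>UNIV. partial_deriv i (partial_deriv i f) x)"

definition has_L2_weak_gradient :: "(real^3 \<Rightarrow> complex) \<Rightarrow> (real^3 \<Rightarrow> complex^3) \<Rightarrow> bool" where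
  "has_L2_weak_gradient u G \<longleftrightarrow>
     (\<forall>i. (\<lambda>x. G x $ i) \<in> L2) \<and>
     (\<forall>\<phi>\<in>test_functions. \<forall>i.
        (LINT x|lebesgue. u x * partial_deriv i \<phi> x) = - (LINT x|lebesgue. G x $ i * \<phi> x))"

definition H1 :: "(real^3 \<Rightarrow> complex) set" where
  "H1 = {u \<in> L2. \<exists>G. has_L2_weak_gradient u G}"

text \<open>The weak gradient is unique up to a null set, so the choice is immaterial under integrals.\<close>

definition weak_grad :: "(real^3 \<Rightarrow> complex) \<Rightarrow> real^3 \<Rightarrow> complex^3" where
  "weak_grad u = (SOME G. has_L2_weak_gradient u G)"

definition H1_norm :: "(real^3 \<Rightarrow> complex) \<Rightarrow> real" where
  "H1_norm u = sqrt ((L2_norm u)\<^sup>2 + (\<Sum>i\<in>UNIV. (L2_norm (\<lambda>x. weak_grad u x $ i))\<^sup>2))"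

definition lattice_point :: "int^3 \<Rightarrow> real^3" where
  "lattice_point j = (\<chi> i. real_of_int (j $ i))"

text \<open>
  For \<open>\<delta> \<le> 1/2\<close> the balls are pairwise disjoint, so the series over the lattice converges
  absolutely for square-integrable arguments.
\<close>

definition penalty :: "real \<Rightarrow> real \<Rightarrow> (real^3 \<Rightarrow> complex) \<Rightarrow> (real^3 \<Rightarrow> complex) \<Rightarrow> complex" where
  "penalty \<epsilon> \<delta> U \<Phi> =
     (if \<delta> = 0 then 0
      else of_real (1 / (\<epsilon>\<^sup>2 * \<delta>)) *
        (\<Sum>\<^sub>\<infinity>j\<in>(UNIV :: (int^3) set).
           LINT x:ball (\<epsilon> *\<^sub>R lattice_point j) (\<delta> * \<epsilon>)|lebesgue. U x * cnj (\<Phi> x)))"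

definition solves_penalised ::
    "real \<Rightarrow> real \<Rightarrow> (real^3 \<Rightarrow> complex) \<Rightarrow> (real^3 \<Rightarrow> complex) \<Rightarrow> bool" where
  "solves_penalised \<epsilon> \<delta> F U \<longleftrightarrow>
     U \<in> H1 \<and>
     (\<forall>\<Phi>\<in>H1.
        (LINT x|lebesgue. (\<Sum>i\<in>UNIV. weak_grad U x $ i * cnj (weak_grad \<Phi> x $ i)))
        + penalty \<epsilon> \<delta> U \<Phi>
        + (LINT x|lebesgue. U x * cnj (\<Phi> x))
        = (LINT x|lebesgue. F x * cnj (\<Phi> x)))"

text \<open>
  The constant-coefficient equation is understood in the sense of distributions on the whole space,
  for an unknown in \<^const>\<open>H1\<close>.
\<close>

definition solves_effective :: "real \<Rightarrow> (real^3 \<Rightarrow> complex) \<Rightarrow> (real^3 \<Rightarrow> complex) \<Rightarrow> bool" where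
  "solves_effective \<alpha> F U \<longleftrightarrow>
     U \<in> H1 \<and>
     (\<forall>\<phi>\<in>test_functions.
        (LINT x|lebesgue. U x * (- laplacian \<phi> x + of_real (4 / 3 * pi * \<alpha>\<^sup>2 + 1) * \<phi> x))
        = (LINT x|lebesgue. F x * \<phi> x))"

end

theory Submission
  imports Defs
begin

text \<open>
  Around each lattice point put a radial \<open>C\<^sup>1\<close> corrector \<open>n\<close> that vanishes outside \<open>B\<^sub>\<epsilon>\<^sub>/\<^sub>2\<close> and satisfies
  \<open>- \<Delta> n = \<epsilon>\<^sup>-\<^sup>2 \<delta>\<^sup>-\<^sup>1 1\<close> on \<open>B\<^sub>\<delta>\<^sub>\<epsilon>\<close> minus \<open>8 (\<delta>/\<epsilon>)\<^sup>2 1\<close> on \<open>B\<^sub>\<epsilon>\<^sub>/\<^sub>2\<close>. Inserting \<open>(1 - n) V\<close> into the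
  penalised form therefore trades the penalty for \<open>8 (\<delta>/\<epsilon>)\<^sup>2\<close> times the indicator of the balls of radius
  \<open>\<epsilon>/2\<close>, whose mean over a lattice cell is \<open>\<pi>/6\<close>; this produces the effective potential
  \<open>4/3 \<pi> (\<delta>/\<epsilon>)\<^sup>2\<close>. The averaging error is controlled by translation estimates in \<open>L\<^sup>1\<close>, and \<open>n\<close> and its
  gradient by Hardy-type inequalities, obtained from divergences of radial fields. Together with the
  \<open>H\<^sup>2\<close>-regularity of \<open>V\<close>, whose norms are needed with their dependence on \<open>\<delta>/\<epsilon>\<close>, the residual is
  \<open>O(\<epsilon>)\<close> in the energy norm, so that \<open>U - (1 - n) V\<close> is \<open>O(\<epsilon>)\<close> there. Finally \<open>n V\<close> is \<open>O(\<epsilon>)\<close> in \<open>L\<^sup>2\<close> but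
  only \<open>O(\<epsilon>\<^sup>1\<^sup>/\<^sup>2)\<close> in \<open>H\<^sup>1\<close>. All estimates are made for smooth compactly supported functions and
  extended by density.
\<close>

text \<open>The ratio \<open>\<alpha> = d / e\<close> is unbounded, so no constant may depend on it,
  and every factor \<alpha> that arises must be put where it can be paid for. The right-hand side
  pays for \<alpha>^2 on V and for \<alpha> on grad V, because the effective operator contains
  \<alpha>^2. The energy pays for one \<alpha> on the test function: although the penalty sees a
  function only in the holes, the corrector equation itself shows that \<alpha> times the L2 norm is
  at most five times the energy norm (\<open>coercivity\<close>). Smallness then comes from d =
  \<alpha> e or from shifts of length e. The number 8 balances mass: in units of e, density 1/d on a
  ball of radius d and density 8 d^2 on a ball of radius 1/2 have equal integrals, so the radial
  field vanishes from radius 1/2 on and neighbouring correctors do not interact. The gradient of n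
  is large near the holes, and its contribution to the squared H1 norm is bounded only to first
  order in d, whence e^(1/2).\<close>

section \<open>Partial derivatives as values of the Frechet derivative\<close>

lemma has_derivative_imp_partial_deriv:
  "(f has_derivative D) (at x) \<Longrightarrow> partial_deriv i f x = D (axis i 1)"
  unfolding partial_deriv_def using frechet_derivative_at by metis

lemma has_derivative_partial_deriv:
  assumes "f differentiable at x"
  shows "(f has_derivative (\<lambda>h. \<Sum>i\<in>UNIV. (h $ i) *\<^sub>R partial_deriv i f x))
      (at x)"
proof -
  let ?D = "frechet_derivative f (at x)"
  have D: "(f has_derivative ?D) (at x)"
    using assms by (simp add: frechet_derivative_works)
  then have lin: "linear ?D" by (rule has_derivative_linear)
  have "?D h = (\<Sum>i\<in>UNIV. (h $ i) *\<^sub>R partial_deriv i f x)" for h :: "real^3"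
  proof -
    have "?D h = ?D (\<Sum>i\<in>UNIV. (h $ i) *\<^sub>R axis i 1)"
      using basis_expansion[of h] by (simp add: scalar_mult_eq_scaleR)
    also have "\<dots> = (\<Sum>i\<in>UNIV. (h $ i) *\<^sub>R ?D (axis i 1))"
      using lin by (simp add: linear_sum linear_cmul)
    finally show ?thesis by (simp add: partial_deriv_def)
  qed
  then have "?D = (\<lambda>h. \<Sum>i\<in>UNIV. (h $ i) *\<^sub>R partial_deriv i f x)" by auto
  with D show ?thesis by simp
qed

lemma has_derivative_frechet:
  "f differentiable at x \<Longrightarrow> (f has_derivative frechet_derivative f (at x)) (at x)"
  by (simp add: frechet_derivative_works)

lemma partial_deriv_add:
  assumes "f differentiable at x" "g differentiable at x"
  shows "partial_deriv i (\<lambda>x. f x + g x) x = partial_deriv i f x + partial_deriv i g x"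
  by (subst has_derivative_imp_partial_deriv[OF has_derivative_add[OF assms[THEN
      has_derivative_frechet]]])
     (simp add: partial_deriv_def)

lemma partial_deriv_diff:
  assumes "f differentiable at x" "g differentiable at x"
  shows "partial_deriv i (\<lambda>x. f x - g x) x = partial_deriv i f x - partial_deriv i g x"
  by (subst has_derivative_imp_partial_deriv[OF has_derivative_diff[OF assms[THEN
      has_derivative_frechet]]])
     (simp add: partial_deriv_def)

lemma partial_deriv_mult:
  assumes "f differentiable at x" "g differentiable at x"
  shows "partial_deriv i (\<lambda>x. f x * g x) x = partial_deriv i f x * g x
      + f x * partial_deriv i g x"
  by (subst has_derivative_imp_partial_deriv[OF has_derivative_mult[OF assms[THEN
      has_derivative_frechet]]])
     (simp add: partial_deriv_def algebra_simps)

lemma partial_deriv_bounded_linear: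
  assumes "bounded_linear T" "f differentiable at x"
  shows "partial_deriv i (\<lambda>x. T (f x)) x = T (partial_deriv i f x)"
  by (subst has_derivative_imp_partial_deriv[OF bounded_linear.has_derivative
        [OF assms(1) has_derivative_frechet[OF assms(2)]]])
     (simp add: partial_deriv_def)

lemma differentiable_bounded_linear:
  "bounded_linear T \<Longrightarrow> f differentiable at x
      \<Longrightarrow> (\<lambda>x. T (f x)) differentiable at x"
  unfolding differentiable_def by (blast intro: bounded_linear.has_derivative)

lemma partial_deriv_affine:
  fixes c :: real
  assumes "f differentiable at (a + c *\<^sub>R x)"
  shows "(\<lambda>x. f (a + c *\<^sub>R x)) differentiable at x"
    and "partial_deriv i (\<lambda>x. f (a + c *\<^sub>R x)) x
        = of_real c * partial_deriv i f (a + c *\<^sub>R x)"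
proof -
  have D: "((\<lambda>x. a + c *\<^sub>R x) has_derivative (\<lambda>h. c *\<^sub>R h)) (at x)"
    by (auto intro!: derivative_eq_intros)
  have F: "((\<lambda>x. f (a + c *\<^sub>R x)) has_derivative (\<lambda>h. frechet_derivative f
      (at (a + c *\<^sub>R x)) (c *\<^sub>R h))) (at x)"
    using has_derivative_compose[OF D has_derivative_frechet[OF assms]] by simp
  then show "(\<lambda>x. f (a + c *\<^sub>R x)) differentiable at x"
    unfolding differentiable_def by blast
  have "linear (frechet_derivative f (at (a + c *\<^sub>R x)))"
    using has_derivative_frechet[OF assms] by (rule has_derivative_linear)
  then show "partial_deriv i (\<lambda>x. f (a + c *\<^sub>R x)) x
      = of_real c * partial_deriv i f (a + c *\<^sub>R x)"
    unfolding has_derivative_imp_partial_deriv[OF F]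
    by (simp add: partial_deriv_def linear_cmul flip: scaleR_conv_of_real)
qed

subsection \<open>Smooth functions\<close>

lemma C_k_SucD: "C_k (Suc k) f \<Longrightarrow> C_k k f"
proof (induction k arbitrary: f)
  case 0
  then show ?case
    by (auto simp: differentiable_imp_continuous_within continuous_on_eq_continuous_within)
qed auto

lemma C_k_continuous: "C_k k f \<Longrightarrow> continuous_on UNIV f"
  by (induction k) (auto dest: C_k_SucD simp del: C_k.simps(2))

lemma C_k_add: "C_k k f \<Longrightarrow> C_k k g \<Longrightarrow> C_k k (\<lambda>x. f x + g x)"
proof (induction k arbitrary: f g)
  case 0
  then show ?case by (auto intro: continuous_intros)
next
  case (Suc k)
  then have "partial_deriv i (\<lambda>x. f x + g x)
      = (\<lambda>x. partial_deriv i f x + partial_deriv i g x)" for i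
    by (auto simp: partial_deriv_add)
  with Suc show ?case by (auto simp: differentiable_add)
qed

lemma C_k_mult: "C_k k f \<Longrightarrow> C_k k g \<Longrightarrow> C_k k (\<lambda>x. f x * g x)"
proof (induction k arbitrary: f g)
  case 0
  then show ?case by (auto intro: continuous_intros)
next
  case (Suc k)
  then have "partial_deriv i (\<lambda>x. f x * g x)
    = (\<lambda>x. partial_deriv i f x * g x + f x * partial_deriv i g x)" for i
    by (auto simp: partial_deriv_mult)
  moreover from Suc.prems have "C_k k f" "C_k k g"
    by (auto intro: C_k_SucD simp del: C_k.simps(2))
  then have "C_k k (\<lambda>x. partial_deriv i f x * g x + f x * partial_deriv i g x)" for i
    using Suc.prems by (intro C_k_add Suc.IH) auto
  ultimately show ?case using Suc.prems by (simp add: differentiable_mult)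
qed

lemma C_k_bounded_linear: "bounded_linear T \<Longrightarrow> C_k k f
    \<Longrightarrow> C_k k (\<lambda>x. T (f x))"
proof (induction k arbitrary: f)
  case 0
  then show ?case
    using bounded_linear.continuous_on[of T UNIV f] by simp
next
  case (Suc k)
  then have "partial_deriv i (\<lambda>x. T (f x)) = (\<lambda>x. T (partial_deriv i f x))" for i
    by (auto simp: partial_deriv_bounded_linear)
  with Suc show ?case by (auto simp: differentiable_bounded_linear)
qed

lemma C_k_cmult: "C_k k f \<Longrightarrow> C_k k (\<lambda>x. c * f x)"
  by (rule C_k_bounded_linear[OF bounded_linear_mult_right])

lemma C_k_cnj: "C_k k f \<Longrightarrow> C_k k (\<lambda>x. cnj (f x))"
  by (rule C_k_bounded_linear[OF bounded_linear_cnj])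

lemma C_k_diff: "C_k k f \<Longrightarrow> C_k k g \<Longrightarrow> C_k k (\<lambda>x. f x - g x)"
  using C_k_add[of k f "\<lambda>x. - 1 * g x"] C_k_cmult[of k g "- 1"] by simp

lemma C_k_affine: "C_k k f \<Longrightarrow> C_k k (\<lambda>x. f (a + c *\<^sub>R x))"
proof (induction k arbitrary: f)
  case 0
  then show ?case by (auto intro!: continuous_intros continuous_on_compose2[of UNIV f])
next
  case (Suc k)
  then have "partial_deriv i (\<lambda>x. f (a + c *\<^sub>R x))
    = (\<lambda>x. of_real c * partial_deriv i f (a + c *\<^sub>R x))" for i
    by (auto simp: partial_deriv_affine)
  with Suc show ?case by (auto intro!: partial_deriv_affine C_k_cmult)
qed

definition smooth :: "(real^3 \<Rightarrow> complex) \<Rightarrow> bool" where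
  "smooth f \<longleftrightarrow> (\<forall>k. C_k k f)"

text \<open>Coinduction on the order of differentiation: \<open>C_k\<close> only ever asks about
  partial derivatives, so a set of differentiable functions closed under them consists of smooth
  functions. The sets used are the \<open>bumplike\<close> functions and the convolutions of a fixed
  function with test kernels.\<close>

lemma smoothI_coinduct:
  assumes "f \<in> S"
    and diff: "\<And>g x. g \<in> S \<Longrightarrow> g differentiable at x"
    and step: "\<And>g i. g \<in> S \<Longrightarrow> partial_deriv i g \<in> S"
  shows "smooth f"
proof -
  have "g \<in> S \<Longrightarrow> C_k k g" for k g
  proof (induction k arbitrary: g)
    case 0
    then show ?case using diff[of g]
      by (auto simp: continuous_on_eq_continuous_within intro: differentiable_imp_continuous_within)
  qed (use diff step in auto)
  with assms(1) show ?thesis by (auto simp: smooth_def)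
qed

lemma smooth_partial_deriv: "smooth f \<Longrightarrow> smooth (partial_deriv i f)"
  unfolding smooth_def using C_k.simps(2) by blast

lemma smooth_mult: "smooth f \<Longrightarrow> smooth g
    \<Longrightarrow> smooth (\<lambda>x. f x * g x)"
  by (auto simp: smooth_def C_k_mult)

lemma test_functions_iff: "f \<in> test_functions \<longleftrightarrow> smooth f
    \<and> bounded {x. f x \<noteq> 0}"
  by (simp add: test_functions_def smooth_def compact_closure)

text \<open>Outside the closed support the function is zero in a whole neighbourhood of the
  point.\<close>

lemma partial_deriv_supp: "{x. partial_deriv i f x \<noteq> 0} \<subseteq> closure {x. f x \<noteq>
    0}"
proof (rule ccontr)
  assume "\<not> ?thesis"
  then obtain x where x: "partial_deriv i f x \<noteq> 0" "x \<notin> closure {x. f x \<noteq> 0}"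
      by auto
  have "((\<lambda>x. 0) has_derivative (\<lambda>h. 0 :: complex)) (at x)" by simp
  moreover have "open (- closure {x. f x \<noteq> 0})" by auto
  moreover have "0 = f y" if "y \<in> - closure {x. f x \<noteq> 0}" for y
    using that closure_subset[of "{x. f x \<noteq> 0}"] by auto
  ultimately have "(f has_derivative (\<lambda>h. 0)) (at x)"
    using x(2) by (metis (no_types, lifting) ComplI has_derivative_transform_within_open)
  from has_derivative_imp_partial_deriv[OF this, of i] x(1) show False by simp
qed

lemma bounded_supp_partial_deriv:
  "bounded {x. f x \<noteq> 0} \<Longrightarrow> bounded {x. partial_deriv i f x \<noteq> 0}"
  using bounded_subset[OF bounded_closure partial_deriv_supp] .

lemma test_partial_deriv: "f \<in> test_functions
    \<Longrightarrow> partial_deriv i f \<in> test_functions"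
  by (simp add: test_functions_iff smooth_partial_deriv bounded_supp_partial_deriv)

section \<open>Continuously differentiable functions with bounded support\<close>

text \<open>The corrector is in general only once continuously differentiable, as its gradient has
  kinks on two spheres; its products with test functions stay in this class but not among the test
  functions. Test functions are reserved for the places where second derivatives or density are
  needed.\<close>

definition C1c :: "(real^3 \<Rightarrow> complex) \<Rightarrow> bool" where
  "C1c f \<longleftrightarrow> C_k 1 f \<and> bounded {x. f x \<noteq> 0}"

lemma C1c_test: "f \<in> test_functions \<Longrightarrow> C1c f"
  by (simp add: test_functions_iff smooth_def C1c_def)

lemma C1c_differentiable: "C1c f \<Longrightarrow> f differentiable at x"
  by (auto simp: C1c_def)

lemma C1c_continuous: "C1c f \<Longrightarrow> continuous_on UNIV f"
  unfolding C1c_def using C_k_continuous by blast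

lemma C1c_continuous_partial: "C1c f \<Longrightarrow> continuous_on UNIV (partial_deriv i f)"
  by (auto simp: C1c_def)

lemma C1c_bounded: "C1c f \<Longrightarrow> bounded {x. f x \<noteq> 0}"
  by (auto simp: C1c_def)

lemma C1c_bounded_partial: "C1c f \<Longrightarrow> bounded {x. partial_deriv i f x \<noteq> 0}"
  by (auto simp: C1c_def bounded_supp_partial_deriv)

lemma C1c_mult_left: "C1c f \<Longrightarrow> C_k 1 g \<Longrightarrow> C1c (\<lambda>x. g x * f x)"
  unfolding C1c_def by (auto simp: C_k_mult simp del: C_k.simps One_nat_def intro: bounded_subset)

lemma C1c_mult: "C1c f \<Longrightarrow> C1c g \<Longrightarrow> C1c (\<lambda>x. g x * f x)"
  by (rule C1c_mult_left) (auto simp: C1c_def)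

lemma C1c_cnj: "C1c f \<Longrightarrow> C1c (\<lambda>x. cnj (f x))"
  unfolding C1c_def by (auto simp: C_k_cnj simp del: C_k.simps One_nat_def)

lemma C1c_diff: "C1c f \<Longrightarrow> C1c g \<Longrightarrow> C1c (\<lambda>x. f x - g x)"
  unfolding C1c_def
  by (auto simp: C_k_diff simp del: C_k.simps One_nat_def
      intro: bounded_subset[of "{x. f x \<noteq> 0} \<union> {x. g x \<noteq> 0}"])

lemma C1c_add: "C1c f \<Longrightarrow> C1c g \<Longrightarrow> C1c (\<lambda>x. f x + g x)"
  unfolding C1c_def
  by (auto simp: C_k_add simp del: C_k.simps One_nat_def
      intro: bounded_subset[of "{x. f x \<noteq> 0} \<union> {x. g x \<noteq> 0}"])

lemma C1c_affine:
  assumes "C1c f" "c \<noteq> 0" shows "C1c (\<lambda>x. f (a + c *\<^sub>R x))"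
proof -
  have "{x. f (a + c *\<^sub>R x) \<noteq> 0} \<subseteq> (\<lambda>y. inverse c *\<^sub>R (y - a))
      ` {x. f x \<noteq> 0}"
  proof
    fix x assume "x \<in> {x. f (a + c *\<^sub>R x) \<noteq> 0}"
    then show "x \<in> (\<lambda>y. inverse c *\<^sub>R (y - a)) ` {x. f x \<noteq> 0}"
      using assms(2) by (intro image_eqI[of _ _ "a + c *\<^sub>R x"]) auto
  qed
  moreover have "bounded ((\<lambda>y. inverse c *\<^sub>R (y - a)) ` {x. f x \<noteq> 0})"
    using bounded_scaling[OF bounded_translation_minus[OF C1c_bounded[OF assms(1)], of a], of
        "inverse c"]
    by (simp add: image_image)
  ultimately show ?thesis
    using assms C_k_affine[of 1 f a c]
        by (auto simp: C1c_def intro: bounded_subset simp del: C_k.simps One_nat_def)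
qed

lemma test_affine: 
  assumes "f \<in> test_functions" "c \<noteq> 0"
      shows "(\<lambda>x. f (a + c *\<^sub>R x)) \<in> test_functions"
  using assms C1c_affine[OF C1c_test[OF assms(1)] assms(2), of a]
  by (auto simp: test_functions_iff smooth_def C1c_def C_k_affine simp del: C_k.simps One_nat_def)

lemma test_cmult: "f \<in> test_functions
    \<Longrightarrow> (\<lambda>x. c * f x) \<in> test_functions"
  by (auto simp: test_functions_iff smooth_def C_k_cmult intro: bounded_subset)

lemma test_mult_left: "f \<in> test_functions \<Longrightarrow> smooth g
    \<Longrightarrow> (\<lambda>x. g x * f x) \<in> test_functions"
  by (auto simp: test_functions_iff smooth_mult intro: bounded_subset)

lemma continuous_bounded_supp_bounded:
  fixes f :: "'a::euclidean_space \<Rightarrow> 'b::real_normed_vector"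
  assumes "continuous_on UNIV f" "bounded {x. f x \<noteq> 0}"
  obtains M where "M \<ge> 0" "\<And>x. norm (f x) \<le> M"
proof -
  have "compact (f ` closure {x. f x \<noteq> 0})"
    using assms by (intro compact_continuous_image) (auto simp: compact_closure intro:
        continuous_on_subset)
  then have "bounded (f ` closure {x. f x \<noteq> 0})"
    by (rule compact_imp_bounded)
  then obtain M where M: "\<forall>y\<in>f ` closure {x. f x \<noteq> 0}. norm y \<le> M"
    unfolding bounded_iff by blast
  have "norm (f x) \<le> max M 0" for x
  proof (cases "f x = 0")
    case False
    then have "x \<in> closure {x. f x \<noteq> 0}"
      using subsetD[OF closure_subset, of x "{x. f x \<noteq> 0}"] by simp
    with M show ?thesis by (simp add: le_max_iff_disj)
  qed auto
  then show ?thesis using that[of "max M 0"] by auto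
qed

lemma C1c_bound_partial:
  assumes "C1c f" obtains M where "M \<ge> 0" "\<And>i x. norm (partial_deriv i f x) \<le> M"
proof -
  have "\<forall>i. \<exists>M\<ge>0. \<forall>x. norm (partial_deriv i f x) \<le> M"
    using continuous_bounded_supp_bounded[OF C1c_continuous_partial C1c_bounded_partial] assms
        by metis
  then obtain M where M: "\<And>i. M i \<ge> 0" "\<And>i x. norm (partial_deriv i f x) \<le> M i"
      by metis
  have "norm (partial_deriv i f x) \<le> (\<Sum>i\<in>UNIV. M i)" for i x
    using M member_le_sum[of i UNIV M] order_trans by fastforce
  then show ?thesis using that[of "\<Sum>i\<in>UNIV. M i"] M by (simp add: sum_nonneg)
qed

lemma C1c_lipschitz:
  assumes "C1c f" obtains L where "L \<ge> 0" "\<And>x y. norm (f x - f y) \<le> L * norm (x - y)"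
proof -
  obtain M where M: "M \<ge> 0" "\<And>i x. norm (partial_deriv i f x) \<le> M"
    using C1c_bound_partial[OF assms] by blast
  have "norm (f x - f y) \<le> 3 * M * norm (x - y)" for x y
  proof (rule differentiable_bound[of UNIV f])
    show "(f has_derivative (\<lambda>h. \<Sum>i\<in>UNIV. (h $ i) *\<^sub>R partial_deriv i f z))
        (at z within UNIV)" for z
      using has_derivative_partial_deriv[OF C1c_differentiable[OF assms]] by simp
    show "onorm (\<lambda>h. \<Sum>i\<in>UNIV. (h $ i) *\<^sub>R partial_deriv i f z) \<le> 3 * M"
        for z
    proof (rule onorm_bound)
      fix h :: "real^3"
      have "norm (\<Sum>i\<in>UNIV. (h $ i) *\<^sub>R partial_deriv i f z)
          \<le> (\<Sum>i\<in>(UNIV::3 set). norm h * M)"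
        by (rule sum_norm_le) (auto intro!: mult_mono M component_le_norm_cart)
      then show "norm (\<Sum>i\<in>UNIV. (h $ i) *\<^sub>R partial_deriv i f z)
          \<le> 3 * M * norm h"
        by (simp add: mult_ac)
    qed (use M in auto)
  qed auto
  then show ?thesis using that[of "3 * M"] M by auto
qed

subsection \<open>A smooth bump\<close>

text \<open>
  The derivative of \<open>flat_exp m\<close> is a combination of \<open>flat_exp (m + 1)\<close> and \<open>flat_exp (m + 2)\<close>, so the family
  is closed under differentiation.
\<close>

definition flat_exp :: "nat \<Rightarrow> real \<Rightarrow> real" where
  "flat_exp m t = (if t > 0 then exp (- 1 / t) / t ^ m else 0)"

lemma flat_exp_tendsto: "((\<lambda>t. exp (- 1 / t) / t ^ m) \<longlongrightarrow> 0)
    (at_right (0::real))"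
proof -
  have "((\<lambda>s. s ^ m / exp s) \<longlongrightarrow> 0) (at_top :: real filter)"
    by (rule tendsto_power_div_exp_0)
  then have "((\<lambda>t. inverse t ^ m / exp (inverse t)) \<longlongrightarrow> 0)
      (at_right (0::real))"
    by (rule filterlim_compose[OF _ filterlim_inverse_at_top_right])
  then show ?thesis by (simp add: field_simps exp_minus power_inverse)
qed

lemma flat_exp_has_derivative:
  "(flat_exp m has_real_derivative (flat_exp (m + 2) t - real m * flat_exp (m + 1) t)) (at t)"
proof -
  consider "t > 0" | "t < 0" | "t = 0" by linarith
  then show ?thesis
  proof cases
    case 1
    have "((\<lambda>t. exp (- 1 / t) / t ^ m) has_real_derivative (flat_exp (m + 2) t
        - real m * flat_exp (m + 1) t)) (at t)"
    proof (cases m)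
      case 0
      with 1 show ?thesis
        by (auto intro!: derivative_eq_intros simp: flat_exp_def power2_eq_square)
    next
      case (Suc k)
      with 1 show ?thesis
        by (auto intro!: derivative_eq_intros simp: flat_exp_def power2_eq_square field_simps)
           (metis Suc_pred not_gr_zero power_Suc One_nat_def)
    qed
    moreover have "\<forall>\<^sub>F s in nhds t. s > 0" using 1
        by (intro eventually_nhds_in_open[of "{0<..}", simplified]) auto
    then have "\<forall>\<^sub>F s in nhds t. exp (- 1 / s) / s ^ m = flat_exp m s"
      by eventually_elim (simp add: flat_exp_def)
    ultimately show ?thesis by (rule iffD1[OF DERIV_cong_ev[OF refl _ refl], rotated])
  next
    case 2
    have "\<forall>\<^sub>F s in nhds t. s < 0" using 2
        by (intro eventually_nhds_in_open[of "{..<0}", simplified]) auto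
    then have "\<forall>\<^sub>F s in nhds t. 0 = flat_exp m s"
      by eventually_elim (simp add: flat_exp_def)
    then have "(flat_exp m has_real_derivative 0) (at t)"
      by (rule iffD1[OF DERIV_cong_ev[OF refl _ refl]]) simp
    with 2 show ?thesis by (simp add: flat_exp_def)
  next
    case 3
    \<comment> \<open>Division by \<open>h\<close> only raises the exponent in the denominator, so
      the limit is the one known for \<open>Suc m\<close>.\<close>
    have "((\<lambda>h. flat_exp m h / h) \<longlongrightarrow> 0) (at_right 0)"
      by (rule Lim_transform_eventually[OF flat_exp_tendsto[of "Suc m"]])
         (auto simp: flat_exp_def eventually_at_filter)
    moreover have "((\<lambda>h. flat_exp m h / h) \<longlongrightarrow> 0) (at_left 0)"
      by (rule Lim_transform_eventually[OF tendsto_const])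
         (auto simp: flat_exp_def eventually_at_filter)
    ultimately have "((\<lambda>h. flat_exp m h / h) \<longlongrightarrow> 0) (at 0)"
      by (simp add: filterlim_split_at)
    with 3 show ?thesis by (simp add: DERIV_def flat_exp_def)
  qed
qed

text \<open>Combinations of the functions \<open>flat_exp m (1 - x \<bullet> x)\<close> with
  polynomial coefficients. Differentiating the base functions brings out a factor -2 x_j and raises
  \<open>m\<close>, so the class is stable under partial derivatives, as
  \<open>smoothI_coinduct\<close> requires.\<close>

inductive bumplike :: "(real^3 \<Rightarrow> complex) \<Rightarrow> bool" where
  base: "bumplike (\<lambda>x. of_real (flat_exp m (1 - x \<bullet> x)))"
| coord: "bumplike f \<Longrightarrow> bumplike (\<lambda>x. of_real (x $ i) * f x)"
| add: "bumplike f \<Longrightarrow> bumplike g \<Longrightarrow> bumplike (\<lambda>x. f x + g x)"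
| cmult: "bumplike f \<Longrightarrow> bumplike (\<lambda>x. c * f x)"

lemma has_derivative_coord:
  "((\<lambda>x. of_real (x $ i) :: complex) has_derivative (\<lambda>h. of_real (h $ i))) (at x)"
  by (rule bounded_linear_imp_has_derivative)
     (rule bounded_linear_compose[OF bounded_linear_of_real bounded_linear_vec_nth])

lemma bumplike_step:
  assumes "bumplike f"
  shows "(\<forall>x. f differentiable at x) \<and> (\<forall>j. bumplike (partial_deriv j f))"
  using assms
proof induction
  case (base m)
  have D: "((\<lambda>x. of_real (flat_exp m (1 - x \<bullet> x)) :: complex) has_derivative
     (\<lambda>h. of_real ((flat_exp (m + 2) (1 - x \<bullet> x) - real m * flat_exp (m + 1)
         (1 - x \<bullet> x)) * (- 2 * (x \<bullet> h))))) (at x)"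
    for x :: "real^3"
  proof -
    have "((\<lambda>x::real^3. 1 - x \<bullet> x) has_derivative (\<lambda>h.
        - 2 * (x \<bullet> h))) (at x)"
      by (auto intro!: derivative_eq_intros simp: inner_commute)
    from has_derivative_compose[OF this flat_exp_has_derivative[unfolded has_field_derivative_def]]
    show ?thesis
      using bounded_linear.has_derivative[OF bounded_linear_of_real] by blast
  qed
  have "partial_deriv j (\<lambda>x. of_real (flat_exp m (1 - x \<bullet> x)) :: complex) =
     (\<lambda>x. - 2 * (of_real (x $ j) * (of_real (flat_exp (m + 2) (1 - x \<bullet> x))
        + - of_nat m * of_real (flat_exp (m + 1) (1 - x \<bullet> x)))))" for j
    by (rule ext, subst has_derivative_imp_partial_deriv[OF D]) (simp add: inner_axis algebra_simps)
  then have "bumplike (partial_deriv j (\<lambda>x. of_real (flat_exp m (1 - x \<bullet> x))))"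
      for j
    by (simp only:) (rule bumplike.cmult bumplike.coord bumplike.add bumplike.base)+
  with D show ?case unfolding differentiable_def by blast
next
  case (coord f i)
  have d: "(\<lambda>x::real^3. of_real (x $ i) :: complex) differentiable at x" for x
    using has_derivative_coord unfolding differentiable_def by blast
  have p: "partial_deriv j (\<lambda>x. of_real (x $ i)) x = (if i = j then 1 else 0)" for j x
    by (subst has_derivative_imp_partial_deriv[OF has_derivative_coord]) (auto simp: axis_def)
  have "partial_deriv j (\<lambda>x. of_real (x $ i) * f x) =
    (\<lambda>x. (if i = j then 1 else 0) * f x + of_real (x $ i) * partial_deriv j f x)" for j
    using coord d by (intro ext) (simp add: partial_deriv_mult p)
  then have "bumplike (partial_deriv j (\<lambda>x. of_real (x $ i) * f x))" for j
    using coord by (simp only: bumplike.add bumplike.cmult bumplike.coord)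
  with coord d show ?case by (auto simp: differentiable_mult)
next
  case (add f g)
  then have "partial_deriv j (\<lambda>x. f x + g x)
      = (\<lambda>x. partial_deriv j f x + partial_deriv j g x)" for j
    by (auto simp: partial_deriv_add)
  with add show ?case by (auto simp: differentiable_add intro: bumplike.add)
next
  case (cmult f c)
  then have "partial_deriv j (\<lambda>x. c * f x) = (\<lambda>x. c * partial_deriv j f x)" for j
    by (auto simp: partial_deriv_bounded_linear[OF bounded_linear_mult_right])
  with cmult show ?case by (auto simp: differentiable_bounded_linear[OF bounded_linear_mult_right]
      intro: bumplike.cmult)
qed

definition bump :: "real^3 \<Rightarrow> real" where
  "bump x = flat_exp 0 (1 - x \<bullet> x)"

lemma bump_nonneg: "bump x \<ge> 0" and bump_pos: "norm x < 1 \<Longrightarrow> bump x > 0"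
  and bump_zero: "norm x \<ge> 1 \<Longrightarrow> bump x = 0" and bump_le: "bump x \<le> exp (- 1)"
  using norm_eq_sqrt_inner[of x] 
  by (auto simp: bump_def flat_exp_def real_sqrt_ge_1_iff field_simps intro: order_trans[OF _
      inner_ge_zero])

lemma test_bump: "(\<lambda>x. of_real (bump x)) \<in> test_functions"
proof -
  have "smooth (\<lambda>x. of_real (bump x))"
    by (rule smoothI_coinduct[of _ "Collect bumplike"])
       (use bumplike_step bumplike.base[of 0] in \<open>auto simp: bump_def\<close>)
  moreover have "{x. of_real (bump x) \<noteq> (0::complex)} \<subseteq> ball 0 1"
    using bump_zero by (force simp: not_less)
  ultimately show ?thesis
    using bounded_subset[OF bounded_ball] by (auto simp: test_functions_iff)
qed

subsection \<open>Integration by parts\<close>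

lemma integrable_bounded_supp:
  fixes f :: "real^3 \<Rightarrow> 'b::{banach, second_countable_topology}"
  assumes "f \<in> borel_measurable lebesgue" "\<And>x. norm (f x)
      \<le> M" "bounded {x. f x \<noteq> 0}"
  shows "integrable lebesgue f"
proof -
  obtain R where R: "{x. f x \<noteq> 0} \<subseteq> ball 0 R"
    using bounded_subset_ballD[OF assms(3)] by blast
  have "f x = 0" if "x \<notin> ball 0 R" for x using R that by blast
  then show ?thesis
    using assms emeasure_bounded_finite[OF bounded_ball, of 0 R]
    by (intro integrableI_bounded_set[of "ball 0 R" lebesgue f M] AE_I2) auto
qed

lemma borel_imp_lebesgue: "f \<in> borel_measurable borel
    \<Longrightarrow> f \<in> borel_measurable lebesgue"
  by (simp add: measurable_completion)

lemma continuous_lebesgue: "continuous_on UNIV f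
    \<Longrightarrow> f \<in> borel_measurable lebesgue"
  by (intro borel_imp_lebesgue borel_measurable_continuous_onI)

lemma integrable_continuous_bounded_supp:
  fixes f :: "real^3 \<Rightarrow> complex"
  assumes "continuous_on UNIV f" "bounded {x. f x \<noteq> 0}"
  shows "integrable lebesgue f"
  using continuous_bounded_supp_bounded[OF assms] integrable_bounded_supp[OF continuous_lebesgue]
      assms
  by metis

text \<open>The change of variables is that of \<open>lborel\<close>, whence the Borel
  measurability; the factor is the determinant of the dilation in dimension 3.\<close>

lemma lebesgue_integral_affine:
  fixes f :: "real^3 \<Rightarrow> 'b::{banach, second_countable_topology}"
  assumes f: "f \<in> borel_measurable borel" and c: "c \<noteq> 0"
  shows "integral\<^sup>L lebesgue f
      = \<bar>c\<bar> ^ 3 *\<^sub>R (LINT x|lebesgue. f (t + c *\<^sub>R x))"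
proof -
  have "integral\<^sup>L lborel f
      = integral\<^sup>L (density (distr lborel borel (\<lambda>x. t + c *\<^sub>R x))
      (\<lambda>_. \<bar>c\<bar>^DIM(real^3))) f"
    using lborel_affine[OF c, of t] by metis
  also have "\<dots> = \<bar>c\<bar> ^ 3 *\<^sub>R (LINT x|lborel. f (t + c *\<^sub>R x))"
    using f by (subst integral_density) (auto simp: integral_distr)
  finally show ?thesis
    using f by (simp add: integral_completion)
qed

lemma lebesgue_integral_translation:
  fixes f :: "real^3 \<Rightarrow> 'b::{banach, second_countable_topology}"
  assumes "f \<in> borel_measurable borel"
  shows "(LINT x|lebesgue. f (t + x)) = integral\<^sup>L lebesgue f"
  using lebesgue_integral_affine[OF assms, of 1 t] by simp

lemma lebesgue_integral_reflection:
  fixes f :: "real^3 \<Rightarrow> 'b::{banach, second_countable_topology}"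
  assumes "f \<in> borel_measurable borel"
  shows "(LINT x|lebesgue. f (t - x)) = integral\<^sup>L lebesgue f"
  using lebesgue_integral_affine[OF assms, of "-1" t] by simp

section \<open>Bounded Lipschitz functions and derivatives that exist almost everywhere\<close>

text \<open>An algebra large enough for radial profiles with kinks, whose difference quotients are
  nevertheless bounded uniformly, as dominated convergence requires in the integration by parts
  below.\<close>

definition lipb :: "('a::real_normed_vector \<Rightarrow> 'b::real_normed_vector) \<Rightarrow>
    bool" where
  "lipb f \<longleftrightarrow> (\<exists>L\<ge>0. \<exists>M\<ge>0. (\<forall>x. norm (f x)
      \<le> M) \<and> (\<forall>x y. norm (f x - f y) \<le> L * norm (x - y)))"

lemma lipbI:
  assumes "\<And>x. norm (f x) \<le> M" "\<And>x y. norm (f x - f y) \<le> L * norm (x - y)"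
  shows "lipb f"
proof -
  have "L * norm (x - y) \<le> max L 0 * norm (x - y)" for x y :: 'a
    by (intro mult_right_mono) auto
  then have "norm (f x - f y) \<le> max L 0 * norm (x - y)" for x y
    using assms(2) order_trans by blast
  moreover have "norm (f x) \<le> max M 0" for x using assms(1)[of x] by simp
  ultimately show ?thesis unfolding lipb_def by (meson max.cobounded2)
qed

lemma lipbE:
  assumes "lipb f"
  obtains L M where "L \<ge> 0" "M \<ge> 0" "\<And>x. norm (f x)
      \<le> M" "\<And>x y. norm (f x - f y) \<le> L * norm (x - y)"
  using assms unfolding lipb_def by blast

lemma lipb_const: "lipb (\<lambda>x. c)"
  by (rule lipbI[of _ "norm c" 0]) auto

lemma lipb_mult:
  fixes f g :: "'a::real_normed_vector \<Rightarrow> 'b::real_normed_algebra"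
  assumes "lipb f" "lipb g" shows "lipb (\<lambda>x. f x * g x)"
proof -
  obtain L M where f: "L \<ge> 0" "M \<ge> 0" "\<And>x. norm (f x)
      \<le> M" "\<And>x y. norm (f x - f y) \<le> L * norm (x - y)"
    using lipbE[OF assms(1)] by blast
  obtain L' M' where g: "L' \<ge> 0" "M' \<ge> 0" "\<And>x. norm (g x)
      \<le> M'" "\<And>x y. norm (g x - g y) \<le> L' * norm (x - y)"
    using lipbE[OF assms(2)] by blast
  show ?thesis
  proof (rule lipbI[of _ "M * M'" "M * L' + L * M'"])
    show "norm (f x * g x) \<le> M * M'" for x
      using f g by (intro order_trans[OF norm_mult_ineq] mult_mono) auto
    fix x y
    have "f x * g x - f y * g y = f x * (g x - g y) + (f x - f y) * g y"
      by (simp add: algebra_simps)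
    also have "norm \<dots> \<le> M * (L' * norm (x - y)) + (L * norm (x - y)) * M'"
      using f g by (intro norm_triangle_le add_mono order_trans[OF norm_mult_ineq] mult_mono) auto
    finally show "norm (f x * g x - f y * g y) \<le> (M * L' + L * M') * norm (x - y)"
      by (simp add: algebra_simps)
  qed
qed

lemma lipb_compose:
  assumes "lipb f" "\<And>x y. norm (g x - g y) \<le> K * norm (x - y)"
  shows "lipb (\<lambda>x. f (g x))"
proof -
  obtain L M where f: "L \<ge> 0" "M \<ge> 0" "\<And>x. norm (f x)
      \<le> M" "\<And>x y. norm (f x - f y) \<le> L * norm (x - y)"
    using lipbE[OF assms(1)] by blast
  show ?thesis
  proof (rule lipbI[of _ M "L * K"])
    show "norm (f (g x) - f (g y)) \<le> L * K * norm (x - y)" for x y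
      using f(4)[of "g x" "g y"] mult_left_mono[OF assms(2)[of x y] f(1)] by (simp add: mult.assoc)
  qed (rule f)
qed

text \<open>Meant for truncations: \<open>max 0\<close> does not enlarge differences. One value of
  \<open>h\<close> bounds all the others because \<open>f\<close> is bounded.\<close>

lemma lipb_contraction:
  assumes "lipb f" "\<And>x y. norm (h x - h y) \<le> norm (f x - f y)" "norm (h z) \<le> K"
  shows "lipb h"
proof -
  obtain L M where f: "L \<ge> 0" "M \<ge> 0" "\<And>x. norm (f x)
      \<le> M" "\<And>x y. norm (f x - f y) \<le> L * norm (x - y)"
    using lipbE[OF assms(1)] by blast
  show ?thesis
  proof (rule lipbI[of _ "M + M + K" L])
    show "norm (h x - h y) \<le> L * norm (x - y)" for x y
      using assms(2)[of x y] f(4)[of x y] by linarith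
    show "norm (h x) \<le> M + M + K" for x
      using norm_triangle_sub[of "h x" "h z"] assms(2)[of x z] norm_triangle_ineq4[of "f x"
          "f z"] f(3)[of x] f(3)[of z] assms(3)
      by linarith
  qed
qed

lemma lipb_continuous: "lipb f \<Longrightarrow> continuous_on UNIV f"
proof -
  assume "lipb f"
  then obtain L M where "L \<ge> 0" "\<And>x y. norm (f x - f y) \<le> L * norm (x - y)"
    using lipbE by metis
  then have "L-lipschitz_on UNIV f" by (intro lipschitz_onI) (auto simp: dist_norm)
  then show ?thesis by (rule lipschitz_on_continuous_on)
qed

lemma lipb_C1c: "C1c f \<Longrightarrow> lipb f"
  using C1c_lipschitz[of f] continuous_bounded_supp_bounded[OF C1c_continuous C1c_bounded, of f]
      lipbI[of f]
  by metis

lemma has_derivative_directional_LIMSEQ: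
  fixes f :: "'a::real_normed_vector \<Rightarrow> 'b::real_normed_vector"
  assumes "(f has_derivative D) (at x)"
  shows "(\<lambda>n. real (Suc n) *\<^sub>R (f (x + (1 / real (Suc n)) *\<^sub>R v) - f x))
      \<longlonglongrightarrow> D v"
proof -
  have D: "bounded_linear D" using assms by (rule has_derivative_bounded_linear)
  then interpret D: bounded_linear D .
  show ?thesis
  \<comment> \<open>For \<open>v = 0\<close> the points \<open>y n\<close> never leave
    \<open>x\<close>, so the punctured filter \<open>at x\<close> cannot be used; the claim is then
    trivial.\<close>
  proof (cases "v = 0")
    case False
    define y where "y n = x + (1 / real (Suc n)) *\<^sub>R v" for n
    have "(\<lambda>n. 1 / real (Suc n)) \<longlonglongrightarrow> 0"
        by (rule LIMSEQ_Suc[OF lim_1_over_n])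
    then have "y \<longlonglongrightarrow> x + 0 *\<^sub>R v" unfolding y_def
        by (intro tendsto_intros)
    then have "filterlim y (at x) sequentially"
      using False by (auto simp: filterlim_at y_def)
    moreover have "((\<lambda>y. norm (f y - f x - D (y - x)) / norm (y - x)) \<longlongrightarrow>
        0) (at x)"
      using assms by (simp add: has_derivative_iff_norm)
    ultimately have "(\<lambda>n. norm (f (y n) - f x - D (y n - x)) / norm (y n - x))
        \<longlonglongrightarrow> 0"
      by (rule filterlim_compose[rotated])
    then have "(\<lambda>n. norm v * (norm (f (y n) - f x - D (y n - x)) / norm (y n - x)))
        \<longlonglongrightarrow> norm v * 0"
      by (intro tendsto_intros)
    moreover have "norm v * (norm (f (y n) - f x - D (y n - x)) / norm (y n - x))
        = norm (real (Suc n) *\<^sub>R (f (y n) - f x) - D v)" for n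
    proof -
      have "real (Suc n) *\<^sub>R (f (y n) - f x) - D v
          = real (Suc n) *\<^sub>R (f (y n) - f x - D (y n - x))"
        by (simp add: y_def D.scaleR scaleR_diff_right del: of_nat_Suc)
      then show ?thesis using False by (simp add: y_def del: of_nat_Suc)
    qed
    ultimately have "(\<lambda>n. norm (real (Suc n) *\<^sub>R (f (y n) - f x) - D v))
        \<longlonglongrightarrow> 0" by simp
    then show ?thesis unfolding y_def by (rule LIM_zero_cancel[OF tendsto_norm_zero_cancel])
  qed (simp add: D.zero)
qed

text \<open>By translation invariance the difference quotients have integral zero. They are bounded
  by the Lipschitz constant and, since the step 1/(n+1) is at most 1, vanish off a ball whose radius
  exceeds that of the support by 1; dominated convergence applies. Asking for the derivative almost
  everywhere admits profiles with kinks on spheres.\<close>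

lemma integral_partial_eq_0:
  fixes f g :: "real^3 \<Rightarrow> complex"
  assumes lip: "lipb f" and supp: "bounded {x. f x \<noteq> 0}"
    and g: "g \<in> borel_measurable lebesgue"
    and ae: "AE x in lebesgue. \<exists>D. (f has_derivative D) (at x) \<and> D (axis i 1) = g x"
  shows "integrable lebesgue g" "integral\<^sup>L lebesgue g = 0"
proof -
  obtain L M where L: "L \<ge> 0" "\<And>x. norm (f x) \<le> M" "\<And>x y. norm (f x - f y)
      \<le> L * norm (x - y)"
    using lipbE[OF lip] by metis
  obtain R where R: "{x. f x \<noteq> 0} \<subseteq> ball 0 R"
    using bounded_subset_ballD[OF supp] by blast
  define s where "s n x = real (Suc n) *\<^sub>R (f (x + (1 / real (Suc n)) *\<^sub>R axis i 1)
      - f x)" for n x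
  have cont: "continuous_on UNIV f" by (rule lipb_continuous[OF lip])
  have [measurable]: "f \<in> borel_measurable borel" using cont
      by (rule borel_measurable_continuous_onI)
  have fi: "integrable lebesgue f" by (rule integrable_continuous_bounded_supp[OF cont supp])
  have sm: "s n \<in> borel_measurable lebesgue" for n
    unfolding s_def by (intro borel_imp_lebesgue) measurable
  define w :: "real^3 \<Rightarrow> real" where "w = indicat_real (ball 0 (R + 1))"
  have wi: "integrable lebesgue (\<lambda>x. L * w x)"
    unfolding w_def using emeasure_bounded_finite[OF bounded_ball, of 0 "R + 1"]
    by (intro integrable_mult_right integrable_real_indicator) auto
  have lim: "AE x in lebesgue. (\<lambda>n. s n x) \<longlonglongrightarrow> g x"
    using ae by eventually_elim (auto simp: s_def dest!: has_derivative_directional_LIMSEQ[where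
        v="axis i 1"])
  have bound: "AE x in lebesgue. norm (s n x) \<le> L * w x" for n
  proof (rule AE_I2)
    fix x :: "real^3"
    let ?y = "x + (1 / real (Suc n)) *\<^sub>R axis i 1"
    have ny: "norm (?y - x) = 1 / real (Suc n)" by simp
    show "norm (s n x) \<le> L * w x"
    proof (cases "x \<in> ball 0 (R + 1)")
      case True
      have "norm (s n x) = real (Suc n) * norm (f ?y - f x)" by (simp add: s_def)
      also have "\<dots> \<le> real (Suc n) * (L * norm (?y - x))"
        by (intro mult_left_mono L(3)) simp
      also have "\<dots> = L" by (simp only: ny) simp
      finally show ?thesis using True by (simp add: w_def)
    next
      case False
      have "norm x \<le> norm ?y + norm (?y - x)"
        using norm_triangle_sub[of x ?y] by (simp add: norm_minus_commute)
      moreover have "1 / real (Suc n) \<le> 1" by simp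
      moreover have "norm x \<ge> R + 1" using False by simp
      ultimately have "norm ?y \<ge> R" "norm x \<ge> R" unfolding ny by linarith+
      then have "f ?y = 0" "f x = 0" using R by fastforce+
      then show ?thesis using False by (simp add: s_def w_def)
    qed
  qed
  show "integrable lebesgue g"
    by (rule integrable_dominated_convergence[OF g sm wi lim bound])
  have "integral\<^sup>L lebesgue (s n) = 0" for n
  proof -
    let ?t = "(1 / real (Suc n)) *\<^sub>R axis i 1 :: real^3"
    have fi': "integrable lebesgue (\<lambda>x. f (x + ?t))"
    proof (rule integrable_continuous_bounded_supp)
      show "continuous_on UNIV (\<lambda>x. f (x + ?t))"
        by (intro continuous_on_compose2[OF cont] continuous_intros) auto
      have "{x. f (x + ?t) \<noteq> 0} \<subseteq> (\<lambda>y. y - ?t) ` {x. f x \<noteq> 0}"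
        by (auto intro!: image_eqI[of _ _ "_ + ?t"])
      then show "bounded {x. f (x + ?t) \<noteq> 0}"
        using bounded_translation_minus[OF supp] bounded_subset by blast
    qed
    have "integral\<^sup>L lebesgue (s n) = real (Suc n) *\<^sub>R ((LINT x|lebesgue. f (x + ?t))
        - (LINT x|lebesgue. f x))"
      unfolding s_def using fi fi' by simp
    then show ?thesis
      using lebesgue_integral_translation[of f ?t] by (simp add: add.commute)
  qed
  moreover have "(\<lambda>n. integral\<^sup>L lebesgue (s n))
      \<longlonglongrightarrow> integral\<^sup>L lebesgue g"
    by (rule integral_dominated_convergence[OF g sm wi lim bound])
  ultimately show "integral\<^sup>L lebesgue g = 0"
    using LIMSEQ_unique[OF tendsto_const] by fastforce
qed

lemma integral_partial_deriv_eq_0: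
  assumes "C1c f" shows "(LINT x|lebesgue. partial_deriv i f x) = 0"
proof (rule integral_partial_eq_0(2)[OF lipb_C1c[OF assms] C1c_bounded[OF assms]])
  show "partial_deriv i f \<in> borel_measurable lebesgue"
    using C1c_continuous_partial[OF assms] by (rule continuous_lebesgue)
  show "AE x in lebesgue. \<exists>D. (f has_derivative D) (at x) \<and> D (axis i 1)
      = partial_deriv i f x"
    using has_derivative_frechet[OF C1c_differentiable[OF assms]]
    by (intro AE_I2 exI conjI) (auto simp: partial_deriv_def)
qed

lemma C1c_integrable_mult:
  assumes "C1c f" "continuous_on UNIV g"
  shows "integrable lebesgue (\<lambda>x. f x * g x)"
      "integrable lebesgue (\<lambda>x. partial_deriv i f x * g x)"
  using assms
  by (auto intro!: integrable_continuous_bounded_supp continuous_on_mult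
      intro: bounded_subset[OF C1c_bounded[OF assms(1)]] bounded_subset[OF C1c_bounded_partial[OF
          assms(1)]]
      C1c_continuous C1c_continuous_partial)

lemma integration_by_parts:
  assumes f: "C1c f" and g: "C_k 1 g"
  shows "(LINT x|lebesgue. partial_deriv i f x * g x)
      = - (LINT x|lebesgue. f x * partial_deriv i g x)"
proof -
  have c: "C1c (\<lambda>x. f x * g x)" using C1c_mult_left[OF f g] by (simp add: mult.commute)
  have gd: "g differentiable at x" for x using g by auto
  have "partial_deriv i (\<lambda>x. f x * g x)
      = (\<lambda>x. partial_deriv i f x * g x + f x * partial_deriv i g x)"
    using C1c_differentiable[OF f] gd by (intro ext partial_deriv_mult)
  with integral_partial_deriv_eq_0[OF c, of i]
  have "(LINT x|lebesgue. partial_deriv i f x * g x + f x * partial_deriv i g x) = 0" by simp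
  moreover have "continuous_on UNIV g" "continuous_on UNIV (partial_deriv i g)"
    using g C_k_continuous by (blast, simp)
  ultimately show ?thesis
    using C1c_integrable_mult[OF f] by (simp add: eq_neg_iff_add_eq_0)
qed

text \<open>With s = |x - a| / e the field (x - a) P(s) w has divergence (3 P + s P') w + P (x - a)
  . grad w, because (x - a) . grad s = s. Each component has a derivative with integral zero. The
  centre and the spheres with s in \<open>S\<close>, where the chain rule may fail, form a null
  set.\<close>

lemma radial_integration_by_parts:
  fixes P P' :: "real \<Rightarrow> real" and a :: "real^3"
  assumes P: "lipb P" and S: "finite S"
    and D: "\<And>s. s > 0 \<Longrightarrow> s \<notin> S
        \<Longrightarrow> (P has_real_derivative P' s) (at s)"
    and P'[measurable]: "P' \<in> borel_measurable borel"
    and w: "C1c w" and e: "e > 0"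
  defines "s \<equiv> \<lambda>x. norm (x - a) / e"
  shows "integrable lebesgue (\<lambda>x. of_real (3 * P (s x) + s x * P' (s x)) * w x
            + of_real (P (s x)) * (\<Sum>i\<in>UNIV. of_real ((x - a) $ i) * partial_deriv i w x))"
                (is "integrable _ ?F")
    and "(LINT x|lebesgue. of_real (3 * P (s x) + s x * P' (s x)) * w x
            + of_real (P (s x)) * (\<Sum>i\<in>UNIV. of_real ((x - a) $ i) * partial_deriv i w x)) =
                0"
proof -
  define f where "f i x = of_real (P (s x)) * (of_real ((x - a) $ i) * w x)" for i x
  define g where "g i x = of_real (P' (s x) * ((x - a) $ i / (norm (x - a) * e))) *
      (of_real ((x - a) $ i) * w x)
     + of_real (P (s x)) * (w x + of_real ((x - a) $ i) * partial_deriv i w x)" for i x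
  have Pc: "continuous_on UNIV P" by (rule lipb_continuous[OF P])
  have [measurable]: "P \<in> borel_measurable borel" using Pc
      by (rule borel_measurable_continuous_onI)
  have [measurable]: "w \<in> borel_measurable borel" using C1c_continuous[OF w]
      by (rule borel_measurable_continuous_onI)
  have [measurable]: "partial_deriv i w \<in> borel_measurable borel" for i
    using C1c_continuous_partial[OF w] by (rule borel_measurable_continuous_onI)
  have [measurable]: "(\<lambda>x. (x - a) $ i) \<in> borel_measurable borel" for i
    by (intro borel_measurable_continuous_onI continuous_intros)
  have co: "((\<lambda>x. of_real ((x - a) $ i) :: complex) has_derivative
      (\<lambda>h. of_real (h $ i))) (at x)" for i x
    using has_derivative_diff[OF has_derivative_coord has_derivative_const, of i "of_real (a $ i)"]
        by simp
  have coC: "C_k 1 (\<lambda>x. of_real ((x - a) $ i) :: complex)" for i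
  proof -
    have "partial_deriv j (\<lambda>x. of_real ((x - a) $ i) :: complex)
        = (\<lambda>x. of_real ((axis j 1 :: real^3) $ i))" for j
      by (rule ext, rule has_derivative_imp_partial_deriv[OF co])
    then show ?thesis using co by (auto simp: differentiable_def)
  qed
  have cow: "C1c (\<lambda>x. of_real ((x - a) $ i) * w x)" for i
    by (rule C1c_mult_left[OF w coC])
  have lipP: "lipb (\<lambda>x. complex_of_real (P (s x)))"
  proof -
    have "lipb (\<lambda>x. P (s x))"
    proof (rule lipb_compose[OF P])
      fix x y
      show "norm (s x - s y) \<le> (1 / e) * norm (x - y)"
        using norm_triangle_ineq3[of "x - a" "y - a"] e
        by (simp add: s_def divide_right_mono flip: diff_divide_distrib)
    qed
    then show ?thesis unfolding lipb_def by (simp flip: of_real_diff)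
  qed
  have fl: "lipb (f i)" for i
    unfolding f_def by (intro lipb_mult lipP lipb_C1c cow)
  have fb: "bounded {x. f i x \<noteq> 0}" for i
    using C1c_bounded[OF w] by (rule bounded_subset) (auto simp: f_def)
  have gm: "g i \<in> borel_measurable lebesgue" for i
    unfolding g_def s_def by (intro borel_imp_lebesgue) measurable
  have neg: "negligible ({a} \<union> (\<Union>t\<in>S. sphere a (t * e)))"
    using S by (intro negligible_Un negligible_Union) (auto simp: negligible_sphere)
  have ae: "AE x in lebesgue. x \<notin> {a} \<union> (\<Union>t\<in>S. sphere a (t * e))"
    using neg by (intro AE_not_in) (simp add: negligible_iff_null_sets)
  have gd: "AE x in lebesgue. \<exists>D. (f i has_derivative D) (at x) \<and> D (axis i 1) = g i x"
      for i
    using ae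
  proof eventually_elim
    fix x assume x: "x \<notin> {a} \<union> (\<Union>t\<in>S. sphere a (t * e))"
    then have xa: "x \<noteq> a" by auto
    have "s x > 0" using xa e by (simp add: s_def)
    moreover have "s x \<notin> S"
    proof
      assume "s x \<in> S"
      moreover have "x \<in> sphere a (s x * e)" using e
          by (simp add: s_def dist_norm norm_minus_commute)
      ultimately show False using x by blast
    qed
    ultimately have "(P has_real_derivative P' (s x)) (at (s x))" by (rule D)
    moreover have sd: "(s has_derivative (\<lambda>h. (x - a) \<bullet> h / (norm (x - a) * e)))
        (at x)"
    proof -
      have "((\<lambda>x. norm (x - a)) has_derivative (\<lambda>h. sgn (x - a) \<bullet> h))
          (at x)"
      proof (rule has_derivative_compose[of "\<lambda>x. x - a" "\<lambda>h. h"])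
        show "((\<lambda>x. x - a) has_derivative (\<lambda>h. h)) (at x)"
          using has_derivative_diff[OF has_derivative_ident has_derivative_const] by simp
        show "(norm has_derivative (\<lambda>h. sgn (x - a) \<bullet> h)) (at (x - a))"
          using xa has_derivative_norm[of "x - a"] by (simp add: inner_commute)
      qed
      from bounded_linear.has_derivative[OF bounded_linear_divide this, of e]
      show ?thesis by (simp add: s_def sgn_div_norm divide_inverse mult_ac)
    qed
    ultimately have "((\<lambda>x. P (s x)) has_derivative
        (\<lambda>h. P' (s x) * ((x - a) \<bullet> h / (norm (x - a) * e)))) (at x)"
      using has_derivative_compose[OF sd] unfolding has_field_derivative_def by blast
    then have "((\<lambda>x. complex_of_real (P (s x))) has_derivative
        (\<lambda>h. of_real (P' (s x) * ((x - a) \<bullet> h / (norm (x - a) * e))))) (at x)"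
      by (rule bounded_linear.has_derivative[OF bounded_linear_of_real])
    from has_derivative_mult[OF this has_derivative_mult[OF co[of i x] has_derivative_frechet[OF
        C1c_differentiable[OF w, of x]]]]
    have "(f i has_derivative (\<lambda>h. of_real (P (s x)) * (of_real ((x - a) $ i) *
        frechet_derivative w (at x) h + of_real (h $ i) * w x)
       + of_real (P' (s x) * ((x - a) \<bullet> h / (norm (x - a) * e))) * (of_real ((x - a) $ i) *
           w x))) (at x)"
      unfolding f_def by blast
    moreover have "of_real (P (s x)) * (of_real ((x - a) $ i) * frechet_derivative w (at x)
        (axis i 1) + of_real ((axis i 1 :: real^3) $ i) * w x)
       + of_real (P' (s x) * ((x - a) \<bullet> axis i 1 / (norm (x - a) * e))) *
           (of_real ((x - a) $ i) * w x) = g i x"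
      by (simp add: g_def inner_axis partial_deriv_def algebra_simps)
    ultimately show "\<exists>D. (f i has_derivative D) (at x) \<and> D (axis i 1) = g i x" by blast
  qed
  note gi = integral_partial_eq_0[OF fl fb gm gd]
  have sum: "(\<Sum>i\<in>UNIV. g i x) = ?F x" for x
  proof -
    have "(\<Sum>i\<in>UNIV. ((x - a) $ i / (norm (x - a) * e)) * (x - a) $ i) = s x"
    proof -
      have "(\<Sum>i\<in>UNIV. ((x - a) $ i / (norm (x - a) * e)) * (x - a) $ i)
         = ((x - a) \<bullet> (x - a)) / (norm (x - a) * e)"
        by (simp add: inner_vec_def sum_divide_distrib)
      also have "\<dots> = s x"
        by (simp add: s_def power2_norm_eq_inner[symmetric] power2_eq_square)
      finally show ?thesis .
    qed
    moreover define y c where "y i = (x - a) $ i" and "c i = (x - a) $ i / (norm (x - a) * e)" for i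
    ultimately have sx: "(\<Sum>i\<in>UNIV. c i * y i) = s x" by simp
    have "g i x = of_real (P' (s x)) * w x * of_real (c i * y i) + (of_real (P (s x)) * w x
       + of_real (P (s x)) * (of_real (y i) * partial_deriv i w x))" for i
      unfolding g_def y_def c_def by (simp only: of_real_mult distrib_left mult_ac)
    then have "(\<Sum>i\<in>UNIV. g i x)
        = of_real (P' (s x)) * w x * of_real (\<Sum>i\<in>UNIV. c i * y i)
       + (3 * (of_real (P (s x)) * w x)
       + of_real (P (s x)) * (\<Sum>i\<in>UNIV. of_real (y i) * partial_deriv i w x))"
      by (simp only: sum.distrib sum_distrib_left of_real_sum) simp
    then show ?thesis unfolding sx unfolding y_def
        by (simp only: of_real_mult of_real_add of_real_numeral distrib_right distrib_left mult_ac
        add_ac)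
  qed
  show "integrable lebesgue ?F" unfolding sum[symmetric]
      by (rule Bochner_Integration.integrable_sum) (rule gi)
  show "integral\<^sup>L lebesgue ?F = 0" unfolding sum[symmetric] using gi
      by (subst Bochner_Integration.integral_sum) auto
qed

subsection \<open>The corrector on a single cell\<close>

definition sq :: "(real^3 \<Rightarrow> complex) \<Rightarrow> real^3 \<Rightarrow> real" where
  "sq w x = (cmod (w x))\<^sup>2"

definition gsq :: "(real^3 \<Rightarrow> complex) \<Rightarrow> real^3 \<Rightarrow> real" where
  "gsq w x = (\<Sum>i\<in>UNIV. (cmod (partial_deriv i w x))\<^sup>2)"

lemma sq_nonneg [simp]: "sq w x \<ge> 0" and gsq_nonneg [simp]: "gsq w x \<ge> 0"
  by (simp_all add: sq_def gsq_def sum_nonneg)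

lemma C1c_sq: "C1c w \<Longrightarrow> continuous_on UNIV (sq w)" "C1c w
    \<Longrightarrow> bounded {x. sq w x \<noteq> 0}"
  using C1c_continuous[of w] C1c_bounded[of w]
  by (auto simp: sq_def[abs_def] intro!: continuous_intros)

lemma C1c_gsq:
  assumes "C1c w"
  shows "continuous_on UNIV (gsq w)" "bounded {x. gsq w x \<noteq> 0}"
proof -
  show "continuous_on UNIV (gsq w)"
    unfolding gsq_def[abs_def]
    by (intro continuous_on_sum continuous_on_power continuous_on_norm C1c_continuous_partial assms)
  have "{x. gsq w x \<noteq> 0} \<subseteq> (\<Union>i. {x. partial_deriv i w x \<noteq> 0})"
    by (auto simp: gsq_def intro: sum.neutral ccontr)
  moreover have "bounded (\<Union>i. {x. partial_deriv i w x \<noteq> 0})"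
    by (intro bounded_UN) (auto intro: C1c_bounded_partial[OF assms])
  ultimately show "bounded {x. gsq w x \<noteq> 0}" by (rule bounded_subset[rotated])
qed

lemma integrable_weighted:
  fixes h :: "real^3 \<Rightarrow> real"
      and f :: "real^3 \<Rightarrow> 'b::{banach, second_countable_topology}"
  assumes "h \<in> borel_measurable lebesgue" "\<And>x. \<bar>h x\<bar> \<le> M"
    and f: "continuous_on UNIV f" "bounded {x. f x \<noteq> 0}"
  shows "integrable lebesgue (\<lambda>x. h x *\<^sub>R f x)"
proof -
  obtain K where K: "K \<ge> 0" "\<And>x. norm (f x) \<le> K"
    using continuous_bounded_supp_bounded[OF f] by blast
  show ?thesis
  proof (rule integrable_bounded_supp[of _ "M * K"])
    show "(\<lambda>x. h x *\<^sub>R f x) \<in> borel_measurable lebesgue"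
      using assms(1) continuous_lebesgue[OF f(1)] by measurable
    show "norm (h x *\<^sub>R f x) \<le> M * K" for x
      using mult_mono[OF assms(2)[of x] K(2)[of x]] order_trans[OF abs_ge_zero assms(2)] by simp
    show "bounded {x. h x *\<^sub>R f x \<noteq> 0}"
      by (rule bounded_subset[OF f(2)]) auto
  qed
qed

lemmas integrable_weighted_real = integrable_weighted[where 'b=real, simplified]

lemma integrable_weighted_complex:
  fixes h :: "real^3 \<Rightarrow> real" and f :: "real^3 \<Rightarrow> complex"
  assumes "h \<in> borel_measurable lebesgue" "\<And>x. \<bar>h x\<bar> \<le> M"
    and f: "continuous_on UNIV f" "bounded {x. f x \<noteq> 0}"
  shows "integrable lebesgue (\<lambda>x. of_real (h x) * f x)"
  using integrable_weighted[OF assms] by (simp add: scaleR_conv_of_real)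

text \<open>
  In the variable \<open>s = norm (x - a) / e\<close>, the radial field \<open>(x - a) \<psi>(s)\<close> has divergence
  \<open>3 \<psi>(s) + s \<psi>'(s)\<close>. The profile \<open>cprof\<close> makes this \<open>1 / d - 8 d\<^sup>2\<close> for \<open>s < d\<close> and \<open>- 8 d\<^sup>2\<close> for
  \<open>d < s < 1/2\<close>, and \<open>corr\<close> is the potential with gradient \<open>- (x - a) cprof(s) / e\<^sup>2\<close>. For \<open>hprof\<close> the
  divergence is \<open>1 / s\<^sup>2 - 12\<close> on \<open>d < s < 1/2\<close>, the field behind Hardy's inequality. The potential is
  integrated in the variable \<open>s\<^sup>2\<close> because \<open>norm\<close> is not differentiable at the origin.
\<close>

definition inv_max :: "real \<Rightarrow> real \<Rightarrow> real" where
  "inv_max d s = 1 / max s d"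

definition cprof :: "real \<Rightarrow> real \<Rightarrow> real" where
  "cprof d s = max 0 (d\<^sup>2 / 3 * inv_max d s ^ 3 - 8 / 3 * d\<^sup>2)"

definition cprof' :: "real \<Rightarrow> real \<Rightarrow> real" where
  "cprof' d s = (if d < s \<and> s < 1/2 then - d\<^sup>2 / s ^ 4 else 0)"

definition hprof :: "real \<Rightarrow> real \<Rightarrow> real" where
  "hprof d s = max 0 (inv_max d s ^ 2 - 4)"

definition hprof' :: "real \<Rightarrow> real \<Rightarrow> real" where
  "hprof' d s = (if d < s \<and> s < 1/2 then - 2 / s ^ 3 else 0)"

text \<open>The integrals start at -1 so that 0 is an interior point and the derivative there is
  two-sided; for negative \<open>s\<close> the value \<open>sqrt s\<close> is negative and
  \<open>cprof\<close> takes its constant inner value. The first integral normalises the potential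
  to vanish at t = 1/4, that is, at radius 1/2.\<close>

definition cpot :: "real \<Rightarrow> real \<Rightarrow> real" where
  "cpot d t = integral {-1..1/4} (\<lambda>s. cprof d (sqrt s) / 2)
      - integral {-1..t} (\<lambda>s. cprof d (sqrt s) / 2)"

definition corr :: "real \<Rightarrow> real \<Rightarrow> real^3 \<Rightarrow> real^3 \<Rightarrow>
    real" where
  "corr d e a x = cpot d ((norm (x - a) / e)\<^sup>2)"

text \<open>
  At \<open>x = a\<close> the weight is \<open>min 1 0 = 0\<close> by division by zero instead of the limit \<open>1\<close>; this only affects a null
  set.
\<close>

definition hwt :: "real \<Rightarrow> real \<Rightarrow> real^3 \<Rightarrow> real^3 \<Rightarrow>
    real" where
  "hwt d e a x = (if norm (x - a) < e / 2 then min 1 ((d * e / norm (x - a))\<^sup>2) else 0)"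

definition wpot :: "real \<Rightarrow> real \<Rightarrow> real^3 \<Rightarrow> real^3 \<Rightarrow>
    real" where
  "wpot d e a x = 1 / (e\<^sup>2 * d) * indicat_real (ball a (d * e)) x"

text \<open>The ball inscribed in the cubic lattice cell, not the cube itself, which is
  \<open>qcell\<close>.\<close>

definition cell :: "real \<Rightarrow> real^3 \<Rightarrow> real^3 \<Rightarrow> real" where
  "cell e a x = indicat_real (ball a (e / 2)) x"

text \<open>A hole of relative radius \<open>d\<close> in a cell of size \<open>e\<close>. The
  corrector divides by \<open>d\<close>, so the case without penalty is left to
  \<open>corrector_exists\<close>.\<close>

locale hole =
  fixes d e :: real
  assumes d_pos: "0 < d" and d_le: "d \<le> 1/2" and e_pos: "0 < e"
begin

lemma inv_max_nonneg: "0 \<le> inv_max d s" and inv_max_le: "inv_max d s \<le> 1 / d"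
  using d_pos by (auto simp: inv_max_def intro!: divide_left_mono mult_pos_pos)

lemma inv_max_small: "s \<le> d \<Longrightarrow> inv_max d s = 1 / d"
    and inv_max_large: "s \<ge> d \<Longrightarrow> inv_max d s = 1 / s"
  by (auto simp: inv_max_def max_def)

lemma lipb_inv_max: "lipb (inv_max d)"
proof (rule lipbI)
  show "norm (inv_max d s) \<le> 1 / d" for s
    using inv_max_nonneg inv_max_le by simp
  fix s t :: real
  have p: "max s d > 0" "max t d > 0" "d\<^sup>2 \<le> max s d * max t d"
    using d_pos by (auto simp: power2_eq_square intro!: mult_mono)
  have "\<bar>inv_max d s - inv_max d t\<bar> = \<bar>max t d - max s d\<bar> / (max s d * max t d)"
    unfolding inv_max_def using p
    by (subst diff_frac_eq) (auto simp: abs_mult)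
  also have "\<dots> \<le> \<bar>s - t\<bar> / d\<^sup>2"
    using p d_pos by (intro frac_le) auto
  finally show "norm (inv_max d s - inv_max d t) \<le> 1 / d\<^sup>2 * norm (s - t)" by simp
qed

lemma lipb_cprof: "lipb (cprof d)"
proof (rule lipb_contraction)
  show "lipb (\<lambda>s. d\<^sup>2 / 3 * (inv_max d s * inv_max d s * inv_max d s))"
    by (intro lipb_mult lipb_const lipb_inv_max)
  show "norm (cprof d s - cprof d t)
      \<le> norm (d\<^sup>2 / 3 * (inv_max d s * inv_max d s * inv_max d s)
      - d\<^sup>2 / 3 * (inv_max d t * inv_max d t * inv_max d t))" for s t
    by (auto simp: cprof_def power3_eq_cube)
qed auto

lemma lipb_hprof: "lipb (hprof d)"
proof (rule lipb_contraction)
  show "lipb (\<lambda>s. inv_max d s * inv_max d s)"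
    by (intro lipb_mult lipb_inv_max)
  show "norm (hprof d s - hprof d t)
      \<le> norm (inv_max d s * inv_max d s - inv_max d t * inv_max d t)" for s t
    by (auto simp: hprof_def power2_eq_square)
qed auto

lemma inv_ge_2: "0 < s \<Longrightarrow> s \<le> 1/2 \<Longrightarrow> 2 \<le> 1 / (s::real)"
  by (simp add: field_simps)

text \<open>From \<open>d \<le> 1/2\<close> one has 1/d \<ge> 2, so the expression under
  \<open>max 0\<close> is nonnegative up to s = 1/2. The truncation takes effect exactly from there
  on, where the expression has its zero, and so creates no jump.\<close>

lemma cprof_small: "s \<le> d \<Longrightarrow> cprof d s = (1 / d - 8 * d\<^sup>2) / 3"
proof -
  assume s: "s \<le> d"
  have "2 ^ 3 \<le> (1 / d) ^ 3" using inv_ge_2[OF d_pos d_le] by (intro power_mono) auto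
  then have "d\<^sup>2 / 3 * 8 \<le> d\<^sup>2 / 3 * (1 / d) ^ 3" by (intro mult_left_mono) auto
  then show ?thesis using s d_pos
      by (simp add: cprof_def inv_max_small field_simps power2_eq_square power3_eq_cube)
qed

lemma cprof_mid: "d \<le> s \<Longrightarrow> s \<le> 1/2 \<Longrightarrow> cprof d s
    = (d\<^sup>2 / s ^ 3 - 8 * d\<^sup>2) / 3"
proof -
  assume s: "d \<le> s" "s \<le> 1/2"
  have "2 ^ 3 \<le> (1 / s) ^ 3" using inv_ge_2[of s] s d_pos by (intro power_mono) auto
  then have "d\<^sup>2 / 3 * 8 \<le> d\<^sup>2 / 3 * (1 / s) ^ 3" by (intro mult_left_mono) auto
  then show ?thesis using s by (simp add: cprof_def inv_max_large field_simps)
qed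

lemma cprof_large: "1/2 \<le> s \<Longrightarrow> cprof d s = 0"
proof -
  assume s: "1/2 \<le> s"
  have "(1 / s) ^ 3 \<le> 2 ^ 3" using s by (intro power_mono) (auto simp: field_simps)
  then have "d\<^sup>2 / 3 * (1 / s) ^ 3 \<le> d\<^sup>2 / 3 * 8" by (intro mult_left_mono) auto
  then show ?thesis using s d_le by (simp add: cprof_def inv_max_large)
qed

lemma hprof_small: "s \<le> d \<Longrightarrow> hprof d s = 1 / d\<^sup>2 - 4"
proof -
  assume s: "s \<le> d"
  have "2\<^sup>2 \<le> (1 / d)\<^sup>2" using inv_ge_2[OF d_pos d_le] by (intro power_mono) auto
  then show ?thesis using s by (simp add: hprof_def inv_max_small power_one_over)
qed

lemma hprof_mid: "d \<le> s \<Longrightarrow> s \<le> 1/2 \<Longrightarrow> hprof d s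
    = 1 / s\<^sup>2 - 4"
proof -
  assume s: "d \<le> s" "s \<le> 1/2"
  have "2\<^sup>2 \<le> (1 / s)\<^sup>2" using inv_ge_2[of s] s d_pos by (intro power_mono) auto
  then show ?thesis using s by (simp add: hprof_def inv_max_large power_one_over)
qed

lemma hprof_large: "1/2 \<le> s \<Longrightarrow> hprof d s = 0"
proof -
  assume s: "1/2 \<le> s"
  have "(1 / s)\<^sup>2 \<le> 2\<^sup>2" using s by (intro power_mono) (auto simp: field_simps)
  then show ?thesis using s d_le by (simp add: hprof_def inv_max_large)
qed

lemma cprof_deriv:
  assumes "s > 0" "s \<notin> {d, 1/2}"
  shows "(cprof d has_real_derivative cprof' d s) (at s)"
proof -
  consider "s < d" | "d < s" "s < 1/2" | "1/2 < s" using assms d_le by fastforce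
  then show ?thesis
  proof cases
    case 1
    have "((\<lambda>_. (1 / d - 8 * d\<^sup>2) / 3) has_real_derivative 0) (at s)" by simp
    from has_field_derivative_transform_within_open[OF this, of "{..<d}" "cprof d"] 1
    show ?thesis by (simp add: cprof_small cprof'_def)
  next
    case 2
    have "((\<lambda>s. (d\<^sup>2 / s ^ 3 - 8 * d\<^sup>2) / 3) has_real_derivative
        (- d\<^sup>2 / s ^ 4)) (at s)"
      using assms by (auto intro!: derivative_eq_intros simp: field_simps power2_eq_square
          eval_nat_numeral)
    from has_field_derivative_transform_within_open[OF this, of "{d<..<1/2}" "cprof d"] 2
    show ?thesis by (simp add: cprof_mid cprof'_def)
  next
    case 3
    have "((\<lambda>_. 0) has_real_derivative 0) (at s)" by simp
    from has_field_derivative_transform_within_open[OF this, of "{1/2<..}" "cprof d"] 3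
    show ?thesis by (simp add: cprof_large cprof'_def)
  qed
qed

lemma hprof_deriv:
  assumes "s > 0" "s \<notin> {d, 1/2}"
  shows "(hprof d has_real_derivative hprof' d s) (at s)"
proof -
  consider "s < d" | "d < s" "s < 1/2" | "1/2 < s" using assms d_le by fastforce
  then show ?thesis
  proof cases
    case 1
    have "((\<lambda>_. 1 / d\<^sup>2 - 4) has_real_derivative 0) (at s)" by simp
    from has_field_derivative_transform_within_open[OF this, of "{..<d}" "hprof d"] 1
    show ?thesis by (simp add: hprof_small hprof'_def)
  next
    case 2
    have "((\<lambda>s. 1 / s\<^sup>2 - 4) has_real_derivative (- 2 / s ^ 3)) (at s)"
      using assms by (auto intro!: derivative_eq_intros simp: field_simps eval_nat_numeral)
    from has_field_derivative_transform_within_open[OF this, of "{d<..<1/2}" "hprof d"] 2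
    show ?thesis by (simp add: hprof_mid hprof'_def)
  next
    case 3
    have "((\<lambda>_. 0) has_real_derivative 0) (at s)" by simp
    from has_field_derivative_transform_within_open[OF this, of "{1/2<..}" "hprof d"] 3
    show ?thesis by (simp add: hprof_large hprof'_def)
  qed
qed

lemma cprof_nonneg: "0 \<le> cprof d s" and hprof_nonneg: "0 \<le> hprof d s"
  by (simp_all add: cprof_def hprof_def)

text \<open>Dropping the negative part -8/3 d^2 leaves s / (3 d) inside the hole and d^2 / (3 s^2)
  outside. As \<open>cprof d s * s / e\<close> is the length of the gradient of \<open>corr\<close>,
  this is what makes \<open>hwt\<close> the right weight.\<close>

lemma cprof_mult_le: "0 < s \<Longrightarrow> s < 1/2 \<Longrightarrow> cprof d s * s
    \<le> min 1 ((d / s)\<^sup>2) / 3"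
proof -
  assume s: "0 < s" "s < 1/2"
  show ?thesis
  proof (cases "s \<le> d")
    case True
    have "cprof d s * s \<le> (1 / d / 3) * s"
      using s True by (intro mult_right_mono) (auto simp: cprof_small)
    also have "\<dots> \<le> 1 / 3" using True d_pos by (simp add: field_simps)
    also have "1 \<le> (d / s)\<^sup>2" using True s by (simp add: one_le_power)
    ultimately show ?thesis by (simp add: min_def)
  next
    case False
    have "cprof d s * s \<le> (d\<^sup>2 / s ^ 3 / 3) * s"
      using s False by (intro mult_right_mono) (auto simp: cprof_mid)
    also have "\<dots> = (d / s)\<^sup>2 / 3" using s
        by (simp add: field_simps power2_eq_square power3_eq_cube)
    also have "(d / s)\<^sup>2 \<le> 1" using False s d_pos by (simp add: power_le_one)
    ultimately show ?thesis by (simp add: min_def)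
  qed
qed

text \<open>The square appears because Young's inequality splits the cross term in Hardy's
  inequality; the bound reproduces the weight found in the divergence, so that the term can be
  absorbed there.\<close>

lemma hprof_mult_le: "0 < s \<Longrightarrow> s < 1/2 \<Longrightarrow> (hprof d s * s)\<^sup>2
    \<le> min 1 ((d / s)\<^sup>2) / d\<^sup>2"
proof -
  assume s: "0 < s" "s < 1/2"
  show ?thesis
  proof (cases "s \<le> d")
    case True
    have "hprof d s * s \<le> (1 / d\<^sup>2) * s"
      using s True by (intro mult_right_mono) (auto simp: hprof_small)
    also have "\<dots> \<le> 1 / d" using True d_pos by (simp add: field_simps power2_eq_square)
    finally have "(hprof d s * s)\<^sup>2 \<le> (1 / d)\<^sup>2" using s hprof_nonneg
        by (intro power_mono) auto
    moreover have "1 \<le> (d / s)\<^sup>2" using True s by (simp add: one_le_power)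
    ultimately show ?thesis by (simp add: min_def power_one_over)
  next
    case False
    have "hprof d s * s \<le> (1 / s\<^sup>2) * s"
      using s False by (intro mult_right_mono) (auto simp: hprof_mid)
    also have "\<dots> = 1 / s" using s by (simp add: field_simps power2_eq_square)
    finally have "(hprof d s * s)\<^sup>2 \<le> (1 / s)\<^sup>2" using s hprof_nonneg
        by (intro power_mono) auto
    also have "\<dots> = (d / s)\<^sup>2 / d\<^sup>2" using d_pos by (simp add: power_divide)
    also have "(d / s)\<^sup>2 \<le> 1" using False s d_pos by (simp add: power_le_one)
    ultimately show ?thesis by (simp add: min_def)
  qed
qed

lemma cprof_div:
  assumes "s > 0" "s \<notin> {d, 1/2}"
  shows "3 * cprof d s + s * cprof' d s = (if s < d then 1 / d else 0)
      - (if s < 1/2 then 8 * d\<^sup>2 else 0)"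
proof -
  consider "s < d" | "d < s" "s < 1/2" | "1/2 < s" using assms d_le by fastforce
  then show ?thesis
  proof cases
    case 1 then show ?thesis using d_le by (simp add: cprof_small cprof'_def)
  next
    case 2 then show ?thesis using assms
        by (simp add: cprof_mid cprof'_def field_simps eval_nat_numeral)
  next
    case 3 then show ?thesis using d_le by (simp add: cprof_large cprof'_def)
  qed
qed

text \<open>Inside the hole the divergence is 3 / d^2 - 12, above the required 1 / d^2 - 12; between
  the hole and s = 1/2 the two sides agree.\<close>

lemma hprof_div:
  assumes "s > 0" "s \<notin> {d, 1/2}"
  shows "(if s < 1/2 then min 1 ((d / s)\<^sup>2) / d\<^sup>2 - 12 else 0)
      \<le> 3 * hprof d s + s * hprof' d s"
proof -
  consider "s < d" | "d < s" "s < 1/2" | "1/2 < s" using assms d_le by fastforce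
  then show ?thesis
  proof cases
    case 1
    have "min 1 ((d / s)\<^sup>2) / d\<^sup>2 \<le> 3 / d\<^sup>2" by (intro divide_right_mono) auto
    with 1 show ?thesis using d_le by (simp add: hprof_small hprof'_def)
  next
    case 2
    have "min 1 ((d / s)\<^sup>2) / d\<^sup>2 \<le> (d / s)\<^sup>2 / d\<^sup>2"
        by (intro divide_right_mono) auto
    also have "\<dots> = 1 / s\<^sup>2" using d_pos by (simp add: power_divide)
    finally show ?thesis using 2 assms
      by (simp add: hprof_mid hprof'_def) (simp add: field_simps eval_nat_numeral)
  next
    case 3 then show ?thesis using d_le by (simp add: hprof_large hprof'_def)
  qed
qed

lemma cpot_deriv: "t > -1 \<Longrightarrow> (cpot d has_real_derivative - cprof d (sqrt t) / 2)
    (at t)"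
proof -
  assume t: "t > -1"
  have cc: "continuous_on A (\<lambda>s. cprof d (sqrt s) / 2)" for A
    using continuous_on_compose2[OF lipb_continuous[OF lipb_cprof] continuous_on_real_sqrt[OF
        continuous_on_id]]
    by (intro continuous_on_divide) auto
  have "((\<lambda>x. integral {-1..x} (\<lambda>s. cprof d (sqrt s) / 2)) has_real_derivative cprof
      d (sqrt t) / 2) (at t within {-1..t+1})"
    using t by (intro integral_has_real_derivative cc) auto
  then have "((\<lambda>x. integral {-1..x} (\<lambda>s. cprof d (sqrt s) / 2)) has_real_derivative
      cprof d (sqrt t) / 2) (at t)"
    using t by (simp add: at_within_Icc_at)
  from DERIV_diff[OF DERIV_const this] show ?thesis
    unfolding cpot_def[abs_def] by simp
qed

lemma cpot_quarter: "cpot d (1/4) = 0" by (simp add: cpot_def)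

lemma cpot_antimono: "0 \<le> s \<Longrightarrow> s \<le> t \<Longrightarrow> cpot d t
    \<le> cpot d s"
proof (rule DERIV_nonpos_imp_nonincreasing[of s t "cpot d"])
  fix x assume "0 \<le> s" "s \<le> x"
  then show "\<exists>y. (cpot d has_real_derivative y) (at x) \<and> y \<le> 0"
    using cpot_deriv[of x] cprof_nonneg[of "sqrt x"] by (intro exI conjI) auto
qed

lemma cpot_zero: "t \<ge> 1/4 \<Longrightarrow> cpot d t = 0"
proof -
  assume t: "t \<ge> 1/4"
  have "cpot d (1/4) \<le> cpot d t"
  proof (rule DERIV_nonneg_imp_nondecreasing[OF t])
    fix x :: real assume x: "1/4 \<le> x" "x \<le> t"
    have "sqrt (1/4) \<le> sqrt x" using x by (intro real_sqrt_le_mono)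
    then have "1/2 \<le> sqrt x" by (simp add: real_sqrt_divide)
    then show "\<exists>y. (cpot d has_real_derivative y) (at x) \<and> 0 \<le> y"
      using cpot_deriv[of x] x by (auto simp: cprof_large)
  qed
  with cpot_antimono[of "1/4" t] t show ?thesis by (simp add: cpot_quarter)
qed

lemma cpot_nonneg: "t \<ge> 0 \<Longrightarrow> 0 \<le> cpot d t"
  using cpot_antimono[of t "max t (1/4)"] cpot_zero[of "max t (1/4)"] by simp

text \<open>d/2 is d/3 + d/6. For t between d^2 and 1/4 the potential decreases no faster than the
  Newtonian d^2 / (3 sqrt t), which gives at most d/3 at t = d^2. For t below d^2 the slope is at
  most 1 / (6 d) in absolute value, over an interval of length d^2.\<close>

lemma cpot_le: "t \<ge> 0 \<Longrightarrow> cpot d t \<le> d / 2"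
proof -
  assume t: "t \<ge> 0"
  define h where "h s = cpot d s - d\<^sup>2 / (3 * sqrt s)" for s
  have d4: "d\<^sup>2 \<le> 1/4" using power_mono[OF d_le, of 2] d_pos
      by (simp add: power2_eq_square)
  have "h (d\<^sup>2) \<le> h (1/4)"
  proof (rule DERIV_nonneg_imp_nondecreasing[OF d4])
    fix x :: real assume x: "d\<^sup>2 \<le> x" "x \<le> 1/4"
    have x0: "x > 0" using x d_pos by (meson less_le_trans zero_less_power)
    have sx: "sqrt x \<ge> d" "sqrt x \<le> 1/2"
      using real_sqrt_le_mono[OF x(1)] real_sqrt_le_mono[OF x(2)] d_pos
          by (auto simp: real_sqrt_divide)
    have "(h has_real_derivative (- cprof d (sqrt x) / 2 + d\<^sup>2 / (6 * sqrt x ^ 3))) (at x)"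
      unfolding h_def[abs_def] using x0
      by (auto intro!: derivative_eq_intros cpot_deriv simp: field_simps eval_nat_numeral)
    moreover have "0 \<le> - cprof d (sqrt x) / 2 + d\<^sup>2 / (6 * sqrt x ^ 3)"
      using sx by (simp add: cprof_mid field_simps)
    ultimately show "\<exists>y. (h has_real_derivative y) (at x) \<and> 0 \<le> y" by blast
  qed
  moreover have "h (1/4) \<le> 0" by (simp add: h_def cpot_quarter)
  ultimately have A: "cpot d (d\<^sup>2) \<le> d / 3"
    using d_pos by (simp add: h_def power2_eq_square)
  define g where "g s = cpot d s + s / (6 * d)" for s
  have "g 0 \<le> g (d\<^sup>2)"
  proof (rule DERIV_nonneg_imp_nondecreasing[of 0 "d\<^sup>2" g])
    fix x :: real assume x: "0 \<le> x" "x \<le> d\<^sup>2"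
    have sx: "sqrt x \<le> d"
      using real_sqrt_le_mono[OF x(2)] d_pos by auto
    have "(g has_real_derivative (- cprof d (sqrt x) / 2 + 1 / (6 * d))) (at x)"
      unfolding g_def[abs_def] using x d_pos
      by (auto intro!: derivative_eq_intros cpot_deriv)
    moreover have "0 \<le> - cprof d (sqrt x) / 2 + 1 / (6 * d)"
      using sx d_pos by (simp add: cprof_small field_simps)
    ultimately show "\<exists>y. (g has_real_derivative y) (at x) \<and> 0 \<le> y" by blast
  qed simp
  then have "cpot d 0 \<le> cpot d (d\<^sup>2) + d / 6" using d_pos
      by (simp add: g_def power2_eq_square)
  with A have "cpot d 0 \<le> d / 2" by simp
  with cpot_antimono[of 0 t] t show ?thesis by simp
qed

lemma corr_nonneg: "0 \<le> corr d e a x" and corr_le: "corr d e a x \<le> d / 2"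
  unfolding corr_def by (rule cpot_nonneg cpot_le; simp)+

lemma corr_zero: "norm (x - a) \<ge> e / 2 \<Longrightarrow> corr d e a x = 0"
proof -
  assume "norm (x - a) \<ge> e / 2"
  then have "1/2 \<le> norm (x - a) / e" using e_pos by (simp add: field_simps)
  then have "(1/2)\<^sup>2 \<le> (norm (x - a) / e)\<^sup>2" by (intro power_mono) auto
  then show ?thesis unfolding corr_def by (intro cpot_zero) (simp add: power2_eq_square)
qed

lemma corr_has_derivative:
  "((\<lambda>x. complex_of_real (corr d e a x)) has_derivative
     (\<lambda>h. of_real (- cprof d (norm (x - a) / e) * ((x - a) \<bullet> h) / e\<^sup>2)))
         (at x)"
proof -
  have "((\<lambda>x. ((x - a) \<bullet> (x - a)) / e\<^sup>2) has_derivative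
      (\<lambda>h. (2 * ((x - a) \<bullet> h)) / e\<^sup>2)) (at x)"
    by (auto intro!: derivative_eq_intros bounded_linear.has_derivative[OF bounded_linear_divide]
        simp: inner_commute)
  then have D: "((\<lambda>x. (norm (x - a) / e)\<^sup>2) has_derivative
      (\<lambda>h. (2 * ((x - a) \<bullet> h)) / e\<^sup>2)) (at x)"
    by (simp add: power_divide power2_norm_eq_inner)
  have "(cpot d has_real_derivative - cprof d (sqrt ((norm (x - a) / e)\<^sup>2)) / 2)
      (at ((norm (x - a) / e)\<^sup>2))"
    by (rule cpot_deriv) (smt (verit) zero_le_power2)
  moreover have "sqrt ((norm (x - a) / e)\<^sup>2) = norm (x - a) / e" using e_pos by simp
  ultimately have "((\<lambda>x. corr d e a x) has_derivative (\<lambda>h.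
      - cprof d (norm (x - a) / e) / 2 * ((2 * ((x - a) \<bullet> h)) / e\<^sup>2))) (at x)"
    using has_derivative_compose[OF D] unfolding has_field_derivative_def corr_def by metis
  then have "((\<lambda>x. corr d e a x) has_derivative (\<lambda>h.
      - cprof d (norm (x - a) / e) * ((x - a) \<bullet> h) / e\<^sup>2)) (at x)"
    by simp
  then show ?thesis by (rule bounded_linear.has_derivative[OF bounded_linear_of_real])
qed

lemma partial_corr:
  "partial_deriv i (\<lambda>x. of_real (corr d e a x)) x
      = of_real (- cprof d (norm (x - a) / e) * (x - a) $ i / e\<^sup>2)"
  by (subst has_derivative_imp_partial_deriv[OF corr_has_derivative]) (simp add: inner_axis)

lemma C1c_corr: "C1c (\<lambda>x. of_real (corr d e a x))"
proof -
  have "continuous_on UNIV (partial_deriv i (\<lambda>x. of_real (corr d e a x)))" for i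
    unfolding partial_corr using e_pos
    by (intro continuous_intros continuous_on_compose2[OF lipb_continuous[OF lipb_cprof]]) auto
  moreover have "(\<lambda>x. complex_of_real (corr d e a x)) differentiable at x" for x
    using corr_has_derivative unfolding differentiable_def by blast
  moreover have "{x. complex_of_real (corr d e a x) \<noteq> 0} \<subseteq> cball a (e / 2)"
  proof
    fix x assume "x \<in> {x. complex_of_real (corr d e a x) \<noteq> 0}"
    then show "x \<in> cball a (e / 2)"
      using corr_zero[of x a] by (cases "e / 2
          \<le> norm (x - a)") (auto simp: dist_norm norm_minus_commute)
  qed
  ultimately show ?thesis
    using bounded_subset[OF bounded_cball] by (auto simp: C1c_def)
qed

lemma hwt_bounds: "0 \<le> hwt d e a x" "hwt d e a x \<le> cell e a x"
  by (auto simp: hwt_def cell_def indicator_def dist_norm norm_minus_commute)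

lemma corr_le_cell: "corr d e a x \<le> d / 2 * cell e a x"
  using corr_le[of a x] corr_zero[of x a]
  by (cases "norm (x - a) < e / 2") (auto simp: cell_def indicator_def dist_norm norm_minus_commute)

lemma gsq_corr: "gsq (\<lambda>x. of_real (corr d e a x)) x
    = (cprof d (norm (x - a) / e) * norm (x - a) / e\<^sup>2)\<^sup>2"
proof -
  have "gsq (\<lambda>x. of_real (corr d e a x)) x
      = (\<Sum>i\<in>UNIV. (cprof d (norm (x - a) / e) / e\<^sup>2)\<^sup>2 *
      ((x - a) $ i)\<^sup>2)"
    unfolding gsq_def partial_corr norm_of_real by (simp add: power_mult_distrib power_divide)
  also have "\<dots> = (cprof d (norm (x - a) / e) / e\<^sup>2)\<^sup>2 * (norm (x - a))\<^sup>2"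
  proof -
    have "(norm (x - a))\<^sup>2 = (\<Sum>i\<in>UNIV. ((x - a) $ i)\<^sup>2)"
      unfolding power2_norm_eq_inner inner_vec_def by (simp add: power2_eq_square)
    then show ?thesis by (simp only: sum_distrib_left)
  qed
  finally show ?thesis by (simp add: power_mult_distrib power_divide)
qed

text \<open>The length is cprof(s) s / e, so the bound for the profile applies away from the centre.
  At the centre both sides are zero, in accordance with the default value of \<open>hwt\<close>
  there.\<close>

lemma grad_corr_le: "sqrt (gsq (\<lambda>x. of_real (corr d e a x)) x) \<le> hwt d e a x / (3 * e)"
proof -
  let ?s = "norm (x - a) / e"
  have "sqrt (gsq (\<lambda>x. of_real (corr d e a x)) x) = cprof d ?s * ?s / e"
  proof -
    have nn: "0 \<le> cprof d ?s * norm (x - a) / e\<^sup>2" using e_pos cprof_nonneg by simp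
    show ?thesis unfolding gsq_corr real_sqrt_abs abs_of_nonneg[OF nn]
        by (simp add: power2_eq_square)
  qed
  also have "\<dots> \<le> hwt d e a x / 3 / e"
  proof (intro divide_right_mono)
    show "cprof d ?s * ?s \<le> hwt d e a x / 3"
    proof (cases "x = a")
      case False
      show ?thesis
      proof (cases "norm (x - a) < e / 2")
        case True
        then show ?thesis using False cprof_mult_le[of ?s] e_pos by (simp add: hwt_def field_simps)
      next
        case 2: False
        then have "1/2 \<le> ?s" using e_pos by (simp add: field_simps)
        with 2 show ?thesis by (simp add: cprof_large hwt_def)
      qed
    qed (use hwt_bounds(1)[of a a] in auto)
  qed (use e_pos in auto)
  finally show ?thesis by (simp add: mult.commute)
qed

end

section \<open>Gradients of squared moduli\<close>

lemma inner_sum_le_sqrt: "(\<Sum>i\<in>(UNIV::3 set). cmod (u i) * cmod (v i))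
    \<le> sqrt (\<Sum>i\<in>UNIV. (cmod (u i))\<^sup>2) * sqrt
    (\<Sum>i\<in>UNIV. (cmod (v i))\<^sup>2)"
  using L2_set_mult_ineq[of "\<lambda>i. cmod (u i)" "\<lambda>i. cmod (v i)" UNIV]
      by (simp add: L2_set_def)

lemma partial_sq:
  assumes "w differentiable at x"
  shows "partial_deriv i (\<lambda>x. w x * cnj (w x)) x
      = of_real (2 * Re (cnj (w x) * partial_deriv i w x))"
proof -
  have "partial_deriv i (\<lambda>x. w x * cnj (w x)) x = partial_deriv i w x * cnj (w x)
      + w x * cnj (partial_deriv i w x)"
    using assms by (simp add: partial_deriv_mult differentiable_bounded_linear[OF
        bounded_linear_cnj]
      partial_deriv_bounded_linear[OF bounded_linear_cnj])
  then show ?thesis by (simp add: complex_eq_iff)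
qed

lemma C1c_sq_fun: "C1c w \<Longrightarrow> C1c (\<lambda>x. w x * cnj (w x))"
  by (rule C1c_mult[OF C1c_cnj]) auto

lemma sq_eq: "w x * cnj (w x) = of_real (sq w x)"
  unfolding sq_def by (rule complex_norm_square[symmetric])

lemma grad_sq_bound:
  fixes r :: "3 \<Rightarrow> real"
  assumes "w differentiable at x"
  shows "\<bar>\<Sum>i\<in>UNIV. r i * Re (partial_deriv i (\<lambda>x. w x * cnj (w x)) x)\<bar>
    \<le> 2 * sqrt (\<Sum>i\<in>UNIV. (r i)\<^sup>2) * sqrt (sq w x) * sqrt (gsq w x)"
proof -
  have "\<bar>\<Sum>i\<in>UNIV. r i * Re (partial_deriv i (\<lambda>x. w x * cnj (w x)) x)\<bar>
    \<le> (\<Sum>i\<in>UNIV. 2 * cmod (w x) * (cmod (of_real (r i)) * cmod (partial_deriv i w x)))"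
  proof (intro order_trans[OF sum_abs] sum_mono)
    fix i
    have "\<bar>Re (cnj (w x) * partial_deriv i w x)\<bar>
        \<le> cmod (w x) * cmod (partial_deriv i w x)"
      using abs_Re_le_cmod[of "cnj (w x) * partial_deriv i w x"] by (simp add: norm_mult)
    then have "\<bar>r i\<bar> * (2 * \<bar>Re (cnj (w x) * partial_deriv i w x)\<bar>)
        \<le> \<bar>r i\<bar> * (2 * (cmod (w x) * cmod (partial_deriv i w x)))"
      by (intro mult_left_mono) auto
    then show "\<bar>r i * Re (partial_deriv i (\<lambda>x. w x * cnj (w x)) x)\<bar>
        \<le> 2 * cmod (w x) * (cmod (of_real (r i)) * cmod (partial_deriv i w x))"
      unfolding partial_sq[OF assms] Re_complex_of_real abs_mult norm_of_real by (simp add: mult_ac)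
  qed
  also have "\<dots> = 2 * cmod (w x) * (\<Sum>i\<in>UNIV. cmod (of_real (r i)) * cmod
      (partial_deriv i w x))"
    by (simp add: sum_distrib_left)
  also have "\<dots> \<le> 2 * cmod (w x) * (sqrt (\<Sum>i\<in>UNIV. (cmod (of_real (r i)))\<^sup>2)
      * sqrt (gsq w x))"
    unfolding gsq_def by (intro mult_left_mono inner_sum_le_sqrt) auto
  finally show ?thesis by (simp add: sq_def mult_ac)
qed

lemma C1c_borel [measurable_dest]:
  assumes "C1c w"
  shows "w \<in> borel_measurable borel"
  by (intro borel_measurable_continuous_onI C1c_continuous assms)

lemma Re_of_real_mult: "Re (of_real r * z) = r * Re z"
  by simp

context hole
begin

section \<open>Integral identities and energy estimates in one cell\<close>

lemma cprof_radial:
  fixes a :: "real^3"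
  assumes "C1c w"
  defines "s \<equiv> \<lambda>x. norm (x - a) / e"
  defines "F \<equiv> \<lambda>x. of_real (3 * cprof d (s x) + s x * cprof' d (s x)) * w x
            + of_real (cprof d (s x)) * (\<Sum>i\<in>UNIV. of_real ((x - a) $ i) * partial_deriv i w
                x)"
  shows "integrable lebesgue F" "integral\<^sup>L lebesgue F = 0"
proof -
  have "cprof' d \<in> borel_measurable borel" unfolding cprof'_def[abs_def] by measurable
  from radial_integration_by_parts[OF lipb_cprof _ cprof_deriv this assms(1) e_pos, of "{d, 1/2}" a]
  show "integrable lebesgue F" "integral\<^sup>L lebesgue F = 0" unfolding F_def s_def by blast+
qed

lemma hprof_radial:
  fixes a :: "real^3"
  assumes "C1c w"
  defines "s \<equiv> \<lambda>x. norm (x - a) / e"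
  defines "F \<equiv> \<lambda>x. of_real (3 * hprof d (s x) + s x * hprof' d (s x)) * w x
            + of_real (hprof d (s x)) * (\<Sum>i\<in>UNIV. of_real ((x - a) $ i) * partial_deriv i w
                x)"
  shows "integrable lebesgue F" "integral\<^sup>L lebesgue F = 0"
proof -
  have "hprof' d \<in> borel_measurable borel" unfolding hprof'_def[abs_def] by measurable
  from radial_integration_by_parts[OF lipb_hprof _ hprof_deriv this assms(1) e_pos, of "{d, 1/2}" a]
  show "integrable lebesgue F" "integral\<^sup>L lebesgue F = 0" unfolding F_def s_def by blast+
qed

lemma AE_off_spheres: "AE x in lebesgue. x \<noteq> a \<and> norm (x - a) / e \<notin> {d, 1/2}"
proof -
  have "negligible ({a} \<union> sphere a (d * e) \<union> sphere a (1/2 * e))"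
    by (intro negligible_Un negligible_sphere) auto
  then have "AE x in lebesgue. x \<notin> {a} \<union> sphere a (d * e) \<union> sphere a (1/2 * e)"
    by (intro AE_not_in) (simp add: negligible_iff_null_sets)
  then show ?thesis
  proof eventually_elim
    case (elim x)
    then have "dist a x \<noteq> d * e" "dist a x \<noteq> 1/2 * e" "x \<noteq> a" by auto
    then show ?case using e_pos by (auto simp: dist_norm norm_minus_commute field_simps)
  qed
qed

lemma weight_measurable [measurable]:
  "wpot d e a \<in> borel_measurable lebesgue" "cell e a \<in> borel_measurable lebesgue"
  "hwt d e a \<in> borel_measurable lebesgue" "corr d e a \<in> borel_measurable lebesgue"
proof -
  show "wpot d e a \<in> borel_measurable lebesgue" "cell e a \<in> borel_measurable lebesgue"
    unfolding wpot_def[abs_def] cell_def[abs_def]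
    by (intro borel_imp_lebesgue borel_measurable_times borel_measurable_indicator
        borel_measurable_const; simp)+
  have [measurable]: "(\<lambda>x. norm (x - a)) \<in> borel_measurable borel"
    by (intro borel_measurable_continuous_onI continuous_intros)
  show "hwt d e a \<in> borel_measurable lebesgue"
    unfolding hwt_def[abs_def] by (intro borel_imp_lebesgue) measurable
  have "(\<lambda>x. Re (complex_of_real (corr d e a x))) \<in> borel_measurable lebesgue"
    using continuous_lebesgue[OF C1c_continuous[OF C1c_corr]] by measurable
  then show "corr d e a \<in> borel_measurable lebesgue" by simp
qed

lemma weight_bounds:
  "\<bar>wpot d e a x\<bar> \<le> 1 / (e\<^sup>2 * d)" "\<bar>cell e a x\<bar>
      \<le> 1" "\<bar>hwt d e a x\<bar> \<le> 1" "\<bar>corr d e a x\<bar> \<le> d"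
  using hwt_bounds[of a x] d_pos corr_nonneg[of a x] corr_le[of a x]
  by (auto simp: wpot_def cell_def indicator_def hwt_def)

lemma weight_nonneg: "0 \<le> wpot d e a x" "0 \<le> cell e a x"
  using d_pos by (auto simp: wpot_def cell_def)

lemmas integrable_cell [intro] =
  integrable_weighted_real[OF weight_measurable(1) weight_bounds(1)]
  integrable_weighted_real[OF weight_measurable(2) weight_bounds(2)]
  integrable_weighted_real[OF weight_measurable(3) weight_bounds(3)]
  integrable_weighted_real[OF weight_measurable(4) weight_bounds(4)]

text \<open>The weak form of the corrector equation. Off the centre and two spheres the difference
  of the integrands is the integrand of \<open>cprof_radial\<close> divided by e^2, so the jumps of
  the Laplacian of \<open>corr\<close> are already accounted for by that identity.\<close>

lemma corr_identity:
  assumes w: "C1c w"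
  shows "integrable lebesgue (\<lambda>x. \<Sum>i\<in>UNIV. partial_deriv i
      (\<lambda>x. of_real (corr d e a x)) x * partial_deriv i w x)"
    and "integrable lebesgue (\<lambda>x. of_real (wpot d e a x - 8 * (d / e)\<^sup>2 * cell e a x)
        * w x)"
    and "(LINT x|lebesgue. (\<Sum>i\<in>UNIV. partial_deriv i (\<lambda>x. of_real (corr d e a x)) x
        * partial_deriv i w x))
      = (LINT x|lebesgue. of_real (wpot d e a x - 8 * (d / e)\<^sup>2 * cell e a x) * w x)"
proof -
  let ?s = "\<lambda>x. norm (x - a) / e"
  let ?G = "\<lambda>x. \<Sum>i\<in>UNIV. partial_deriv i (\<lambda>x. of_real (corr d e a x)) x *
      partial_deriv i w x"
  let ?W = "\<lambda>x. of_real (wpot d e a x - 8 * (d / e)\<^sup>2 * cell e a x) * w x"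
  define F where "F x = of_real (3 * cprof d (?s x) + ?s x * cprof' d (?s x)) * w x
            + of_real (cprof d (?s x)) * (\<Sum>i\<in>UNIV. of_real ((x - a) $ i) * partial_deriv i
                w x)" for x
  have Fi: "integrable lebesgue F" and F0: "integral\<^sup>L lebesgue F = 0"
    using cprof_radial[OF w, of a] unfolding F_def[abs_def] by blast+
  have G: "integrable lebesgue ?G"
  proof (intro Bochner_Integration.integrable_sum)
    fix i
    show "integrable lebesgue (\<lambda>x. partial_deriv i (\<lambda>x. of_real (corr d e a x)) x *
        partial_deriv i w x)"
      using C1c_integrable_mult(2)[OF C1c_corr C1c_continuous_partial[OF w]] .
  qed
  have W: "integrable lebesgue ?W"
  proof (rule integrable_weighted_complex[of _ "1 / (e\<^sup>2 * d) + 8 * (d / e)\<^sup>2"])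
    fix x
    have "\<bar>8 * (d / e)\<^sup>2 * cell e a x\<bar> \<le> 8 * (d / e)\<^sup>2 * 1"
      unfolding abs_mult using weight_bounds(2)[of a x] by (intro mult_mono) auto
    then show "\<bar>wpot d e a x - 8 * (d / e)\<^sup>2 * cell e a x\<bar> \<le> 1 / (e\<^sup>2 * d)
        + 8 * (d / e)\<^sup>2"
      using weight_bounds(1)[of a x] by linarith
  qed (use C1c_continuous[OF w] C1c_bounded[OF w] in auto)
  show "integrable lebesgue ?G" "integrable lebesgue ?W" by fact+
  have aux: "of_real (A / E) * z - (- B) / of_real E = (of_real A * z + B) / of_real E"
      for A E :: real and z B :: complex
    by (simp add: add_divide_distrib)
  have "AE x in lebesgue. ?W x - ?G x = F x / of_real (e\<^sup>2)"
    using AE_off_spheres[of a]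
  proof eventually_elim
    case (elim x)
    then have s: "?s x > 0" "?s x \<notin> {d, 1/2}" using e_pos by auto
    have 1: "wpot d e a x - 8 * (d / e)\<^sup>2 * cell e a x
        = (3 * cprof d (?s x) + ?s x * cprof' d (?s x)) / e\<^sup>2"
      unfolding cprof_div[OF s] using e_pos d_pos
      by (auto simp: wpot_def cell_def indicator_def dist_norm norm_minus_commute power_divide
          field_simps)
    have 2: "?G x = - (of_real (cprof d (?s x)) * (\<Sum>i\<in>UNIV. of_real ((x - a) $ i) *
        partial_deriv i w x)) / of_real (e\<^sup>2)"
      unfolding partial_corr by (simp add: sum_distrib_left sum_divide_distrib sum_negf[symmetric]
          mult.assoc del: vector_minus_component)
    show ?case unfolding 1 2 F_def by (rule aux)
  qed
  then have "(LINT x|lebesgue. ?W x - ?G x) = (LINT x|lebesgue. F x / of_real (e\<^sup>2))"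
  proof (rule integral_cong_AE[rotated 2])
    show "(\<lambda>x. ?W x - ?G x) \<in> borel_measurable lebesgue" using G W by simp
    have "F \<in> borel_measurable lebesgue" using Fi by auto
    then show "(\<lambda>x. F x / of_real (e\<^sup>2)) \<in> borel_measurable lebesgue" by simp
  qed
  also have "\<dots> = 0" using F0 by simp
  finally show "integral\<^sup>L lebesgue ?G = integral\<^sup>L lebesgue ?W" using G W by simp
qed

text \<open>Testing the field of \<open>hprof\<close> with |w|^2 bounds the integral of
  (\<open>hwt\<close> / d^2 - 12 \<open>cell\<close>) |w|^2 by that of 2 e A |w| |grad w| with A =
  \<open>hprof\<close> s. By Young's inequality this is at most A^2 |w|^2 / 2 + 2 e^2 |grad w|^2,
  and A^2 \<le> \<open>hwt\<close> / d^2, so half of the main term absorbs the first part. The gain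
  is the factor d^2 on the right.\<close>

lemma hardy:
  assumes w: "C1c w"
  shows "(LINT x|lebesgue. hwt d e a x * sq w x) \<le>
    d\<^sup>2 * (24 * (LINT x|lebesgue. cell e a x * sq w x) + 4 * e\<^sup>2 *
        (LINT x|lebesgue. cell e a x * gsq w x))"
proof -
  let ?s = "\<lambda>x. norm (x - a) / e"
  let ?w = "\<lambda>x. w x * cnj (w x)"
  define F where "F x = of_real (3 * hprof d (?s x) + ?s x * hprof' d (?s x)) * ?w x
            + of_real (hprof d (?s x)) * (\<Sum>i\<in>UNIV. of_real ((x - a) $ i) * partial_deriv i
                ?w x)" for x
  define H where "H x = (1 / (2 * d\<^sup>2)) * (hwt d e a x * sq w x) - 12 * (cell e a x * sq w x)
      - 2 * e\<^sup>2 * (cell e a x * gsq w x)" for x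
  have Fi: "integrable lebesgue F" and F0: "integral\<^sup>L lebesgue F = 0"
    using hprof_radial[OF C1c_sq_fun[OF w], of a] unfolding F_def[abs_def] by blast+
  have Hi: "integrable lebesgue (\<lambda>x. hwt d e a x * sq w x)"
      "integrable lebesgue (\<lambda>x. cell e a x * sq w x)"
    "integrable lebesgue (\<lambda>x. cell e a x * gsq w x)"
    using C1c_sq[OF w] C1c_gsq[OF w] by auto
  have "integral\<^sup>L lebesgue H \<le> (LINT x|lebesgue. Re (F x))"
  proof (rule integral_mono_AE)
    show "integrable lebesgue H" unfolding H_def[abs_def]
      by (intro Bochner_Integration.integrable_diff integrable_mult_right Hi)
    show "integrable lebesgue (\<lambda>x. Re (F x))" using Fi by simp
    show "AE x in lebesgue. H x \<le> Re (F x)"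
      using AE_off_spheres[of a]
    proof eventually_elim
      case (elim x)
      then have s: "?s x > 0" "?s x \<notin> {d, 1/2}" using e_pos by auto
      define S where "S = (\<Sum>i\<in>UNIV. (x - a) $ i * Re (partial_deriv i ?w x))"
      have RF: "Re (F x) = (3 * hprof d (?s x) + ?s x * hprof' d (?s x)) * sq w x
          + hprof d (?s x) * S"
        unfolding F_def sq_eq S_def by (simp del: vector_minus_component)
      have "norm (x - a) = sqrt (\<Sum>i\<in>UNIV. ((x - a) $ i)\<^sup>2)"
        unfolding norm_eq_sqrt_inner inner_vec_def by (simp add: power2_eq_square)
      then have Sb: "\<bar>S\<bar> \<le> 2 * norm (x - a) * sqrt (sq w x) * sqrt (gsq w x)"
        unfolding S_def using grad_sq_bound[OF C1c_differentiable[OF w], of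
            "\<lambda>i. (x - a) $ i" x] by simp
      show "H x \<le> Re (F x)"
      proof (cases "?s x < 1/2")
        case True
        define A where "A = hprof d (?s x) * ?s x"
        define u v where "u = sqrt (sq w x)" and "v = sqrt (gsq w x)"
        have uv: "u\<^sup>2 = sq w x" "v\<^sup>2 = gsq w x" by (simp_all add: u_def v_def)
        have h: "hwt d e a x = min 1 ((d / ?s x)\<^sup>2)" "cell e a x = 1"
          using True e_pos by (auto simp: hwt_def cell_def indicator_def dist_norm
              norm_minus_commute field_simps)
        have "hprof d (?s x) * \<bar>S\<bar> \<le> hprof d (?s x) * (2 * norm (x - a) * u * v)"
          unfolding u_def v_def by (intro mult_left_mono Sb hprof_nonneg)
        also have "\<dots> = 2 * e * A * u * v" using e_pos by (simp add: A_def)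
        also have "\<dots> \<le> A\<^sup>2 * u\<^sup>2 / 2 + 2 * e\<^sup>2 * v\<^sup>2"
          using zero_le_power2[of "A * u - 2 * e * v"]
              by (simp add: power2_diff power_mult_distrib field_simps)
        also have "A\<^sup>2 * u\<^sup>2 \<le> hwt d e a x / d\<^sup>2 * u\<^sup>2"
          using hprof_mult_le[OF s(1) True] unfolding h A_def by (intro mult_right_mono) auto
        finally have "hprof d (?s x) * \<bar>S\<bar> \<le> hwt d e a x / d\<^sup>2 * sq w x / 2
            + 2 * e\<^sup>2 * gsq w x"
          by (simp add: uv)
        moreover have "- (hprof d (?s x) * \<bar>S\<bar>) \<le> hprof d (?s x) * S"
          using mult_left_mono[OF _ hprof_nonneg, of "- \<bar>S\<bar>" S "?s x"] by simp
        moreover have "(hwt d e a x / d\<^sup>2 - 12) * sq w x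
            \<le> (3 * hprof d (?s x) + ?s x * hprof' d (?s x)) * sq w x"
          using hprof_div[OF s] True unfolding h by (intro mult_right_mono) auto
        ultimately show ?thesis unfolding RF H_def h(2) by (simp add: algebra_simps)
      next
        case False
        then have 0: "hwt d e a x = 0" "cell e a x = 0" "hprof d (?s x) = 0"
          using e_pos by (auto simp: hwt_def cell_def indicator_def dist_norm norm_minus_commute
              field_simps intro!: hprof_large)
        have "0 \<le> (3 * hprof d (?s x) + ?s x * hprof' d (?s x)) * sq w x"
          using hprof_div[OF s] False by (intro mult_nonneg_nonneg) auto
        then show ?thesis unfolding RF H_def using 0 by simp
      qed
    qed
  qed
  also have "\<dots> = 0" using F0 Fi by simp
  finally have "integral\<^sup>L lebesgue H \<le> 0" .
  then have "(1 / (2 * d\<^sup>2)) * (LINT x|lebesgue. hwt d e a x * sq w x)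
      - 12 * (LINT x|lebesgue. cell e a x * sq w x)
     - 2 * e\<^sup>2 * (LINT x|lebesgue. cell e a x * gsq w x) \<le> 0"
    unfolding H_def using Hi by simp
  then show ?thesis using d_pos by (simp add: field_simps)
qed

text \<open>\<open>r\<close> lists the real components of the gradient of \<open>corr\<close>; the
  estimate is Cauchy-Schwarz combined with the fact that the gradient of |w|^2 has length at most 2
  |w| |grad w|.\<close>

lemma grad_corr_inner:
  fixes w :: "real^3 \<Rightarrow> complex" and a :: "real^3"
  assumes w: "C1c w"
  defines "r \<equiv> \<lambda>x i. - cprof d (norm (x - a) / e) * (x - a) $ i / e\<^sup>2"
  defines "S \<equiv> \<lambda>x. \<Sum>i\<in>UNIV. r x i * Re
      (partial_deriv i (\<lambda>x. w x * cnj (w x)) x)"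
  shows "Re (\<Sum>i\<in>UNIV. partial_deriv i (\<lambda>x. of_real (corr d e a x)) x *
      partial_deriv i (\<lambda>x. w x * cnj (w x)) x) = S x"
    and "\<bar>S x\<bar> \<le> 2 * sqrt (gsq (\<lambda>x. of_real (corr d e a x)) x) * sqrt (sq w x)
        * sqrt (gsq w x)"
    and "(\<Sum>i\<in>UNIV. (r x i)\<^sup>2) = gsq (\<lambda>x. of_real (corr d e a x)) x"
proof -
  show "Re (\<Sum>i\<in>UNIV. partial_deriv i (\<lambda>x. of_real (corr d e a x)) x * partial_deriv
      i (\<lambda>x. w x * cnj (w x)) x) = S x"
    unfolding partial_corr S_def r_def Re_sum by (simp only: Re_of_real_mult)
  show 3: "(\<Sum>i\<in>UNIV. (r x i)\<^sup>2) = gsq (\<lambda>x. of_real (corr d e a x)) x"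
    unfolding gsq_def partial_corr r_def norm_of_real by (simp only: power2_abs)
  show "\<bar>S x\<bar> \<le> 2 * sqrt (gsq (\<lambda>x. of_real (corr d e a x)) x) * sqrt (sq w x)
      * sqrt (gsq w x)"
    unfolding S_def 3[symmetric] by (rule grad_sq_bound[OF C1c_differentiable[OF w]])
qed

text \<open>The corrector equation tested with |w|^2 gives the cell term with factor 8 plus a
  pairing of gradients. The pairing is at most \<open>hwt\<close> |w|^2 / (9 e^2) +
  \<open>cell\<close> |grad w|^2, and Hardy's inequality turns the first part into the factors 24/9
  (d/e)^2 \<le> 3 (d/e)^2 and 4/9 d^2 \<le> 1. Hence 11 = 8 + 3 and 2 = 1 + 1.\<close>

lemma wpot_energy:
  assumes w: "C1c w"
  shows "(LINT x|lebesgue. wpot d e a x * sq w x) \<le>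
    11 * (d / e)\<^sup>2 * (LINT x|lebesgue. cell e a x * sq w x) + 2 * (LINT x|lebesgue. cell e a x
        * gsq w x)"
proof -
  let ?w = "\<lambda>x. w x * cnj (w x)"
  define G where "G x = (\<Sum>i\<in>UNIV. partial_deriv i (\<lambda>x. of_real (corr d e a x)) x *
      partial_deriv i ?w x)" for x
  note I = corr_identity[OF C1c_sq_fun[OF w], of a, folded G_def]
  have Hi: "integrable lebesgue (\<lambda>x. hwt d e a x * sq w x)"
      "integrable lebesgue (\<lambda>x. cell e a x * sq w x)"
    "integrable lebesgue (\<lambda>x. cell e a x * gsq w x)"
        "integrable lebesgue (\<lambda>x. wpot d e a x * sq w x)"
    using C1c_sq[OF w] C1c_gsq[OF w] by auto
  have "(LINT x|lebesgue. Re (of_real (wpot d e a x - 8 * (d / e)\<^sup>2 * cell e a x) * ?w x))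
      = (LINT x|lebesgue. Re (G x))"
    using I by (simp only: integral_Re)
  also have "\<dots> \<le> (LINT x|lebesgue. (1 / (9 * e\<^sup>2)) * (hwt d e a x * sq w x)
      + cell e a x * gsq w x)"
  proof (rule integral_mono)
    show "integrable lebesgue (\<lambda>x. Re (G x))" using I(1) by simp
    show "integrable lebesgue (\<lambda>x. (1 / (9 * e\<^sup>2)) * (hwt d e a x * sq w x)
        + cell e a x * gsq w x)"
      by (intro Bochner_Integration.integrable_add integrable_mult_right Hi)
    fix x
    define u v g where "u = sqrt (sq w x)" and "v = sqrt (gsq w x)"
        and "g = sqrt (gsq (\<lambda>x. of_real (corr d e a x)) x)"
    have uv: "u\<^sup>2 = sq w x" "v\<^sup>2 = gsq w x" "u \<ge> 0" "v \<ge> 0" "g \<ge> 0"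
        by (simp_all add: u_def v_def g_def)
    define k where "k = hwt d e a x"
    have k: "0 \<le> k" "k \<le> 1" "g \<le> k / (3 * e)" "k = 0 \<or> cell e a x = 1"
      using hwt_bounds[of a x] weight_bounds(3)[of a x] grad_corr_le[of a x]
      by (auto simp: k_def g_def cell_def indicator_def split: if_splits)
    have "Re (G x) \<le> 2 * g * u * v"
      using grad_corr_inner(1)[OF w, of a x] grad_corr_inner(2)[OF w, of x a]
          unfolding G_def u_def v_def g_def by linarith
    also have "\<dots> \<le> 2 * (k / (3 * e)) * u * v"
      using k uv by (intro mult_right_mono mult_left_mono) auto
    also have "\<dots> \<le> k * u\<^sup>2 / (9 * e\<^sup>2) + cell e a x * v\<^sup>2"
    proof (cases "k = 0")
      case True then show ?thesis using weight_nonneg by simp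
    next
      case False
      have "0 \<le> (k * u / (3 * e) - v)\<^sup>2" by simp
      then have "2 * (k / (3 * e)) * u * v \<le> (k * u / (3 * e))\<^sup>2 + v\<^sup>2"
          by (simp add: power2_diff)
      also have "(k * u / (3 * e))\<^sup>2 = k\<^sup>2 * u\<^sup>2 / (9 * e\<^sup>2)"
          by (simp add: power_divide power_mult_distrib)
      \<comment> \<open>Since \<open>hwt\<close> is at most 1, its square may be replaced by its
        first power, to which Hardy's inequality applies.\<close>
      also have "\<dots> \<le> k * u\<^sup>2 / (9 * e\<^sup>2)"
        using k by (intro divide_right_mono mult_right_mono) (auto simp: power2_eq_square
            mult_left_le)
      finally show ?thesis using False k by simp
    qed
    finally show "Re (G x) \<le> (1 / (9 * e\<^sup>2)) * (hwt d e a x * sq w x)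
        + cell e a x * gsq w x"
      by (simp add: uv k_def)
  qed
  also have "\<dots> = (1 / (9 * e\<^sup>2)) * (LINT x|lebesgue. hwt d e a x * sq w x)
      + (LINT x|lebesgue. cell e a x * gsq w x)"
    using Hi by simp
  also have "(LINT x|lebesgue. Re (of_real (wpot d e a x - 8 * (d / e)\<^sup>2 * cell e a x) * ?w
      x))
     = (LINT x|lebesgue. wpot d e a x * sq w x) - 8 * (d / e)\<^sup>2 * (LINT x|lebesgue. cell e a x
         * sq w x)"
  proof -
    have "Re (of_real (wpot d e a x - 8 * (d / e)\<^sup>2 * cell e a x) * ?w x)
       = wpot d e a x * sq w x - 8 * (d / e)\<^sup>2 * (cell e a x * sq w x)" for x
      unfolding sq_eq by (simp add: algebra_simps)
    then show ?thesis using Hi by simp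
  qed
  finally have "(LINT x|lebesgue. wpot d e a x * sq w x)
      \<le> 8 * (d / e)\<^sup>2 * (LINT x|lebesgue. cell e a x * sq w x)
    + (1 / (9 * e\<^sup>2)) * (LINT x|lebesgue. hwt d e a x * sq w x) + (LINT x|lebesgue. cell e a x
        * gsq w x)" by simp
  also have "(1 / (9 * e\<^sup>2)) * (LINT x|lebesgue. hwt d e a x * sq w x)
      \<le> (1 / (9 * e\<^sup>2)) *
    (d\<^sup>2 * (24 * (LINT x|lebesgue. cell e a x * sq w x) + 4 * e\<^sup>2 *
        (LINT x|lebesgue. cell e a x * gsq w x)))"
    by (intro mult_left_mono hardy w) auto
  also have "\<dots> = 24 / 9 * (d / e)\<^sup>2 * (LINT x|lebesgue. cell e a x * sq w x)
      + 4 / 9 * d\<^sup>2 * (LINT x|lebesgue. cell e a x * gsq w x)"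
    using e_pos by (simp add: field_simps power_divide)
  also have "\<dots> \<le> 3 * (d / e)\<^sup>2 * (LINT x|lebesgue. cell e a x * sq w x)
      + 1 * (LINT x|lebesgue. cell e a x * gsq w x)"
  proof (intro add_mono mult_right_mono)
    show "0 \<le> (LINT x|lebesgue. cell e a x * sq w x)" "0
        \<le> (LINT x|lebesgue. cell e a x * gsq w x)"
      by (intro Bochner_Integration.integral_nonneg mult_nonneg_nonneg weight_nonneg; simp)+
    have "d\<^sup>2 \<le> 1" using d_pos d_le by (intro power_le_one) auto
    then show "4 / 9 * d\<^sup>2 \<le> 1" by simp
  qed auto
  finally show ?thesis by (simp add: algebra_simps)
qed

text \<open>
  This is the corrector equation tested with \<open>corr * (cmod w)\<^sup>2\<close>.
\<close>

lemma corr_grad_energy: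
  assumes w: "C1c w"
  shows "(LINT x|lebesgue. gsq (\<lambda>x. of_real (corr d e a x)) x * sq w x) \<le>
    d * (LINT x|lebesgue. wpot d e a x * sq w x) + d\<^sup>2 * (LINT x|lebesgue. cell e a x * gsq w
        x)"
proof -
  let ?n = "\<lambda>x. complex_of_real (corr d e a x)"
  let ?w = "\<lambda>x. w x * cnj (w x)"
  let ?v = "\<lambda>x. ?n x * ?w x"
  define G where "G x = (\<Sum>i\<in>UNIV. partial_deriv i ?n x * partial_deriv i ?v x)" for x
  have Cv: "C1c ?v" by (rule C1c_mult[OF C1c_sq_fun[OF w] C1c_corr])
  note I = corr_identity[OF Cv, of a, folded G_def]
  have Hi: "integrable lebesgue (\<lambda>x. cell e a x * sq w x)"
    "integrable lebesgue (\<lambda>x. cell e a x * gsq w x)"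
        "integrable lebesgue (\<lambda>x. wpot d e a x * sq w x)"
    using C1c_sq[OF w] C1c_gsq[OF w] by auto
  have Ni: "integrable lebesgue (\<lambda>x. gsq ?n x * sq w x)"
  proof -
    have "bounded {x. gsq ?n x * sq w x \<noteq> 0}"
        by (rule bounded_subset[OF C1c_sq(2)[OF w]]) auto
    moreover have c: "continuous_on UNIV (\<lambda>x. gsq ?n x * sq w x)"
      by (intro continuous_on_mult C1c_gsq C1c_sq w C1c_corr)
    ultimately show ?thesis using continuous_bounded_supp_bounded[of
        "\<lambda>x. gsq ?n x * sq w x"]
      integrable_bounded_supp[OF continuous_lebesgue[OF c]] by metis
  qed
  have "(LINT x|lebesgue. (1/2) * (gsq ?n x * sq w x) - (d\<^sup>2 / 2) * (cell e a x * gsq w x))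
    \<le> (LINT x|lebesgue. Re (G x))"
  proof (rule integral_mono)
    show "integrable lebesgue (\<lambda>x. Re (G x))" using I(1) by simp
    show "integrable lebesgue (\<lambda>x. (1/2) * (gsq ?n x * sq w x)
        - (d\<^sup>2 / 2) * (cell e a x * gsq w x))"
      by (intro Bochner_Integration.integrable_diff integrable_mult_right Hi Ni)
    fix x
    let ?r = "\<lambda>i. - cprof d (norm (x - a) / e) * (x - a) $ i / e\<^sup>2"
    define S where "S = (\<Sum>i\<in>UNIV. ?r i * Re (partial_deriv i ?w x))"
    have pv: "partial_deriv i ?v x = of_real (?r i) * of_real (sq w x)
        + ?n x * partial_deriv i ?w x" for i
      using partial_deriv_mult[OF C1c_differentiable[OF C1c_corr] C1c_differentiable[OF
          C1c_sq_fun[OF w]]]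
      unfolding partial_corr sq_eq by metis
    have "Re (G x) = (\<Sum>i\<in>UNIV. ?r i * (?r i * sq w x
        + corr d e a x * Re (partial_deriv i ?w x)))"
      unfolding G_def Re_sum pv unfolding partial_corr
      by (intro sum.cong refl) (simp only: Re_of_real_mult plus_complex.simps Re_complex_of_real
          of_real_mult[symmetric])
    also have "\<dots> = (\<Sum>i\<in>UNIV. (?r i)\<^sup>2) * sq w x + corr d e a x * S"
      unfolding S_def sum_distrib_left sum_distrib_right sum.distrib[symmetric]
      by (intro sum.cong refl) (simp only: power2_eq_square distrib_left mult_ac)
    also have "(\<Sum>i\<in>UNIV. (?r i)\<^sup>2) = gsq ?n x" by (rule grad_corr_inner(3)[OF w])
    finally have R: "Re (G x) = gsq ?n x * sq w x + corr d e a x * S" .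
    define u v g where "u = sqrt (sq w x)" and "v = sqrt (gsq w x)" and "g = sqrt (gsq ?n x)"
    have uv: "u\<^sup>2 = sq w x" "v\<^sup>2 = gsq w x" "g\<^sup>2 = gsq ?n x"
        by (simp_all add: u_def v_def g_def)
    have Sb: "\<bar>S\<bar> \<le> 2 * g * u * v"
      unfolding S_def u_def v_def g_def by (rule grad_corr_inner(2)[OF w])
    have "\<bar>corr d e a x * S\<bar> \<le> (d / 2 * cell e a x) * (2 * g * u * v)"
      unfolding abs_mult using Sb corr_le_cell[of a x] corr_nonneg[of a x] by (intro mult_mono) auto
    also have "\<dots> = cell e a x * (g * u * (d * v))" by simp
    also have "\<dots> \<le> cell e a x * ((1/2) * (g\<^sup>2 * u\<^sup>2)
        + (d\<^sup>2 / 2) * v\<^sup>2)"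
    proof (intro mult_left_mono weight_nonneg)
      show "g * u * (d * v) \<le> (1/2) * (g\<^sup>2 * u\<^sup>2) + (d\<^sup>2 / 2) * v\<^sup>2"
        using zero_le_power2[of "g * u - d * v"]
            by (simp add: power2_diff power_mult_distrib field_simps)
    qed
    also have "\<dots> \<le> (1/2) * (gsq ?n x * sq w x) + (d\<^sup>2 / 2) * (cell e a x * gsq w x)"
      using weight_nonneg(2)[of a x] weight_bounds(2)[of a x]
          by (auto simp: uv cell_def indicator_def)
    finally show "(1/2) * (gsq ?n x * sq w x) - (d\<^sup>2 / 2) * (cell e a x * gsq w x)
        \<le> Re (G x)"
      unfolding R by linarith
  qed
  also have "\<dots> = (LINT x|lebesgue. Re (of_real (wpot d e a x
      - 8 * (d / e)\<^sup>2 * cell e a x) * ?v x))"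
    using I by (simp only: integral_Re)
  also have "\<dots> \<le> (LINT x|lebesgue. (d / 2) * (wpot d e a x * sq w x))"
  proof (rule integral_mono)
    show "integrable lebesgue (\<lambda>x. Re (of_real (wpot d e a x
        - 8 * (d / e)\<^sup>2 * cell e a x) * ?v x))"
      using I(2) by (rule integrable_Re)
    show "integrable lebesgue (\<lambda>x. (d / 2) * (wpot d e a x * sq w x))"
      by (intro integrable_mult_right Hi)
    fix x
    have "Re (of_real (wpot d e a x - 8 * (d / e)\<^sup>2 * cell e a x) * ?v x)
      = (wpot d e a x - 8 * (d / e)\<^sup>2 * cell e a x) * (corr d e a x * sq w x)"
      unfolding sq_eq by (simp only: Re_of_real_mult Re_complex_of_real)
    \<comment> \<open>The cell term has a negative sign and may be dropped because
      \<open>corr\<close> is nonnegative.\<close>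
    also have "\<dots> \<le> wpot d e a x * (corr d e a x * sq w x)"
      using weight_nonneg[of a x] corr_nonneg[of a x] by (intro mult_right_mono) auto
    also have "\<dots> \<le> wpot d e a x * (d / 2 * sq w x)"
      using weight_nonneg[of a x] corr_le[of a x] by (intro mult_left_mono mult_right_mono) auto
    finally show "Re (of_real (wpot d e a x - 8 * (d / e)\<^sup>2 * cell e a x) * ?v x)
        \<le> (d / 2) * (wpot d e a x * sq w x)"
      by (simp add: mult_ac)
  qed
  also have "(LINT x|lebesgue. (1/2) * (gsq ?n x * sq w x)
      - (d\<^sup>2 / 2) * (cell e a x * gsq w x))
    = (1/2) * (LINT x|lebesgue. gsq ?n x * sq w x) - (d\<^sup>2 / 2) * (LINT x|lebesgue. cell e a x
        * gsq w x)"
    by (subst Bochner_Integration.integral_diff) (auto intro: integrable_mult_right Hi Ni simp del: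
        mult_1 times_divide_eq_left)
  finally show ?thesis using Hi by simp
qed

end

subsection \<open>Square-integrable functions\<close>

lemma L2_measurable: "u \<in> L2 \<Longrightarrow> u \<in> borel_measurable lebesgue"
  and L2_integrable: "u \<in> L2
      \<Longrightarrow> integrable lebesgue (\<lambda>x. (cmod (u x))\<^sup>2)"
  by (auto simp: L2_def)

lemma L2_norm_nonneg [simp]: "0 \<le> L2_norm u"
  by (simp add: L2_norm_def)

lemma L2_norm_square: "(L2_norm u)\<^sup>2 = (LINT x|lebesgue. (cmod (u x))\<^sup>2)"
  by (simp add: L2_norm_def)

lemma L2_bound:
  assumes "v \<in> L2" "u \<in> borel_measurable lebesgue" "AE x in lebesgue. cmod (u x)
      \<le> C * cmod (v x)" "C \<ge> 0"
  shows "u \<in> L2" "L2_norm u \<le> C * L2_norm v"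
proof -
  have ae: "AE x in lebesgue. (cmod (u x))\<^sup>2 \<le> C\<^sup>2 * (cmod (v x))\<^sup>2"
    using assms(3)
  proof eventually_elim
    case (elim x)
    from power_mono[OF elim norm_ge_zero, of 2] show ?case by (simp only: power_mult_distrib)
  qed
  have vi: "integrable lebesgue (\<lambda>x. C\<^sup>2 * (cmod (v x))\<^sup>2)"
    using L2_integrable[OF assms(1)] by simp
  have um: "(\<lambda>x. (cmod (u x))\<^sup>2) \<in> borel_measurable lebesgue" using assms(2)
      by measurable
  have ui: "integrable lebesgue (\<lambda>x. (cmod (u x))\<^sup>2)"
  proof (rule Bochner_Integration.integrable_bound[OF vi um])
    show "AE x in lebesgue. norm ((cmod (u x))\<^sup>2)
        \<le> norm (C\<^sup>2 * (cmod (v x))\<^sup>2)"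
      using ae by eventually_elim (simp add: abs_mult)
  qed
  show "u \<in> L2" unfolding L2_def using assms(2) ui by blast
  have "(L2_norm u)\<^sup>2 \<le> (C * L2_norm v)\<^sup>2"
    unfolding power_mult_distrib L2_norm_square
    using integral_mono_AE[OF ui vi ae] by simp
  then show "L2_norm u \<le> C * L2_norm v"
    by (rule power2_le_imp_le) (simp add: assms(4))
qed

lemma L2_norm_cong_AE:
  assumes "AE x in lebesgue. u x = v x" "u \<in> borel_measurable lebesgue"
      "v \<in> borel_measurable lebesgue"
  shows "L2_norm u = L2_norm v"
  unfolding L2_norm_def using assms
  by (intro arg_cong[of _ _ sqrt] integral_cong_AE) (auto elim: eventually_mono)

lemma L2_add: "u \<in> L2 \<Longrightarrow> v \<in> L2
    \<Longrightarrow> (\<lambda>x. u x + v x) \<in> L2"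
proof -
  assume u: "u \<in> L2" and v: "v \<in> L2"
  have i: "integrable lebesgue (\<lambda>x. 2 * (cmod (u x))\<^sup>2 + 2 * (cmod (v x))\<^sup>2)"
    using L2_integrable[OF u] L2_integrable[OF v] by simp
  have m: "(\<lambda>x. u x + v x) \<in> borel_measurable lebesgue"
    using L2_measurable[OF u] L2_measurable[OF v] by measurable
  have "(cmod (u x + v x))\<^sup>2 \<le> 2 * (cmod (u x))\<^sup>2 + 2 * (cmod (v x))\<^sup>2" for x
  proof -
    have "(cmod (u x + v x))\<^sup>2 \<le> (cmod (u x) + cmod (v x))\<^sup>2"
        by (intro power_mono norm_triangle_ineq) auto
    also have "\<dots> \<le> 2 * (cmod (u x))\<^sup>2 + 2 * (cmod (v x))\<^sup>2"
      using zero_le_power2[of "cmod (u x) - cmod (v x)"] by (simp add: power2_sum power2_diff)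
    finally show ?thesis .
  qed
  then have "integrable lebesgue (\<lambda>x. (cmod (u x + v x))\<^sup>2)"
    by (intro Bochner_Integration.integrable_bound[OF i]) (use m in auto)
  with m show ?thesis by (simp add: L2_def)
qed

lemma L2_cmult: "u \<in> L2 \<Longrightarrow> (\<lambda>x. c * u x) \<in> L2"
  by (rule L2_bound(1)[of u _ "cmod c"]) (auto simp: norm_mult dest: L2_measurable)

lemma L2_diff: "u \<in> L2 \<Longrightarrow> v \<in> L2
    \<Longrightarrow> (\<lambda>x. u x - v x) \<in> L2"
  using L2_add[of u "\<lambda>x. - 1 * v x"] L2_cmult[of v "- 1"] by simp

lemma L2_cnj: "u \<in> L2 \<Longrightarrow> (\<lambda>x. cnj (u x)) \<in> L2"
  unfolding L2_def
  using measurable_compose[of u lebesgue borel cnj borel]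
    borel_measurable_continuous_onI[OF continuous_on_cnj[OF continuous_on_id]] by simp

lemma L2_norm_cnj [simp]: "L2_norm (\<lambda>x. cnj (u x)) = L2_norm u"
  by (simp add: L2_norm_def)

lemma L2_norm_minus_commute: "L2_norm (\<lambda>x. u x - v x) = L2_norm (\<lambda>x. v x - u x)"
  by (simp add: L2_norm_def norm_minus_commute)

lemma L2_weight:
  assumes "u \<in> L2" "h \<in> borel_measurable lebesgue" "\<And>x. cmod (h x) \<le> C"
  shows "(\<lambda>x. h x * u x) \<in> L2" "L2_norm (\<lambda>x. h x * u x) \<le> C * L2_norm u"
proof -
  have C: "C \<ge> 0" using order_trans[OF norm_ge_zero assms(3)] .
  have m: "(\<lambda>x. h x * u x) \<in> borel_measurable lebesgue"
    using L2_measurable[OF assms(1)] assms(2) by measurable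
  have ae: "AE x in lebesgue. cmod (h x * u x) \<le> C * cmod (u x)"
    using assms(3) by (intro AE_I2) (simp add: norm_mult mult_right_mono)
  show "(\<lambda>x. h x * u x) \<in> L2" "L2_norm (\<lambda>x. h x * u x) \<le> C * L2_norm u"
    using L2_bound[OF assms(1) m ae C] by auto
qed

lemma L2_prod_integrable:
  assumes "u \<in> L2" "v \<in> L2"
  shows "integrable lebesgue (\<lambda>x. u x * v x)"
proof (rule Bochner_Integration.integrable_bound)
  show "integrable lebesgue (\<lambda>x. (cmod (u x))\<^sup>2 + (cmod (v x))\<^sup>2)"
    using assms L2_integrable by simp
  show "(\<lambda>x. u x * v x) \<in> borel_measurable lebesgue"
    using assms[THEN L2_measurable] by measurable
  have "cmod (u x) * cmod (v x) \<le> (cmod (u x))\<^sup>2 + (cmod (v x))\<^sup>2" for x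
    using sum_squares_bound[of "cmod (u x)" "cmod (v x)"] mult_nonneg_nonneg[of "cmod (u x)"
        "cmod (v x)"]
    by (simp del: mult_nonneg_nonneg)
  then show "AE x in lebesgue. norm (u x * v x)
      \<le> norm ((cmod (u x))\<^sup>2 + (cmod (v x))\<^sup>2)"
    by (intro AE_I2) (simp add: norm_mult)
qed

lemma integral_Cauchy_Schwarz:
  fixes f g :: "real^3 \<Rightarrow> real"
  assumes m: "f \<in> borel_measurable lebesgue" "g \<in> borel_measurable lebesgue"
    and i: "integrable lebesgue (\<lambda>x. (f x)\<^sup>2)"
        "integrable lebesgue (\<lambda>x. (g x)\<^sup>2)"
  shows "(LINT x|lebesgue. \<bar>f x\<bar> * \<bar>g x\<bar>)
      \<le> sqrt (LINT x|lebesgue. (f x)\<^sup>2) * sqrt (LINT x|lebesgue. (g x)\<^sup>2)"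
proof -
  have fg: "integrable lebesgue (\<lambda>x. \<bar>f x\<bar> * \<bar>g x\<bar>)"
  proof (rule Bochner_Integration.integrable_bound)
    show "integrable lebesgue (\<lambda>x. (f x)\<^sup>2 + (g x)\<^sup>2)" using i by simp
    have "\<bar>f x\<bar> * \<bar>g x\<bar> \<le> (f x)\<^sup>2 + (g x)\<^sup>2" for x
      using sum_squares_bound[of "\<bar>f x\<bar>" "\<bar>g x\<bar>"] mult_nonneg_nonneg[of
          "\<bar>f x\<bar>" "\<bar>g x\<bar>"]
      by (simp del: mult_nonneg_nonneg)
    then show "AE x in lebesgue. norm (\<bar>f x\<bar> * \<bar>g x\<bar>)
        \<le> norm ((f x)\<^sup>2 + (g x)\<^sup>2)"
      by (intro AE_I2) (simp add: abs_mult)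
  qed (use m in measurable)
  have "(\<integral>\<^sup>+x. ennreal \<bar>f x\<bar> * ennreal \<bar>g x\<bar>
      \<partial>lebesgue)\<^sup>2
      \<le> (\<integral>\<^sup>+x. (ennreal \<bar>f x\<bar>)\<^sup>2 \<partial>lebesgue) *
          (\<integral>\<^sup>+x. (ennreal \<bar>g x\<bar>)\<^sup>2 \<partial>lebesgue)"
    by (rule Cauchy_Schwarz_nn_integral) (use m in measurable)
  also have "(\<integral>\<^sup>+x. ennreal \<bar>f x\<bar> * ennreal \<bar>g x\<bar>
      \<partial>lebesgue) = ennreal (LINT x|lebesgue. \<bar>f x\<bar> * \<bar>g x\<bar>)"
    using fg by (subst nn_integral_eq_integral[symmetric]) (auto simp: ennreal_mult)
  also have "(\<integral>\<^sup>+x. (ennreal \<bar>f x\<bar>)\<^sup>2 \<partial>lebesgue)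
      = ennreal (LINT x|lebesgue. (f x)\<^sup>2)"
    using i by (subst nn_integral_eq_integral[symmetric]) (auto simp: ennreal_power)
  also have "(\<integral>\<^sup>+x. (ennreal \<bar>g x\<bar>)\<^sup>2 \<partial>lebesgue)
      = ennreal (LINT x|lebesgue. (g x)\<^sup>2)"
    using i by (subst nn_integral_eq_integral[symmetric]) (auto simp: ennreal_power)
  finally have "(LINT x|lebesgue. \<bar>f x\<bar> * \<bar>g x\<bar>)\<^sup>2
      \<le> (LINT x|lebesgue. (f x)\<^sup>2) * (LINT x|lebesgue. (g x)\<^sup>2)"
    by (simp add: ennreal_power ennreal_mult[symmetric] Bochner_Integration.integral_nonneg)
  then show ?thesis
    unfolding real_sqrt_mult[symmetric] by (rule real_le_rsqrt)
qed

lemma L2_Cauchy_Schwarz: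
  assumes "u \<in> L2" "v \<in> L2"
  shows "(LINT x|lebesgue. cmod (u x) * cmod (v x)) \<le> L2_norm u * L2_norm v"
  using integral_Cauchy_Schwarz[of "\<lambda>x. cmod (u x)" "\<lambda>x. cmod (v x)"] assms
  by (auto simp: L2_def L2_norm_def intro: borel_measurable_norm)

lemma L2_prod_bound:
  assumes "u \<in> L2" "v \<in> L2"
  shows "cmod (LINT x|lebesgue. u x * v x) \<le> L2_norm u * L2_norm v"
  using L2_Cauchy_Schwarz[OF assms] integral_norm_bound[of lebesgue "\<lambda>x. u x * v x"]
  by (simp add: norm_mult)

lemma L2_triangle:
  assumes u: "u \<in> L2" and v: "v \<in> L2"
  shows "L2_norm (\<lambda>x. u x + v x) \<le> L2_norm u + L2_norm v"
proof (rule power2_le_imp_le)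
  have uv: "integrable lebesgue (\<lambda>x. cmod (u x) * cmod (v x))"
    using integrable_norm[OF L2_prod_integrable[OF u v]] by (simp add: norm_mult)
  have "(L2_norm (\<lambda>x. u x + v x))\<^sup>2 \<le> (LINT x|lebesgue. (cmod (u x))\<^sup>2
      + 2 * (cmod (u x) * cmod (v x)) + (cmod (v x))\<^sup>2)"
    unfolding L2_norm_square
  proof (rule integral_mono)
    show "integrable lebesgue (\<lambda>x. (cmod (u x + v x))\<^sup>2)"
      using L2_integrable[OF L2_add[OF u v]] .
    show "integrable lebesgue (\<lambda>x. (cmod (u x))\<^sup>2 + 2 * (cmod (u x) * cmod (v x))
        + (cmod (v x))\<^sup>2)"
      using uv L2_integrable[OF u] L2_integrable[OF v] by simp
    show "(cmod (u x + v x))\<^sup>2 \<le> (cmod (u x))\<^sup>2 + 2 * (cmod (u x) * cmod (v x))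
        + (cmod (v x))\<^sup>2" for x
      using power_mono[OF norm_triangle_ineq[of "u x" "v x"], of 2] by (simp add: power2_sum)
  qed
  also have "\<dots> = (L2_norm u)\<^sup>2 + 2 * (LINT x|lebesgue. cmod (u x) * cmod (v x))
      + (L2_norm v)\<^sup>2"
    unfolding L2_norm_square using uv L2_integrable[OF u] L2_integrable[OF v] by simp
  also have "\<dots> \<le> (L2_norm u + L2_norm v)\<^sup>2"
    using L2_Cauchy_Schwarz[OF u v] by (simp add: power2_sum)
  finally show "(L2_norm (\<lambda>x. u x + v x))\<^sup>2 \<le> (L2_norm u + L2_norm v)\<^sup>2" .
qed simp

lemma L2_triangle_diff:
  assumes "u \<in> L2" "v \<in> L2" "w \<in> L2"
  shows "L2_norm (\<lambda>x. u x - w x) \<le> L2_norm (\<lambda>x. u x - v x)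
      + L2_norm (\<lambda>x. v x - w x)"
  using L2_triangle[OF L2_diff[OF assms(1,2)] L2_diff[OF assms(2,3)]] by simp

lemma L2_norm_diff_le:
  assumes "u \<in> L2" "v \<in> L2"
  shows "\<bar>L2_norm u - L2_norm v\<bar> \<le> L2_norm (\<lambda>x. u x - v x)"
  using L2_triangle[OF L2_diff[OF assms] assms(2)] L2_triangle[OF L2_diff[OF assms(2,1)] assms(1)]
    L2_norm_minus_commute[of u v] by simp

lemma continuous_supp_L2:
  assumes "continuous_on UNIV f" "bounded {x. f x \<noteq> 0}" shows "f \<in> L2"
proof -
  have "continuous_on UNIV (\<lambda>x. (cmod (f x))\<^sup>2)" by (intro continuous_intros assms)
  moreover have "bounded {x. (cmod (f x))\<^sup>2 \<noteq> 0}" using assms(2) by simp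
  ultimately have "integrable lebesgue (\<lambda>x. (cmod (f x))\<^sup>2)"
    using continuous_bounded_supp_bounded[of "\<lambda>x. (cmod (f x))\<^sup>2"]
      integrable_bounded_supp[OF continuous_lebesgue, of "\<lambda>x. (cmod (f x))\<^sup>2"]
          by metis
  then show ?thesis using continuous_lebesgue[OF assms(1)] by (simp add: L2_def)
qed

lemma C1c_L2: "C1c f \<Longrightarrow> f \<in> L2" "C1c f
    \<Longrightarrow> partial_deriv i f \<in> L2"
  by (auto intro!: continuous_supp_L2 C1c_continuous C1c_bounded C1c_continuous_partial
      C1c_bounded_partial)

lemma L2_dominated_convergence:
  assumes m: "u \<in> borel_measurable lebesgue" "\<And>n. s n \<in> borel_measurable lebesgue"
    and w: "integrable lebesgue w"
        and lim: "AE x in lebesgue. (\<lambda>n. s n x) \<longlonglongrightarrow> u x"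
    and bound: "\<And>n x. (cmod (s n x - u x))\<^sup>2 \<le> w x"
  shows "(\<lambda>n. L2_norm (\<lambda>x. s n x - u x)) \<longlonglongrightarrow> 0"
proof -
  have "(\<lambda>n. LINT x|lebesgue. (cmod (s n x - u x))\<^sup>2)
      \<longlonglongrightarrow> (LINT (x::real^3)|lebesgue. (0::real))"
  proof (rule integral_dominated_convergence[where f="\<lambda>x. 0"
      and s="\<lambda>n x. (cmod (s n x - u x))\<^sup>2" and w=w])
    show "AE x in lebesgue. (\<lambda>n. (cmod (s n x - u x))\<^sup>2) \<longlonglongrightarrow> 0"
      using lim
    proof eventually_elim
      case (elim x)
      then have "(\<lambda>n. (cmod (s n x - u x))\<^sup>2)
          \<longlonglongrightarrow> (cmod (u x - u x))\<^sup>2" by (intro tendsto_intros)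
      then show ?case by simp
    qed
  qed (use m w bound in auto)
  then have "(\<lambda>n. sqrt (LINT x|lebesgue. (cmod (s n x - u x))\<^sup>2))
      \<longlonglongrightarrow> sqrt 0"
    by (intro tendsto_intros) simp
  then show ?thesis by (simp add: L2_norm_def)
qed

lemma integrable_indicator_ball:
    "integrable lebesgue (\<lambda>x. c * indicat_real (ball (a::real^3) R) x)"
  using emeasure_bounded_finite[OF bounded_ball, of a R]
  by (intro integrable_mult_right integrable_real_indicator) auto

lemma L2_bounded_approx:
  assumes u: "u \<in> L2" and e: "e > 0"
  obtains v M where "v \<in> L2" "M > 0" "\<And>x. cmod (v x) \<le> M" "\<And>x. norm x \<ge> M
      \<Longrightarrow> v x = 0"
    "L2_norm (\<lambda>x. v x - u x) < e"
proof -
  define s where "s n x = (if cmod (u x) \<le> real n \<and> norm x < real n then u x else 0)"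
      for n :: nat and x
  note [measurable] = L2_measurable[OF u]
  have nm: "(\<lambda>x::real^3. norm x) \<in> borel_measurable lebesgue"
    by (intro continuous_lebesgue continuous_intros)
  have sm: "s n \<in> borel_measurable lebesgue" for n
    unfolding s_def using nm by measurable
  have lim: "(\<lambda>n. s n x) \<longlonglongrightarrow> u x" for x
  proof (rule tendsto_eventually)
    obtain N :: nat where "real N > max (cmod (u x)) (norm x)" using reals_Archimedean2 by blast
    then have "\<forall>n\<ge>N. s n x = u x" by (auto simp: s_def)
    then show "\<forall>\<^sub>F n in sequentially. s n x = u x" unfolding eventually_sequentially
        by blast
  qed
  have "(\<lambda>n. L2_norm (\<lambda>x. s n x - u x)) \<longlonglongrightarrow> 0"
    by (rule L2_dominated_convergence[OF _ sm L2_integrable[OF u]]) (use lim in \<open>auto simp: s_def\<close>)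
  then have "\<forall>\<^sub>F n in sequentially. L2_norm (\<lambda>x. s n x - u x) < e"
    using e by (simp add: order_tendstoD)
  then obtain N where N: "\<And>n. n \<ge> N \<Longrightarrow> L2_norm (\<lambda>x. s n x
      - u x) < e"
    unfolding eventually_sequentially by blast
  show ?thesis
  proof (rule that[of "s (Suc N)" "real (Suc N)"])
    show "s (Suc N) \<in> L2"
      using L2_bound(1)[OF u sm, of "Suc N" 1] by (auto simp: s_def)
  qed (use N[of "Suc N"] in \<open>auto simp: s_def\<close>)
qed

text \<open>A measurable function is an almost-everywhere limit of continuous functions. To make
  such a sequence dominated it is composed with the radial retraction \<open>pr\<close> onto the
  disc of radius \<open>M\<close> and multiplied by a cutoff; both leave the bounded function
  \<open>v\<close>, which vanishes from radius \<open>M\<close> on, unchanged.\<close>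

lemma L2_continuous_approx:
  assumes u: "u \<in> L2" and e: "e > 0"
  obtains g where "continuous_on UNIV g" "bounded {x. g x \<noteq> 0}" "L2_norm (\<lambda>x. g x
      - u x) < e"
proof -
  obtain v M where v: "v \<in> L2" "M > 0" "\<And>x. cmod (v x) \<le> M" "\<And>x. norm x \<ge> M
      \<Longrightarrow> v x = 0"
    "L2_norm (\<lambda>x. v x - u x) < e / 2"
    using L2_bounded_approx[OF u, of "e / 2"] e by auto
  have "v measurable_on UNIV"
    by (rule lebesgue_measurable_imp_measurable_on[OF L2_measurable[OF v(1)]]) simp
  then obtain N g where N: "negligible N" and gc: "\<And>n. continuous_on UNIV (g n)"
    and gl: "\<And>x. x \<notin> N \<Longrightarrow> (\<lambda>n. g n x)
        \<longlonglongrightarrow> v x"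
    unfolding measurable_on_def by auto
  define pr where "pr z = of_real (M / max M (cmod z)) * z" for z
  define cut where "cut x = max 0 (min 1 (M + 1 - norm x))" for x :: "real^3"
  define h where "h n x = of_real (cut x) * pr (g n x)" for n x
  have prb: "cmod (pr z) \<le> M" for z
  proof -
    have "cmod (pr z) = M / max M (cmod z) * cmod z" using v(2)
        by (simp add: pr_def norm_mult norm_divide)
    also have "\<dots> \<le> M" using v(2) by (auto simp: max_def field_simps)
    finally show ?thesis .
  qed
  have prc: "continuous_on UNIV pr"
    unfolding pr_def[abs_def] using v(2) by (intro continuous_intros) auto
  have cutb: "0 \<le> cut x" "cut x \<le> 1" for x by (auto simp: cut_def)
  have cutc: "continuous_on UNIV cut" unfolding cut_def[abs_def] by (intro continuous_intros)
  have hc: "continuous_on UNIV (h n)" for n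
    unfolding h_def[abs_def]
    by (intro continuous_on_mult continuous_on_of_real cutc continuous_on_compose2[OF prc gc]) auto
  have hb: "cmod (h n x) \<le> M" for n x
    using mult_mono[OF cutb(2)[of x] prb[of "g n x"]] cutb[of x] by (simp add: h_def norm_mult)
  have h0: "h n x = 0" if "norm x \<ge> M + 1" for n x
    using that by (simp add: h_def cut_def)
  have "(\<lambda>n. L2_norm (\<lambda>x. h n x - v x)) \<longlonglongrightarrow> 0"
  proof (rule L2_dominated_convergence[OF L2_measurable[OF v(1)] continuous_lebesgue[OF hc]
        integrable_indicator_ball[of "(2 * M)\<^sup>2" 0 "M + 1"]])
    have "AE x in lebesgue. x \<notin> N" using N
        by (intro AE_not_in) (simp add: negligible_iff_null_sets)
    then show "AE x in lebesgue. (\<lambda>n. h n x) \<longlonglongrightarrow> v x"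
    proof eventually_elim
      case (elim x)
      have "isCont pr (v x)" using prc by (simp add: continuous_on_eq_continuous_at)
      then have "(\<lambda>n. pr (g n x)) \<longlonglongrightarrow> pr (v x)" using gl[OF elim]
          by (rule isCont_tendsto_compose)
      then have "(\<lambda>n. h n x) \<longlonglongrightarrow> of_real (cut x) * pr (v x)"
          unfolding h_def by (intro tendsto_intros)
      moreover have "of_real (cut x) * pr (v x) = v x"
        using v(2) v(3)[of x] v(4)[of x]
            by (cases "norm x \<ge> M") (auto simp: pr_def cut_def max_def)
      ultimately show ?case by simp
    qed
    fix n and x :: "real^3"
    show "(cmod (h n x - v x))\<^sup>2 \<le> (2 * M)\<^sup>2 * indicat_real (ball 0 (M + 1)) x"
    proof (cases "norm x < M + 1")
      case True
      have "cmod (h n x - v x) \<le> 2 * M"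
          using norm_triangle_ineq4[of "h n x" "v x"] hb[of n x] v(3)[of x] by linarith
      then have "(cmod (h n x - v x))\<^sup>2 \<le> (2 * M)\<^sup>2" by (intro power_mono) auto
      then show ?thesis using True by simp
    qed (use h0[of x n] v(4)[of x] in auto)
  qed
  then have "\<forall>\<^sub>F n in sequentially. L2_norm (\<lambda>x. h n x - v x) < e / 2"
    by (rule order_tendstoD(2)) (use e in simp)
  then obtain n where n: "L2_norm (\<lambda>x. h n x - v x) < e / 2"
    unfolding eventually_sequentially by blast
  have "{x. h n x \<noteq> 0} \<subseteq> ball 0 (M + 1)" using h0[of _ n] by (force simp: not_le)
  then have hs: "bounded {x. h n x \<noteq> 0}" using bounded_subset[OF bounded_ball] by blast
  show ?thesis
    using that[OF hc hs] L2_triangle_diff[OF continuous_supp_L2[OF hc hs] v(1) u] n v(5) by linarith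
qed

subsection \<open>Convolution with test functions\<close>

definition conv :: "(real^3 \<Rightarrow> complex) \<Rightarrow> (real^3 \<Rightarrow> complex)
    \<Rightarrow> real^3 \<Rightarrow> complex" where
  "conv K u x = (LINT y|lebesgue. u y * K (x - y))"

lemma continuous_reflect:
  assumes "continuous_on UNIV (K :: real^3 \<Rightarrow> complex)" "bounded {x. K x \<noteq> 0}"
  shows "continuous_on UNIV (\<lambda>y. K (x - y))" "bounded {y. K (x - y) \<noteq> 0}"
proof -
  show "continuous_on UNIV (\<lambda>y. K (x - y))"
    by (intro continuous_on_compose2[OF assms(1)] continuous_intros) auto
  obtain R where R: "{x. K x \<noteq> 0} \<subseteq> ball 0 R"
      using bounded_subset_ballD[OF assms(2)] by blast
  have "{y. K (x - y) \<noteq> 0} \<subseteq> ball x R"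
  proof
    fix y assume "y \<in> {y. K (x - y) \<noteq> 0}"
    then have "x - y \<in> ball 0 R" using R by blast
    then show "y \<in> ball x R" by (simp add: dist_norm norm_minus_commute)
  qed
  then show "bounded {y. K (x - y) \<noteq> 0}" using bounded_subset[OF bounded_ball] by blast
qed

lemma conv_integrable:
  assumes "u \<in> L2" "continuous_on UNIV K" "bounded {x. K x \<noteq> 0}"
  shows "integrable lebesgue (\<lambda>y. u y * K (x - y))"
  by (rule L2_prod_integrable[OF assms(1) continuous_supp_L2[OF continuous_reflect[OF assms(2,3)]]])

lemma conv_diff:
  assumes "u \<in> L2" "v \<in> L2" "continuous_on UNIV K" "bounded {x. K x \<noteq> 0}"
  shows "conv K (\<lambda>y. u y - v y) = (\<lambda>x. conv K u x - conv K v x)"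
  using conv_integrable[OF assms(1,3,4)] conv_integrable[OF assms(2,3,4)]
  by (auto simp: conv_def left_diff_distrib)

text \<open>Differentiation under the integral sign. The first-order remainder of the kernel divided
  by the increment tends to zero pointwise and is bounded by L + 3 M, where L is a Lipschitz
  constant of the kernel and 3 M bounds its differential. It vanishes off a ball, on which the L2
  function \<open>u\<close> is integrable.\<close>

lemma conv_has_derivative:
  assumes u: "u \<in> L2" and K: "C1c K"
  shows "(conv K u has_derivative (\<lambda>h. \<Sum>i\<in>UNIV. (h $ i) *\<^sub>R conv
      (partial_deriv i K) u x)) (at x)"
proof -
  note Kc = C1c_continuous[OF K] C1c_bounded[OF K]
  note Kpc = C1c_continuous_partial[OF K] C1c_bounded_partial[OF K]
  obtain L where L: "L \<ge> 0" "\<And>x y. cmod (K x - K y) \<le> L * norm (x - y)"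
      using C1c_lipschitz[OF K] by blast
  obtain M where M: "M \<ge> 0" "\<And>i x. cmod (partial_deriv i K x) \<le> M"
      using C1c_bound_partial[OF K] by blast
  define DK where "DK z h = (\<Sum>i\<in>UNIV. (h $ i) *\<^sub>R partial_deriv i K z)" for z h
  have DKb: "cmod (DK z h) \<le> 3 * M * norm h" for z h
  proof -
    have "cmod (DK z h) \<le> (\<Sum>i\<in>(UNIV::3 set). norm h * M)"
      unfolding DK_def by (rule sum_norm_le) (auto intro!: mult_mono M component_le_norm_cart)
    then show ?thesis by (simp add: mult_ac)
  qed
  have DK: "(K has_derivative DK z) (at z)" for z
    unfolding DK_def using has_derivative_partial_deriv[OF C1c_differentiable[OF K]] .
  obtain R where R: "{x. K x \<noteq> 0} \<subseteq> ball 0 R" using bounded_subset_ballD[OF Kc(2)]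
      by blast
  have DKs: "DK z h = 0" if "norm z > R" for z h
  proof -
    have "K z' = 0" if "z' \<in> - cball 0 R" for z' using R that by fastforce
    then have "((\<lambda>_. 0) has_derivative DK z) (at z)"
      by (intro has_derivative_transform_within_open[OF DK, of "- cball 0 R"]) (use that in auto)
    from has_derivative_unique[OF this has_derivative_const] show ?thesis by simp
  qed
  have int_DK: "(\<Sum>i\<in>UNIV. (h $ i) *\<^sub>R conv (partial_deriv i K) u x)
      = (LINT y|lebesgue. u y * DK (x - y) h)" for h
  proof -
    have "(LINT y|lebesgue. u y * DK (x - y) h)
        = (LINT y|lebesgue. (\<Sum>i\<in>UNIV. (h $ i) *\<^sub>R (u y * partial_deriv i K
        (x - y))))"
      by (simp add: DK_def sum_distrib_left)
    also have "\<dots> = (\<Sum>i\<in>UNIV. (LINT y|lebesgue. (h $ i) *\<^sub>R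
        (u y * partial_deriv i K (x - y))))"
      by (rule Bochner_Integration.integral_sum) (intro integrable_scaleR_right conv_integrable[OF u
          Kpc])
    finally show ?thesis by (simp add: conv_def)
  qed
  have iDK: "integrable lebesgue (\<lambda>y. u y * DK (x - y) h)" for h
  proof -
    have "(\<lambda>y. u y * DK (x - y) h)
        = (\<lambda>y. \<Sum>i\<in>UNIV. (h $ i) *\<^sub>R (u y * partial_deriv i K (x - y)))"
      by (simp add: DK_def sum_distrib_left)
    then show ?thesis
      by (simp only:) (intro Bochner_Integration.integrable_sum integrable_scaleR_right
          conv_integrable[OF u Kpc])
  qed
  define q where "q y x' = (K (x' - y) - K (x - y) - DK (x - y) (x' - x)) / of_real (norm (x' - x))"
      for y x'
  have quot: "norm (conv K u x' - conv K u x
      - (\<Sum>i\<in>UNIV. ((x' - x) $ i) *\<^sub>R conv (partial_deriv i K) u x)) / norm (x' - x)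
     = cmod (LINT y|lebesgue. u y * q y x')" for x'
  proof -
    have eq: "conv K u x' - conv K u x
        - (\<Sum>i\<in>UNIV. ((x' - x) $ i) *\<^sub>R conv (partial_deriv i K) u x)
      = (LINT y|lebesgue. u y * K (x' - y) - u y * K (x - y) - u y * DK (x - y) (x' - x))"
      unfolding int_DK unfolding conv_def
      using conv_integrable[OF u Kc] iDK by simp
    have "norm (conv K u x' - conv K u x
        - (\<Sum>i\<in>UNIV. ((x' - x) $ i) *\<^sub>R conv (partial_deriv i K) u x)) / norm (x' - x)
        = norm ((conv K u x' - conv K u x - (\<Sum>i\<in>UNIV. ((x' - x) $ i) *\<^sub>R conv
        (partial_deriv i K) u x)) / of_real (norm (x' - x)))"
      by (simp add: norm_divide)
    also have "(conv K u x' - conv K u x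
        - (\<Sum>i\<in>UNIV. ((x' - x) $ i) *\<^sub>R conv (partial_deriv i K) u x)) / of_real
        (norm (x' - x))
      = (LINT y|lebesgue. u y * q y x')"
      unfolding eq integral_divide_zero[symmetric] by (simp add: q_def algebra_simps)
    finally show ?thesis .
  qed
  have "((\<lambda>x'. LINT y|lebesgue. u y * q y x') \<longlongrightarrow> 0) (at x)"
    unfolding tendsto_at_iff_sequentially comp_def
  proof (intro allI impI)
    fix X assume X: "\<forall>i. X i \<in> UNIV - {x}" "X \<longlonglongrightarrow> x"
    obtain B where B: "\<And>n. norm (X n) \<le> B"
      using convergent_imp_bounded[OF X(2)] unfolding bounded_iff by auto
    \<comment> \<open>The sequence is bounded by \<open>B\<close>, so this ball contains the
      supports of the reflected kernels based at \<open>x\<close> and at every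
      \<open>X n\<close>.\<close>
    define w where "w = indicat_real (ball 0 (\<bar>R\<bar> + B + norm x + 1) :: (real^3) set)"
    have wL2: "(\<lambda>y. complex_of_real (w y)) \<in> L2"
    proof -
      have "(\<lambda>y. (cmod (complex_of_real (w y)))\<^sup>2)
          = (\<lambda>y. 1 * indicat_real (ball 0 (\<bar>R\<bar> + B + norm x + 1)) y)"
        by (auto simp: w_def indicator_def)
      moreover have "(\<lambda>y. complex_of_real (w y)) \<in> borel_measurable lebesgue"
      proof -
        have [measurable]: "w \<in> borel_measurable lebesgue"
          unfolding w_def by (rule borel_measurable_indicator) simp
        show ?thesis by measurable
      qed
      ultimately show ?thesis unfolding L2_def using integrable_indicator_ball
          by (simp only: mem_Collect_eq)
    qed
    have dom: "integrable lebesgue (\<lambda>y. (L + 3 * M) * (cmod (u y) * w y))"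
      using integrable_norm[OF L2_prod_integrable[OF u wL2]] by (simp add: norm_mult w_def)
    have "(\<lambda>n. LINT y|lebesgue. u y * q y (X n))
        \<longlonglongrightarrow> (LINT (y::real^3)|lebesgue. (0::complex))"
    proof (rule integral_dominated_convergence[OF _ _ dom])
      show "(\<lambda>y. u y * q y (X n)) \<in> borel_measurable lebesgue" for n
      proof -
        have "(\<lambda>y. K (X n - y)) \<in> borel_measurable lebesgue"
            "(\<lambda>y. K (x - y)) \<in> borel_measurable lebesgue"
          using continuous_reflect(1)[OF Kc] continuous_lebesgue by blast+
        moreover have "(\<lambda>y. DK (x - y) (X n - x)) \<in> borel_measurable lebesgue"
          unfolding DK_def using continuous_reflect(1)[OF Kpc] continuous_lebesgue
          by (intro borel_measurable_sum borel_measurable_scaleR borel_measurable_const) blast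
        ultimately show ?thesis unfolding q_def using L2_measurable[OF u] by measurable
      qed
      show "AE y in lebesgue. (\<lambda>n. u y * q y (X n)) \<longlonglongrightarrow> 0"
      proof (rule AE_I2)
        fix y
        have "((\<lambda>z. norm (K z - K (x - y) - DK (x - y) (z - (x - y))) / norm (z - (x - y)))
            \<longlongrightarrow> 0) (at (x - y))"
          using DK[of "x - y"] by (simp add: has_derivative_iff_norm)
        moreover have "filterlim (\<lambda>n. X n - y) (at (x - y)) sequentially"
          using X by (auto simp: filterlim_at intro!: tendsto_intros)
        ultimately have "(\<lambda>n. norm (K (X n - y) - K (x - y)
            - DK (x - y) (X n - y - (x - y))) / norm (X n - y - (x - y))) \<longlonglongrightarrow>
            0"
          by (rule filterlim_compose)
        then have "(\<lambda>n. norm (q y (X n))) \<longlonglongrightarrow> 0"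
            by (simp add: q_def norm_divide)
        then have "(\<lambda>n. u y * q y (X n)) \<longlonglongrightarrow> u y * 0"
          by (intro tendsto_mult tendsto_const) (rule tendsto_norm_zero_cancel)
        then show "(\<lambda>n. u y * q y (X n)) \<longlonglongrightarrow> 0" by simp
      qed
      show "AE y in lebesgue. norm (u y * q y (X n)) \<le> (L + 3 * M) * (cmod (u y) * w y)" for n
      proof (rule AE_I2)
        fix y
        have xn: "norm (X n - x) > 0" using X(1) by auto
        have "cmod (q y (X n)) \<le> (L + 3 * M) * w y"
        proof (cases "y \<in> ball 0 (\<bar>R\<bar> + B + norm x + 1)")
          case True
          have "cmod (K (X n - y) - K (x - y) - DK (x - y) (X n - x)) \<le> L * norm (X n - x)
              + 3 * M * norm (X n - x)"
            using norm_triangle_ineq4[of "K (X n - y) - K (x - y)" "DK (x - y) (X n - x)"]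
              L(2)[of "X n - y" "x - y"] DKb[of "x - y" "X n - x"] by simp
          then have "cmod (q y (X n))
              \<le> (L * norm (X n - x) + 3 * M * norm (X n - x)) / norm (X n - x)"
            using xn by (simp add: q_def norm_divide divide_right_mono)
          also have "\<dots> = L + 3 * M" using xn by (simp add: field_simps)
          finally show ?thesis using True by (simp add: w_def)
        next
          case False
          then have y: "norm y \<ge> \<bar>R\<bar> + B + norm x + 1" by simp
          have nn: "norm (X n - y) \<ge> norm y - norm (X n)" "norm (x - y) \<ge> norm y - norm x"
            using norm_triangle_ineq2[of y "X n"] norm_triangle_ineq2[of y x]
                by (simp_all add: norm_minus_commute)
          have "0 \<le> B" using order_trans[OF norm_ge_zero B[of 0]] .
          then have "norm (X n - y) > R" "norm (x - y) > R"
              using y B[of n] nn abs_ge_self[of R] norm_ge_zero[of x] by linarith+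
          then have "K (X n - y) = 0" "K (x - y) = 0" "DK (x - y) (X n - x) = 0" using R DKs
              by fastforce+
          then show ?thesis using False by (simp add: q_def w_def)
        qed
        then have "cmod (u y) * cmod (q y (X n)) \<le> cmod (u y) * ((L + 3 * M) * w y)"
            by (intro mult_left_mono) auto
        then show "norm (u y * q y (X n)) \<le> (L + 3 * M) * (cmod (u y) * w y)"
            by (simp add: norm_mult mult_ac)
      qed
    qed simp
    then show "(\<lambda>n. LINT y|lebesgue. u y * q y (X n)) \<longlonglongrightarrow> 0" by simp
  qed
  then have "((\<lambda>x'. norm (conv K u x' - conv K u x
      - (\<Sum>i\<in>UNIV. ((x' - x) $ i) *\<^sub>R conv (partial_deriv i K) u x)) / norm (x' - x))
      \<longlongrightarrow> 0) (at x)"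
    unfolding quot by (rule tendsto_norm_zero)
  moreover have "bounded_linear (\<lambda>h. \<Sum>i\<in>UNIV. (h $ i) *\<^sub>R conv
      (partial_deriv i K) u x)"
    by (intro bounded_linear_sum bounded_linear_scaleR_const bounded_linear_vec_nth)
  ultimately show ?thesis by (simp add: has_derivative_iff_norm)
qed

lemma conv_differentiable: "u \<in> L2 \<Longrightarrow> C1c K
    \<Longrightarrow> conv K u differentiable at x"
  using conv_has_derivative unfolding differentiable_def by blast

lemma partial_deriv_conv:
  assumes "u \<in> L2" "C1c K"
  shows "partial_deriv i (conv K u) = conv (partial_deriv i K) u"
proof
  fix x
  have "(\<Sum>j\<in>UNIV. ((axis i 1 :: real^3) $ j) *\<^sub>R conv (partial_deriv j K) u x)
      = conv (partial_deriv i K) u x"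
    by (simp add: axis_def if_distrib[of "\<lambda>t. t *\<^sub>R _"] cong: if_cong)
  then show "partial_deriv i (conv K u) x = conv (partial_deriv i K) u x"
    by (subst has_derivative_imp_partial_deriv[OF conv_has_derivative[OF assms]])
qed

lemma smooth_conv:
  assumes u: "u \<in> L2" and K: "K \<in> test_functions" shows "smooth (conv K u)"
proof (rule smoothI_coinduct)
  show "conv K u \<in> (\<lambda>K. conv K u) ` test_functions" using K by blast
  show "g differentiable at x" if "g \<in> (\<lambda>K. conv K u) ` test_functions" for g x
    using that conv_differentiable[OF u C1c_test] by blast
  show "partial_deriv i g \<in> (\<lambda>K. conv K u) ` test_functions"
      if "g \<in> (\<lambda>K. conv K u) ` test_functions" for g i
    using that partial_deriv_conv[OF u C1c_test] test_partial_deriv by blast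
qed

subsection \<open>Mollification\<close>

text \<open>Cauchy-Schwarz with respect to the probability density k(x - y) in y bounds the squared
  convolution by the convolution of |u|^2 with k; Tonelli's theorem and the unit mass of k in the
  other variable finish the estimate.\<close>

lemma conv_young:
  fixes k :: "real^3 \<Rightarrow> real"
  assumes u: "u \<in> L2" and K: "C1c (\<lambda>x. complex_of_real (k x))"
      and k0: "\<And>x. k x \<ge> 0"
    and k1: "(LINT x|lebesgue. k x) = 1"
  shows "conv (\<lambda>x. of_real (k x)) u \<in> L2" "L2_norm (conv (\<lambda>x. of_real (k x)) u)
      \<le> L2_norm u"
proof -
  let ?c = "conv (\<lambda>x. of_real (k x)) u"
  have kc: "continuous_on UNIV k"
  proof -
    have "continuous_on UNIV (\<lambda>x. Re (complex_of_real (k x)))"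
      by (intro continuous_on_Re C1c_continuous K)
    then show ?thesis by simp
  qed
  have ks: "bounded {x. k x \<noteq> 0}" using C1c_bounded[OF K] by simp
  obtain M where M: "M \<ge> 0" "\<And>x. \<bar>k x\<bar> \<le> M"
    using continuous_bounded_supp_bounded[OF kc ks] by auto
  have [measurable]: "k \<in> borel_measurable borel" using kc
      by (rule borel_measurable_continuous_onI)
  have ki: "integrable lebesgue k"
    using integrable_bounded_supp[OF continuous_lebesgue[OF kc], of M] M(2) ks by simp
  have krc: "continuous_on UNIV (\<lambda>y. k (x - y))" for x
    by (intro continuous_on_compose2[OF kc] continuous_intros) auto
  have krm [measurable]: "(\<lambda>y. k (x - y)) \<in> borel_measurable lebesgue" for x
    using krc by (rule continuous_lebesgue)
  have kri: "integrable lebesgue (\<lambda>y. k (x - y))" for x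
  proof -
    have "integrable lebesgue (\<lambda>y. Re (complex_of_real (k (x - y))))"
      using integrable_continuous_bounded_supp[OF continuous_reflect[OF C1c_continuous[OF K]
          C1c_bounded[OF K]]]
      by (rule integrable_Re)
    then show ?thesis by simp
  qed
  have kr1: "(LINT y|lebesgue. k (x - y)) = 1" for x
    using lebesgue_integral_reflection[of k x] k1 by simp
  note [measurable] = L2_measurable[OF u]
  have uki: "integrable lebesgue (\<lambda>y. (cmod (u y))\<^sup>2 * k (x - y))" for x
  proof (rule Bochner_Integration.integrable_bound)
    show "integrable lebesgue (\<lambda>y. (cmod (u y))\<^sup>2 * M)" using L2_integrable[OF u]
        by simp
    show "AE y in lebesgue. norm ((cmod (u y))\<^sup>2 * k (x - y))
        \<le> norm ((cmod (u y))\<^sup>2 * M)"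
      using M k0 by (intro AE_I2) (simp add: abs_mult mult_left_mono)
  qed measurable
  have pt: "(cmod (?c x))\<^sup>2 \<le> (LINT y|lebesgue. (cmod (u y))\<^sup>2 * k (x - y))" for x
  proof -
    have "cmod (?c x) \<le> (LINT y|lebesgue. cmod (u y * of_real (k (x - y))))"
      unfolding conv_def by (rule integral_norm_bound)
    also have "\<dots> = (LINT y|lebesgue. \<bar>cmod (u y) * sqrt (k (x - y))\<bar> * \<bar>sqrt
        (k (x - y))\<bar>)"
      using k0 by (simp add: norm_mult abs_mult mult.assoc)
    also have "\<dots> \<le> sqrt (LINT y|lebesgue. (cmod (u y) * sqrt (k (x - y)))\<^sup>2) * sqrt
        (LINT y|lebesgue. (sqrt (k (x - y)))\<^sup>2)"
      by (rule integral_Cauchy_Schwarz) (use uki kri k0 in \<open>simp_all add: power_mult_distrib\<close>)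
    also have "\<dots> = sqrt (LINT y|lebesgue. (cmod (u y))\<^sup>2 * k (x - y))"
      using k0 kr1 by (simp add: power_mult_distrib)
    finally have "cmod (?c x) \<le> sqrt (LINT y|lebesgue. (cmod (u y))\<^sup>2 * k (x - y))" .
    then have "(cmod (?c x))\<^sup>2
        \<le> (sqrt (LINT y|lebesgue. (cmod (u y))\<^sup>2 * k (x - y)))\<^sup>2" by
        (rule power_mono) simp
    also have "\<dots> = (LINT y|lebesgue. (cmod (u y))\<^sup>2 * k (x - y))"
      using k0 by (simp add: Bochner_Integration.integral_nonneg)
    finally show ?thesis .
  qed
  \<comment> \<open>Tonelli's theorem is used for \<open>lborel\<close>, while \<open>u\<close> is
    only Lebesgue measurable, so a Borel representative of |u|^2 takes its place.\<close>
  obtain f where f[measurable]: "f \<in> borel_measurable lborel"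
      and fu: "AE y in lborel. ennreal ((cmod (u y))\<^sup>2) = f y"
    using completion_ex_borel_measurable[of "\<lambda>y. ennreal ((cmod (u y))\<^sup>2)" lborel]
        by auto
  have fu': "AE y in lebesgue. ennreal ((cmod (u y))\<^sup>2) = f y" using fu
      by (rule AE_completion)
  have "(\<integral>\<^sup>+x. ennreal ((cmod (?c x))\<^sup>2) \<partial>lebesgue)
      \<le> (\<integral>\<^sup>+x. (\<integral>\<^sup>+y. f y * ennreal (k (x - y))
      \<partial>lborel) \<partial>lborel)"
    unfolding nn_integral_completion
  proof (rule nn_integral_mono)
    fix x :: "real^3"
    have "ennreal ((cmod (?c x))\<^sup>2)
        \<le> ennreal (LINT y|lebesgue. (cmod (u y))\<^sup>2 * k (x - y))"
      using pt by (rule ennreal_leI)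
    also have "\<dots> = (\<integral>\<^sup>+y. ennreal ((cmod (u y))\<^sup>2 * k (x - y))
        \<partial>lebesgue)"
      using uki k0 by (intro nn_integral_eq_integral[symmetric]) auto
    also have "\<dots> = (\<integral>\<^sup>+y. f y * ennreal (k (x - y)) \<partial>lebesgue)"
      using fu' by (intro nn_integral_cong_AE) (auto simp: ennreal_mult k0 elim: eventually_mono)
    finally show "ennreal ((cmod (?c x))\<^sup>2)
        \<le> (\<integral>\<^sup>+y. f y * ennreal (k (x - y)) \<partial>lborel)"
      by (simp add: nn_integral_completion)
  qed
  also have "\<dots> = (\<integral>\<^sup>+y. (\<integral>\<^sup>+x. f y * ennreal (k (x - y))
      \<partial>lborel) \<partial>lborel)"
    by (rule lborel_pair.Fubini'[symmetric]) measurable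
  also have "\<dots> = (\<integral>\<^sup>+y. f y \<partial>lborel)"
  proof (rule nn_integral_cong)
    fix y :: "real^3"
    have "integrable lebesgue (\<lambda>x. Re (complex_of_real (k (- y + 1 *\<^sub>R x))))"
      using C1c_affine[OF K, of 1 "- y"]
      by (intro integrable_Re integrable_continuous_bounded_supp C1c_continuous C1c_bounded) auto
    then have i: "integrable lebesgue (\<lambda>x. k (x - y))" by simp
    have "(\<integral>\<^sup>+x. ennreal (k (x - y)) \<partial>lborel)
        = (\<integral>\<^sup>+x. ennreal (k (x - y)) \<partial>lebesgue)"
      by (simp add: nn_integral_completion)
    also have "\<dots> = ennreal (LINT x|lebesgue. k (x - y))"
      using i k0 by (intro nn_integral_eq_integral) auto
    also have "\<dots> = 1" using lebesgue_integral_translation[of k "- y"] k1 by simp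
    finally show "(\<integral>\<^sup>+x. f y * ennreal (k (x - y)) \<partial>lborel) = f y"
      by (subst nn_integral_cmult) auto
  qed
  also have "\<dots> = (\<integral>\<^sup>+y. ennreal ((cmod (u y))\<^sup>2) \<partial>lebesgue)"
    unfolding nn_integral_completion using fu by (intro nn_integral_cong_AE) auto
  also have "\<dots> = ennreal ((L2_norm u)\<^sup>2)"
    unfolding L2_norm_square using L2_integrable[OF u] by (intro nn_integral_eq_integral) auto
  finally have main: "(\<integral>\<^sup>+x. ennreal ((cmod (?c x))\<^sup>2) \<partial>lebesgue)
      \<le> ennreal ((L2_norm u)\<^sup>2)" .
  have cm: "?c \<in> borel_measurable lebesgue"
    using conv_differentiable[OF u K]
    by (intro continuous_lebesgue) (auto simp: continuous_on_eq_continuous_within intro: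
        differentiable_imp_continuous_within)
  have ci: "integrable lebesgue (\<lambda>x. (cmod (?c x))\<^sup>2)"
  proof (rule integrableI_bounded)
    show "(\<lambda>x. (cmod (?c x))\<^sup>2) \<in> borel_measurable lebesgue" using cm
        by measurable
    show "(\<integral>\<^sup>+x. ennreal (norm ((cmod (?c x))\<^sup>2)) \<partial>lebesgue) <
        \<infinity>"
      using main by (simp add: order.strict_trans1)
  qed
  then show "?c \<in> L2" using cm by (simp add: L2_def)
  have "ennreal ((L2_norm ?c)\<^sup>2) \<le> ennreal ((L2_norm u)\<^sup>2)"
    using main nn_integral_eq_integral[OF ci] by (simp add: L2_norm_square)
  then have "(L2_norm ?c)\<^sup>2 \<le> (L2_norm u)\<^sup>2" by simp
  then show "L2_norm ?c \<le> L2_norm u" by (rule power2_le_imp_le) simp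
qed

definition mk :: "nat \<Rightarrow> real^3 \<Rightarrow> real" where
  "mk n x = bump (real (Suc n) *\<^sub>R x) / (LINT x|lebesgue. bump (real (Suc n) *\<^sub>R x))"

abbreviation moll :: "nat \<Rightarrow> (real^3 \<Rightarrow> complex) \<Rightarrow> real^3
    \<Rightarrow> complex" where
  "moll n \<equiv> conv (\<lambda>x. of_real (mk n x))"

lemma test_bump_scaled: "c \<noteq> 0 \<Longrightarrow> (\<lambda>x. of_real (bump (c *\<^sub>R x)))
    \<in> test_functions"
  using test_affine[OF test_bump, of c 0] by simp

lemma bump_scaled_integrable: "c \<noteq> 0
    \<Longrightarrow> integrable lebesgue (\<lambda>x. bump (c *\<^sub>R x))"
proof -
  assume "c \<noteq> 0"
  then have "integrable lebesgue (\<lambda>x. Re (complex_of_real (bump (c *\<^sub>R x))))"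
    by (intro integrable_Re integrable_continuous_bounded_supp C1c_continuous C1c_bounded C1c_test
        test_bump_scaled)
  then show ?thesis by simp
qed

lemma bump_scaled_integral_pos:
  assumes "c > 0" shows "(LINT x|lebesgue. bump (c *\<^sub>R x)) > 0"
proof -
  have "(LINT x|lebesgue. bump (c *\<^sub>R x)) \<noteq> 0"
  proof
    assume "(LINT x|lebesgue. bump (c *\<^sub>R x)) = 0"
    then have "AE x in lebesgue. bump (c *\<^sub>R x) = 0"
      using assms bump_nonneg by (subst (asm) integral_nonneg_eq_0_iff_AE)
          (auto intro: bump_scaled_integrable)
    then obtain N where N: "\<And>x. x \<in> space lebesgue - N
        \<Longrightarrow> bump (c *\<^sub>R x) = 0" "N \<in> null_sets lebesgue"
      by (rule AE_E3) (rule that)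
    have "ball 0 (1 / c) \<subseteq> N"
    proof
      fix x :: "real^3" assume "x \<in> ball 0 (1 / c)"
      then have "norm (c *\<^sub>R x) < 1" using assms by (simp add: field_simps)
      then show "x \<in> N" using bump_pos[of "c *\<^sub>R x"] N(1)[of x] by auto
    qed
    then have "emeasure lebesgue (ball 0 (1 / c) :: (real^3) set) \<le> emeasure lebesgue N"
      using N(2) by (intro emeasure_mono) auto
    also have "\<dots> = 0" using N(2) by (rule null_setsD1)
    finally have "measure lebesgue (ball 0 (1 / c) :: (real^3) set) = 0"
      by (simp add: measure_def)
    then show False using content_ball_pos[of "1 / c" "0 :: real^3"] assms by simp
  qed
  moreover have "(LINT x|lebesgue. bump (c *\<^sub>R x)) \<ge> 0" by (simp add: bump_nonneg)
  ultimately show ?thesis by simp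
qed

lemma mk_nonneg: "mk n x \<ge> 0"
  unfolding mk_def by (intro divide_nonneg_nonneg bump_nonneg Bochner_Integration.integral_nonneg)

lemma mk_test: "(\<lambda>x. of_real (mk n x)) \<in> test_functions"
  using test_cmult[OF test_bump_scaled[of "real (Suc n)"], of
      "1 / of_real (LINT x|lebesgue. bump (real (Suc n) *\<^sub>R x))"]
  by (simp add: mk_def)

lemma mk_integral: "(LINT x|lebesgue. mk n x) = 1"
  using bump_scaled_integral_pos[of "real (Suc n)"] by (simp add: mk_def del: of_nat_Suc)

lemma mk_zero: "norm x \<ge> 1 / real (Suc n) \<Longrightarrow> mk n x = 0"
proof -
  assume "norm x \<ge> 1 / real (Suc n)"
  then have "norm (real (Suc n) *\<^sub>R x) \<ge> 1" by (simp add: field_simps del: of_nat_Suc)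
  then show ?thesis unfolding mk_def by (subst bump_zero) auto
qed

lemmas mk_C1c = C1c_test[OF mk_test]

lemma moll_L2: "u \<in> L2 \<Longrightarrow> moll n u \<in> L2"
    and moll_norm: "u \<in> L2 \<Longrightarrow> L2_norm (moll n u) \<le> L2_norm u"
  using conv_young[OF _ mk_C1c mk_nonneg mk_integral] by blast+

lemma moll_measurable: "u \<in> L2 \<Longrightarrow> moll n u \<in> borel_measurable lebesgue"
  by (rule L2_measurable[OF moll_L2])

text \<open>The kernel is a probability density supported in the ball of radius 1/(n+1), so the
  mollified value averages nearby values. Below, \<open>e\<close> is a small oscillation, twice a
  bound of g, and zero away from the support, in turn.\<close>

lemma moll_close:
  assumes g: "continuous_on UNIV g" "bounded {x. g x \<noteq> 0}"
      and e: "\<And>y. norm (x - y) < 1 / real (Suc n) \<Longrightarrow> cmod (g y - g x) \<le> e"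
  shows "cmod (moll n g x - g x) \<le> e"
proof -
  have gL: "g \<in> L2" by (rule continuous_supp_L2[OF g])
  note kc = C1c_continuous[OF mk_C1c[of n]] C1c_bounded[OF mk_C1c[of n]]
  have kr: "integrable lebesgue (\<lambda>y. complex_of_real (mk n (x - y)))"
    by (rule integrable_continuous_bounded_supp[OF continuous_reflect[OF kc]])
  have mkc: "mk n \<in> borel_measurable borel"
    using borel_measurable_continuous_onI[OF continuous_on_Re[OF kc(1)]] by simp
  have kri: "integrable lebesgue (\<lambda>y. mk n (x - y))" using integrable_Re[OF kr] by simp
  have one: "(LINT y|lebesgue. mk n (x - y)) = 1"
    using lebesgue_integral_reflection[OF mkc, of x] mk_integral by simp
  have "g x = g x * of_real (LINT y|lebesgue. mk n (x - y))" using one by simp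
  also have "\<dots> = (LINT y|lebesgue. g x * of_real (mk n (x - y)))" using kr by simp
  finally have "moll n g x - g x = (LINT y|lebesgue. g y * of_real (mk n (x - y))
      - g x * of_real (mk n (x - y)))"
    unfolding conv_def using conv_integrable[OF gL kc] kr by simp
  also have "cmod \<dots> \<le> (LINT y|lebesgue. e * mk n (x - y))"
  proof (rule Bochner_Integration.integral_norm_bound_integral)
    show "integrable lebesgue (\<lambda>y. g y * of_real (mk n (x - y))
        - g x * of_real (mk n (x - y)))"
      using conv_integrable[OF gL kc] kr by simp
    show "integrable lebesgue (\<lambda>y. e * mk n (x - y))" using kri by simp
    fix y
    have "cmod (g y * of_real (mk n (x - y)) - g x * of_real (mk n (x - y)))
        = cmod (g y - g x) * mk n (x - y)"
      by (simp add: mk_nonneg norm_mult flip: left_diff_distrib)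
    also have "\<dots> \<le> e * mk n (x - y)"
      using e[of y] mk_zero[of n "x - y"] mk_nonneg[of n "x - y"]
      by (cases "norm (x - y) < 1 / real (Suc n)") (auto intro: mult_right_mono simp: not_less simp
          del: of_nat_Suc)
    finally show "norm (g y * of_real (mk n (x - y)) - g x * of_real (mk n (x - y)))
        \<le> e * mk n (x - y)" .
  qed
  also have "\<dots> = e" using one kri by simp
  finally show ?thesis .
qed

lemma moll_tendsto_continuous:
  assumes g: "continuous_on UNIV g" "bounded {x. g x \<noteq> 0}"
  shows "(\<lambda>n. L2_norm (\<lambda>x. moll n g x - g x)) \<longlonglongrightarrow> 0"
proof -
  have gL: "g \<in> L2" by (rule continuous_supp_L2[OF g])
  obtain M where M: "M \<ge> 0" "\<And>x. cmod (g x) \<le> M"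
      using continuous_bounded_supp_bounded[OF g] by blast
  obtain R where R: "{x. g x \<noteq> 0} \<subseteq> ball 0 R" using bounded_subset_ballD[OF g(2)]
      by blast
  show ?thesis
  proof (rule L2_dominated_convergence[OF L2_measurable[OF gL] moll_measurable[OF gL]
        integrable_indicator_ball[of "(2 * M)\<^sup>2" 0 "\<bar>R\<bar> + 1"]])
    show "AE x in lebesgue. (\<lambda>n. moll n g x) \<longlonglongrightarrow> g x"
    proof (rule AE_I2, rule LIMSEQ_I)
      fix x :: "real^3" and r :: real assume r: "r > 0"
      have "isCont g x" using g(1) by (simp add: continuous_on_eq_continuous_at)
      then obtain s where s: "s > 0" "\<And>y. norm (y - x) < s
          \<Longrightarrow> cmod (g y - g x) < r / 2"
        using g(1)[unfolded continuous_on_iff, rule_format, of x "r / 2"] r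
            by (auto simp: dist_norm)
      obtain N :: nat where N: "1 / real (Suc N) < s" using s(1) nat_approx_posE by blast
      show "\<exists>no. \<forall>n\<ge>no. norm (moll n g x - g x) < r"
      proof (intro exI allI impI)
        fix n assume "n \<ge> N"
        then have "1 / real (Suc n) \<le> 1 / real (Suc N)" by (intro divide_left_mono) auto
        then have "norm (y - x) < s" if "norm (x - y) < 1 / real (Suc n)" for y
          using that N by (simp add: norm_minus_commute)
        then have "cmod (moll n g x - g x) \<le> r / 2"
          by (intro moll_close[OF g] less_imp_le[OF s(2)])
        then show "norm (moll n g x - g x) < r" using r by simp
      qed
    qed
    fix n and x :: "real^3"
    have b: "cmod (moll n g x - g x) \<le> 2 * M"
    proof (rule moll_close[OF g])
      fix y show "cmod (g y - g x) \<le> 2 * M"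
        using norm_triangle_ineq4[of "g y" "g x"] M(2)[of x] M(2)[of y] by linarith
    qed
    show "(cmod (moll n g x - g x))\<^sup>2
        \<le> (2 * M)\<^sup>2 * indicat_real (ball 0 (\<bar>R\<bar> + 1)) x"
    proof (cases "norm x < \<bar>R\<bar> + 1")
      case True
      then show ?thesis using power_mono[OF b, of 2] by simp
    next
      case False
      have "cmod (moll n g x - g x) \<le> 0"
      proof (rule moll_close[OF g])
        fix y assume y: "norm (x - y) < 1 / real (Suc n)"
        have "1 / real (Suc n) \<le> 1" by simp
        moreover have "norm x - norm (x - y) \<le> norm y" using norm_triangle_ineq2[of x "x - y"]
            by simp
        ultimately have "norm y \<ge> R" "norm x \<ge> R"
          using False y by linarith+
        then have "g y = 0" "g x = 0" using R by fastforce+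
        then show "cmod (g y - g x) \<le> 0" by simp
      qed
      then show ?thesis by simp
    qed
  qed
qed

text \<open>Membership in \<open>L2\<close> is part of the notion: outside \<open>L2\<close> the
  integral, and with it \<open>L2_norm\<close>, may take the default value 0, and smallness of the
  norm would then mean nothing.\<close>

definition L2_lim :: "(nat \<Rightarrow> real^3 \<Rightarrow> complex) \<Rightarrow>
    (real^3 \<Rightarrow> complex) \<Rightarrow> bool" where
  "L2_lim s u \<longleftrightarrow> (\<forall>n. s n \<in> L2) \<and> u \<in> L2
      \<and> (\<lambda>n. L2_norm (\<lambda>x. s n x - u x)) \<longlonglongrightarrow> 0"

lemma L2_limI:
  assumes "\<And>n. s n \<in> L2" "u \<in> L2" "\<And>n. L2_norm (\<lambda>x. s n x - u x)
      \<le> b n" "b \<longlonglongrightarrow> 0"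
  shows "L2_lim s u"
  unfolding L2_lim_def using assms
  by (auto intro: tendsto_sandwich[OF _ _ tendsto_const assms(4)])

lemma L2_lim_add:
  assumes "L2_lim s u" "L2_lim t v"
  shows "L2_lim (\<lambda>n x. s n x + t n x) (\<lambda>x. u x + v x)"
proof (rule L2_limI)
  show "L2_norm (\<lambda>x. s n x + t n x - (u x + v x)) \<le> L2_norm (\<lambda>x. s n x - u x)
      + L2_norm (\<lambda>x. t n x - v x)" for n
    using L2_triangle[OF L2_diff L2_diff, of "s n" u "t n" v] assms
        by (simp add: L2_lim_def algebra_simps)
  show "(\<lambda>n. L2_norm (\<lambda>x. s n x - u x) + L2_norm (\<lambda>x. t n x - v x))
      \<longlonglongrightarrow> 0"
    using tendsto_add[of _ 0 _ _ 0] assms by (fastforce simp: L2_lim_def)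
qed (use assms in \<open>auto simp: L2_lim_def L2_add\<close>)

lemma L2_lim_weight:
  assumes "L2_lim s u" "h \<in> borel_measurable lebesgue" "\<And>x. cmod (h x) \<le> C"
  shows "L2_lim (\<lambda>n x. h x * s n x) (\<lambda>x. h x * u x)"
proof (rule L2_limI)
  show "L2_norm (\<lambda>x. h x * s n x - h x * u x) \<le> C * L2_norm (\<lambda>x. s n x - u x)"
      for n
    using L2_weight(2)[OF L2_diff assms(2,3), of "s n" u] assms(1)
        by (simp add: L2_lim_def right_diff_distrib)
  show "(\<lambda>n. C * L2_norm (\<lambda>x. s n x - u x)) \<longlonglongrightarrow> 0"
    using assms(1) tendsto_mult_right_zero by (auto simp: L2_lim_def)
qed (use assms L2_weight(1)[OF _ assms(2,3)] in \<open>auto simp: L2_lim_def\<close>)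

lemma L2_lim_const: "u \<in> L2 \<Longrightarrow> L2_lim (\<lambda>n. u) u"
  by (rule L2_limI[of _ _ "\<lambda>_. 0"]) (auto simp: L2_norm_def)

lemma L2_lim_cmult: "L2_lim s u
    \<Longrightarrow> L2_lim (\<lambda>n x. c * s n x) (\<lambda>x. c * u x)"
  by (rule L2_lim_weight[of _ _ "\<lambda>_. c" "cmod c"]) auto

lemma L2_lim_diff: "L2_lim s u \<Longrightarrow> L2_lim t v
    \<Longrightarrow> L2_lim (\<lambda>n x. s n x - t n x) (\<lambda>x. u x - v x)"
  using L2_lim_add[of s u "\<lambda>n x. - 1 * t n x" "\<lambda>x. - 1 * v x"] L2_lim_cmult[of t v
      "- 1"] by simp

lemma L2_lim_norm: "L2_lim s u \<Longrightarrow> (\<lambda>n. L2_norm (s n))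
    \<longlonglongrightarrow> L2_norm u"
proof -
  assume l: "L2_lim s u"
  have "\<bar>L2_norm (s n) - L2_norm u\<bar> \<le> L2_norm (\<lambda>x. s n x - u x)" for n
    using l by (intro L2_norm_diff_le) (auto simp: L2_lim_def)
  then have "(\<lambda>n. L2_norm (s n) - L2_norm u) \<longlonglongrightarrow> 0"
    using l by (intro Lim_null_comparison[of "\<lambda>n. L2_norm (s n)
        - L2_norm u"]) (auto simp: L2_lim_def)
  then show ?thesis by (rule LIM_zero_cancel)
qed

lemma L2_lim_prod: "L2_lim s u \<Longrightarrow> v \<in> L2
    \<Longrightarrow> (\<lambda>n. LINT x|lebesgue. v x * s n x) \<longlonglongrightarrow>
    (LINT x|lebesgue. v x * u x)"
proof -
  assume l: "L2_lim s u" and v: "v \<in> L2"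
  have "norm ((LINT x|lebesgue. v x * s n x) - (LINT x|lebesgue. v x * u x))
      \<le> L2_norm v * L2_norm (\<lambda>x. s n x - u x)" for n
  proof -
    have "(LINT x|lebesgue. v x * s n x) - (LINT x|lebesgue. v x * u x)
        = (LINT x|lebesgue. v x * (s n x - u x))"
      using l v L2_prod_integrable by (auto simp: L2_lim_def right_diff_distrib)
    then show ?thesis using L2_prod_bound[OF v L2_diff, of "s n" u] l by (simp add: L2_lim_def)
  qed
  moreover have "(\<lambda>n. L2_norm v * L2_norm (\<lambda>x. s n x - u x))
      \<longlonglongrightarrow> 0"
    using l tendsto_mult_right_zero by (auto simp: L2_lim_def)
  ultimately have "(\<lambda>n. (LINT x|lebesgue. v x * s n x) - (LINT x|lebesgue. v x * u x))
      \<longlonglongrightarrow> 0"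
    by (intro Lim_null_comparison[of "\<lambda>n. (LINT x|lebesgue. v x * s n x)
        - (LINT x|lebesgue. v x * u x)"]) auto
  then show ?thesis by (rule LIM_zero_cancel)
qed

lemma L2_lim_cnj: "L2_lim s u
    \<Longrightarrow> L2_lim (\<lambda>n x. cnj (s n x)) (\<lambda>x. cnj (u x))"
  using L2_norm_cnj[of "\<lambda>x. s n x - u x" for n] by (simp add: L2_lim_def L2_cnj)

text \<open>Convergence is known for continuous functions of bounded support, which are dense, and
  \<open>moll_norm\<close> makes the error of replacing \<open>u\<close> by such a function
  independent of \<open>n\<close>.\<close>

lemma moll_tendsto:
  assumes u: "u \<in> L2" shows "L2_lim (\<lambda>n. moll n u) u"
proof -
  have "(\<lambda>n. L2_norm (\<lambda>x. moll n u x - u x)) \<longlonglongrightarrow> 0"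
  proof (rule LIMSEQ_I)
    fix r :: real assume r: "r > 0"
    obtain g where g: "continuous_on UNIV g" "bounded {x. g x \<noteq> 0}" "L2_norm (\<lambda>x. g x
        - u x) < r / 3"
      using L2_continuous_approx[OF u, of "r / 3"] r by auto
    have gL: "g \<in> L2" by (rule continuous_supp_L2[OF g(1,2)])
    obtain N where N: "\<And>n. n \<ge> N \<Longrightarrow> L2_norm (\<lambda>x. moll n g x
        - g x) < r / 3"
      using order_tendstoD(2)[OF moll_tendsto_continuous[OF g(1,2)], of "r / 3"] r
      unfolding eventually_sequentially by auto
    have "L2_norm (\<lambda>x. moll n u x - u x) < r" if "n \<ge> N" for n
    proof -
      have "L2_norm (\<lambda>x. moll n u x - u x)
          \<le> L2_norm (\<lambda>x. moll n u x - moll n g x) + L2_norm (\<lambda>x. moll n g x - u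
          x)"
        by (intro L2_triangle_diff moll_L2 u gL)
      also have "L2_norm (\<lambda>x. moll n g x - u x) \<le> L2_norm (\<lambda>x. moll n g x - g x)
          + L2_norm (\<lambda>x. g x - u x)"
        by (intro L2_triangle_diff moll_L2 u gL)
      also have "L2_norm (\<lambda>x. moll n u x - moll n g x)
          \<le> L2_norm (\<lambda>x. u x - g x)"
        using moll_norm[OF L2_diff[OF u gL]] conv_diff[OF u gL C1c_continuous[OF mk_C1c]
            C1c_bounded[OF mk_C1c]] by simp
      finally show ?thesis using N[OF that] g(3) L2_norm_minus_commute[of u g] by linarith
    qed
    then show "\<exists>no. \<forall>n\<ge>no. norm (L2_norm (\<lambda>x. moll n u x - u x)
        - 0) < r" by auto
  qed
  then show ?thesis using u by (simp add: L2_lim_def moll_L2)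
qed

subsection \<open>Weak gradients\<close>

text \<open>The definition is tested with y \<mapsto> K(x - y); the sign from the reflection cancels
  the sign from integration by parts.\<close>

lemma weak_gradient_conv:
  assumes G: "has_L2_weak_gradient u G" and K: "K \<in> test_functions"
  shows "conv (partial_deriv i K) u = conv K (\<lambda>x. G x $ i)"
proof
  fix x
  have t: "(\<lambda>y. K (x - y)) \<in> test_functions" using test_affine[OF K, of "-1" x] by simp
  have "partial_deriv i (\<lambda>y. K (x - y)) = (\<lambda>y. - partial_deriv i K (x - y))"
    using partial_deriv_affine(2)[of K x "-1" _ i] C1c_differentiable[OF C1c_test[OF K]]
        by (auto simp: fun_eq_iff)
  then show "conv (partial_deriv i K) u x = conv K (\<lambda>x. G x $ i) x"
  proof -
    have "(LINT y|lebesgue. u y * partial_deriv i (\<lambda>y. K (x - y)) y)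
        = - (LINT y|lebesgue. G y $ i * K (x - y))"
      using G t unfolding has_L2_weak_gradient_def by blast
    then show ?thesis using \<open>partial_deriv i _ = _\<close> by (simp add: conv_def)
  qed
qed

lemma partial_deriv_moll:
  assumes "u \<in> L2" "has_L2_weak_gradient u G"
  shows "partial_deriv i (moll n u) = moll n (\<lambda>x. G x $ i)"
  using partial_deriv_conv[OF assms(1) mk_C1c] weak_gradient_conv[OF assms(2) mk_test] by simp

lemma L2_norm_zero_AE:
  assumes "u \<in> L2" "L2_norm u = 0" shows "AE x in lebesgue. u x = 0"
proof -
  have "(LINT x|lebesgue. (cmod (u x))\<^sup>2) = 0" using assms(2) L2_norm_square[of u] by simp
  then have "AE x in lebesgue. (cmod (u x))\<^sup>2 = 0"
    using L2_integrable[OF assms(1)] by (subst (asm) integral_nonneg_eq_0_iff_AE) auto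
  then show ?thesis by simp
qed

text \<open>Both gradients have the same mollifications, as these are determined by
  \<open>u\<close>, and each is the limit of its mollifications. Hence \<open>weak_grad\<close> may
  be exchanged for any other weak gradient under integrals.\<close>

lemma weak_gradient_unique:
  assumes G: "has_L2_weak_gradient u G" "has_L2_weak_gradient u G'"
  shows "AE x in lebesgue. G x $ i = G' x $ i"
proof -
  have L: "(\<lambda>x. G x $ i) \<in> L2" "(\<lambda>x. G' x $ i) \<in> L2" using G
      by (auto simp: has_L2_weak_gradient_def)
  have eq: "moll n (\<lambda>x. G x $ i) = moll n (\<lambda>x. G' x $ i)" for n
    using weak_gradient_conv[OF G(1) mk_test] weak_gradient_conv[OF G(2) mk_test] by metis
  have "L2_norm (\<lambda>x. G x $ i - G' x $ i)
      \<le> L2_norm (\<lambda>x. moll n (\<lambda>x. G x $ i) x - G x $ i) + L2_norm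
      (\<lambda>x. moll n (\<lambda>x. G' x $ i) x - G' x $ i)" for n
    using L2_triangle_diff[OF L(1) moll_L2[OF L(1)] L(2), of n] L2_norm_minus_commute[of
        "moll n (\<lambda>x. G x $ i)" "\<lambda>x. G x $ i"] eq[of n] by simp
  moreover have "(\<lambda>n. L2_norm (\<lambda>x. moll n (\<lambda>x. G x $ i) x - G x $ i)
      + L2_norm (\<lambda>x. moll n (\<lambda>x. G' x $ i) x - G' x $ i)) \<longlonglongrightarrow>
      0 + 0"
    using moll_tendsto[OF L(1)] moll_tendsto[OF L(2)] by (intro tendsto_add) (auto simp: L2_lim_def)
  ultimately have "L2_norm (\<lambda>x. G x $ i - G' x $ i) \<le> 0"
    using LIMSEQ_le_const[of _ "0::real"] by auto
  then have "AE x in lebesgue. G x $ i - G' x $ i = 0"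
    by (intro L2_norm_zero_AE L2_diff L) (simp add: antisym)
  then show ?thesis by simp
qed

subsection \<open>Density of test functions\<close>

text \<open>Normalised to be 1 at the origin, without a plateau. The dilations \<open>cut n\<close>
  tend to 1 pointwise and are bounded by 1, which is what dominated convergence uses.\<close>

definition cut0 :: "real^3 \<Rightarrow> complex" where
  "cut0 x = of_real (bump x / bump 0)"

definition cut :: "nat \<Rightarrow> real^3 \<Rightarrow> complex" where
  "cut n x = cut0 ((1 / real (Suc n)) *\<^sub>R x)"

text \<open>Mollification comes first and the cutoff afterwards: weak derivatives and the effective
  equation pass through \<open>moll\<close> exactly, so the errors are the terms in which a
  derivative falls on \<open>cut n\<close>.\<close>

definition approx :: "(real^3 \<Rightarrow> complex) \<Rightarrow> nat \<Rightarrow> real^3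
    \<Rightarrow> complex" where
  "approx u n x = cut n x * moll n u x"

lemma bump_0: "bump 0 = exp (- 1)" by (simp add: bump_def flat_exp_def)

lemma cut0_test: "cut0 \<in> test_functions"
  using test_cmult[OF test_bump, of "1 / of_real (bump 0)"] by (simp add: cut0_def[abs_def])

lemma cut_test: "cut n \<in> test_functions"
  using test_affine[OF cut0_test, of "1 / real (Suc n)" 0] by (simp add: cut_def[abs_def])

lemma cut_le: "cmod (cut n x) \<le> 1"
proof -
  have "bump y / bump 0 \<le> 1" for y using bump_le[of y] by (simp add: bump_0 field_simps)
  moreover have "bump y / bump 0 \<ge> 0" for y by (simp add: bump_nonneg)
  ultimately show ?thesis by (simp add: cut_def cut0_def norm_divide bump_nonneg)
qed

lemma cut_lim: "(\<lambda>n. cut n x) \<longlonglongrightarrow> 1"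
proof -
  have "isCont cut0 0"
    using C1c_continuous[OF C1c_test[OF cut0_test]] by (simp add: continuous_on_eq_continuous_at)
  moreover have "(\<lambda>n. (1 / real (Suc n)) *\<^sub>R x)
      \<longlonglongrightarrow> 0 *\<^sub>R x"
    by (intro tendsto_intros LIMSEQ_Suc[OF lim_1_over_n])
  ultimately have "(\<lambda>n. cut n x) \<longlonglongrightarrow> cut0 0"
    unfolding cut_def by (intro isCont_tendsto_compose[of 0 cut0]) auto
  then show ?thesis by (simp add: cut0_def bump_0)
qed

lemma partial_deriv_scaled:
  assumes "f \<in> test_functions"
  shows "partial_deriv i (\<lambda>x. f (c *\<^sub>R x))
      = (\<lambda>x. of_real c * partial_deriv i f (c *\<^sub>R x))"
  using partial_deriv_affine(2)[of f 0 c _ i] C1c_differentiable[OF C1c_test[OF assms]]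
      by (auto simp: fun_eq_iff)

lemma partial_deriv_cmult: "f differentiable at x
    \<Longrightarrow> partial_deriv i (\<lambda>x. c * f x) x = c * partial_deriv i f x"
  by (rule partial_deriv_bounded_linear[OF bounded_linear_mult_right])

text \<open>The second derivatives even decay like 1/(n+1)^2; the weaker common rate lets
  \<open>moll_vanish\<close> treat both orders alike.\<close>

lemma cut_partial_bound:
  obtains C where "C \<ge> 0" "\<And>n i x. cmod (partial_deriv i (cut n) x) \<le> C / real (Suc n)"
    "\<And>n i x. cmod (partial_deriv i (partial_deriv i (cut n)) x) \<le> C / real (Suc n)"
proof -
  obtain M where M: "M \<ge> 0" "\<And>i x. cmod (partial_deriv i cut0 x) \<le> M"
    using C1c_bound_partial[OF C1c_test[OF cut0_test]] by blast
  have "\<forall>i. \<exists>M\<ge>0. \<forall>x. cmod (partial_deriv i (partial_deriv i cut0) x)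
      \<le> M"
    using C1c_bound_partial[OF C1c_test[OF test_partial_deriv[OF cut0_test]]] by metis
  then obtain N where N: "\<And>i. N i \<ge> 0"
      "\<And>i x. cmod (partial_deriv i (partial_deriv i cut0) x) \<le> N i" by metis
  define C where "C = M + (\<Sum>i\<in>UNIV. N i)"
  have NC: "N i \<le> C" for i
    using member_le_sum[of i UNIV N] N(1) M(1) by (simp add: C_def add_increasing)
  have MC: "M \<le> C" using N(1) by (simp add: C_def sum_nonneg)
  have c1: "partial_deriv i (cut n)
      = (\<lambda>x. of_real (1 / real (Suc n)) * partial_deriv i cut0 ((1 / real (Suc n)) *\<^sub>R
      x))" for i n
    unfolding cut_def[abs_def] by (rule partial_deriv_scaled[OF cut0_test])
  have c2: "partial_deriv i (partial_deriv i (cut n)) x =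
     of_real (1 / real (Suc n)) * (of_real (1 / real (Suc n)) * partial_deriv i
         (partial_deriv i cut0) ((1 / real (Suc n)) *\<^sub>R x))" for i n x
  proof -
    have t: "(\<lambda>x. partial_deriv i cut0 ((1 / real (Suc n)) *\<^sub>R x)) \<in>
        test_functions"
      using test_affine[OF test_partial_deriv[OF cut0_test], where c="1 / real (Suc n)" and a=0]
          by simp
    show ?thesis unfolding c1
      by (subst partial_deriv_cmult[OF C1c_differentiable[OF C1c_test[OF t]]])
         (simp only: partial_deriv_scaled[OF test_partial_deriv[OF cut0_test]])
  qed
  show ?thesis
  proof (rule that[of C])
    show "C \<ge> 0" using MC M(1) by simp
    fix n i x
    have "cmod (partial_deriv i (cut n) x) \<le> 1 / real (Suc n) * M"
      unfolding c1 norm_mult norm_of_real using M(2) by (intro mult_mono) auto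
    also have "\<dots> \<le> 1 / real (Suc n) * C" using MC by (intro mult_left_mono) auto
    finally show "cmod (partial_deriv i (cut n) x) \<le> C / real (Suc n)" by simp
    have "cmod (partial_deriv i (partial_deriv i (cut n)) x) \<le> 1 / real (Suc n) * (1 * N i)"
      unfolding c2 norm_mult norm_of_real using N by (intro mult_mono) auto
    also have "\<dots> \<le> 1 / real (Suc n) * C" using NC by (intro mult_left_mono) auto
    finally show "cmod (partial_deriv i (partial_deriv i (cut n)) x) \<le> C / real (Suc n)" by simp
  qed
qed

lemma test_measurable: "f \<in> test_functions \<Longrightarrow> f \<in> borel_measurable lebesgue"
  by (intro continuous_lebesgue C1c_continuous C1c_test)

lemma moll_vanish:
  assumes u: "u \<in> L2" and w: "\<And>n. w n \<in> borel_measurable lebesgue"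
      "\<And>n x. cmod (w n x) \<le> C / real (Suc n)"
  shows "L2_lim (\<lambda>n x. w n x * moll n u x) (\<lambda>x. 0)"
proof (rule L2_limI)
  show "(\<lambda>x. w n x * moll n u x) \<in> L2" for n
    by (rule L2_weight(1)[OF moll_L2[OF u] w])
  have C: "C \<ge> 0" using order_trans[OF norm_ge_zero w(2)[of 0]] by simp
  show "L2_norm (\<lambda>x. w n x * moll n u x - 0) \<le> C / real (Suc n) * L2_norm u" for n
  proof -
    have "L2_norm (\<lambda>x. w n x * moll n u x) \<le> C / real (Suc n) * L2_norm (moll n u)"
      by (rule L2_weight(2)[OF moll_L2[OF u] w])
    also have "\<dots> \<le> C / real (Suc n) * L2_norm u"
      using moll_norm[OF u] C by (intro mult_left_mono) auto
    finally show ?thesis by simp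
  qed
  have "(\<lambda>n. C * (1 / real (Suc n)) * L2_norm u)
      \<longlonglongrightarrow> C * 0 * L2_norm u"
    by (intro tendsto_intros LIMSEQ_Suc[OF lim_1_over_n])
  then show "(\<lambda>n. C / real (Suc n) * L2_norm u) \<longlonglongrightarrow> 0" by simp
qed (auto simp: L2_def)

text \<open>The error splits into the cutoff times the mollification error, no larger than the
  latter as the cutoff is bounded by 1, and (cut n - 1) u, which tends to zero by dominated
  convergence.\<close>

lemma approx_lim:
  assumes u: "u \<in> L2" shows "L2_lim (approx u) u"
proof -
  have c: "(\<lambda>n. L2_norm (\<lambda>x. cut n x * u x - u x)) \<longlonglongrightarrow> 0"
  proof (rule L2_dominated_convergence[of _ _ "\<lambda>x. 4 * (cmod (u x))\<^sup>2"])
    show "integrable lebesgue (\<lambda>x. 4 * (cmod (u x))\<^sup>2)" using L2_integrable[OF u]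
        by simp
    show "AE x in lebesgue. (\<lambda>n. cut n x * u x) \<longlonglongrightarrow> u x"
      using tendsto_mult[OF cut_lim tendsto_const] by (intro AE_I2) fastforce
    show "(\<lambda>x. cut n x * u x) \<in> borel_measurable lebesgue" for n
      using test_measurable[OF cut_test] L2_measurable[OF u] by measurable
    fix n x
    have "cmod (cut n x * u x - u x) \<le> 2 * cmod (u x)"
    proof -
      have "cmod (cut n x * u x - u x) \<le> cmod (cut n x) * cmod (u x) + cmod (u x)"
        using norm_triangle_ineq4[of "cut n x * u x" "u x"] by (simp add: norm_mult)
      also have "\<dots> \<le> 1 * cmod (u x) + cmod (u x)" using cut_le
          by (intro add_mono mult_right_mono) auto
      finally show ?thesis by simp
    qed
    from power_mono[OF this, of 2] show "(cmod (cut n x * u x - u x))\<^sup>2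
        \<le> 4 * (cmod (u x))\<^sup>2"
      by (simp add: power_mult_distrib)
  qed (use L2_measurable[OF u] in auto)
  have mL: "(\<lambda>x. cut n x * v x) \<in> L2" "L2_norm (\<lambda>x. cut n x * v x)
      \<le> L2_norm v" if "v \<in> L2" for v n
    using L2_weight[OF that test_measurable[OF cut_test] cut_le] by auto
  have m0: "(\<lambda>n. L2_norm (\<lambda>x. moll n u x - u x)) \<longlonglongrightarrow> 0"
      using moll_tendsto[OF u] by (simp add: L2_lim_def)
  show ?thesis
  proof (rule L2_limI[of _ _ "\<lambda>n. L2_norm (\<lambda>x. moll n u x - u x)
      + L2_norm (\<lambda>x. cut n x * u x - u x)"])
    show "approx u n \<in> L2" for n unfolding approx_def[abs_def] by (rule mL(1)[OF moll_L2[OF u]])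
    show "L2_norm (\<lambda>x. approx u n x - u x) \<le> L2_norm (\<lambda>x. moll n u x - u x)
        + L2_norm (\<lambda>x. cut n x * u x - u x)" for n
    proof -
      have "L2_norm (\<lambda>x. approx u n x - u x)
          \<le> L2_norm (\<lambda>x. approx u n x - cut n x * u x) + L2_norm
          (\<lambda>x. cut n x * u x - u x)"
        using mL(1)[OF moll_L2[OF u]] mL(1)[OF u] u unfolding approx_def by (intro L2_triangle_diff)
      also have "L2_norm (\<lambda>x. approx u n x - cut n x * u x)
          \<le> L2_norm (\<lambda>x. moll n u x - u x)"
        using mL(2)[OF L2_diff[OF moll_L2[OF u] u], of n n]
            by (simp add: approx_def right_diff_distrib)
      finally show ?thesis by simp
    qed
    show "(\<lambda>n. L2_norm (\<lambda>x. moll n u x - u x) + L2_norm (\<lambda>x. cut n x * u x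
        - u x)) \<longlonglongrightarrow> 0"
      using tendsto_add[OF m0 c] by simp
  qed (rule u)
qed

lemma approx_test: "u \<in> L2 \<Longrightarrow> approx u n \<in> test_functions"
  using test_mult_left[OF cut_test smooth_conv[OF _ mk_test]]
      by (simp add: approx_def[abs_def] mult.commute)

lemma partial_deriv_approx:
  assumes u: "u \<in> L2" and G: "has_L2_weak_gradient u G"
  shows "partial_deriv i (approx u n) = (\<lambda>x. partial_deriv i (cut n) x * moll n u x
      + approx (\<lambda>x. G x $ i) n x)"
  unfolding approx_def[abs_def] partial_deriv_moll[OF assms, symmetric]
  by (intro ext partial_deriv_mult C1c_differentiable[OF C1c_test[OF cut_test]]
      conv_differentiable[OF u mk_C1c])

lemma approx_grad_lim:
  assumes u: "u \<in> L2" and G: "has_L2_weak_gradient u G"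
  shows "L2_lim (\<lambda>n. partial_deriv i (approx u n)) (\<lambda>x. G x $ i)"
proof -
  obtain C where C: "C \<ge> 0" "\<And>n i x. cmod (partial_deriv i (cut n) x)
      \<le> C / real (Suc n)"
    using cut_partial_bound by metis
  have Gi: "(\<lambda>x. G x $ i) \<in> L2" using G by (simp add: has_L2_weak_gradient_def)
  have "L2_lim (\<lambda>n x. partial_deriv i (cut n) x * moll n u x) (\<lambda>x. 0)"
    by (rule moll_vanish[OF u test_measurable[OF test_partial_deriv[OF cut_test]] C(2)])
  from L2_lim_add[OF this approx_lim[OF Gi]] show ?thesis
    unfolding partial_deriv_approx[OF assms] by simp
qed

section \<open>Approximation of the effective equation by test functions\<close>

text \<open>The distributional equation tested with y \<mapsto> mk n (x - y) is the classical
  equation for the mollified functions at \<open>x\<close>, since second derivatives do not change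
  sign under the reflection.\<close>

lemma moll_effective:
  assumes V: "solves_effective \<alpha> F V"
  shows "- laplacian (moll n V) x + of_real (4 / 3 * pi * \<alpha>\<^sup>2 + 1) * moll n V x
      = moll n F x"
proof -
  let ?K = "\<lambda>x. complex_of_real (mk n x)"
  let ?b = "complex_of_real (4 / 3 * pi * \<alpha>\<^sup>2 + 1)"
  have VL: "V \<in> L2" using V by (auto simp: solves_effective_def H1_def)
  have t: "(\<lambda>y. ?K (x - y)) \<in> test_functions" using test_affine[OF mk_test, where c="-1"
      and a=x] by simp
  have p: "partial_deriv i (\<lambda>y. f (x - y)) = (\<lambda>y. - partial_deriv i f (x - y))"
      if "f \<in> test_functions" for f i
    using partial_deriv_affine(2)[of f x "-1" _ i] C1c_differentiable[OF C1c_test[OF that]]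
        by (auto simp: fun_eq_iff)
  have pp: "partial_deriv i (partial_deriv i (\<lambda>y. ?K (x - y))) y
      = partial_deriv i (partial_deriv i ?K) (x - y)" for i y
  proof -
    have "(\<lambda>y. partial_deriv i ?K (x - y)) \<in> test_functions"
      using test_affine[OF test_partial_deriv[OF mk_test], where c="-1" and a=x] by simp
    then have "partial_deriv i (\<lambda>y. - 1 * partial_deriv i ?K (x - y)) y
        = - 1 * partial_deriv i (\<lambda>y. partial_deriv i ?K (x - y)) y"
      by (intro partial_deriv_cmult C1c_differentiable C1c_test)
    then show ?thesis unfolding p[OF mk_test] p[OF test_partial_deriv[OF mk_test]] by simp
  qed
  have "(LINT y|lebesgue. V y * (- laplacian (\<lambda>y. ?K (x - y)) y + ?b * ?K (x - y)))
      = moll n F x"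
    using V t unfolding solves_effective_def conv_def by blast
  moreover have "(\<lambda>y. V y * (- laplacian (\<lambda>y. ?K (x - y)) y + ?b * ?K (x - y)))
     = (\<lambda>y. - (\<Sum>i\<in>UNIV. V y * partial_deriv i (partial_deriv i ?K) (x - y)) + ?b *
         (V y * ?K (x - y)))"
    unfolding laplacian_def pp by (simp add: sum_distrib_left algebra_simps)
  moreover have "integrable lebesgue (\<lambda>y. V y * K (x - y))" if "C1c K" for K
    by (rule conv_integrable[OF VL C1c_continuous[OF that] C1c_bounded[OF that]])
  note this[OF mk_C1c] this[OF C1c_test[OF test_partial_deriv[OF test_partial_deriv[OF mk_test]]]]
  ultimately have "- (\<Sum>i\<in>UNIV. conv (partial_deriv i (partial_deriv i ?K)) V x)
      + ?b * conv ?K V x = moll n F x"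
    using \<open>integrable lebesgue (\<lambda>y. V y * ?K (x - y))\<close>
      \<open>\<And>i. integrable lebesgue (\<lambda>y. V y * partial_deriv _ (partial_deriv _ ?K) (x - y))\<close>
    by (simp add: conv_def del: of_real_add of_real_mult)
  moreover have "partial_deriv i (partial_deriv i (moll n V))
      = conv (partial_deriv i (partial_deriv i ?K)) V" for i
    using partial_deriv_conv[OF VL mk_C1c] partial_deriv_conv[OF VL C1c_test[OF
        test_partial_deriv[OF mk_test]]] by simp
  ultimately show ?thesis by (simp add: laplacian_def)
qed

lemma L2_lim_sum: "finite A \<Longrightarrow> (\<And>i. i \<in> A
    \<Longrightarrow> L2_lim (s i) (u i)) \<Longrightarrow> L2_lim (\<lambda>n x. \<Sum>i\<in>A. s i
    n x) (\<lambda>x. \<Sum>i\<in>A. u i x)"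
proof (induction A rule: finite_induct)
  case empty
  have "(\<lambda>x. 0) \<in> L2" by (simp add: L2_def)
  then show ?case using L2_lim_const by simp
next
  case (insert a A)
  then show ?case using L2_lim_add[of "s a" "u a" "\<lambda>n x. \<Sum>i\<in>A. s i n x"
      "\<lambda>x. \<Sum>i\<in>A. u i x"] by simp
qed

text \<open>This carries a priori estimates over to V: they are proved for test functions v in terms
  of the norm of (-Laplacian + b) v, and here these right-hand sides converge to F. By
  \<open>moll_effective\<close> they differ from \<open>approx F n\<close> only by terms with a
  derivative on the cutoff, which vanish in the limit.\<close>

lemma approx_effective_lim:
  assumes V: "solves_effective \<alpha> F V" and F: "F \<in> L2"
  shows "L2_lim (\<lambda>n x. - laplacian (approx V n) x + of_real (4 / 3 * pi * \<alpha>\<^sup>2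
      + 1) * approx V n x) F"
proof -
  let ?b = "complex_of_real (4 / 3 * pi * \<alpha>\<^sup>2 + 1)"
  obtain G where VL: "V \<in> L2" and G: "has_L2_weak_gradient V G"
    using V by (auto simp: solves_effective_def H1_def)
  have Gi: "(\<lambda>x. G x $ i) \<in> L2" for i using G by (simp add: has_L2_weak_gradient_def)
  obtain C where C: "C \<ge> 0" "\<And>n i x. cmod (partial_deriv i (cut n) x)
      \<le> C / real (Suc n)"
    "\<And>n i x. cmod (partial_deriv i (partial_deriv i (cut n)) x) \<le> C / real (Suc n)"
    using cut_partial_bound by metis
  have pd: "partial_deriv i (partial_deriv i (approx V n)) x
     = partial_deriv i (partial_deriv i (cut n)) x * moll n V x
       + 2 * (partial_deriv i (cut n) x * moll n (\<lambda>x. G x $ i) x)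
       + cut n x * partial_deriv i (partial_deriv i (moll n V)) x" for i n x
  proof -
    have d: "partial_deriv i (cut n) differentiable at x" "cut n differentiable at x"
        "moll n V differentiable at x"
      "moll n (\<lambda>x. G x $ i) differentiable at x"
      by (intro C1c_differentiable C1c_test test_partial_deriv cut_test conv_differentiable VL Gi
          mk_C1c)+
    then show ?thesis
      unfolding partial_deriv_approx[OF VL G]
          unfolding approx_def partial_deriv_moll[OF VL G, symmetric]
      by (subst partial_deriv_add)
         (simp_all add: differentiable_mult partial_deriv_mult algebra_simps partial_deriv_moll[OF
             VL G])
  qed
  have eq: "- laplacian (approx V n) x + ?b * approx V n x =
     approx F n x - (\<Sum>i\<in>UNIV. partial_deriv i (partial_deriv i (cut n)) x * moll n V x
       + 2 * (partial_deriv i (cut n) x * moll n (\<lambda>x. G x $ i) x))" for n x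
  proof -
    have "laplacian (approx V n) x
        = (\<Sum>i\<in>UNIV. partial_deriv i (partial_deriv i (cut n)) x * moll n V x
       + 2 * (partial_deriv i (cut n) x * moll n (\<lambda>x. G x $ i) x)) + cut n x * laplacian
           (moll n V) x"
      unfolding laplacian_def pd by (simp add: sum.distrib sum_distrib_left)
    then show ?thesis
      unfolding approx_def moll_effective[OF V, symmetric] by (simp add: algebra_simps)
  qed
  have "L2_lim (\<lambda>n x. partial_deriv i (partial_deriv i (cut n)) x * moll n V x
       + 2 * (partial_deriv i (cut n) x * moll n (\<lambda>x. G x $ i) x)) (\<lambda>x. 0 + 2 * 0)"
           for i
    by (intro L2_lim_add L2_lim_cmult moll_vanish[of _ _ C] VL Gi C test_measurable
        test_partial_deriv cut_test)
  then have "L2_lim (\<lambda>n x. \<Sum>i\<in>UNIV. partial_deriv i (partial_deriv i (cut n)) x *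
      moll n V x
       + 2 * (partial_deriv i (cut n) x * moll n (\<lambda>x. G x $ i) x))
           (\<lambda>x. \<Sum>i\<in>(UNIV::3 set). 0 + 2 * 0)"
    by (intro L2_lim_sum) auto
  from L2_lim_diff[OF approx_lim[OF F] this] show ?thesis unfolding eq by simp
qed

subsection \<open>The second-order energy identity\<close>

lemma C1c_translate: "C1c f \<Longrightarrow> C1c (\<lambda>x. f (x + a))"
  using C1c_affine[of f 1 a] by (simp add: add.commute)

text \<open>Dominated convergence: the quotients are bounded by a Lipschitz constant of f, and g is
  integrable.\<close>

lemma translation_quotient_LIMSEQ:
  assumes f: "C1c f" and g: "continuous_on UNIV g" "bounded {x. g x \<noteq> 0}"
  shows "(\<lambda>n. LINT x|lebesgue.
      (of_nat (Suc n) * (f (x + (1 / real (Suc n)) *\<^sub>R axis j 1) - f x)) * g x)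
      \<longlonglongrightarrow> (LINT x|lebesgue. partial_deriv j f x * g x)"
proof -
  obtain L where L: "L \<ge> 0" "\<And>x y. cmod (f x - f y) \<le> L * norm (x - y)"
      using C1c_lipschitz[OF f] by blast
  show ?thesis
  proof (rule integral_dominated_convergence[where w="\<lambda>x. L * cmod (g x)"])
    show "(\<lambda>x. partial_deriv j f x * g x) \<in> borel_measurable lebesgue"
      by (intro continuous_lebesgue continuous_on_mult C1c_continuous_partial f g)
    show "(\<lambda>x. (of_nat (Suc n) * (f (x + (1 / real (Suc n)) *\<^sub>R axis j 1) - f x)) * g
        x) \<in> borel_measurable lebesgue" for n
      by (intro continuous_lebesgue continuous_on_mult continuous_on_diff continuous_on_const
          C1c_continuous C1c_translate[OF f] f g)
    show "integrable lebesgue (\<lambda>x. L * cmod (g x))"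
      using integrable_norm[OF integrable_continuous_bounded_supp[OF g]] by simp
    show "AE x in lebesgue. (\<lambda>n.
        (of_nat (Suc n) * (f (x + (1 / real (Suc n)) *\<^sub>R axis j 1) - f x)) * g x)
        \<longlonglongrightarrow> partial_deriv j f x * g x"
    proof (rule AE_I2, rule tendsto_mult[OF _ tendsto_const])
      fix x
      show "(\<lambda>n. of_nat (Suc n) * (f (x + (1 / real (Suc n)) *\<^sub>R axis j 1) - f x))
          \<longlonglongrightarrow> partial_deriv j f x"
        using has_derivative_directional_LIMSEQ[OF has_derivative_frechet[OF C1c_differentiable[OF
            f]], where x=x and v="axis j 1"]
        by (simp add: scaleR_conv_of_real[where 'a=complex] partial_deriv_def)
    qed
    show "AE x in lebesgue. norm ((of_nat (Suc n) * (f (x + (1 / real (Suc n)) *\<^sub>R axis j 1)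
        - f x)) * g x) \<le> L * cmod (g x)" for n
    proof (rule AE_I2)
      fix x
      let ?h = "(1 / real (Suc n)) *\<^sub>R axis j 1 :: real^3"
      have "real (Suc n) * cmod (f (x + ?h) - f x) \<le> real (Suc n) * (L * norm (x + ?h - x))"
        by (intro mult_left_mono L(2)) simp
      also have "\<dots> = L" by simp
      finally show "norm ((of_nat (Suc n) * (f (x + ?h) - f x)) * g x) \<le> L * cmod (g x)"
        unfolding norm_mult norm_of_nat by (intro mult_right_mono) auto
    qed
  qed
qed

text \<open>Symmetry of second derivatives in weak form. The difference quotient in direction j
  commutes with the derivative in direction i. Integrating by parts in i and letting the step tend
  to zero gives minus the integral of the j-derivative of f times the i-derivative of g, which is
  also what one integration by parts gives on the right.\<close>

lemma mixed_partials_weak: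
  assumes f: "f \<in> test_functions" and g: "C1c g"
  shows "(LINT x|lebesgue. partial_deriv j (partial_deriv i f) x * g x)
      = (LINT x|lebesgue. partial_deriv i (partial_deriv j f) x * g x)"
proof -
  let ?q = "\<lambda>f n x. of_nat (Suc n) * (f (x + (1 / real (Suc n)) *\<^sub>R axis j 1)
      - f x) :: complex"
  note fc = C1c_test[OF f] and fpc = C1c_test[OF test_partial_deriv[OF f]]
  have gk: "C_k 1 g" using g by (simp only: C1c_def)
  have qc: "C1c (?q f n)" for n
    by (rule C1c_mult_left[OF C1c_diff[OF C1c_translate[OF fc] fc],
        where g="\<lambda>_. of_nat (Suc n)"])
       (auto simp: fun_eq_iff has_derivative_imp_partial_deriv[OF has_derivative_const] intro:
           continuous_on_cong[THEN iffD2, OF refl _ continuous_on_const])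
  have pq: "partial_deriv i (?q f n) = ?q (partial_deriv i f) n" for n
  proof
    fix x
    have t: "partial_deriv i (\<lambda>x. f (x + a)) x = partial_deriv i f (x + a)" for a
      using partial_deriv_affine(2)[of f a 1 x i] C1c_differentiable[OF fc]
          by (simp add: add.commute)
    have d: "(\<lambda>x. f (x + a)) differentiable at x" for a
        by (rule C1c_differentiable[OF C1c_translate[OF fc]])
    show "partial_deriv i (?q f n) x = ?q (partial_deriv i f) n x"
      by (subst partial_deriv_cmult)
         (auto simp only: partial_deriv_diff[OF d C1c_differentiable[OF fc]] t intro!:
             differentiable_diff d C1c_differentiable[OF fc])
  qed
  have "(LINT x|lebesgue. ?q (partial_deriv i f) n x * g x)
      = - (LINT x|lebesgue. ?q f n x * partial_deriv i g x)" for n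
    using integration_by_parts[OF qc gk, of i n] unfolding pq .
  then have "(\<lambda>n. LINT x|lebesgue. ?q (partial_deriv i f) n x * g x)
      \<longlonglongrightarrow> - (LINT x|lebesgue. partial_deriv j f x * partial_deriv i g x)"
    using tendsto_minus[OF translation_quotient_LIMSEQ[OF fc C1c_continuous_partial[OF g]
        C1c_bounded_partial[OF g], of j i]] by simp
  moreover have "(\<lambda>n. LINT x|lebesgue. ?q (partial_deriv i f) n x * g x)
      \<longlonglongrightarrow> (LINT x|lebesgue. partial_deriv j (partial_deriv i f) x * g x)"
    by (rule translation_quotient_LIMSEQ[OF fpc C1c_continuous[OF g] C1c_bounded[OF g]])
  ultimately have "(LINT x|lebesgue. partial_deriv j (partial_deriv i f) x * g x)
      = - (LINT x|lebesgue. partial_deriv j f x * partial_deriv i g x)"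
    using LIMSEQ_unique by blast
  with integration_by_parts[OF fpc gk, of i j] show ?thesis by simp
qed

lemma partial_cnj: "f differentiable at x
    \<Longrightarrow> partial_deriv i (\<lambda>x. cnj (f x)) x = cnj (partial_deriv i f x)"
  by (rule partial_deriv_bounded_linear[OF bounded_linear_cnj])

lemma ibp_cnj:
  assumes "C1c f" "C1c g"
  shows "(LINT x|lebesgue. partial_deriv i f x * cnj (g x))
      = - (LINT x|lebesgue. f x * cnj (partial_deriv i g x))"
proof -
  have "C_k 1 (\<lambda>x. cnj (g x))" using C1c_cnj[OF assms(2)] by (simp only: C1c_def)
  from integration_by_parts[OF assms(1) this, of i] show ?thesis
    by (simp add: partial_cnj[OF C1c_differentiable[OF assms(2)]])
qed

text \<open>Integration by parts in j and then in i exchanges inner and outer indices; in between,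
  the order of the derivatives j and i applied to \<open>partial_deriv i f\<close> is
  switched.\<close>

lemma second_partials:
  assumes f: "f \<in> test_functions"
  shows "(LINT x|lebesgue. partial_deriv i (partial_deriv i f) x * cnj
      (partial_deriv j (partial_deriv j f) x))
     = of_real (LINT x|lebesgue. sq (partial_deriv j (partial_deriv i f)) x)"
proof -
  note t = f test_partial_deriv[OF f] test_partial_deriv[OF test_partial_deriv[OF f]]
  have c: "C1c (\<lambda>x. cnj (g x))" if "g \<in> test_functions" for g
      by (rule C1c_cnj[OF C1c_test[OF that]])
  have "(LINT x|lebesgue. partial_deriv i (partial_deriv i f) x * cnj
      (partial_deriv j (partial_deriv j f) x))
     = - (LINT x|lebesgue. partial_deriv j (partial_deriv i (partial_deriv i f)) x * cnj
         (partial_deriv j f x))"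
    using ibp_cnj[OF C1c_test[OF t(3)] C1c_test[OF t(2)], of j i i j] by simp
  also have "\<dots> = - (LINT x|lebesgue. partial_deriv i (partial_deriv j (partial_deriv i f)) x *
      cnj (partial_deriv j f x))"
    using mixed_partials_weak[OF t(2) c[OF t(2)], of j i i j] by simp
  also have "\<dots> = (LINT x|lebesgue. partial_deriv j (partial_deriv i f) x * cnj
      (partial_deriv i (partial_deriv j f) x))"
    using ibp_cnj[OF C1c_test[OF t(3)] C1c_test[OF t(2)], of i j i j] by simp
  \<comment> \<open>Weak symmetry acts on the unconjugated factor, so the integral is written as a
    conjugate before the last exchange.\<close>
  also have "\<dots> = (LINT x|lebesgue. cnj (partial_deriv i (partial_deriv j f) x * cnj
      (partial_deriv j (partial_deriv i f) x)))"
    by (simp only: complex_cnj_mult complex_cnj_cnj mult.commute)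
  also have "\<dots> = cnj (LINT x|lebesgue. partial_deriv i (partial_deriv j f) x * cnj
      (partial_deriv j (partial_deriv i f) x))"
    by (rule integral_bounded_linear[OF bounded_linear_cnj])
       (intro L2_prod_integrable L2_cnj C1c_L2 C1c_test t)
  also have "(LINT x|lebesgue. partial_deriv i (partial_deriv j f) x * cnj
      (partial_deriv j (partial_deriv i f) x))
      = (LINT x|lebesgue. partial_deriv j (partial_deriv i f) x * cnj
          (partial_deriv j (partial_deriv i f) x))"
    using mixed_partials_weak[OF f c[OF t(3)], of i j j i] by simp
  also have "\<dots> = of_real (LINT x|lebesgue. sq (partial_deriv j (partial_deriv i f)) x)"
    unfolding sq_eq by simp
  finally show ?thesis by simp
qed

lemma integrable_sq: "u \<in> L2 \<Longrightarrow> integrable lebesgue (sq u)"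
  using L2_integrable[of u] by (simp add: sq_def[abs_def])

lemma L2_norm_sq: "(L2_norm u)\<^sup>2 = integral\<^sup>L lebesgue (sq u)"
  by (simp add: L2_norm_square sq_def[abs_def])

lemma integrable_gsq: "C1c u \<Longrightarrow> integrable lebesgue (gsq u)"
  unfolding gsq_def[abs_def] using L2_integrable[OF C1c_L2(2)]
      by (intro Bochner_Integration.integrable_sum) blast

lemma integral_gsq: "C1c u \<Longrightarrow> integral\<^sup>L lebesgue (gsq u)
    = (\<Sum>i\<in>UNIV. (L2_norm (partial_deriv i u))\<^sup>2)"
  unfolding gsq_def[abs_def] using L2_integrable[OF C1c_L2(2)]
      by (subst Bochner_Integration.integral_sum) (auto simp: L2_norm_square)

text \<open>In the expanded square the Laplacian gives the full Hessian by
  \<open>second_partials\<close>, and the cross term becomes 2 b times the squared gradient after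
  one integration by parts. For b \<ge> 0 all terms are nonnegative, so each is controlled with its
  own power of b. As b is of order 1 + \<alpha>^2, this is the source of the powers of \<alpha> on
  the side of V.\<close>

lemma energy_H2:
  assumes f: "f \<in> test_functions"
  shows "(L2_norm (\<lambda>x. - laplacian f x + of_real b * f x))\<^sup>2 =
    (\<Sum>i\<in>UNIV. integral\<^sup>L lebesgue (gsq (partial_deriv i f))) + 2 * b *
        integral\<^sup>L lebesgue (gsq f) + b\<^sup>2 * integral\<^sup>L lebesgue (sq f)"
proof -
  note t = f test_partial_deriv[OF f] test_partial_deriv[OF test_partial_deriv[OF f]]
  have fL: "f \<in> L2" and dL: "partial_deriv i (partial_deriv i f) \<in> L2" for i
    using t by (auto intro!: C1c_L2 C1c_test)
  let ?l = "laplacian f"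
  have lL: "?l \<in> L2"
  proof -
    have "smooth (laplacian f)"
      unfolding laplacian_def[abs_def] smooth_def
    proof
      fix k show "C_k k (\<lambda>x. \<Sum>i\<in>UNIV. partial_deriv i (partial_deriv i f) x)"
        unfolding sum_3 using t(3) by (intro C_k_add) (auto simp: test_functions_iff smooth_def)
    qed
    moreover have "bounded {x. laplacian f x \<noteq> 0}"
    proof (rule bounded_subset)
      show "bounded (\<Union>i. {x. partial_deriv i (partial_deriv i f) x \<noteq> 0})"
        using t(3) by (intro bounded_UN) (auto simp: test_functions_iff)
      show "{x. laplacian f x \<noteq> 0} \<subseteq> (\<Union>i. {x. partial_deriv i
          (partial_deriv i f) x \<noteq> 0})"
        by (auto simp: laplacian_def intro: sum.neutral ccontr)
    qed
    ultimately show ?thesis by (intro C1c_L2 C1c_test) (simp add: test_functions_iff)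
  qed
  have 1: "(LINT x|lebesgue. ?l x * cnj (?l x))
      = of_real (\<Sum>i\<in>UNIV. integral\<^sup>L lebesgue (gsq (partial_deriv i f)))"
  proof -
    have i: "integrable lebesgue (\<lambda>x. partial_deriv i (partial_deriv i f) x * cnj
        (partial_deriv j (partial_deriv j f) x))" for i j
      by (rule L2_prod_integrable[OF dL L2_cnj[OF dL]])
    have "(LINT x|lebesgue. ?l x * cnj (?l x))
        = (LINT x|lebesgue. (\<Sum>i\<in>UNIV. \<Sum>j\<in>UNIV. partial_deriv i (partial_deriv i f)
        x * cnj (partial_deriv j (partial_deriv j f) x)))"
      by (simp add: laplacian_def sum_product)
    also have "\<dots> = (\<Sum>i\<in>UNIV. \<Sum>j\<in>UNIV. LINT x|lebesgue. partial_deriv i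
        (partial_deriv i f) x * cnj (partial_deriv j (partial_deriv j f) x))"
      using i by (subst Bochner_Integration.integral_sum; simp)+
    also have "\<dots> = of_real (\<Sum>i\<in>UNIV. \<Sum>j\<in>UNIV. LINT x|lebesgue. sq
        (partial_deriv j (partial_deriv i f)) x)"
      unfolding second_partials[OF f] by simp
    also have "\<dots> = of_real (\<Sum>i\<in>UNIV. integral\<^sup>L lebesgue
        (gsq (partial_deriv i f)))"
      by (simp add: integral_gsq[OF C1c_test[OF t(2)]] L2_norm_sq)
    finally show ?thesis .
  qed
  have 2: "(LINT x|lebesgue. ?l x * cnj (f x)) = - of_real (integral\<^sup>L lebesgue (gsq f))"
  proof -
    have "(LINT x|lebesgue. ?l x * cnj (f x))
        = (\<Sum>i\<in>UNIV. LINT x|lebesgue. partial_deriv i (partial_deriv i f) x * cnj (f x))"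
      unfolding laplacian_def sum_distrib_right
      by (rule Bochner_Integration.integral_sum) (rule L2_prod_integrable[OF dL L2_cnj[OF fL]])
    also have "\<dots> = (\<Sum>i\<in>UNIV.
        - (LINT x|lebesgue. partial_deriv i f x * cnj (partial_deriv i f x)))"
      using ibp_cnj[OF C1c_test[OF t(2)] C1c_test[OF f]] by simp
    also have "\<dots> = - of_real (\<Sum>i\<in>UNIV. LINT x|lebesgue. sq (partial_deriv i f) x)"
      unfolding sq_eq by (simp add: sum_negf)
    also have "(\<Sum>i\<in>UNIV. LINT x|lebesgue. sq (partial_deriv i f) x)
        = integral\<^sup>L lebesgue (gsq f)"
      using integral_gsq[OF C1c_test[OF f]] by (simp add: L2_norm_sq)
    finally show ?thesis .
  qed
  have i: "integrable lebesgue (\<lambda>x. ?l x * cnj (?l x))"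
      "integrable lebesgue (\<lambda>x. ?l x * cnj (f x))"
    by (intro L2_prod_integrable lL fL L2_cnj)+
  have "(L2_norm (\<lambda>x. - ?l x + of_real b * f x))\<^sup>2 =
    (LINT x|lebesgue. Re (?l x * cnj (?l x)) - 2 * b * Re (?l x * cnj (f x)) + b\<^sup>2 * sq f x)"
    unfolding L2_norm_square
  proof (intro Bochner_Integration.integral_cong refl)
    fix x
    have "(cmod (- z + of_real b * w))\<^sup>2 = Re (z * cnj z) - 2 * b * Re (z * cnj w)
        + b\<^sup>2 * (cmod w)\<^sup>2" for z w
      by (simp add: cmod_power2) (simp add: power2_eq_square algebra_simps)
    then show "(cmod (- ?l x + of_real b * f x))\<^sup>2 = Re (?l x * cnj (?l x))
        - 2 * b * Re (?l x * cnj (f x)) + b\<^sup>2 * sq f x"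
      unfolding sq_def by blast
  qed
  also have "\<dots> = Re (LINT x|lebesgue. ?l x * cnj (?l x))
      - 2 * b * Re (LINT x|lebesgue. ?l x * cnj (f x)) + b\<^sup>2 * integral\<^sup>L lebesgue
      (sq f)"
    using integrable_Re[OF i(1)] integrable_Re[OF i(2)] integrable_sq[OF fL]
    by (simp only: integral_Re[OF i(1)] integral_Re[OF i(2)] Bochner_Integration.integral_add
        Bochner_Integration.integral_diff
        integrable_mult_right integral_mult_right_zero Bochner_Integration.integrable_add
            Bochner_Integration.integrable_diff)
  finally show ?thesis unfolding 1 2 by simp
qed

subsection \<open>Averaging over lattice cells\<close>

text \<open>The L1 modulus T is subadditive along multiples of a vector, so T(s) \<le> n T(s / n)
  for all n, and the right-hand side tends to the integral of |s . grad w| by dominated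
  convergence.\<close>

lemma translation_L1:
  assumes w: "C1c w"
  shows "(LINT x|lebesgue. cmod (w (x + s) - w x))
      \<le> (\<Sum>i\<in>UNIV. \<bar>s $ i\<bar> * (LINT x|lebesgue. cmod (partial_deriv i w x)))"
proof -
  have wi: "integrable lebesgue (\<lambda>x. cmod (w (x + a) - w (x + b)))" for a b
    by (intro integrable_norm integrable_continuous_bounded_supp C1c_continuous C1c_bounded C1c_diff
        C1c_translate[OF w] w)
  define T where "T h = (LINT x|lebesgue. cmod (w (x + h) - w x))" for h
  have Tk: "T (real k *\<^sub>R h) \<le> real k * T h" for k h
  proof (induction k)
    case 0 then show ?case by (simp add: T_def)
  next
    case (Suc k)
    have "T (real (Suc k) *\<^sub>R h)
        \<le> (LINT x|lebesgue. cmod (w (x + real (Suc k) *\<^sub>R h) - w (x + h)) + cmod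
        (w (x + h) - w (x + 0)))"
      unfolding T_def
    proof (rule integral_mono)
      show "integrable lebesgue (\<lambda>x. cmod (w (x + real (Suc k) *\<^sub>R h) - w x))"
          using wi[of _ 0] by simp
      show "integrable lebesgue (\<lambda>x. cmod (w (x + real (Suc k) *\<^sub>R h) - w (x + h))
          + cmod (w (x + h) - w (x + 0)))"
        by (intro Bochner_Integration.integrable_add wi)
      show "cmod (w (x + real (Suc k) *\<^sub>R h) - w x)
          \<le> cmod (w (x + real (Suc k) *\<^sub>R h) - w (x + h)) + cmod (w (x + h) - w (x + 0))"
          for x
        using norm_triangle_ineq[of "w (x + real (Suc k) *\<^sub>R h) - w (x + h)" "w (x + h)
            - w x"] by simp
    qed
    also have "\<dots> = (LINT x|lebesgue. cmod (w (x + real (Suc k) *\<^sub>R h) - w (x + h)))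
        + T h"
      using wi[of h 0] by (subst Bochner_Integration.integral_add[OF wi wi]) (simp add: T_def)
    also have "(LINT x|lebesgue. cmod (w (x + real (Suc k) *\<^sub>R h) - w (x + h)))
        = T (real k *\<^sub>R h)"
    proof -
      have "(\<lambda>x. cmod (w (x + real k *\<^sub>R h) - w x)) \<in> borel_measurable borel"
        by (intro borel_measurable_continuous_onI continuous_on_norm continuous_on_diff
            C1c_continuous C1c_translate[OF w] w)
      from lebesgue_integral_translation[OF this, of h] show ?thesis
        unfolding T_def by (simp add: algebra_simps)
    qed
    finally show ?case using Suc by (simp add: algebra_simps)
  qed
  obtain L where L: "L \<ge> 0" "\<And>x y. cmod (w x - w y) \<le> L * norm (x - y)"
      using C1c_lipschitz[OF w] by blast
  obtain R where R: "{x. w x \<noteq> 0} \<subseteq> ball 0 R"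
      using bounded_subset_ballD[OF C1c_bounded[OF w]] by blast
  let ?q = "\<lambda>n x. cmod (of_nat (Suc n) * (w (x + (1 / real (Suc n)) *\<^sub>R s) - w x))"
  let ?D = "\<lambda>x. \<Sum>i\<in>UNIV. (s $ i) *\<^sub>R partial_deriv i w x"
  have lim: "(\<lambda>n. integral\<^sup>L lebesgue (?q n))
      \<longlonglongrightarrow> (LINT x|lebesgue. cmod (?D x))"
  proof (rule integral_dominated_convergence[OF _ _ integrable_indicator_ball[of "L * norm s" 0
      "\<bar>R\<bar> + norm s + 1"]])
    show "(\<lambda>x. cmod (?D x)) \<in> borel_measurable lebesgue"
      by (intro continuous_lebesgue continuous_on_norm continuous_on_sum continuous_on_scaleR
          continuous_on_const C1c_continuous_partial w)
    show "?q n \<in> borel_measurable lebesgue" for n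
      by (intro continuous_lebesgue continuous_on_norm continuous_on_mult continuous_on_diff
          continuous_on_const C1c_continuous C1c_translate[OF w] w)
    show "AE x in lebesgue. (\<lambda>n. ?q n x) \<longlonglongrightarrow> cmod (?D x)"
    proof (rule AE_I2, rule tendsto_norm)
      fix x
      show "(\<lambda>n. of_nat (Suc n) * (w (x + (1 / real (Suc n)) *\<^sub>R s) - w x))
          \<longlonglongrightarrow> ?D x"
        using has_derivative_directional_LIMSEQ[OF has_derivative_partial_deriv[OF
            C1c_differentiable[OF w]], where x=x and v=s]
        by (simp add: scaleR_conv_of_real[where 'a=complex])
    qed
    show "AE x in lebesgue. norm (?q n x)
        \<le> L * norm s * indicat_real (ball 0 (\<bar>R\<bar> + norm s + 1)) x" for n
    proof (rule AE_I2)
      fix x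
      let ?h = "(1 / real (Suc n)) *\<^sub>R s"
      have nh: "norm ?h \<le> norm s" by (simp add: divide_le_eq mult_le_cancel_left1)
      show "norm (?q n x) \<le> L * norm s * indicat_real (ball 0 (\<bar>R\<bar> + norm s + 1)) x"
      proof (cases "norm x < \<bar>R\<bar> + norm s + 1")
        case True
        have "real (Suc n) * cmod (w (x + ?h) - w x) \<le> real (Suc n) * (L * norm (x + ?h - x))"
          by (intro mult_left_mono L(2)) simp
        also have "\<dots> = L * norm s" by simp
        finally show ?thesis using True by (simp add: norm_mult del: of_nat_Suc)
      next
        case False
        then have "norm (x + ?h) \<ge> R" "norm x \<ge> R"
          using nh norm_diff_ineq[of x ?h] abs_ge_self[of R] norm_ge_zero[of s] by linarith+
        then have "w (x + ?h) = 0" "w x = 0" using R by fastforce+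
        then show ?thesis using False by simp
      qed
    qed
  qed
  have "T s \<le> integral\<^sup>L lebesgue (?q n)" for n
  proof -
    have "T s \<le> real (Suc n) * T ((1 / real (Suc n)) *\<^sub>R s)"
      using Tk[of "Suc n" "(1 / real (Suc n)) *\<^sub>R s"] by simp
    also have "\<dots> = integral\<^sup>L lebesgue (?q n)"
        by (simp add: T_def norm_mult del: of_nat_Suc)
    finally show ?thesis .
  qed
  then have "T s \<le> (LINT x|lebesgue. cmod (?D x))"
    using LIMSEQ_le_const[OF lim] by blast
  also have "\<dots> \<le> (LINT x|lebesgue. (\<Sum>i\<in>UNIV. \<bar>s $ i\<bar> * cmod
      (partial_deriv i w x)))"
  proof (rule integral_mono)
    have pi: "integrable lebesgue (partial_deriv i w)" for i
      by (rule integrable_continuous_bounded_supp[OF C1c_continuous_partial[OF w]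
          C1c_bounded_partial[OF w]])
    show "integrable lebesgue (\<lambda>x. cmod (?D x))"
        "integrable lebesgue (\<lambda>x. \<Sum>i\<in>UNIV. \<bar>s $ i\<bar> * cmod
        (partial_deriv i w x))"
      using pi by (auto intro!: integrable_norm)
    show "cmod (?D x) \<le> (\<Sum>i\<in>UNIV. \<bar>s $ i\<bar> * cmod (partial_deriv i w x))"
        for x
      by (rule order_trans[OF norm_sum]) simp
  qed
  also have "\<dots> = (\<Sum>i\<in>UNIV. \<bar>s $ i\<bar> *
      (LINT x|lebesgue. cmod (partial_deriv i w x)))"
    using integrable_norm[OF integrable_continuous_bounded_supp[OF C1c_continuous_partial[OF w]
        C1c_bounded_partial[OF w]]]
    by (subst Bochner_Integration.integral_sum) auto
  finally show ?thesis by (simp add: T_def)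
qed

section \<open>Lattice points, cubic cells and the averaging estimate\<close>

definition lat :: "real \<Rightarrow> int^3 \<Rightarrow> real^3" where
  "lat e j = e *\<^sub>R lattice_point j"

text \<open>Half open, so that every point lies in exactly one lattice translate.\<close>

definition qcell :: "real \<Rightarrow> (real^3) set" where
  "qcell e = {s. \<forall>i. - e / 2 \<le> s $ i \<and> s $ i < e / 2}"

text \<open>
  Lattice sums are taken over a finite \<open>J\<close> that contains every lattice point whose cell meets the support of
  the functions involved.
\<close>

definition covers :: "real \<Rightarrow> (int^3) set \<Rightarrow> (real^3 \<Rightarrow> complex)
    \<Rightarrow> bool" where
  "covers e J w \<longleftrightarrow> finite J \<and> (\<forall>x j. w x \<noteq> 0
      \<longrightarrow> norm (x - lat e j) < 2 * e \<longrightarrow> j \<in> J)"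

lemma lat_nth [simp]: "lat e j $ i = e * of_int (j $ i)"
  by (simp add: lat_def lattice_point_def)

lemma lat_dist: 
  assumes "e > 0" "i \<noteq> j" shows "e \<le> norm (lat e i - lat e j)"
proof -
  obtain k where k: "i $ k \<noteq> j $ k" using assms(2) by (auto simp: vec_eq_iff)
  then have "1 \<le> \<bar>i $ k - j $ k\<bar>" by simp
  then have "1 \<le> \<bar>real_of_int (i $ k) - real_of_int (j $ k)\<bar>" by linarith
  then have "e * 1 \<le> e * \<bar>real_of_int (i $ k) - real_of_int (j $ k)\<bar>" using assms(1)
      by (intro mult_left_mono) auto
  also have "\<dots> = \<bar>(lat e i - lat e j) $ k\<bar>" using assms(1)
      by (simp add: abs_mult flip: right_diff_distrib)
  also have "\<dots> \<le> norm (lat e i - lat e j)" by (rule component_le_norm_cart)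
  finally show ?thesis by simp
qed

lemma lat_balls_disjoint:
  assumes "e > 0" "r \<le> e / 2" "i \<noteq> j"
      shows "ball (lat e i) r \<inter> ball (lat e j) r = {}"
proof -
  have D: "dist (lat e i) x + dist (lat e j) x \<ge> e" for x
    using lat_dist[OF assms(1,3)] dist_triangle2[of "lat e i" "lat e j" x] by (simp add: dist_norm)
  show ?thesis
  proof (rule ccontr)
    assume "\<not> ?thesis"
    then obtain x where "dist (lat e i) x < r" "dist (lat e j) x < r" by auto
    with D[of x] assms(2) show False by linarith
  qed
qed

lemma finite_lattice_ball:
  assumes "e > 0" shows "finite {j. norm (lat e j) \<le> R}"
proof -
  obtain N :: nat where N: "R / e < real N" using reals_Archimedean2 by blast
  have "{j. norm (lat e j) \<le> R} \<subseteq> {j. \<forall>i. j $ i \<in> {- int N..int N}}"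
  proof safe
    fix j :: "int^3" and i assume "norm (lat e j) \<le> R"
    then have "\<bar>lat e j $ i\<bar> \<le> R" using order_trans[OF component_le_norm_cart]
        by blast
    then have "\<bar>real_of_int (j $ i)\<bar> \<le> R / e" using assms
        by (simp add: abs_mult field_simps)
    with N have "\<bar>real_of_int (j $ i)\<bar> \<le> real N" by linarith
    then show "j $ i \<in> {- int N..int N}" by (simp add: abs_le_iff)
  qed
  moreover have "finite {j :: int^3. \<forall>i. j $ i \<in> {- int N..int N}}"
  proof (rule finite_subset)
    show "{j :: int^3. \<forall>i. j $ i \<in> {- int N..int N}} \<subseteq> vec_lambda `
        (UNIV \<rightarrow>\<^sub>E {- int N..int N})"
    proof
      fix j :: "int^3" assume "j \<in> {j. \<forall>i. j $ i \<in> {- int N..int N}}"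
      then show "j \<in> vec_lambda ` (UNIV \<rightarrow>\<^sub>E {- int N..int N})"
        by (intro image_eqI[of _ _ "vec_nth j"]) (auto simp: vec_nth_inverse)
    qed
    show "finite (vec_lambda ` (UNIV \<rightarrow>\<^sub>E {- int N..int N}) :: (int^3) set)"
      by (intro finite_imageI finite_PiE) auto
  qed
  ultimately show ?thesis by (rule finite_subset)
qed

lemma covers_exists:
  assumes "e > 0" "bounded {x. w x \<noteq> 0}" obtains J where "covers e J w"
proof -
  obtain R where R: "{x. w x \<noteq> 0} \<subseteq> ball 0 R"
      using bounded_subset_ballD[OF assms(2)] by blast
  have "j \<in> {j. norm (lat e j) \<le> R + 2 * e}"
      if "w x \<noteq> 0" "norm (x - lat e j) < 2 * e" for x j
  proof -
    have "norm x < R" using that(1) R by fastforce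
    then show ?thesis using that(2) norm_triangle_sub[of "lat e j" x]
        by (simp add: norm_minus_commute)
  qed
  then show ?thesis using that[of "{j. norm (lat e j)
      \<le> R + 2 * e}"] finite_lattice_ball[OF assms(1)]
    unfolding covers_def by blast
qed

lemma covers_mono: "covers e J w \<Longrightarrow> (\<And>x. w x = 0 \<Longrightarrow> v x = 0)
    \<Longrightarrow> covers e J v"
  unfolding covers_def by blast

lemma qcell_borel: "qcell e \<in> sets borel"
proof -
  have "closed {s :: real^3. - e / 2 \<le> s $ i}" "open {s :: real^3. s $ i < e / 2}" for i
    by (intro closed_Collect_le open_Collect_less continuous_intros)+
  then have "(\<Inter>i. {s :: real^3. - e / 2 \<le> s $ i} \<inter> {s. s $ i < e / 2}) \<in> sets
      borel"
    by (intro sets.finite_INT sets.Int borel_closed borel_open) auto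
  also have "(\<Inter>i. {s :: real^3. - e / 2 \<le> s $ i} \<inter> {s. s $ i < e / 2}) = qcell e"
    by (auto simp: qcell_def)
  finally show ?thesis .
qed

lemma integral_qcell:
  assumes "e > 0"
  shows "integrable lebesgue (\<lambda>s. indicat_real (qcell e) s)"
      "(LINT s|lebesgue. indicat_real (qcell e) s) = e ^ 3"
proof -
  define l u :: "real^3" where "l = (\<chi> i. - e / 2)" and "u = (\<chi> i. e / 2)"
  have sub: "box l u \<subseteq> qcell e" "qcell e \<subseteq> cbox l u"
    by (auto simp: qcell_def l_def u_def mem_box_cart less_imp_le)
  have fin: "emeasure lborel (cbox l u) < \<infinity>" by (rule emeasure_bounded_finite) simp
  have Q: "qcell e \<in> sets lborel" using qcell_borel by simp
  have finQ: "emeasure lborel (qcell e) < \<infinity>"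
    using emeasure_mono[OF sub(2), of lborel] fin by (simp add: order.strict_trans1)
  have le: "l \<bullet> b \<le> u \<bullet> b" if "b \<in> Basis" for b
    using that assms by (auto simp: l_def u_def Basis_vec_def inner_axis)
  have "measure lborel (cbox l u) = (\<Prod>i\<in>UNIV. u $ i - l $ i)"
    by (rule content_cbox_cart) (use assms in \<open>auto simp: l_def u_def interval_ne_empty_cart\<close>)
  also have "\<dots> = e ^ 3" by (simp add: l_def u_def)
  finally have c: "measure lborel (cbox l u) = e ^ 3" .
  have "measure lborel (box l u) \<le> measure lborel (qcell e)" "measure lborel (qcell e)
      \<le> measure lborel (cbox l u)"
    using sub Q finQ fin by (auto intro!: measure_mono_fmeasurable simp: fmeasurable_def)
  moreover have "measure lborel (box l u) = measure lborel (cbox l u)"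
    using le by simp
  ultimately have m: "measure lborel (qcell e) = e ^ 3" using c by linarith
  show "integrable lebesgue (\<lambda>s. indicat_real (qcell e) s)"
    using finQ Q by (intro integrable_real_indicator) auto
  show "(LINT s|lebesgue. indicat_real (qcell e) s) = e ^ 3"
    using m Q by simp
qed

lemma qcell_norm:
  assumes "s \<in> qcell e" shows "\<bar>s $ i\<bar> \<le> e / 2" "norm s \<le> 3 / 2 * e"
proof -
  show c: "\<bar>s $ i\<bar> \<le> e / 2" for i using assms
      by (auto simp: qcell_def abs_le_iff dest!: spec[of _ i])
  have "norm s \<le> (\<Sum>i\<in>UNIV. \<bar>s $ i\<bar>)" by (rule norm_le_l1_cart)
  also have "\<dots> \<le> (\<Sum>i\<in>(UNIV::3 set). e / 2)" by (intro sum_mono c)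
  finally show "norm s \<le> 3 / 2 * e" by simp
qed

text \<open>In each coordinate the condition confines k to a half-open interval of length one, whose
  only integer is the given ceiling.\<close>

lemma qcell_tiling:
  assumes e: "e > 0" obtains j where "\<And>k. v + lat e k \<in> qcell e \<longleftrightarrow> k
      = j"
proof -
  define j :: "int^3" where "j = (\<chi> i. \<lceil>- (v $ i) / e - 1 / 2\<rceil>)"
  have "v + lat e k \<in> qcell e \<longleftrightarrow> k = j" for k
  proof -
    have "(- e / 2 \<le> v $ i + e * of_int (k $ i) \<and> v $ i + e * of_int (k $ i) < e / 2)
        \<longleftrightarrow> k $ i = \<lceil>- (v $ i) / e - 1 / 2\<rceil>" for i
    proof -
      have "- e / 2 \<le> v $ i + e * of_int (k $ i) \<longleftrightarrow> - (v $ i) / e - 1 / 2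
          \<le> of_int (k $ i)"
        using e by (simp add: field_simps; linarith)
      moreover have "v $ i + e * of_int (k $ i) < e / 2 \<longleftrightarrow> of_int (k $ i) - 1 <
          - (v $ i) / e - 1 / 2"
        using e by (simp add: field_simps)
      ultimately show ?thesis by (auto intro: ceiling_unique[symmetric]) linarith+
    qed
    then show ?thesis by (simp add: qcell_def vec_eq_iff j_def)
  qed
  then show ?thesis using that by blast
qed

text \<open>After the substitution z = y + lat e j - s the indicators are those of a shifted tiling,
  exactly one of which is 1 at a given z; for z in the support its index belongs to
  \<open>J\<close>.\<close>

lemma tile_integral:
  assumes e: "e > 0" and w: "C1c w" and J: "covers e J w" and y: "norm y < e / 2"
  shows "(\<Sum>j\<in>J. LINT s|lebesgue. of_real (indicat_real (qcell e) s) * w (y + lat e j - s))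
      = integral\<^sup>L lebesgue w"
proof -
  have [measurable]: "w \<in> borel_measurable borel" by (rule C1c_borel[OF w])
  have [measurable]: "qcell e \<in> sets borel" by (rule qcell_borel)
  have wi: "integrable lebesgue w"
      by (rule integrable_continuous_bounded_supp[OF C1c_continuous[OF w] C1c_bounded[OF w]])
  have i: "integrable lebesgue (\<lambda>z. of_real (indicat_real (qcell e) (y + lat e j - z)) * w
      z)" for j
    by (rule integrable_weighted_complex[OF _ _ C1c_continuous[OF w] C1c_bounded[OF w], of _ 1])
       (auto intro!: borel_imp_lebesgue simp: indicator_def)
  have "(LINT s|lebesgue. of_real (indicat_real (qcell e) s) * w (y + lat e j - s))
     = (LINT z|lebesgue. of_real (indicat_real (qcell e) (y + lat e j - z)) * w z)" for j
  proof -
    have "(\<lambda>z. complex_of_real (indicat_real (qcell e) (y + lat e j - z)) * w z) \<in>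
        borel_measurable borel" by measurable
    from lebesgue_integral_reflection[OF this, of "y + lat e j"] show ?thesis by simp
  qed
  then have "(\<Sum>j\<in>J. LINT s|lebesgue. of_real (indicat_real (qcell e) s) * w (y + lat e j
      - s))
    = (LINT z|lebesgue. (\<Sum>j\<in>J. of_real (indicat_real (qcell e) (y + lat e j - z)) * w z))"
    using i by (subst Bochner_Integration.integral_sum) auto
  also have "\<dots> = integral\<^sup>L lebesgue w"
  proof (rule Bochner_Integration.integral_cong[OF refl])
    fix z
    show "(\<Sum>j\<in>J. of_real (indicat_real (qcell e) (y + lat e j - z)) * w z) = w z"
    proof (cases "w z = 0")
      case False
      obtain j where j: "\<And>k. (y - z) + lat e k \<in> qcell e \<longleftrightarrow> k = j"
          using qcell_tiling[OF e] by blast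
      \<comment> \<open>The cube contributes 3/2 e, half an edge for each of three coordinates, and
        \<open>y\<close> contributes less than e/2; together they account for the radius 2 e in
        \<open>covers\<close>.\<close>
      have "norm (y - z + lat e j) \<le> 3 / 2 * e" using qcell_norm(2) j by blast
      moreover have "norm (z - lat e j) \<le> norm y + norm (y - z + lat e j)"
        using norm_triangle_ineq4[of y "y - z + lat e j"] by simp
      ultimately have "norm (z - lat e j) < 2 * e" using y by linarith
      then have jJ: "j \<in> J" "finite J" using J False by (auto simp: covers_def)
      have "indicat_real (qcell e) (y + lat e k - z) = (if k = j then 1 else 0)" for k
        using j[of k] by (auto simp: indicator_def algebra_simps)
      then show ?thesis using jJ
          by (simp add: if_distrib[of of_real] if_distrib[of "\<lambda>t. t * _"] cong: if_cong)
    qed simp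
  qed
  finally show ?thesis .
qed

lemma cell_le_1: 
  assumes "e > 0" "finite J" shows "(\<Sum>j\<in>J. cell e (lat e j) x) \<le> 1"
proof -
  have "disjoint_family_on (\<lambda>j. ball (lat e j) (e / 2)) J"
    using lat_balls_disjoint[OF assms(1)] by (auto simp: disjoint_family_on_def)
  from indicator_UN_disjoint[OF assms(2) this, of x, where 'c=real] show ?thesis
    unfolding cell_def by (metis indicator_le_1)
qed

lemma cell_lebesgue: "cell e a \<in> borel_measurable lebesgue"
    and cell_borel: "cell e a \<in> borel_measurable borel"
  unfolding cell_def[abs_def] by (intro borel_measurable_indicator; simp)+

lemma cell_bounds: "0 \<le> cell e a x" "\<bar>cell e a x\<bar> \<le> 1"
  by (auto simp: cell_def indicator_def)

text \<open>
  For fixed \<open>y\<close>, the translates by \<open>y\<close> of the lattice cells tile the space, so averaging over \<open>y\<close> in the ball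
  gives \<open>\<pi>/6\<close> times the full integral; the lattice sum of ball integrals differs from it by a shift of size
  at most \<open>e / 2\<close> in each coordinate.
\<close>

lemma cell_average:
  assumes e: "e > 0" and w: "C1c w" and J: "covers e J w"
  shows "cmod (of_real (pi / 6) * integral\<^sup>L lebesgue w
      - (\<Sum>j\<in>J. LINT x|lebesgue. of_real (cell e (lat e j) x) * w x))
     \<le> (\<Sum>i\<in>UNIV. e / 2 * (LINT x|lebesgue. cmod (partial_deriv i w x)))"
proof -
  have fJ: "finite J" using J by (simp add: covers_def)
  have [measurable]: "w \<in> borel_measurable borel" by (rule C1c_borel[OF w])
  have [measurable]: "qcell e \<in> sets borel" by (rule qcell_borel)
  have [measurable]: "cell e a \<in> borel_measurable borel" for a by (rule cell_borel)
  obtain M where M: "M \<ge> 0" "\<And>x. cmod (w x) \<le> M"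
    using continuous_bounded_supp_bounded[OF C1c_continuous[OF w] C1c_bounded[OF w]] by blast
  define Q where "Q s = indicat_real (qcell e) s" for s
  have [measurable]: "Q \<in> borel_measurable borel" unfolding Q_def[abs_def] by measurable
  have Q01: "0 \<le> Q s" "Q s \<le> 1" for s by (auto simp: Q_def indicator_def)
  \<comment> \<open>Fubini's theorem is applied to this function. The order \<open>s\<close> before
    \<open>y\<close> gives the ball volume times the integral of \<open>w\<close>; the order
    \<open>y\<close> before \<open>s\<close> gives, for each shift \<open>s\<close> in the cube, the
    lattice sum of ball integrals of the translate w(x - s), which is compared with the unshifted
    sum \<open>S\<close>.\<close>
  define g where "g y s = of_real (cell e 0 y) * (of_real (Q s) * (\<Sum>j\<in>J. w (y + lat e j
      - s)))" for y s
  define K where "K = (\<Sum>i\<in>UNIV. e / 2 * (LINT x|lebesgue. cmod (partial_deriv i w x)))"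
  define S where "S = (\<Sum>j\<in>J. LINT x|lebesgue. of_real (cell e (lat e j) x) * w x)"
  have gi: "integrable (lborel \<Otimes>\<^sub>M lborel) (\<lambda>(y, s). g y s)"
  proof -
    have m: "(\<lambda>(y, s). g y s) \<in> borel_measurable (lborel \<Otimes>\<^sub>M lborel)"
      unfolding g_def by measurable
    have fin: "emeasure (lborel \<Otimes>\<^sub>M lborel) (ball (0::real^3) (e / 2) \<times> ball
        (0::real^3) (2 * e)) < \<infinity>"
      unfolding lborel_prod by (intro emeasure_bounded_finite bounded_Times bounded_ball)
    show ?thesis
    proof (rule integrableI_bounded_set[OF _ m fin])
      show "ball 0 (e / 2) \<times> ball 0 (2 * e) \<in> sets (lborel \<Otimes>\<^sub>M lborel)"
          by (intro pair_measureI) auto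
      have "cmod (g y s) \<le> real (card J) * M" for y s
      proof -
        have "cmod (\<Sum>j\<in>J. w (y + lat e j - s)) \<le> (\<Sum>j\<in>J. M)"
          by (rule sum_norm_le) (rule M(2))
        then have "cmod (g y s) \<le> 1 * (1 * (real (card J) * M))"
          unfolding g_def norm_mult norm_of_real using Q01[of s] cell_bounds[of e 0 y] M
          by (intro mult_mono) auto
        then show ?thesis by simp
      qed
      then show "AE x in lborel \<Otimes>\<^sub>M lborel. x \<in> ball 0 (e / 2) \<times> ball 0
          (2 * e) \<longrightarrow> norm (case x of (y, s) \<Rightarrow> g y s) \<le> real (card J)
          * M"
        by (intro AE_I2) auto
      have "g y s = 0" if "(y, s) \<notin> ball 0 (e / 2) \<times> ball 0 (2 * e)" for y s
      proof -
        have "y \<notin> ball 0 (e / 2) \<or> s \<notin> qcell e"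
          using that qcell_norm(2)[of s e] e by auto
        then show ?thesis by (auto simp: g_def cell_def Q_def)
      qed
      then show "AE x in lborel \<Otimes>\<^sub>M lborel. x \<notin> ball 0 (e / 2) \<times> ball 0
          (2 * e) \<longrightarrow> (case x of (y, s) \<Rightarrow> g y s) = 0"
        by (intro AE_I2) (simp only: split_paired_all prod.case, blast)
    qed
  qed
  have si: "integrable lebesgue (\<lambda>s. of_real (Q s) * w (a - s))" for a
    by (rule integrable_weighted_complex[OF _ _ continuous_reflect[OF C1c_continuous[OF w]
        C1c_bounded[OF w]], of _ 1])
       (use Q01 in \<open>auto intro!: borel_imp_lebesgue\<close>)
  have ci: "integrable lebesgue (\<lambda>x. of_real (cell e a x) * w (x + b))" for a b
    by (rule integrable_weighted_complex[OF cell_lebesgue cell_bounds(2) C1c_continuous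
        C1c_bounded]) (rule C1c_translate[OF w])+
  have "(LINT s|lebesgue. g y s) = of_real (cell e 0 y) * integral\<^sup>L lebesgue w" for y
  proof (cases "norm y < e / 2")
    case True
    have "(LINT s|lebesgue. g y s)
        = of_real (cell e 0 y) * (\<Sum>j\<in>J. LINT s|lebesgue. of_real (Q s) * w
        (y + lat e j - s))"
      unfolding g_def sum_distrib_left using si
          by (subst Bochner_Integration.integral_sum) (auto simp: sum_distrib_left)
    also have "(\<Sum>j\<in>J. LINT s|lebesgue. of_real (Q s) * w (y + lat e j - s))
        = integral\<^sup>L lebesgue w"
      unfolding Q_def by (rule tile_integral[OF e w J True])
    finally show ?thesis .
  qed (simp add: g_def cell_def)
  moreover have gm1: "(\<lambda>s. g y s) \<in> borel_measurable borel"
      and gm2: "(\<lambda>y. g y s) \<in> borel_measurable borel" for y s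
    unfolding g_def by measurable
  ultimately have A: "(LINT y|lborel. LINT s|lborel. g y s)
      = (LINT y|lebesgue. of_real (cell e 0 y) * integral\<^sup>L lebesgue w)"
    by (simp add: integral_completion)
  \<comment> \<open>4/3 pi (e/2)^3; divided by the volume e^3 of the cube this is the fraction
    pi/6.\<close>
  have c1: "(LINT y|lebesgue. cell e 0 y) = pi / 6 * e ^ 3"
    using e by (simp add: cell_def[abs_def] content_ball unit_ball_vol_3 power_divide)
  have c2: "integrable lebesgue (cell e 0)"
    using integrable_indicator_ball[of 1 0 "e / 2"] by (simp add: cell_def[abs_def])
  have A': "(LINT y|lborel. LINT s|lborel. g y s)
      = of_real (pi / 6 * e ^ 3) * integral\<^sup>L lebesgue w"
    unfolding A c1[symmetric] using c2 by simp
  have B: "(LINT y|lborel. g y s)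
      = of_real (Q s) * (\<Sum>j\<in>J. LINT x|lebesgue. of_real (cell e (lat e j) x) * w
      (x + (- s)))" for s
  proof -
    have sh: "(LINT y|lebesgue. of_real (cell e 0 y) * w (y + (lat e j - s)))
        = (LINT x|lebesgue. of_real (cell e (lat e j) x) * w (x + (- s)))" for j
    proof -
      have "(\<lambda>x. complex_of_real (cell e (lat e j) x) * w (x + (- s))) \<in>
          borel_measurable borel" by measurable
      from lebesgue_integral_translation[OF this, of "lat e j"] show ?thesis
        by (simp add: cell_def indicator_def dist_norm algebra_simps)
    qed
    have "(LINT y|lborel. g y s) = (LINT y|lebesgue. g y s)" using gm2
        by (simp add: integral_completion)
    also have "\<dots> = (LINT y|lebesgue. (\<Sum>j\<in>J. of_real (Q s) * (of_real (cell e 0 y) * w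
        (y + (lat e j - s)))))"
      unfolding g_def by (simp add: sum_distrib_left algebra_simps)
    also have "\<dots> = of_real (Q s) * (\<Sum>j\<in>J. LINT y|lebesgue. of_real (cell e 0 y) * w
        (y + (lat e j - s)))"
      using ci by (subst Bochner_Integration.integral_sum) (auto simp: sum_distrib_left)
    also have "\<dots> = of_real (Q s) * (\<Sum>j\<in>J. LINT x|lebesgue. of_real
        (cell e (lat e j) x) * w (x + (- s)))"
      unfolding sh ..
    finally show ?thesis .
  qed
  have Bi: "integrable lborel (\<lambda>s. LINT y|lborel. g y s)"
    using lborel_pair.integrable_snd[OF gi] by simp
  have Qi: "integrable lborel Q" "(LINT s|lborel. Q s) = e ^ 3"
    using integral_qcell[OF e]
        by (simp_all add: Q_def[abs_def] integrable_completion integral_completion)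
  have "of_real (e ^ 3) * (of_real (pi / 6) * integral\<^sup>L lebesgue w - S)
     = (LINT s|lborel. LINT y|lborel. g y s) - (LINT s|lborel. of_real (Q s) * S)"
    using lborel_pair.Fubini_integral[OF gi] A' Qi by (simp add: algebra_simps)
  also have "\<dots> = (LINT s|lborel. (LINT y|lborel. g y s) - of_real (Q s) * S)"
    using Bi Qi(1) by (subst Bochner_Integration.integral_diff) auto
  also have "cmod \<dots> \<le> (LINT s|lborel. Q s * K)"
  proof (rule Bochner_Integration.integral_norm_bound_integral)
    show "integrable lborel (\<lambda>s. (LINT y|lborel. g y s) - of_real (Q s) * S)" using Bi Qi(1)
        by auto
    show "integrable lborel (\<lambda>s. Q s * K)" using Qi(1) by simp
    fix s
    let ?d = "\<lambda>x. w (x + (- s)) - w x"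
    show "norm ((LINT y|lborel. g y s) - of_real (Q s) * S) \<le> Q s * K"
    proof (cases "s \<in> qcell e")
      case True
      have dc: "C1c ?d" by (intro C1c_diff C1c_translate[OF w] w)
      have di: "integrable lebesgue (\<lambda>x. of_real (cell e a x) * ?d x)" for a
        by (rule integrable_weighted_complex[OF cell_lebesgue cell_bounds(2) C1c_continuous[OF dc]
            C1c_bounded[OF dc]])
      have dn: "integrable lebesgue (\<lambda>x. cmod (?d x))"
        by (intro integrable_norm integrable_continuous_bounded_supp C1c_continuous[OF dc]
            C1c_bounded[OF dc])
      have "(LINT y|lborel. g y s) - of_real (Q s) * S
          = of_real (Q s) * (\<Sum>j\<in>J. LINT x|lebesgue. of_real (cell e (lat e j) x) * ?d x)"
        unfolding B S_def right_diff_distrib[symmetric] sum_subtractf[symmetric]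
        using ci[of _ "- s"] ci[of _ 0] by (simp add: right_diff_distrib)
      also have "\<dots> = of_real (Q s) *
          (LINT x|lebesgue. (\<Sum>j\<in>J. of_real (cell e (lat e j) x) * ?d x))"
        using di by (subst Bochner_Integration.integral_sum) auto
      finally have "norm ((LINT y|lborel. g y s) - of_real (Q s) * S)
          = Q s * cmod (LINT x|lebesgue. (\<Sum>j\<in>J. of_real (cell e (lat e j) x) * ?d x))"
        using Q01 by (simp add: norm_mult)
      also have "\<dots> \<le> Q s * K"
      proof (intro mult_left_mono Q01)
        \<comment> \<open>The balls are disjoint, so the weights add up to at most 1 and a single L1
          norm controls the errors in all cells at once.\<close>
        have "cmod (LINT x|lebesgue. (\<Sum>j\<in>J. of_real (cell e (lat e j) x) * ?d x))
            \<le> (LINT x|lebesgue. cmod (?d x))"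
        proof (rule Bochner_Integration.integral_norm_bound_integral[OF _ dn])
          show "integrable lebesgue (\<lambda>x. \<Sum>j\<in>J. of_real (cell e (lat e j) x) * ?d
              x)"
            by (intro Bochner_Integration.integrable_sum di)
          fix x
          have "(\<Sum>j\<in>J. of_real (cell e (lat e j) x) * ?d x)
              = of_real (\<Sum>j\<in>J. cell e (lat e j) x) * ?d x"
            by (simp add: sum_distrib_right)
          also have "cmod \<dots> = (\<Sum>j\<in>J. cell e (lat e j) x) * cmod (?d x)"
            unfolding norm_mult norm_of_real using cell_bounds(1) by (simp add: sum_nonneg)
          also have "\<dots> \<le> 1 * cmod (?d x)" by (intro mult_right_mono cell_le_1 e fJ) auto
          finally show "norm (\<Sum>j\<in>J. of_real (cell e (lat e j) x) * ?d x) \<le> cmod (?d x)"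
              by simp
        qed
        also have "\<dots> \<le> (\<Sum>i\<in>UNIV. \<bar>(- s) $ i\<bar> *
            (LINT x|lebesgue. cmod (partial_deriv i w x)))"
          by (rule translation_L1[OF w])
        also have "\<dots> \<le> K" unfolding K_def
          using qcell_norm(1)[OF True]
              by (intro sum_mono mult_right_mono) (auto intro: Bochner_Integration.integral_nonneg)
        finally show "cmod (LINT x|lebesgue. (\<Sum>j\<in>J. of_real (cell e (lat e j) x) * ?d x))
            \<le> K" .
      qed
      finally show ?thesis .
    qed (simp add: B Q_def)
  qed
  also have "\<dots> = e ^ 3 * K" using Qi by simp
  finally have "e ^ 3 * cmod (of_real (pi / 6) * integral\<^sup>L lebesgue w - S) \<le> e ^ 3 * K"
    using e by (simp add: norm_mult norm_power)
  then show ?thesis using e unfolding K_def S_def by simp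
qed

subsection \<open>The penalty term as an integral\<close>

text \<open>
  For \<open>d = 0\<close> this is \<open>0\<close> (division by zero), which matches the convention for the penalty term.
\<close>

definition wtot :: "real \<Rightarrow> real \<Rightarrow> real^3 \<Rightarrow> real" where
  "wtot d e x = 1 / (e\<^sup>2 * d) * indicat_real (\<Union>j. ball (lat e j) (d * e)) x"

text \<open>The lattice is enumerated by the natural numbers, where countable additivity gives the
  value of the series. Disjointness bounds the sums of absolute values by the integral of |f|, so
  the series converges absolutely and may be summed in any order.\<close>

lemma has_sum_lattice_integral:
  fixes f :: "real^3 \<Rightarrow> complex" and B :: "int^3 \<Rightarrow> (real^3) set"
  assumes f: "integrable lebesgue f" and B: "\<And>j. B j \<in> sets lebesgue"
      and disj: "disjoint_family B"
  shows "((\<lambda>j. LINT x:B j|lebesgue. f x) has_sum (LINT x:(\<Union>j. B j)|lebesgue. f x))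
      UNIV"
proof -
  have "infinite (UNIV :: (int^3) set)"
  proof
    assume fin: "finite (UNIV :: (int^3) set)"
    have "inj (\<lambda>k::int. (\<chi> i. k) :: int^3)" by (rule injI) (simp add: vec_eq_iff)
    from finite_imageD[OF _ this] fin have "finite (UNIV :: int set)"
        using finite_subset subset_UNIV by blast
    then show False by simp
  qed
  then have h: "bij (from_nat_into (UNIV :: (int^3) set))"
    using bij_betw_from_nat_into[of "UNIV :: (int^3) set"] by simp
  define h where "h = from_nat_into (UNIV :: (int^3) set)"
  have bh: "bij h" using h by (simp add: h_def)
  define A where "A n = B (h n)" for n
  have Am: "A n \<in> sets lebesgue" for n unfolding A_def by (rule B)
  have dA: "disjoint_family A"
    unfolding disjoint_family_on_def A_def using disj bij_is_inj[OF bh]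
    by (auto simp: disjoint_family_on_def inj_def)
  have UA: "(\<Union>n. A n) = (\<Union>j. B j)"
    unfolding A_def using bij_is_surj[OF bh] by (metis image_image)
  have si: "set_integrable lebesgue S f" if "S \<in> sets lebesgue" for S
    unfolding set_integrable_def by (rule integrable_mult_indicator[OF that f])
  have sum_le: "(\<Sum>i<n. norm (LINT x:A i|lebesgue. f x)) \<le> (LINT x|lebesgue. norm (f x))"
      for n
  proof -
    have "norm (LINT x:A i|lebesgue. f x)
        \<le> (LINT x|lebesgue. indicat_real (A i) x * norm (f x))" for i
      using integral_norm_bound[of lebesgue "\<lambda>x. indicat_real (A i) x *\<^sub>R f x"]
      by (simp add: set_lebesgue_integral_def)
    then have "(\<Sum>i<n. norm (LINT x:A i|lebesgue. f x))
        \<le> (\<Sum>i<n. LINT x|lebesgue. indicat_real (A i) x * norm (f x))"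
      by (rule sum_mono)
    also have "\<dots> = (LINT x|lebesgue. (\<Sum>i<n. indicat_real (A i) x * norm (f x)))"
      using integrable_mult_indicator[OF Am integrable_norm[OF f]]
          by (subst Bochner_Integration.integral_sum) auto
    also have "\<dots> \<le> (LINT x|lebesgue. norm (f x))"
    proof (rule integral_mono)
      show "integrable lebesgue (\<lambda>x. \<Sum>i<n. indicat_real (A i) x * norm (f x))"
        using integrable_mult_indicator[OF Am integrable_norm[OF f]]
            by (intro Bochner_Integration.integrable_sum) auto
      show "integrable lebesgue (\<lambda>x. norm (f x))" using f by simp
      fix x
      have "disjoint_family_on A {..<n}" using dA by (auto simp: disjoint_family_on_def)
      from indicator_UN_disjoint[OF _ this, of x, where 'c=real]
      have "(\<Sum>i<n. indicat_real (A i) x) \<le> 1" by (metis finite_lessThan indicator_le_1)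
      then have "(\<Sum>i<n. indicat_real (A i) x) * norm (f x) \<le> 1 * norm (f x)"
          by (intro mult_right_mono) auto
      then show "(\<Sum>i<n. indicat_real (A i) x * norm (f x)) \<le> norm (f x)"
          by (simp add: sum_distrib_right)
    qed
    finally show ?thesis .
  qed
  have sm: "summable (\<lambda>i. norm (LINT x:A i|lebesgue. f x))"
    by (rule summableI_nonneg_bounded[OF _ sum_le]) simp
  have "(LINT x:(\<Union>n. A n)|lebesgue. f x) = (\<Sum>n. LINT x:A n|lebesgue. f x)"
    by (rule lebesgue_integral_countable_add[OF Am _ si]) (use dA Am in \<open>auto simp: disjoint_family_on_def\<close>)
  then have "(\<lambda>n. LINT x:A n|lebesgue. f x) sums (LINT x:(\<Union>n. A n)|lebesgue. f x)"
    using summable_sums[OF summable_norm_cancel[OF sm]] by simp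
  then have "((\<lambda>n. LINT x:A n|lebesgue. f x) has_sum (LINT x:(\<Union>n. A n)|lebesgue. f
      x)) UNIV"
    by (rule norm_summable_imp_has_sum[OF sm])
  then have "((\<lambda>n. LINT x:B (h n)|lebesgue. f x) has_sum (LINT x:(\<Union>j. B j)|lebesgue.
      f x)) UNIV"
    unfolding UA unfolding A_def .
  then show ?thesis
    using has_sum_reindex_bij_betw[OF bh, of "\<lambda>j. LINT x:B j|lebesgue. f x"] by blast
qed

text \<open>As an integral against the bounded weight \<open>wtot\<close>, the penalty is continuous
  under L2 limits, as the passage from test functions to H1 requires.\<close>

lemma penalty_eq:
  assumes e: "0 < e" and d: "0 \<le> d" "d \<le> 1/2"
      and f: "integrable lebesgue (\<lambda>x. U x * cnj (\<Phi> x))"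
  shows "penalty e d U \<Phi> = (LINT x|lebesgue. of_real (wtot d e x) * (U x * cnj (\<Phi> x)))"
proof (cases "d = 0")
  case True then show ?thesis by (simp add: penalty_def wtot_def)
next
  case False
  have "d * e \<le> e / 2" using d e by simp
  then have "disjoint_family (\<lambda>j. ball (lat e j) (d * e))"
    using lat_balls_disjoint[OF e] unfolding disjoint_family_on_def by blast
  from has_sum_lattice_integral[OF f _ this]
  have "(\<Sum>\<^sub>\<infinity>j. LINT x:ball (lat e j) (d * e)|lebesgue. U x * cnj (\<Phi> x))
      = (LINT x:(\<Union>j. ball (lat e j) (d * e))|lebesgue. U x * cnj (\<Phi> x))"
    by (intro infsumI) auto
  then have "penalty e d U \<Phi>
      = of_real (1 / (e\<^sup>2 * d)) * (LINT x:(\<Union>j. ball (lat e j) (d * e))|lebesgue. U x *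
      cnj (\<Phi> x))"
    using False by (simp add: penalty_def lat_def)
  also have "\<dots> = (LINT x|lebesgue. of_real (wtot d e x) * (U x * cnj (\<Phi> x)))"
    unfolding set_lebesgue_integral_def integral_mult_right_zero[symmetric]
    by (intro Bochner_Integration.integral_cong refl) (simp add: wtot_def scaleR_conv_of_real)
  finally show ?thesis .
qed

subsection \<open>The corrected limit as an approximate solution\<close>

definition nrm2 :: "(real^3 \<Rightarrow> complex) \<Rightarrow> real" where
  "nrm2 u = integral\<^sup>L lebesgue (sq u)"

definition grd2 :: "(real^3 \<Rightarrow> complex) \<Rightarrow> real" where
  "grd2 u = integral\<^sup>L lebesgue (gsq u)"

definition wgt2 :: "real \<Rightarrow> real \<Rightarrow> (real^3 \<Rightarrow> complex)
    \<Rightarrow> real" where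
  "wgt2 d e u = (LINT x|lebesgue. wtot d e x * sq u x)"

lemma nrm2_nonneg: "0 \<le> nrm2 u" and grd2_nonneg: "0 \<le> grd2 u"
  by (simp_all add: nrm2_def grd2_def)

lemma nrm2_L2_norm: "nrm2 u = (L2_norm u)\<^sup>2"
  by (simp add: nrm2_def L2_norm_sq)

lemma weighted_Cauchy_Schwarz:
  fixes a b h :: "real^3 \<Rightarrow> real"
  assumes h: "h \<in> borel_measurable lebesgue" "\<And>x. 0 \<le> h x" "\<And>x. h x \<le> M"
    and a: "continuous_on UNIV a" "bounded {x. a x \<noteq> 0}" "\<And>x. 0 \<le> a x"
    and b: "continuous_on UNIV b" "bounded {x. b x \<noteq> 0}" "\<And>x. 0 \<le> b x"
  shows "integrable lebesgue (\<lambda>x. h x * (sqrt (a x) * sqrt (b x)))"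
    and "(LINT x|lebesgue. h x * (sqrt (a x) * sqrt (b x)))
        \<le> sqrt (LINT x|lebesgue. h x * a x) * sqrt (LINT x|lebesgue. h x * b x)"
proof -
  have hM: "\<bar>h x\<bar> \<le> M" for x using h(2,3) by (simp add: abs_of_nonneg)
  note ha = integrable_weighted_real[OF h(1) hM a(1,2)]
      and hb = integrable_weighted_real[OF h(1) hM b(1,2)]
  have c: "continuous_on UNIV (\<lambda>x. sqrt (a x) * sqrt (b x))"
    by (intro continuous_intros a b)
  have s: "bounded {x. sqrt (a x) * sqrt (b x) \<noteq> 0}"
    by (rule bounded_subset[OF a(2)]) auto
  show "integrable lebesgue (\<lambda>x. h x * (sqrt (a x) * sqrt (b x)))"
    by (rule integrable_weighted_real[OF h(1) hM c s])
  have m: "(\<lambda>x. sqrt (h x) * sqrt (a x)) \<in> borel_measurable lebesgue"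
      "(\<lambda>x. sqrt (h x) * sqrt (b x)) \<in> borel_measurable lebesgue"
    using h(1) continuous_lebesgue[OF a(1)] continuous_lebesgue[OF b(1)] by measurable
  have e: "(\<lambda>x. (sqrt (h x) * sqrt (a x))\<^sup>2) = (\<lambda>x. h x * a x)"
      "(\<lambda>x. (sqrt (h x) * sqrt (b x))\<^sup>2) = (\<lambda>x. h x * b x)"
    using h(2) a(3) b(3) by (auto simp: power_mult_distrib)
  have p: "\<bar>sqrt (h x) * sqrt (a x)\<bar> * \<bar>sqrt (h x) * sqrt (b x)\<bar>
      = h x * (sqrt (a x) * sqrt (b x))" for x
  proof -
    have "\<bar>sqrt (h x) * sqrt (a x)\<bar> * \<bar>sqrt (h x) * sqrt (b x)\<bar>
        = (sqrt (h x) * sqrt (h x)) * (sqrt (a x) * sqrt (b x))"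
      using h(2)[of x] a(3)[of x] b(3)[of x]
          by (simp add: abs_mult mult_ac del: real_sqrt_mult_self real_sqrt_mult_self)
    then show ?thesis using h(2)[of x] by simp
  qed
  show "(LINT x|lebesgue. h x * (sqrt (a x) * sqrt (b x)))
      \<le> sqrt (LINT x|lebesgue. h x * a x) * sqrt (LINT x|lebesgue. h x * b x)"
    using integral_Cauchy_Schwarz[OF m] unfolding e p using ha hb by blast
qed

lemma wtot_measurable: "wtot d e \<in> borel_measurable lebesgue"
  unfolding wtot_def[abs_def]
  by (intro borel_measurable_times borel_measurable_const borel_measurable_indicator) auto

lemma wtot_bounds: "e > 0 \<Longrightarrow> d \<ge> 0 \<Longrightarrow> 0 \<le> wtot d e x" "e > 0
    \<Longrightarrow> d \<ge> 0 \<Longrightarrow> wtot d e x \<le> 1 / (e\<^sup>2 * d)"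
  by (auto simp: wtot_def indicator_def)

context hole
begin

definition corr_sum :: "(int^3) set \<Rightarrow> real^3 \<Rightarrow> real" where
  "corr_sum J x = (\<Sum>j\<in>J. corr d e (lat e j) x)"

definition hwt_sum :: "(int^3) set \<Rightarrow> real^3 \<Rightarrow> real" where
  "hwt_sum J x = (\<Sum>j\<in>J. hwt d e (lat e j) x)"

abbreviation gcorr :: "int^3 \<Rightarrow> 3 \<Rightarrow> real^3 \<Rightarrow> complex" where
  "gcorr j i \<equiv> partial_deriv i (\<lambda>x. of_real (corr d e (lat e j) x))"

text \<open>The supports lie in disjoint balls, so the bound for a single corrector survives
  summation.\<close>

lemma corr_sum_bounds:
  assumes "finite J" shows "0 \<le> corr_sum J x" "corr_sum J x \<le> d / 2"
proof -
  show "0 \<le> corr_sum J x" unfolding corr_sum_def by (intro sum_nonneg corr_nonneg)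
  have "corr_sum J x \<le> (\<Sum>j\<in>J. d / 2 * cell e (lat e j) x)" unfolding corr_sum_def
      by (intro sum_mono corr_le_cell)
  also have "\<dots> = d / 2 * (\<Sum>j\<in>J. cell e (lat e j) x)" by (simp add: sum_distrib_left)
  also have "\<dots> \<le> d / 2 * 1" using d_pos
      by (intro mult_left_mono cell_le_1 e_pos assms) auto
  finally show "corr_sum J x \<le> d / 2" by simp
qed

lemma hwt_sum_props:
  assumes "finite J"
  shows "0 \<le> hwt_sum J x" "hwt_sum J x \<le> 1" "hwt_sum J \<in> borel_measurable lebesgue"
proof -
  show "0 \<le> hwt_sum J x" unfolding hwt_sum_def by (intro sum_nonneg hwt_bounds)
  have "hwt_sum J x \<le> (\<Sum>j\<in>J. cell e (lat e j) x)" unfolding hwt_sum_def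
      by (intro sum_mono hwt_bounds)
  also have "\<dots> \<le> 1" by (intro cell_le_1 e_pos assms)
  finally show "hwt_sum J x \<le> 1" .
  show "hwt_sum J \<in> borel_measurable lebesgue" unfolding hwt_sum_def[abs_def]
      by (intro borel_measurable_sum weight_measurable)
qed

lemma C1c_corr_sum:
  assumes "finite J"
  shows "C1c (\<lambda>x. of_real (corr_sum J x))"
    and "partial_deriv i (\<lambda>x. of_real (corr_sum J x)) x = (\<Sum>j\<in>J. gcorr j i x)"
proof -
  have "C1c (\<lambda>x. complex_of_real (corr_sum J x))
      \<and> (\<forall>x i. partial_deriv i (\<lambda>x. of_real (corr_sum J x)) x =
      (\<Sum>j\<in>J. gcorr j i x))"
    using assms
  proof (induction J rule: finite_induct)
    case empty
    have p: "partial_deriv i (\<lambda>x. 0) x = 0" for i x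
      by (rule has_derivative_imp_partial_deriv[OF has_derivative_const])
    then have "partial_deriv i (\<lambda>x. 0) = (\<lambda>x. 0)" for i by auto
    then show ?case by (simp add: corr_sum_def C1c_def p)
  next
    case (insert j J)
    then have s: "(\<lambda>x. complex_of_real (corr_sum (insert j J) x))
        = (\<lambda>x. of_real (corr d e (lat e j) x) + of_real (corr_sum J x))"
      by (simp add: corr_sum_def)
    show ?case
      unfolding s using insert C1c_add[OF C1c_corr]
      by (simp add: partial_deriv_add[OF C1c_differentiable[OF C1c_corr] C1c_differentiable])
  qed
  then show "C1c (\<lambda>x. of_real (corr_sum J x))"
      "partial_deriv i (\<lambda>x. of_real (corr_sum J x)) x = (\<Sum>j\<in>J. gcorr j i x)"
      by auto
qed

lemma sum_cells_le:
  assumes J: "finite J" and f: "continuous_on UNIV f" "bounded {x. f x \<noteq> 0}" "\<And>x. 0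
      \<le> f x"
  shows "(\<Sum>j\<in>J. LINT x|lebesgue. cell e (lat e j) x * f x)
      \<le> integral\<^sup>L lebesgue f"
proof -
  have fi: "integrable lebesgue f" using integrable_weighted_real[of "\<lambda>_. 1" 1 f] f by simp
  have i: "integrable lebesgue (\<lambda>x. cell e (lat e j) x * f x)" for j
    by (rule integrable_weighted_real[OF weight_measurable(2) weight_bounds(2) f(1,2)])
  have "(\<Sum>j\<in>J. LINT x|lebesgue. cell e (lat e j) x * f x)
      = (LINT x|lebesgue. (\<Sum>j\<in>J. cell e (lat e j) x) * f x)"
    using i by (subst Bochner_Integration.integral_sum[symmetric]) (auto simp: sum_distrib_right)
  also have "\<dots> \<le> (LINT x|lebesgue. f x)"
  proof (rule integral_mono[OF _ fi])
    show "integrable lebesgue (\<lambda>x. (\<Sum>j\<in>J. cell e (lat e j) x) * f x)"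
      unfolding sum_distrib_right by (intro Bochner_Integration.integrable_sum i)
    show "(\<Sum>j\<in>J. cell e (lat e j) x) * f x \<le> f x" for x
      using mult_right_mono[OF cell_le_1[OF e_pos J] f(3), of x x] by simp
  qed
  finally show ?thesis .
qed

lemma hardy_sum:
  assumes J: "finite J" and w: "C1c w"
  shows "(LINT x|lebesgue. hwt_sum J x * sq w x)
      \<le> d\<^sup>2 * (24 * nrm2 w + 4 * e\<^sup>2 * grd2 w)"
proof -
  have "(LINT x|lebesgue. hwt_sum J x * sq w x)
      = (\<Sum>j\<in>J. LINT x|lebesgue. hwt d e (lat e j) x * sq w x)"
    unfolding hwt_sum_def sum_distrib_right
    by (rule Bochner_Integration.integral_sum) (rule integrable_weighted_real[OF
        weight_measurable(3) weight_bounds(3) C1c_sq[OF w]])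
  also have "\<dots> \<le> (\<Sum>j\<in>J. d\<^sup>2 *
      (24 * (LINT x|lebesgue. cell e (lat e j) x * sq w x) + 4 * e\<^sup>2 *
      (LINT x|lebesgue. cell e (lat e j) x * gsq w x)))"
    by (intro sum_mono hardy w)
  also have "\<dots> = d\<^sup>2 * (24 * (\<Sum>j\<in>J. LINT x|lebesgue. cell e (lat e j) x * sq w
      x) + 4 * e\<^sup>2 * (\<Sum>j\<in>J. LINT x|lebesgue. cell e (lat e j) x * gsq w x))"
    by (simp add: sum_distrib_left sum.distrib distrib_left)
  also have "\<dots> \<le> d\<^sup>2 * (24 * nrm2 w + 4 * e\<^sup>2 * grd2 w)"
    unfolding nrm2_def grd2_def
    by (intro mult_left_mono add_mono sum_cells_le J C1c_sq C1c_gsq w) auto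
  finally show ?thesis .
qed

lemma wpot_sum:
  assumes J: "finite J" and w: "C1c w"
  shows "(\<Sum>j\<in>J. LINT x|lebesgue. wpot d e (lat e j) x * sq w x)
      \<le> 11 * (d / e)\<^sup>2 * nrm2 w + 2 * grd2 w"
proof -
  have "(\<Sum>j\<in>J. LINT x|lebesgue. wpot d e (lat e j) x * sq w x)
    \<le> (\<Sum>j\<in>J. 11 * (d / e)\<^sup>2 * (LINT x|lebesgue. cell e (lat e j) x * sq w x) + 2
        * (LINT x|lebesgue. cell e (lat e j) x * gsq w x))"
    by (intro sum_mono wpot_energy w)
  also have "\<dots> = 11 * (d / e)\<^sup>2 * (\<Sum>j\<in>J. LINT x|lebesgue. cell e (lat e j) x *
      sq w x) + 2 * (\<Sum>j\<in>J. LINT x|lebesgue. cell e (lat e j) x * gsq w x)"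
    by (simp add: sum_distrib_left sum.distrib)
  also have "\<dots> \<le> 11 * (d / e)\<^sup>2 * nrm2 w + 2 * grd2 w"
    unfolding nrm2_def grd2_def
    by (intro mult_left_mono add_mono sum_cells_le J C1c_sq C1c_gsq w) auto
  finally show ?thesis .
qed

text \<open>A hole containing a point of the support has its centre within d e < 2 e of that point,
  so its index lies in \<open>J\<close>; the remaining holes contribute nothing.\<close>

lemma wtot_covers:
  assumes J: "covers e J w"
  shows "of_real (wtot d e x) * w x = (\<Sum>j\<in>J. of_real (wpot d e (lat e j) x) * w x)"
proof (cases "w x = 0")
  case False
  have fJ: "finite J" using J by (simp add: covers_def)
  have de: "d * e \<le> e / 2" using d_le e_pos by simp
  have "disjoint_family_on (\<lambda>j. ball (lat e j) (d * e)) J"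
    using lat_balls_disjoint[OF e_pos de] by (auto simp: disjoint_family_on_def)
  note ind = indicator_UN_disjoint[OF fJ this, of x, where 'c=real]
  have "x \<in> (\<Union>j. ball (lat e j) (d * e))
      \<longleftrightarrow> x \<in> (\<Union>j\<in>J. ball (lat e j) (d * e))"
  proof
    assume "x \<in> (\<Union>j. ball (lat e j) (d * e))"
    then obtain j where j: "x \<in> ball (lat e j) (d * e)" by blast
    then have "norm (x - lat e j) < d * e" by (simp add: dist_norm norm_minus_commute)
    then have "norm (x - lat e j) < 2 * e" using de e_pos by linarith
    with J False have "j \<in> J" unfolding covers_def by blast
    with j show "x \<in> (\<Union>j\<in>J. ball (lat e j) (d * e))" by blast
  qed blast
  then have "indicat_real (\<Union>j. ball (lat e j) (d * e)) x
      = (\<Sum>j\<in>J. indicat_real (ball (lat e j) (d * e)) x)"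
    unfolding ind[symmetric] by (simp add: indicator_def)
  then have "wtot d e x = (\<Sum>j\<in>J. wpot d e (lat e j) x)"
    unfolding wtot_def wpot_def by (simp add: sum_distrib_left)
  then show ?thesis by (simp add: sum_distrib_right)
qed simp

lemma covers_mult: "covers e J w \<Longrightarrow> covers e J (\<lambda>x. w x * v x)"
  by (rule covers_mono) auto

lemma wgt2_eq:
  assumes w: "C1c w" and J: "covers e J w"
  shows "wgt2 d e w = (\<Sum>j\<in>J. LINT x|lebesgue. wpot d e (lat e j) x * sq w x)"
proof -
  have "wtot d e x * sq w x = (\<Sum>j\<in>J. wpot d e (lat e j) x * sq w x)" for x
  proof -
    have "complex_of_real (wtot d e x * sq w x)
        = of_real (\<Sum>j\<in>J. wpot d e (lat e j) x * sq w x)"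
      using wtot_covers[OF covers_mult[OF J], of x "\<lambda>x. cnj (w x)"] unfolding sq_eq by simp
    then show ?thesis by (simp only: of_real_eq_iff)
  qed
  then show ?thesis unfolding wgt2_def
    by (simp only:) (rule Bochner_Integration.integral_sum, rule integrable_weighted_real[OF
        weight_measurable(1) weight_bounds(1) C1c_sq[OF w]])
qed

text \<open>The counterpart of \<open>coercivity\<close>: together they make the energy equivalent,
  uniformly in \<alpha> = d / e, to the squared gradient norm plus 1 + \<alpha>^2 times the squared
  norm.\<close>

lemma wgt2_le: "C1c w \<Longrightarrow> wgt2 d e w \<le> 11 * (d / e)\<^sup>2 * nrm2 w + 2 * grd2 w"
proof -
  assume w: "C1c w"
  obtain J where J: "covers e J w" using covers_exists[OF e_pos C1c_bounded[OF w]] by blast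
  then show ?thesis using wgt2_eq[OF w J] wpot_sum[OF _ w] by (simp add: covers_def)
qed

text \<open>The supports do not overlap, so at each point at most one gradient is nonzero and the
  square of the sum is at most the sum of the squares. The leading factor is d and not d^2, which
  limits the H1 estimate.\<close>

lemma corr_grad_sum:
  assumes J: "finite J" and w: "C1c w"
  shows "(LINT x|lebesgue. gsq (\<lambda>x. of_real (corr_sum J x)) x * sq w x)
      \<le> d * (11 * (d / e)\<^sup>2 * nrm2 w + 2 * grd2 w) + d\<^sup>2 * grd2 w"
proof -
  let ?g = "\<lambda>j. gsq (\<lambda>x. of_real (corr d e (lat e j) x))"
  have gc: "continuous_on UNIV (\<lambda>x. gsq v x * sq w x)"
      "bounded {x. gsq v x * sq w x \<noteq> 0}" if "C1c v" for v
    using C1c_gsq[OF that] C1c_sq[OF w]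
        by (auto intro!: continuous_on_mult bounded_subset[OF C1c_sq(2)[OF w]])
  have gi: "integrable lebesgue (\<lambda>x. gsq v x * sq w x)" if "C1c v" for v
    using integrable_weighted_real[of "\<lambda>_. 1" 1, OF _ _ gc[OF that]] by simp
  have pt: "gsq (\<lambda>x. of_real (corr_sum J x)) x \<le> (\<Sum>j\<in>J. ?g j x)" for x
  proof -
    have z: "gcorr j i x = 0" if "x \<notin> ball (lat e j) (e / 2)" for j i
    proof -
      have "cell e (lat e j) x = 0" using that by (simp add: cell_def)
      then have "sqrt (?g j x) \<le> 0"
        using grad_corr_le[of "lat e j" x] hwt_bounds(2)[of "lat e j" x] hwt_bounds(1)[of
            "lat e j" x] by simp
      then have "?g j x = 0" using gsq_nonneg[of "\<lambda>x. of_real (corr d e (lat e j) x)" x]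
          by simp
      then show ?thesis unfolding gsq_def by (simp add: sum_nonneg_eq_0_iff)
    qed
    show ?thesis
    proof (cases "\<exists>j\<in>J. x \<in> ball (lat e j) (e / 2)")
      case True
      then obtain j where j: "j \<in> J" "x \<in> ball (lat e j) (e / 2)" by blast
      have "(\<Sum>k\<in>J. gcorr k i x) = gcorr j i x" for i
      proof -
        have "x \<notin> ball (lat e k) (e / 2)" if "k \<noteq> j" for k
          using lat_balls_disjoint[OF e_pos order_refl that] j(2) by blast
        then have "(\<Sum>k\<in>J - {j}. gcorr k i x) = 0" using z by (intro sum.neutral) auto
        then show ?thesis using sum.remove[OF J j(1), of "\<lambda>k. gcorr k i x"] by simp
      qed
      then have "gsq (\<lambda>x. of_real (corr_sum J x)) x = ?g j x"
          unfolding gsq_def C1c_corr_sum(2)[OF J] by simp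
      also have "\<dots> \<le> (\<Sum>j\<in>J. ?g j x)" using J j(1) by (intro member_le_sum) auto
      finally show ?thesis .
    next
      case False
      then have "(\<Sum>k\<in>J. gcorr k i x) = 0" for i using z by (intro sum.neutral) auto
      then show ?thesis unfolding gsq_def C1c_corr_sum(2)[OF J] by (simp add: sum_nonneg)
    qed
  qed
  have "(LINT x|lebesgue. gsq (\<lambda>x. of_real (corr_sum J x)) x * sq w x)
      \<le> (LINT x|lebesgue. (\<Sum>j\<in>J. ?g j x * sq w x))"
  proof (rule integral_mono)
    show "integrable lebesgue (\<lambda>x. gsq (\<lambda>x. of_real (corr_sum J x)) x * sq w x)"
        by (rule gi[OF C1c_corr_sum(1)[OF J]])
    show "integrable lebesgue (\<lambda>x. \<Sum>j\<in>J. ?g j x * sq w x)"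
        by (intro Bochner_Integration.integrable_sum gi C1c_corr)
    show "gsq (\<lambda>x. of_real (corr_sum J x)) x * sq w x
        \<le> (\<Sum>j\<in>J. ?g j x * sq w x)" for x
      unfolding sum_distrib_right[symmetric] by (intro mult_right_mono pt) simp
  qed
  also have "\<dots> = (\<Sum>j\<in>J. LINT x|lebesgue. ?g j x * sq w x)"
    by (intro Bochner_Integration.integral_sum gi C1c_corr)
  also have "\<dots> \<le> (\<Sum>j\<in>J. d * (LINT x|lebesgue. wpot d e (lat e j) x * sq w x)
      + d\<^sup>2 * (LINT x|lebesgue. cell e (lat e j) x * gsq w x))"
    by (intro sum_mono corr_grad_energy w)
  also have "\<dots> = d * (\<Sum>j\<in>J. LINT x|lebesgue. wpot d e (lat e j) x * sq w x)
      + d\<^sup>2 * (\<Sum>j\<in>J. LINT x|lebesgue. cell e (lat e j) x * gsq w x)"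
    by (simp add: sum_distrib_left sum.distrib)
  also have "\<dots> \<le> d * (11 * (d / e)\<^sup>2 * nrm2 w + 2 * grd2 w) + d\<^sup>2 * grd2 w"
    unfolding grd2_def[of w]
    by (intro add_mono mult_left_mono sum_cells_le J C1c_gsq w) (use wpot_sum[OF J w] d_pos in \<open>auto simp: grd2_def\<close>)
  finally show ?thesis .
qed

text \<open>The pointwise bound \<open>hwt\<close> / (3 e) for the gradient of the corrector costs
  1/e. Sharing the weight between both functions by Cauchy-Schwarz lets Hardy's inequality gain d on
  each, and d^2 / e = e (d/e)^2 leaves a factor e and one \<alpha> = d / e for either
  function.\<close>

lemma corr_pairing:
  assumes J: "finite J" and w: "C1c w" and v: "C1c v"
  defines "P \<equiv> \<lambda>x. cnj (w x) * (\<Sum>i\<in>UNIV. partial_deriv i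
      (\<lambda>x. of_real (corr_sum J x)) x * partial_deriv i v x)"
  shows "integrable lebesgue P"
    and "cmod (integral\<^sup>L lebesgue P)
        \<le> 1 / (3 * e) * (sqrt (LINT x|lebesgue. hwt_sum J x * sq w x) * sqrt
        (LINT x|lebesgue. hwt_sum J x * gsq v x))"
proof -
  have cP: "continuous_on UNIV P" unfolding P_def
    by (intro continuous_on_mult continuous_on_cnj continuous_on_sum C1c_continuous
        C1c_continuous_partial w v C1c_corr_sum J)
  have sP: "bounded {x. P x \<noteq> 0}"
    by (rule bounded_subset[OF C1c_bounded[OF w]]) (auto simp: P_def)
  show i: "integrable lebesgue P" by (rule integrable_continuous_bounded_supp[OF cP sP])
  note CS = weighted_Cauchy_Schwarz[OF hwt_sum_props(3,1,2)[OF J] C1c_sq[OF w] sq_nonneg C1c_gsq[OF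
      v] gsq_nonneg]
  have "cmod (integral\<^sup>L lebesgue P)
      \<le> (LINT x|lebesgue. 1 / (3 * e) * (hwt_sum J x * (sqrt (sq w x) * sqrt (gsq v x))))"
  proof (rule Bochner_Integration.integral_norm_bound_integral[OF i])
    show "integrable lebesgue (\<lambda>x. 1 / (3 * e) *
        (hwt_sum J x * (sqrt (sq w x) * sqrt (gsq v x))))"
      using CS(1) by (rule integrable_mult_right)
    fix x
    have "cmod (\<Sum>i\<in>UNIV. gcorr j i x * partial_deriv i v x)
        \<le> hwt d e (lat e j) x / (3 * e) * sqrt (gsq v x)" for j
    proof -
      have "cmod (\<Sum>i\<in>UNIV. gcorr j i x * partial_deriv i v x)
          \<le> (\<Sum>i\<in>UNIV. cmod (gcorr j i x) * cmod (partial_deriv i v x))"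
        by (rule order_trans[OF norm_sum]) (simp add: norm_mult)
      also have "\<dots> \<le> sqrt (gsq (\<lambda>x. of_real (corr d e (lat e j) x)) x) * sqrt
          (gsq v x)"
        unfolding gsq_def by (rule inner_sum_le_sqrt)
      also have "\<dots> \<le> hwt d e (lat e j) x / (3 * e) * sqrt (gsq v x)"
        by (intro mult_right_mono grad_corr_le) simp
      finally show ?thesis .
    qed
    then have "cmod (\<Sum>j\<in>J. \<Sum>i\<in>UNIV. gcorr j i x * partial_deriv i v x)
        \<le> (\<Sum>j\<in>J. hwt d e (lat e j) x / (3 * e) * sqrt (gsq v x))"
      by (intro sum_norm_le)
    also have "(\<Sum>j\<in>J. \<Sum>i\<in>UNIV. gcorr j i x * partial_deriv i v x)
        = (\<Sum>i\<in>UNIV. partial_deriv i (\<lambda>x. of_real (corr_sum J x)) x * partial_deriv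
        i v x)"
      unfolding C1c_corr_sum(2)[OF J] sum_distrib_right by (rule sum.swap)
    also have "(\<Sum>j\<in>J. hwt d e (lat e j) x / (3 * e) * sqrt (gsq v x))
        = hwt_sum J x / (3 * e) * sqrt (gsq v x)"
      unfolding hwt_sum_def by (simp add: sum_distrib_right sum_divide_distrib)
    finally have "cmod (w x) * cmod (\<Sum>i\<in>UNIV. partial_deriv i
        (\<lambda>x. of_real (corr_sum J x)) x * partial_deriv i v x) \<le> cmod (w x) *
        (hwt_sum J x / (3 * e) * sqrt (gsq v x))"
      by (intro mult_left_mono) auto
    then show "norm (P x) \<le> 1 / (3 * e) * (hwt_sum J x * (sqrt (sq w x) * sqrt (gsq v x)))"
      by (simp add: P_def norm_mult sq_def mult_ac)
  qed
  also have "\<dots> \<le> 1 / (3 * e) * (sqrt (LINT x|lebesgue. hwt_sum J x * sq w x) * sqrt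
      (LINT x|lebesgue. hwt_sum J x * gsq v x))"
    unfolding integral_mult_right_zero using CS(2) e_pos by (intro mult_left_mono) auto
  finally show "cmod (integral\<^sup>L lebesgue P)
      \<le> 1 / (3 * e) * (sqrt (LINT x|lebesgue. hwt_sum J x * sq w x) * sqrt
      (LINT x|lebesgue. hwt_sum J x * gsq v x))" .
qed

text \<open>The identities of the single cells are added; as \<open>J\<close> covers the support,
  the weights of the single holes add up to \<open>wtot\<close> there.\<close>

lemma corr_identity_sum:
  assumes w: "C1c w" and J: "covers e J w"
  shows "(LINT x|lebesgue. (\<Sum>i\<in>UNIV. partial_deriv i (\<lambda>x. of_real (corr_sum J x)) x
      * partial_deriv i w x))
    = (LINT x|lebesgue. of_real (wtot d e x) * w x) - 8 * of_real ((d / e)\<^sup>2) *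
        (\<Sum>j\<in>J. LINT x|lebesgue. of_real (cell e (lat e j) x) * w x)"
proof -
  have fJ: "finite J" using J by (simp add: covers_def)
  note wc = C1c_continuous[OF w] C1c_bounded[OF w]
  have ci: "integrable lebesgue (\<lambda>x. of_real (cell e a x) * w x)"
      "integrable lebesgue (\<lambda>x. of_real (wpot d e a x) * w x)" for a
    by (rule integrable_weighted_complex[OF weight_measurable(2) weight_bounds(2) wc]
        integrable_weighted_complex[OF weight_measurable(1) weight_bounds(1) wc])+
  have "(LINT x|lebesgue. (\<Sum>i\<in>UNIV. partial_deriv i (\<lambda>x. of_real (corr_sum J x)) x
      * partial_deriv i w x))
    = (LINT x|lebesgue. (\<Sum>j\<in>J. \<Sum>i\<in>UNIV. gcorr j i x * partial_deriv i w x))"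
    unfolding C1c_corr_sum(2)[OF fJ] sum_distrib_right by (subst sum.swap) (rule refl)
  also have "\<dots> = (\<Sum>j\<in>J. LINT x|lebesgue. (\<Sum>i\<in>UNIV. gcorr j i x *
      partial_deriv i w x))"
    by (rule Bochner_Integration.integral_sum) (rule corr_identity(1)[OF w])
  also have "\<dots> = (\<Sum>j\<in>J. LINT x|lebesgue. of_real (wpot d e (lat e j) x
      - 8 * (d / e)\<^sup>2 * cell e (lat e j) x) * w x)"
    unfolding corr_identity(3)[OF w] ..
  also have "\<dots> = (\<Sum>j\<in>J. (LINT x|lebesgue. of_real (wpot d e (lat e j) x) * w x)
      - 8 * of_real ((d / e)\<^sup>2) * (LINT x|lebesgue. of_real (cell e (lat e j) x) * w x))"
  proof (rule sum.cong[OF refl])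
    fix j
    have "(\<lambda>x. of_real (wpot d e (lat e j) x - 8 * (d / e)\<^sup>2 * cell e (lat e j) x) * w
        x)
      = (\<lambda>x. of_real (wpot d e (lat e j) x) * w x - 8 * of_real ((d / e)\<^sup>2) *
          (of_real (cell e (lat e j) x) * w x))"
      by (simp add: algebra_simps)
    then show "(LINT x|lebesgue. of_real (wpot d e (lat e j) x
        - 8 * (d / e)\<^sup>2 * cell e (lat e j) x) * w x)
      = (LINT x|lebesgue. of_real (wpot d e (lat e j) x) * w x) - 8 * of_real ((d / e)\<^sup>2) *
          (LINT x|lebesgue. of_real (cell e (lat e j) x) * w x)"
      using ci by (simp only: Bochner_Integration.integral_diff[OF ci(2) integrable_mult_right[OF
          ci(1)]] integral_mult_right_zero)
  qed
  also have "\<dots> = (\<Sum>j\<in>J. LINT x|lebesgue. of_real (wpot d e (lat e j) x) * w x)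
      - 8 * of_real ((d / e)\<^sup>2) * (\<Sum>j\<in>J. LINT x|lebesgue. of_real
      (cell e (lat e j) x) * w x)"
    by (simp add: sum_subtractf sum_distrib_left)
  also have "(\<Sum>j\<in>J. LINT x|lebesgue. of_real (wpot d e (lat e j) x) * w x)
      = (LINT x|lebesgue. of_real (wtot d e x) * w x)"
    unfolding wtot_covers[OF J] by (rule Bochner_Integration.integral_sum[symmetric]) (rule ci)
  finally show ?thesis .
qed

text \<open>A bound for the right-hand side of \<open>cell_average\<close> applied to v times the
  conjugate of w; the factor 3 counts the coordinates, each derivative being bounded by the full
  gradient.\<close>

lemma product_gradient_L1:
  assumes w: "C1c w" and v: "C1c v"
  shows "(\<Sum>i\<in>UNIV. e / 2 *
      (LINT x|lebesgue. cmod (partial_deriv i (\<lambda>x. v x * cnj (w x)) x)))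
    \<le> 3 * e / 2 * (sqrt (grd2 v) * sqrt (nrm2 w) + sqrt (nrm2 v) * sqrt (grd2 w))"
proof -
  have one: "(\<lambda>_. 1::real) \<in> borel_measurable lebesgue" "0 \<le> (1::real)" "1
      \<le> (1::real)" by auto
  note CS1 = weighted_Cauchy_Schwarz[OF one C1c_gsq[OF v] gsq_nonneg C1c_sq[OF w] sq_nonneg,
      simplified]
  note CS2 = weighted_Cauchy_Schwarz[OF one C1c_sq[OF v] sq_nonneg C1c_gsq[OF w] gsq_nonneg,
      simplified]
  have pg: "cmod (partial_deriv i u x) \<le> sqrt (gsq u x)" for i u x
    unfolding gsq_def by (rule real_le_rsqrt) (rule member_le_sum; simp)
  have "(LINT x|lebesgue. cmod (partial_deriv i (\<lambda>x. v x * cnj (w x)) x))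
      \<le> sqrt (grd2 v) * sqrt (nrm2 w) + sqrt (nrm2 v) * sqrt (grd2 w)" for i
  proof -
    have "(LINT x|lebesgue. cmod (partial_deriv i (\<lambda>x. v x * cnj (w x)) x))
      \<le> (LINT x|lebesgue. sqrt (gsq v x) * sqrt (sq w x) + sqrt (sq v x) * sqrt (gsq w x))"
    proof (rule integral_mono)
      show "integrable lebesgue (\<lambda>x. cmod (partial_deriv i (\<lambda>x. v x * cnj (w x))
          x))"
        using integrable_norm[OF integrable_continuous_bounded_supp[OF C1c_continuous_partial
            C1c_bounded_partial]] C1c_mult[OF C1c_cnj[OF w] v] by blast
      show "integrable lebesgue (\<lambda>x. sqrt (gsq v x) * sqrt (sq w x)
          + sqrt (sq v x) * sqrt (gsq w x))"
        using CS1(1) CS2(1) by simp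
      fix x
      have "partial_deriv i (\<lambda>x. v x * cnj (w x)) x = partial_deriv i v x * cnj (w x)
          + v x * cnj (partial_deriv i w x)"
        using partial_deriv_mult[OF C1c_differentiable[OF v] C1c_differentiable[OF C1c_cnj[OF w]]]
            partial_cnj[OF C1c_differentiable[OF w]] by simp
      also have "cmod \<dots> \<le> cmod (partial_deriv i v x) * cmod (w x)
          + cmod (v x) * cmod (partial_deriv i w x)"
        by (rule order_trans[OF norm_triangle_ineq]) (simp add: norm_mult)
      also have "\<dots> \<le> sqrt (gsq v x) * sqrt (sq w x) + sqrt (sq v x) * sqrt (gsq w x)"
        by (intro add_mono mult_mono pg) (auto simp: sq_def)
      finally show "cmod (partial_deriv i (\<lambda>x. v x * cnj (w x)) x)
          \<le> sqrt (gsq v x) * sqrt (sq w x) + sqrt (sq v x) * sqrt (gsq w x)" .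
    qed
    also have "\<dots> \<le> sqrt (grd2 v) * sqrt (nrm2 w) + sqrt (nrm2 v) * sqrt (grd2 w)"
      using CS1 CS2 unfolding grd2_def nrm2_def by simp
    finally show ?thesis .
  qed
  then have "(\<Sum>i\<in>UNIV. e / 2 *
      (LINT x|lebesgue. cmod (partial_deriv i (\<lambda>x. v x * cnj (w x)) x)))
     \<le> (\<Sum>i\<in>(UNIV::3 set). e / 2 * (sqrt (grd2 v) * sqrt (nrm2 w) + sqrt (nrm2 v) * sqrt
         (grd2 w)))"
    using e_pos by (intro sum_mono mult_left_mono) auto
  then show ?thesis by simp
qed

end

definition hess2 :: "(real^3 \<Rightarrow> complex) \<Rightarrow> real" where
  "hess2 v = (\<Sum>i\<in>UNIV. grd2 (partial_deriv i v))"

definition energy :: "real \<Rightarrow> real \<Rightarrow> (real^3 \<Rightarrow> complex)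
    \<Rightarrow> real" where
  "energy d e u = grd2 u + wgt2 d e u + nrm2 u"

definition residual :: "real \<Rightarrow> real \<Rightarrow> (real^3 \<Rightarrow> complex)
    \<Rightarrow> (real^3 \<Rightarrow> complex) \<Rightarrow> (real^3 \<Rightarrow> complex)
    \<Rightarrow> complex" where
  "residual d e F Y \<Phi> = (LINT x|lebesgue. F x * cnj (\<Phi> x))
     - (LINT x|lebesgue. (\<Sum>i\<in>UNIV. partial_deriv i Y x * cnj (partial_deriv i \<Phi> x)))
     - (LINT x|lebesgue. of_real (wtot d e x) * (Y x * cnj (\<Phi> x))) -
         (LINT x|lebesgue. Y x * cnj (\<Phi> x))"

lemma wgt2_nonneg: "e > 0 \<Longrightarrow> d \<ge> 0 \<Longrightarrow> 0 \<le> wgt2 d e u"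
  unfolding wgt2_def by (intro Bochner_Integration.integral_nonneg mult_nonneg_nonneg wtot_bounds)
      auto

text \<open>24 is rounded up to 5^2, and completing the square only adds a nonnegative cross
  term.\<close>

lemma sqrt_sum_le:
  assumes "0 \<le> p" "0 \<le> g" "0 \<le> e" "0 \<le> d"
  shows "sqrt (d\<^sup>2 * (24 * p + 4 * e\<^sup>2 * g)) \<le> d * (5 * sqrt p + 2 * e * sqrt g)"
proof (rule real_le_lsqrt)
  have "24 * p + 4 * e\<^sup>2 * g \<le> (5 * sqrt p)\<^sup>2 + (2 * e * sqrt g)\<^sup>2
      + 2 * (5 * sqrt p) * (2 * e * sqrt g)"
    using assms by (simp add: power_mult_distrib)
  then have "24 * p + 4 * e\<^sup>2 * g \<le> (5 * sqrt p + 2 * e * sqrt g)\<^sup>2"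
      by (simp add: power2_sum)
  then show "d\<^sup>2 * (24 * p + 4 * e\<^sup>2 * g)
      \<le> (d * (5 * sqrt p + 2 * e * sqrt g))\<^sup>2"
    unfolding power_mult_distrib by (intro mult_left_mono) auto
qed (use assms in auto)

lemma effective_weak:
  assumes v: "v \<in> test_functions" and w: "C1c w"
  shows "(LINT x|lebesgue. (- laplacian v x + of_real b * v x) * cnj (w x)) =
    (LINT x|lebesgue. (\<Sum>i\<in>UNIV. partial_deriv i v x * cnj (partial_deriv i w x))) + of_real
        b * (LINT x|lebesgue. v x * cnj (w x))"
proof -
  note vc = C1c_test[OF v] and vpc = C1c_test[OF test_partial_deriv[OF v]]
  define q where "q x = v x * cnj (w x)" for x
  let ?G = "\<lambda>x. \<Sum>i\<in>UNIV. partial_deriv i v x * cnj (partial_deriv i w x)"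
  have iq: "integrable lebesgue q"
    unfolding q_def by (rule C1c_integrable_mult(1)[OF vc continuous_on_cnj[OF C1c_continuous[OF
        w]]])
  have il: "integrable lebesgue (\<lambda>x. partial_deriv i (partial_deriv i v) x * cnj (w x))"
      for i
    by (rule C1c_integrable_mult(2)[OF vpc continuous_on_cnj[OF C1c_continuous[OF w]]])
  have ig: "integrable lebesgue (\<lambda>x. partial_deriv i v x * cnj (partial_deriv i w x))" for i
    by (rule C1c_integrable_mult(2)[OF vc continuous_on_cnj[OF C1c_continuous_partial[OF w]]])
  have "(LINT x|lebesgue. (- laplacian v x + of_real b * v x) * cnj (w x))
     = (LINT x|lebesgue. of_real b * q x - (\<Sum>i\<in>UNIV. partial_deriv i (partial_deriv i v) x
         * cnj (w x)))"
    by (simp only: laplacian_def q_def sum_distrib_right[symmetric]) (simp add: algebra_simps)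
  also have "\<dots> = of_real b * integral\<^sup>L lebesgue q
      - (\<Sum>i\<in>UNIV. LINT x|lebesgue. partial_deriv i (partial_deriv i v) x * cnj (w x))"
    using iq il by (simp add: Bochner_Integration.integral_diff)
  also have "(\<Sum>i\<in>UNIV. LINT x|lebesgue. partial_deriv i (partial_deriv i v) x * cnj (w x))
      = - (\<Sum>i\<in>UNIV. LINT x|lebesgue. partial_deriv i v x * cnj (partial_deriv i w x))"
    unfolding ibp_cnj[OF vpc w] by (simp add: sum_negf)
  also have "(\<Sum>i\<in>UNIV. LINT x|lebesgue. partial_deriv i v x * cnj (partial_deriv i w x))
      = integral\<^sup>L lebesgue ?G"
    by (rule Bochner_Integration.integral_sum[symmetric]) (rule ig)
  finally show ?thesis by (simp add: q_def)
qed

context hole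
begin

lemma hardy_sqrt:
  assumes "finite J" "C1c w"
  shows "sqrt (LINT x|lebesgue. hwt_sum J x * sq w x)
      \<le> d * (5 * sqrt (nrm2 w) + 2 * e * sqrt (grd2 w))"
  using order_trans[OF real_sqrt_le_mono[OF hardy_sum[OF assms]] sqrt_sum_le[OF nrm2_nonneg
      grd2_nonneg]] e_pos d_pos
  by simp

text \<open>The weight is bounded by 1 here, without the gain from Hardy's inequality; this serves
  \<open>coercivity\<close>, where w has first derivatives only.\<close>

lemma hwt_sum_gsq_le:
  assumes J: "finite J" and w: "C1c w" shows "(LINT x|lebesgue. hwt_sum J x * gsq w x) \<le> grd2 w"
  unfolding grd2_def
proof (rule integral_mono)
  show "integrable lebesgue (\<lambda>x. hwt_sum J x * gsq w x)"
    by (rule integrable_weighted_real[of _ 1]) (use hwt_sum_props[OF J] C1c_gsq[OF w] in \<open>auto simp: abs_of_nonneg\<close>)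
  show "integrable lebesgue (gsq w)" by (rule integrable_gsq[OF w])
  show "hwt_sum J x * gsq w x \<le> gsq w x" for x
    using mult_right_mono[OF hwt_sum_props(2)[OF J], of "gsq w x" x] by simp
qed

text \<open>Hardy's inequality for every partial derivative of v; this is where the second
  derivatives of v are spent.\<close>

lemma hardy_grad_sqrt:
  assumes J: "finite J" and v: "v \<in> test_functions"
  shows "sqrt (LINT x|lebesgue. hwt_sum J x * gsq v x)
      \<le> d * (5 * sqrt (grd2 v) + 2 * e * sqrt (hess2 v))"
proof -
  note t = C1c_test[OF test_partial_deriv[OF v]]
  have k: "integrable lebesgue (\<lambda>x. hwt_sum J x * sq (partial_deriv i v) x)" for i
    by (rule integrable_weighted_real[of _ 1]) (use hwt_sum_props[OF J] C1c_sq[OF t] in \<open>auto simp: abs_of_nonneg\<close>)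
  have "(LINT x|lebesgue. hwt_sum J x * gsq v x)
      = (LINT x|lebesgue. (\<Sum>i\<in>UNIV. hwt_sum J x * sq (partial_deriv i v) x))"
    by (simp add: gsq_def sq_def sum_distrib_left)
  also have "\<dots> = (\<Sum>i\<in>UNIV. LINT x|lebesgue. hwt_sum J x * sq (partial_deriv i v) x)"
    by (rule Bochner_Integration.integral_sum) (rule k)
  also have "\<dots> \<le> (\<Sum>i\<in>UNIV. d\<^sup>2 * (24 * nrm2 (partial_deriv i v)
      + 4 * e\<^sup>2 * grd2 (partial_deriv i v)))"
    by (intro sum_mono hardy_sum J t)
  also have "\<dots> = d\<^sup>2 * (24 * (\<Sum>i\<in>UNIV. nrm2 (partial_deriv i v))
      + 4 * e\<^sup>2 * hess2 v)"
    by (simp add: hess2_def sum.distrib sum_distrib_left distrib_left)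
  also have "(\<Sum>i\<in>UNIV. nrm2 (partial_deriv i v)) = grd2 v"
    unfolding grd2_def integral_gsq[OF C1c_test[OF v]] nrm2_L2_norm ..
  finally have "sqrt (LINT x|lebesgue. hwt_sum J x * gsq v x)
      \<le> sqrt (d\<^sup>2 * (24 * grd2 v + 4 * e\<^sup>2 * hess2 v))"
    by (rule real_sqrt_le_mono)
  also have "\<dots> \<le> d * (5 * sqrt (grd2 v) + 2 * e * sqrt (hess2 v))"
    using e_pos d_pos by (intro sqrt_sum_le grd2_nonneg) (auto simp: hess2_def grd2_nonneg
        sum_nonneg)
  finally show ?thesis .
qed

text \<open>The corrector equation is tested with |w|^2. Its cell term averages to 8 \<alpha>^2 pi/6
  times the squared norm of w, and the penalty is part of the energy. The averaging error and the
  pairing of gradients consist of \<alpha> |w| |grad w| and |grad w|^2 with bounded factors, as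
  \<alpha> e = d \<le> 1/2. For y = \<alpha> |w| and X the energy norm this leaves 4 y^2 \<le> 16 y
  X + 2 X^2, whence y \<le> 5 X.\<close>

lemma coercivity:
  assumes w: "C1c w"
  shows "d / e * sqrt (nrm2 w) \<le> 5 * sqrt (energy d e w)"
proof -
  define \<alpha> where "\<alpha> = d / e"
  define p g X where "p = sqrt (nrm2 w)" and "g = sqrt (grd2 w)" and "X = sqrt (energy d e w)"
  have wn: "0 \<le> wgt2 d e w" using e_pos d_pos by (intro wgt2_nonneg) auto
  have pos: "0 \<le> p" "0 \<le> g" "0 \<le> X" "0 < \<alpha>"
    using wn d_pos e_pos by (auto simp: p_def g_def X_def energy_def nrm2_nonneg grd2_nonneg
        \<alpha>_def)
  have sqs: "p\<^sup>2 = nrm2 w" "g\<^sup>2 = grd2 w" "X\<^sup>2 = energy d e w"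
    using wn by (simp_all add: p_def g_def X_def energy_def nrm2_nonneg grd2_nonneg)
  have gX: "g \<le> X" unfolding g_def X_def using wn nrm2_nonneg[of w]
      by (intro real_sqrt_le_mono) (simp add: energy_def)
  have ed: "\<alpha> * e = d" using e_pos by (simp add: \<alpha>_def)
  let ?w = "\<lambda>x. w x * cnj (w x)"
  obtain J where J: "covers e J w" using covers_exists[OF e_pos C1c_bounded[OF w]] by blast
  have fJ: "finite J" using J by (simp add: covers_def)
  have Jw: "covers e J ?w" by (rule covers_mult[OF J])
  define S where "S = (\<Sum>j\<in>J. LINT x|lebesgue. of_real (cell e (lat e j) x) * ?w x)"
  define P where "P = (LINT x|lebesgue. cnj (w x) * (\<Sum>i\<in>UNIV. partial_deriv i
      (\<lambda>x. of_real (corr_sum J x)) x * partial_deriv i w x))"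
  note pair = corr_pairing[OF fJ w w, folded P_def]
  have wi: "integrable lebesgue ?w"
      by (intro integrable_continuous_bounded_supp C1c_continuous C1c_bounded C1c_sq_fun w)
  have "integral\<^sup>L lebesgue ?w = of_real (nrm2 w)" unfolding sq_eq nrm2_def by simp
  then have avg: "cmod (of_real (pi / 6) * of_real (nrm2 w) - S) \<le> 3 * e * p * g"
    using order_trans[OF cell_average[OF e_pos C1c_sq_fun[OF w] Jw] product_gradient_L1[OF w w]]
    by (simp add: S_def p_def g_def mult_ac)
  \<comment> \<open>The gradient of |w|^2 is twice a real part; split into \<open>P\<close> and its
    conjugate it becomes accessible to \<open>corr_pairing\<close>.\<close>
  have grad: "(LINT x|lebesgue. (\<Sum>i\<in>UNIV. partial_deriv i
      (\<lambda>x. of_real (corr_sum J x)) x * partial_deriv i ?w x)) = P + cnj P"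
  proof -
    let ?p = "\<lambda>x. cnj (w x) * (\<Sum>i\<in>UNIV. partial_deriv i
        (\<lambda>x. of_real (corr_sum J x)) x * partial_deriv i w x)"
    have r: "cnj (partial_deriv i (\<lambda>x. of_real (corr_sum J x)) x)
        = partial_deriv i (\<lambda>x. of_real (corr_sum J x)) x" for i x
      unfolding C1c_corr_sum(2)[OF fJ] partial_corr by simp
    have "(\<Sum>i\<in>UNIV. partial_deriv i (\<lambda>x. of_real (corr_sum J x)) x * partial_deriv
        i ?w x) = ?p x + cnj (?p x)" for x
      unfolding partial_deriv_mult[OF C1c_differentiable[OF w] C1c_differentiable[OF C1c_cnj[OF w]]]
          partial_cnj[OF C1c_differentiable[OF w]]
      by (simp add: r sum_distrib_left sum.distrib algebra_simps)
    then have "(LINT x|lebesgue. (\<Sum>i\<in>UNIV. partial_deriv i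
        (\<lambda>x. of_real (corr_sum J x)) x * partial_deriv i ?w x)) = (LINT x|lebesgue. ?p x +
        cnj (?p x))"
      by simp
    also have "\<dots> = P + (LINT x|lebesgue. cnj (?p x))"
      unfolding P_def by (rule Bochner_Integration.integral_add[OF pair(1)])
          (rule integrable_bounded_linear[OF bounded_linear_cnj pair(1)])
    also have "(LINT x|lebesgue. cnj (?p x)) = cnj P"
      unfolding P_def by (rule integral_bounded_linear[OF bounded_linear_cnj pair(1)])
    finally show ?thesis .
  qed
  have tot: "(LINT x|lebesgue. of_real (wtot d e x) * ?w x) = of_real (wgt2 d e w)"
    by (simp add: sq_eq wgt2_def del: of_real_mult flip: of_real_mult)
  have "P + cnj P = of_real (wgt2 d e w) - 8 * of_real (\<alpha>\<^sup>2) * S"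
    using corr_identity_sum[OF C1c_sq_fun[OF w] Jw] unfolding grad tot S_def \<alpha>_def .
  then have "2 * Re P = wgt2 d e w - 8 * \<alpha>\<^sup>2 * Re S"
    by (simp add: complex_eq_iff)
  moreover have "pi / 6 * p\<^sup>2 - Re S \<le> 3 * e * p * g"
    using order_trans[OF complex_Re_le_cmod avg] by (simp add: sqs)
  then have "8 * \<alpha>\<^sup>2 * (pi / 6 * p\<^sup>2 - Re S)
      \<le> 8 * \<alpha>\<^sup>2 * (3 * e * p * g)" by (intro mult_left_mono) auto
  moreover have "- Re P \<le> 1 / (3 * e) * (d * (5 * p + 2 * e * g) * g)"
  proof -
    have "- Re P \<le> cmod P" using abs_Re_le_cmod[of P] by linarith
    also have "\<dots> \<le> 1 / (3 * e) * (sqrt (LINT x|lebesgue. hwt_sum J x * sq w x) * sqrt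
        (LINT x|lebesgue. hwt_sum J x * gsq w x))"
      by (rule pair(2))
    also have "\<dots> \<le> 1 / (3 * e) * (d * (5 * p + 2 * e * g) * g)"
      unfolding p_def g_def using e_pos d_pos hwt_sum_props[OF fJ]
      by (intro mult_left_mono mult_mono hardy_sqrt real_sqrt_le_mono hwt_sum_gsq_le fJ w)
         (auto simp: nrm2_nonneg grd2_nonneg intro!: Bochner_Integration.integral_nonneg)
    finally show ?thesis .
  qed
  ultimately have "8 * \<alpha>\<^sup>2 * (pi / 6) * p\<^sup>2
      \<le> 24 * (\<alpha> * e) * (\<alpha> * p) * g + wgt2 d e w + 2 / 3 *
      ((5 * (\<alpha> * p) + 2 * (\<alpha> * e) * g) * g)"
  proof -
    have eq: "1 / (3 * e) * (d * (5 * p + 2 * e * g) * g)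
        = 1 / 3 * ((5 * (\<alpha> * p) + 2 * (\<alpha> * e) * g) * g)"
      using e_pos by (simp add: \<alpha>_def field_simps)
    assume A: "2 * Re P = wgt2 d e w - 8 * \<alpha>\<^sup>2 * Re S"
      "8 * \<alpha>\<^sup>2 * (pi / 6 * p\<^sup>2 - Re S)
          \<le> 8 * \<alpha>\<^sup>2 * (3 * e * p * g)"
      "- Re P \<le> 1 / (3 * e) * (d * (5 * p + 2 * e * g) * g)"
    have "8 * \<alpha>\<^sup>2 * (pi / 6 * p\<^sup>2) - 8 * \<alpha>\<^sup>2 * Re S
        \<le> 8 * \<alpha>\<^sup>2 * (3 * e * p * g)"
      using A(2) by (simp only: right_diff_distrib)
    with A(1) A(3)[unfolded eq] have "8 * \<alpha>\<^sup>2 * (pi / 6 * p\<^sup>2)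
        \<le> 8 * \<alpha>\<^sup>2 * (3 * e * p * g) + wgt2 d e w + 2 *
        (1 / 3 * ((5 * (\<alpha> * p) + 2 * (\<alpha> * e) * g) * g))"
      by linarith
    then show ?thesis by (simp add: power2_eq_square mult_ac)
  qed
  also have "\<dots> \<le> 24 * (1/2) * (\<alpha> * p) * X + X\<^sup>2
      + 2 / 3 * ((5 * (\<alpha> * p) + 2 * (1/2) * X) * X)"
    unfolding ed using pos gX d_le d_pos
    by (intro add_mono mult_mono add_nonneg_nonneg mult_nonneg_nonneg) (auto simp: sqs energy_def
        nrm2_nonneg grd2_nonneg)
  also have "\<dots> = 46 / 3 * ((\<alpha> * p) * X) + 5 / 3 * X\<^sup>2"
    by (simp add: power2_eq_square algebra_simps)
  also have "\<dots> \<le> 16 * ((\<alpha> * p) * X) + 2 * X\<^sup>2"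
    using pos by (intro add_mono mult_right_mono) auto
  finally have 1: "8 * \<alpha>\<^sup>2 * (pi / 6) * p\<^sup>2 \<le> 16 * ((\<alpha> * p) * X)
      + 2 * X\<^sup>2" .
  have "4 * (\<alpha> * p)\<^sup>2 \<le> 8 * \<alpha>\<^sup>2 * (pi / 6) * p\<^sup>2"
    using mult_right_mono[of 3 pi "(\<alpha> * p)\<^sup>2"] pi_gt3
        by (simp add: power_mult_distrib mult_ac)
  with 1 have "4 * (\<alpha> * p)\<^sup>2 \<le> 16 * ((\<alpha> * p) * X) + 2 * X\<^sup>2"
      by linarith
  have "\<alpha> * p \<le> 5 * X"
  proof (rule ccontr)
    \<comment> \<open>With y = \<open>\<alpha> * p\<close>, 20 y X \<le> 4 y^2 gives 4 y X \<le> 2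
      X^2, while 5 X^2 \<le> y X; so X = 0 and then y = 0, against y > 5 X.\<close>
    assume "\<not> \<alpha> * p \<le> 5 * X"
    then have y: "\<alpha> * p > 5 * X" by simp
    have "20 * ((\<alpha> * p) * X) \<le> 4 * (\<alpha> * p)\<^sup>2"
      using mult_left_mono[of "5 * X" "\<alpha> * p" "\<alpha> * p"] y pos
          by (simp add: power2_eq_square mult_ac)
    moreover have "5 * X\<^sup>2 \<le> (\<alpha> * p) * X"
        using mult_right_mono[of "5 * X" "\<alpha> * p" X] y pos by (simp add: power2_eq_square)
    ultimately have "X\<^sup>2 \<le> 0" using \<open>4 * (\<alpha> * p)\<^sup>2 \<le> 16 * ((\<alpha> * p) * X) + 2 * X\<^sup>2\<close>
      using zero_le_power2[of X] by linarith
    then have "X = 0" by simp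
    with \<open>4 * (\<alpha> * p)\<^sup>2 \<le> 16 * ((\<alpha> * p) * X) + 2 * X\<^sup>2\<close> y show False
      by auto
  qed
  then show ?thesis by (simp add: \<alpha>_def p_def X_def)
qed

section \<open>The residual and the size of the correction\<close>

definition corrected :: "(int^3) set \<Rightarrow> (real^3 \<Rightarrow> complex) \<Rightarrow>
    real^3 \<Rightarrow> complex" where
  "corrected J v x = v x - of_real (corr_sum J x) * v x"

text \<open>With w conjugated, grad (n v) . grad w is regrouped as n grad v . grad w + grad n . grad
  (v w) - w grad n . grad v. The middle term is the corrector equation tested with \<open>q\<close>:
  it cancels the leading penalty term and leaves 8 \<alpha>^2 times the cell integrals, with
  \<alpha> = d / e, to be compared with the effective potential 8 \<alpha>^2 pi/6 inside
  \<open>b\<close>.\<close>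

lemma residual_identity:
  assumes v: "v \<in> test_functions" and w: "C1c w" and J: "covers e J v"
    and b: "b = 8 * (d / e)\<^sup>2 * (pi / 6) + 1"
  defines "q \<equiv> \<lambda>x. v x * cnj (w x)"
      and "n \<equiv> \<lambda>x. complex_of_real (corr_sum J x)"
  shows "residual d e (\<lambda>x. - laplacian v x + of_real b * v x) (corrected J v) w =
     (LINT x|lebesgue. n x * (\<Sum>i\<in>UNIV. partial_deriv i v x * cnj (partial_deriv i w x)))
     - (LINT x|lebesgue. cnj (w x) * (\<Sum>i\<in>UNIV. partial_deriv i n x * partial_deriv i v x))
     + 8 * of_real ((d / e)\<^sup>2) * (of_real (pi / 6) * integral\<^sup>L lebesgue q -
         (\<Sum>j\<in>J. LINT x|lebesgue. of_real (cell e (lat e j) x) * q x))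
     + (LINT x|lebesgue. of_real (wtot d e x) * (n x * q x)) + (LINT x|lebesgue. n x * q x)"
proof -
  note vc = C1c_test[OF v] and vpc = C1c_test[OF test_partial_deriv[OF v]]
  have fJ: "finite J" using J by (simp add: covers_def)
  have nc: "C1c n" unfolding n_def by (rule C1c_corr_sum[OF fJ])
  have qc: "C1c q" unfolding q_def by (rule C1c_mult[OF C1c_cnj[OF w] vc])
  have Jq: "covers e J q" unfolding q_def by (rule covers_mult[OF J])
  have wd: "w differentiable at x" and vd: "v differentiable at x" and nd: "n differentiable at x"
      for x
    by (intro C1c_differentiable w vc nc)+
  let ?G = "\<lambda>x. \<Sum>i\<in>UNIV. partial_deriv i v x * cnj (partial_deriv i w x)"
  let ?T = "\<lambda>x. cnj (w x) * (\<Sum>i\<in>UNIV. partial_deriv i n x * partial_deriv i v x)"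
  let ?N = "\<lambda>x. \<Sum>i\<in>UNIV. partial_deriv i n x * partial_deriv i q x"
  have cont: "continuous_on UNIV ?G" "continuous_on UNIV (\<lambda>x. n x * ?G x)"
      "continuous_on UNIV ?N" "continuous_on UNIV q" "continuous_on UNIV (\<lambda>x. n x * q x)"
    by (intro continuous_on_mult continuous_on_sum continuous_on_cnj C1c_continuous
        C1c_continuous_partial vc w nc qc)+
  have Gs: "bounded {x. ?G x \<noteq> 0}"
  proof (rule bounded_subset)
    show "bounded (\<Union>i. {x. partial_deriv i v x \<noteq> 0})" using C1c_bounded_partial[OF vc]
        by (intro bounded_UN) auto
    show "{x. ?G x \<noteq> 0} \<subseteq> (\<Union>i. {x. partial_deriv i v x \<noteq> 0})"
        by (auto intro: sum.neutral ccontr)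
  qed
  have nGs: "bounded {x. n x * ?G x \<noteq> 0}" by (rule bounded_subset[OF Gs]) auto
  have Ns: "bounded {x. ?N x \<noteq> 0}"
  proof (rule bounded_subset)
    show "bounded (\<Union>i. {x. partial_deriv i q x \<noteq> 0})" using C1c_bounded_partial[OF qc]
        by (intro bounded_UN) auto
    show "{x. ?N x \<noteq> 0} \<subseteq> (\<Union>i. {x. partial_deriv i q x \<noteq> 0})"
        by (auto intro: sum.neutral ccontr)
  qed
  have nqs: "bounded {x. n x * q x \<noteq> 0}" by (rule bounded_subset[OF C1c_bounded[OF qc]]) auto
  note I = integrable_continuous_bounded_supp
  have iG: "integrable lebesgue ?G" and inG: "integrable lebesgue (\<lambda>x. n x * ?G x)"
      and iN: "integrable lebesgue ?N"
    and iq: "integrable lebesgue q" and inq: "integrable lebesgue (\<lambda>x. n x * q x)"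
    by (rule I[OF cont(1) Gs] I[OF cont(2) nGs] I[OF cont(3) Ns] I[OF cont(4) C1c_bounded[OF qc]]
        I[OF cont(5) nqs])+
  have iT: "integrable lebesgue ?T" unfolding n_def by (rule corr_pairing(1)[OF fJ w vc])
  have wb: "\<bar>wtot d e x\<bar> \<le> 1 / (e\<^sup>2 * d)" for x
    using wtot_bounds[OF e_pos, of d x] d_pos by simp
  have iWq: "integrable lebesgue (\<lambda>x. of_real (wtot d e x) * q x)"
      and iWnq: "integrable lebesgue (\<lambda>x. of_real (wtot d e x) * (n x * q x))"
    by (rule integrable_weighted_complex[OF wtot_measurable wb cont(4) C1c_bounded[OF qc]]
        integrable_weighted_complex[OF wtot_measurable wb cont(5) nqs])+
  have 1: "(LINT x|lebesgue. (- laplacian v x + of_real b * v x) * cnj (w x))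
      = integral\<^sup>L lebesgue ?G + of_real b * integral\<^sup>L lebesgue q"
    unfolding q_def by (rule effective_weak[OF v w])
  have 2: "(LINT x|lebesgue. (\<Sum>i\<in>UNIV. partial_deriv i (corrected J v) x * cnj
      (partial_deriv i w x)))
     = integral\<^sup>L lebesgue ?G - (LINT x|lebesgue. n x * ?G x) - integral\<^sup>L lebesgue ?N +
         integral\<^sup>L lebesgue ?T"
  proof -
    have "(\<Sum>i\<in>UNIV. partial_deriv i (corrected J v) x * cnj (partial_deriv i w x))
        = ?G x - n x * ?G x - ?N x + ?T x" for x
    proof -
      have py: "partial_deriv i (corrected J v) x = partial_deriv i v x - (partial_deriv i n x * v x
          + n x * partial_deriv i v x)" for i
        unfolding corrected_def[abs_def] n_def[symmetric]
        using partial_deriv_diff[OF vd, of "\<lambda>x. n x * v x"] partial_deriv_mult[OF nd vd]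
            differentiable_mult[OF nd vd]
        by (simp add: n_def)
      have pq: "partial_deriv i q x = partial_deriv i v x * cnj (w x)
          + v x * cnj (partial_deriv i w x)" for i
        unfolding q_def using partial_deriv_mult[OF vd C1c_differentiable[OF C1c_cnj[OF w]]]
            partial_cnj[OF wd] by simp
      show ?thesis unfolding py pq
          by (simp add: sum_distrib_left sum.distrib sum_subtractf algebra_simps)
    qed
    then show ?thesis using iG inG iN iT by simp
  qed
  have 3: "integral\<^sup>L lebesgue ?N = (LINT x|lebesgue. of_real (wtot d e x) * q x)
      - 8 * of_real ((d / e)\<^sup>2) * (\<Sum>j\<in>J. LINT x|lebesgue. of_real
      (cell e (lat e j) x) * q x)"
    unfolding n_def by (rule corr_identity_sum[OF qc Jq])
  have 4: "(LINT x|lebesgue. of_real (wtot d e x) * (corrected J v x * cnj (w x)))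
      = (LINT x|lebesgue. of_real (wtot d e x) * q x) - (LINT x|lebesgue. of_real (wtot d e x) *
      (n x * q x))"
    using iWq iWnq by (subst Bochner_Integration.integral_diff[symmetric]) (auto simp: corrected_def
        n_def q_def algebra_simps)
  have 5: "(LINT x|lebesgue. corrected J v x * cnj (w x)) = integral\<^sup>L lebesgue q
      - (LINT x|lebesgue. n x * q x)"
    using iq inq by (subst Bochner_Integration.integral_diff[symmetric]) (auto simp: corrected_def
        n_def q_def algebra_simps)
  show ?thesis unfolding residual_def 1 2 3 4 5 unfolding b by (simp add: algebra_simps)
qed

end

text \<open>All terms of the identity for A^2 are nonnegative, so b times the norm of v and sqrt b
  times that of its gradient are at most A. The weights follow because 1, \<alpha> and \<alpha>^2
  are at most b, where 2 \<alpha> \<le> \<alpha>^2 + 1 serves for \<alpha>, and because 1 and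
  \<alpha> are at most sqrt b.\<close>

lemma H2_bounds:
  fixes \<alpha> b :: real
  assumes v: "v \<in> test_functions" and a: "0 \<le> \<alpha>"
      and b: "1 + \<alpha>\<^sup>2 \<le> b"
  defines "A \<equiv> L2_norm (\<lambda>x. - laplacian v x + of_real b * v x)"
  shows "sqrt (hess2 v) \<le> A" "sqrt (grd2 v) \<le> A" "\<alpha> * sqrt (grd2 v) \<le> A"
    "sqrt (nrm2 v) \<le> A" "\<alpha> * sqrt (nrm2 v) \<le> A" "\<alpha>\<^sup>2 * sqrt (nrm2 v)
        \<le> A"
proof -
  have A0: "0 \<le> A" by (simp add: A_def)
  have hn: "0 \<le> hess2 v" by (simp add: hess2_def grd2_nonneg sum_nonneg)
  have b1: "1 \<le> b" "\<alpha>\<^sup>2 \<le> b" using b zero_le_power2[of \<alpha>] by linarith+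
  have id: "A\<^sup>2 = hess2 v + 2 * b * grd2 v + b\<^sup>2 * nrm2 v"
    using energy_H2[OF v, of b] unfolding A_def hess2_def grd2_def nrm2_def .
  have p: "0 \<le> 2 * b * grd2 v" "0 \<le> b\<^sup>2 * nrm2 v" using b1
      by (auto simp: grd2_nonneg nrm2_nonneg)
  show "sqrt (hess2 v) \<le> A" using id p A0 by (intro real_le_lsqrt) auto
  have gg: "c\<^sup>2 * grd2 v \<le> A\<^sup>2" if "c\<^sup>2 \<le> b" for c
  proof -
    have "c\<^sup>2 * grd2 v \<le> 2 * b * grd2 v" using that b1
        by (intro mult_right_mono grd2_nonneg) auto
    then show ?thesis using id p hn by linarith
  qed
  have g: "c * sqrt (grd2 v) \<le> A" if "0 \<le> c" "c\<^sup>2 \<le> b" for c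
  proof -
    have "c * sqrt (grd2 v) = sqrt (c\<^sup>2 * grd2 v)" using that by (simp add: real_sqrt_mult)
    also have "\<dots> \<le> A" using gg[OF that(2)] A0 by (intro real_le_lsqrt) auto
    finally show ?thesis .
  qed
  show "sqrt (grd2 v) \<le> A" using g[of 1] b1 by simp
  show "\<alpha> * sqrt (grd2 v) \<le> A" using g[of \<alpha>] b1 a by simp
  have "b * sqrt (nrm2 v) = sqrt (b\<^sup>2 * nrm2 v)" using b1 by (simp add: real_sqrt_mult)
  also have "\<dots> \<le> A" using id p hn A0 by (intro real_le_lsqrt) auto
  finally have bn: "b * sqrt (nrm2 v) \<le> A" .
  have n: "c * sqrt (nrm2 v) \<le> A" if "c \<le> b" for c
    using mult_right_mono[OF that, of "sqrt (nrm2 v)"] bn by (simp add: nrm2_nonneg)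
  have "2 * \<alpha> \<le> \<alpha>\<^sup>2 + 1" using zero_le_power2[of "\<alpha> - 1"]
      by (simp add: power2_diff)
  then have "\<alpha> \<le> b" using b zero_le_power2[of \<alpha>] by linarith
  then show "\<alpha> * sqrt (nrm2 v) \<le> A" by (rule n)
  show "sqrt (nrm2 v) \<le> A" "\<alpha>\<^sup>2 * sqrt (nrm2 v) \<le> A"
      using n[of 1] n[of "\<alpha>\<^sup>2"] b1 by auto
qed

lemma energy_parts:
  assumes "0 < e" "0 \<le> d"
  shows "0 \<le> energy d e w" "sqrt (nrm2 w) \<le> sqrt (energy d e w)" "sqrt (grd2 w)
      \<le> sqrt (energy d e w)"
    "sqrt (wgt2 d e w) \<le> sqrt (energy d e w)"
  using wgt2_nonneg[OF assms] by (auto simp: energy_def nrm2_nonneg grd2_nonneg)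

context hole
begin

text \<open>Each of the five terms has its powers of \<alpha> distributed. A factor n contributes d
  = \<alpha> e with \<alpha> given to v; the pairing of gradients gives one \<alpha> to the
  derivatives of v and one to w; the averaging term uses \<alpha> |grad v| times \<alpha> |w|, and
  \<alpha>^2 |v| times |grad w|. The constant is 127 = 1/2 + 52 + 72 + 2 + 1/2.\<close>

lemma residual_bound:
  assumes v: "v \<in> test_functions" and w: "C1c w" and J: "covers e J v"
    and b: "b = 8 * (d / e)\<^sup>2 * (pi / 6) + 1"
  defines "A \<equiv> L2_norm (\<lambda>x. - laplacian v x + of_real b * v x)"
  shows "cmod (residual d e (\<lambda>x. - laplacian v x + of_real b * v x) (corrected J v) w)
      \<le> 127 * e * A * sqrt (energy d e w)"
proof -
  define \<alpha> where "\<alpha> = d / e"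
  have d0: "0 \<le> d" and a0: "0 \<le> \<alpha>" and da: "d = \<alpha> * e" using d_pos e_pos
      by (auto simp: \<alpha>_def)
  note vc = C1c_test[OF v]
  have fJ: "finite J" using J by (simp add: covers_def)
  define p g X wt where "p = sqrt (nrm2 w)" and "g = sqrt (grd2 w)" and "X = sqrt (energy d e w)"
      and "wt = sqrt (wgt2 d e w)"
  define vn vg vh vw where "vn = sqrt (nrm2 v)" and "vg = sqrt (grd2 v)" and "vh = sqrt (hess2 v)"
      and "vw = sqrt (wgt2 d e v)"
  have b1: "1 + \<alpha>\<^sup>2 \<le> b"
  proof -
    have "3 * \<alpha>\<^sup>2 \<le> pi * \<alpha>\<^sup>2" using pi_gt3
        by (intro mult_right_mono) auto
    moreover have "b = 4 / 3 * (pi * \<alpha>\<^sup>2) + 1" by (simp add: b \<alpha>_def)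
    ultimately show ?thesis using zero_le_power2[of \<alpha>] by linarith
  qed
  have H: "vh \<le> A" "vg \<le> A" "\<alpha> * vg \<le> A" "vn \<le> A" "\<alpha> * vn
      \<le> A" "\<alpha>\<^sup>2 * vn \<le> A"
    using H2_bounds[OF v a0 b1] by (simp_all add: A_def vh_def vg_def vn_def)
  have E: "p \<le> X" "g \<le> X" "wt \<le> X" "\<alpha> * p \<le> 5 * X"
    using energy_parts[OF e_pos d0, of w] coercivity[OF w]
        by (simp_all add: p_def g_def X_def wt_def \<alpha>_def)
  have pos: "0 \<le> p" "0 \<le> g" "0 \<le> X" "0 \<le> wt" "0 \<le> vn" "0 \<le> vg" "0
      \<le> vh" "0 \<le> vw" "0 \<le> A"
    using energy_parts(1)[OF e_pos d0, of w] wgt2_nonneg[OF e_pos d0]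
    by (auto simp: p_def g_def X_def wt_def vn_def vg_def vh_def vw_def A_def hess2_def nrm2_nonneg
        grd2_nonneg sum_nonneg)
  \<comment> \<open>The penalty energy of v is bounded by its norm and gradient, and 11 + 2 \<le>
    4^2.\<close>
  have vwA: "\<alpha> * vw \<le> 4 * A"
  proof -
    have "(\<alpha> * vw)\<^sup>2 = \<alpha>\<^sup>2 * wgt2 d e v" using wgt2_nonneg[OF e_pos d0]
        by (simp add: vw_def power_mult_distrib)
    also have "\<dots> \<le> \<alpha>\<^sup>2 * (11 * \<alpha>\<^sup>2 * vn\<^sup>2
        + 2 * vg\<^sup>2)"
      using wgt2_le[OF vc] by (intro mult_left_mono) (simp_all add: \<alpha>_def vn_def vg_def
          nrm2_nonneg grd2_nonneg)
    also have "\<dots> = 11 * (\<alpha>\<^sup>2 * vn)\<^sup>2 + 2 * (\<alpha> * vg)\<^sup>2"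
        by (simp add: power_mult_distrib power2_eq_square algebra_simps)
    also have "\<dots> \<le> 11 * A\<^sup>2 + 2 * A\<^sup>2" using H pos a0
        by (intro add_mono mult_left_mono power_mono) auto
    also have "\<dots> \<le> (4 * A)\<^sup>2" by (simp add: power_mult_distrib)
    finally show ?thesis using pos by (intro power2_le_imp_le[of "\<alpha> * vw"]) auto
  qed
  define n where "n = (\<lambda>x. complex_of_real (corr_sum J x))"
  define q where "q = (\<lambda>x. v x * cnj (w x))"
  have nn: "cmod (n x) \<le> d / 2" for x using corr_sum_bounds[OF fJ, of x] by (simp add: n_def)
  have nc: "continuous_on UNIV n" unfolding n_def
      by (rule C1c_continuous[OF C1c_corr_sum(1)[OF fJ]])
  have one: "(\<lambda>_. 1::real) \<in> borel_measurable lebesgue" "0 \<le> (1::real)" "1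
      \<le> (1::real)" by auto
  have qc: "C1c q" unfolding q_def by (rule C1c_mult[OF C1c_cnj[OF w] vc])
  define T1 where "T1 = (LINT x|lebesgue. n x * (\<Sum>i\<in>UNIV. partial_deriv i v x * cnj
      (partial_deriv i w x)))"
  define T2 where "T2 = (LINT x|lebesgue. cnj (w x) * (\<Sum>i\<in>UNIV. partial_deriv i n x *
      partial_deriv i v x))"
  define T3 where "T3 = of_real (pi / 6) * integral\<^sup>L lebesgue q
      - (\<Sum>j\<in>J. LINT x|lebesgue. of_real (cell e (lat e j) x) * q x)"
  define T4 where "T4 = (LINT x|lebesgue. of_real (wtot d e x) * (n x * q x))"
  define T5 where "T5 = (LINT x|lebesgue. n x * q x)"
  have t1: "cmod T1 \<le> d / 2 * (vg * g)"
  proof -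
    note CS = weighted_Cauchy_Schwarz[OF one C1c_gsq[OF vc] gsq_nonneg C1c_gsq[OF w] gsq_nonneg,
        simplified]
    have "cmod T1 \<le> (LINT x|lebesgue. d / 2 * (sqrt (gsq v x) * sqrt (gsq w x)))"
      unfolding T1_def
    proof (rule Bochner_Integration.integral_norm_bound_integral)
      have c: "continuous_on UNIV (\<lambda>x. n x * (\<Sum>i\<in>UNIV. partial_deriv i v x * cnj
          (partial_deriv i w x)))"
        by (intro continuous_on_mult continuous_on_sum continuous_on_cnj nc C1c_continuous_partial
            vc w)
      have "bounded {x. n x * (\<Sum>i\<in>UNIV. partial_deriv i v x * cnj (partial_deriv i w x))
          \<noteq> 0}"
      proof (rule bounded_subset)
        show "bounded (\<Union>i. {x. partial_deriv i v x \<noteq> 0})"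
            using C1c_bounded_partial[OF vc] by (intro bounded_UN) auto
        show "{x. n x * (\<Sum>i\<in>UNIV. partial_deriv i v x * cnj (partial_deriv i w x)) \<noteq>
            0} \<subseteq> (\<Union>i. {x. partial_deriv i v x \<noteq> 0})"
          by (auto intro: sum.neutral ccontr)
      qed
      with c show "integrable lebesgue (\<lambda>x. n x * (\<Sum>i\<in>UNIV. partial_deriv i v x *
          cnj (partial_deriv i w x)))"
        by (rule integrable_continuous_bounded_supp)
      show "integrable lebesgue (\<lambda>x. d / 2 * (sqrt (gsq v x) * sqrt (gsq w x)))"
          by (rule integrable_mult_right[OF CS(1)])
      fix x
      have "cmod (\<Sum>i\<in>UNIV. partial_deriv i v x * cnj (partial_deriv i w x))
          \<le> (\<Sum>i\<in>UNIV. cmod (partial_deriv i v x) * cmod (partial_deriv i w x))"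
        by (rule order_trans[OF norm_sum]) (simp add: norm_mult)
      also have "\<dots> \<le> sqrt (gsq v x) * sqrt (gsq w x)" unfolding gsq_def
          by (rule inner_sum_le_sqrt)
      finally show "norm (n x * (\<Sum>i\<in>UNIV. partial_deriv i v x * cnj (partial_deriv i w x)))
          \<le> d / 2 * (sqrt (gsq v x) * sqrt (gsq w x))"
        unfolding norm_mult using nn d0 by (intro mult_mono) auto
    qed
    also have "\<dots> \<le> d / 2 * (vg * g)"
      unfolding integral_mult_right_zero vg_def g_def grd2_def using CS(2) d0
          by (intro mult_left_mono) auto
    finally show ?thesis .
  qed
  have t2: "cmod T2 \<le> 1 / (3 * e) * ((d * (5 * p + 2 * e * g)) * (d * (5 * vg + 2 * e * vh)))"
  proof -
    have "cmod T2 \<le> 1 / (3 * e) * (sqrt (LINT x|lebesgue. hwt_sum J x * sq w x) * sqrt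
        (LINT x|lebesgue. hwt_sum J x * gsq v x))"
      unfolding T2_def n_def by (rule corr_pairing(2)[OF fJ w vc])
    also have "\<dots> \<le> 1 / (3 * e) * ((d * (5 * p + 2 * e * g)) * (d * (5 * vg
        + 2 * e * vh)))"
      unfolding p_def g_def vg_def vh_def using e_pos d0 hwt_sum_props[OF fJ]
      by (intro mult_left_mono mult_mono hardy_sqrt hardy_grad_sqrt fJ w v)
         (auto simp: nrm2_nonneg grd2_nonneg intro!: Bochner_Integration.integral_nonneg)
    finally show ?thesis .
  qed
  have t3: "cmod T3 \<le> 3 * e / 2 * (vg * p + vn * g)"
  proof -
    have "covers e J q" unfolding q_def by (rule covers_mult[OF J])
    from cell_average[OF e_pos qc this] product_gradient_L1[OF w vc]
    show ?thesis unfolding T3_def vg_def p_def vn_def g_def q_def by (rule order_trans)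
  qed
  have t45: "cmod (LINT x|lebesgue. of_real (h x) * (n x * q x))
      \<le> d / 2 * (sqrt (LINT x|lebesgue. h x * sq v x) * sqrt (LINT x|lebesgue. h x * sq w x))"
    if h: "h \<in> borel_measurable lebesgue" "\<And>x. 0 \<le> h x" "\<And>x. h x \<le> M" for h M
  proof -
    note CS = weighted_Cauchy_Schwarz[OF h C1c_sq[OF vc] sq_nonneg C1c_sq[OF w] sq_nonneg]
    have "cmod (LINT x|lebesgue. of_real (h x) * (n x * q x))
        \<le> (LINT x|lebesgue. d / 2 * (h x * (sqrt (sq v x) * sqrt (sq w x))))"
    proof (rule Bochner_Integration.integral_norm_bound_integral)
      have "continuous_on UNIV (\<lambda>x. n x * q x)"
          by (intro continuous_on_mult nc C1c_continuous[OF qc])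
      moreover have "bounded {x. n x * q x \<noteq> 0}"
          by (rule bounded_subset[OF C1c_bounded[OF qc]]) auto
      ultimately show "integrable lebesgue (\<lambda>x. of_real (h x) * (n x * q x))"
        using h by (intro integrable_weighted_complex[of h M]) (auto simp: abs_of_nonneg)
      show "integrable lebesgue (\<lambda>x. d / 2 * (h x * (sqrt (sq v x) * sqrt (sq w x))))"
          by (rule integrable_mult_right[OF CS(1)])
      fix x
      have "cmod (n x) * cmod (q x) \<le> d / 2 * (sqrt (sq v x) * sqrt (sq w x))"
        using nn[of x] d0 by (intro mult_mono) (auto simp: q_def norm_mult sq_def)
      from mult_left_mono[OF this h(2)[of x]]
      show "norm (of_real (h x) * (n x * q x))
          \<le> d / 2 * (h x * (sqrt (sq v x) * sqrt (sq w x)))"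
        using h(2)[of x] by (simp add: norm_mult mult_ac)
    qed
    also have "\<dots> \<le> d / 2 * (sqrt (LINT x|lebesgue. h x * sq v x) * sqrt
        (LINT x|lebesgue. h x * sq w x))"
      unfolding integral_mult_right_zero using CS(2) d0 by (intro mult_left_mono) auto
    finally show ?thesis .
  qed
  have t4: "cmod T4 \<le> d / 2 * (vw * wt)"
    unfolding T4_def vw_def wt_def wgt2_def
        by (rule t45[OF wtot_measurable wtot_bounds[OF e_pos d0]])
  have t5: "cmod T5 \<le> d / 2 * (vn * p)"
    using t45[OF one] unfolding T5_def vn_def p_def nrm2_def by simp
  have "residual d e (\<lambda>x. - laplacian v x + of_real b * v x) (corrected J v) w
      = T1 - T2 + 8 * of_real (\<alpha>\<^sup>2) * T3 + T4 + T5"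
    using residual_identity[OF v w J b]
        unfolding T1_def T2_def T3_def T4_def T5_def n_def q_def \<alpha>_def .
  also have "cmod \<dots> \<le> cmod T1 + cmod T2 + 8 * \<alpha>\<^sup>2 * cmod T3 + cmod T4
      + cmod T5"
  proof -
    have "cmod (8 * of_real (\<alpha>\<^sup>2) * T3) = 8 * \<alpha>\<^sup>2 * cmod T3"
        by (simp add: norm_mult norm_power)
    then show ?thesis
      using norm_triangle_ineq[of "T1 - T2 + 8 * of_real (\<alpha>\<^sup>2) * T3
          + T4" T5] norm_triangle_ineq[of "T1 - T2 + 8 * of_real (\<alpha>\<^sup>2) * T3" T4]
        norm_triangle_ineq[of "T1 - T2"
            "8 * of_real (\<alpha>\<^sup>2) * T3"] norm_triangle_ineq4[of T1 T2] by linarith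
  qed
  also have "\<dots> \<le> e / 2 * (A * X) + 52 * (e * (A * X)) + 72 * (e * (A * X))
      + 2 * (e * (A * X)) + e / 2 * (A * X)"
  proof (intro add_mono)
    have "d / 2 * (vg * g) = e / 2 * ((\<alpha> * vg) * g)" by (simp add: da)
    also have "\<dots> \<le> e / 2 * (A * X)"
      using mult_mono[OF H(3) E(2)] pos e_pos by (intro mult_left_mono) auto
    finally show "cmod T1 \<le> e / 2 * (A * X)" using t1 by linarith
    have "1 / (3 * e) * ((d * (5 * p + 2 * e * g)) * (d * (5 * vg + 2 * e * vh)))
        = e / 3 * ((5 * (\<alpha> * p) + 2 * d * g) * (5 * (\<alpha> * vg) + 2 * d * vh))"
  proof -
      have "d * (5 * p + 2 * e * g) = e * (5 * (\<alpha> * p) + 2 * d * g)"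
          "d * (5 * vg + 2 * e * vh) = e * (5 * (\<alpha> * vg) + 2 * d * vh)"
        by (simp_all add: da algebra_simps)
      then show ?thesis using e_pos by simp
    qed
    \<comment> \<open>Coercivity gives 5 * 5 and the term with d \<le> 1/2 adds one, hence 26; on
      the side of v it is 5 + 1.\<close>
    also have "\<dots> \<le> e / 3 * ((26 * X) * (6 * A))"
    proof (intro mult_left_mono)
      have "d * g \<le> 1/2 * X" "d * vh \<le> 1/2 * A"
        using d_le d0 by (intro mult_mono[OF d_le] E H pos; simp)+
      then have "5 * (\<alpha> * p) + 2 * d * g \<le> 26 * X" "5 * (\<alpha> * vg) + 2 * d * vh
          \<le> 6 * A"
        using E H by linarith+
      then show "(5 * (\<alpha> * p) + 2 * d * g) * (5 * (\<alpha> * vg) + 2 * d * vh)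
          \<le> (26 * X) * (6 * A)"
        by (rule mult_mono) (use pos a0 d0 in auto)
    qed (use e_pos in simp)
    also have "\<dots> = 52 * (e * (A * X))" by (simp add: field_simps)
    finally show "cmod T2 \<le> 52 * (e * (A * X))" using t2 by linarith
    have "8 * \<alpha>\<^sup>2 * cmod T3
        \<le> 8 * \<alpha>\<^sup>2 * (3 * e / 2 * (vg * p + vn * g))" by (intro mult_left_mono t3)
        auto
    also have "\<dots> = 12 * e * ((\<alpha> * vg) * (\<alpha> * p) + (\<alpha>\<^sup>2 * vn) * g)"
        by (simp add: power2_eq_square algebra_simps)
    also have "\<dots> \<le> 12 * e * (A * (5 * X) + A * X)"
    proof (intro mult_left_mono add_mono)
      show "(\<alpha> * vg) * (\<alpha> * p) \<le> A * (5 * X)" using H(3) E(4)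
          by (rule mult_mono) (use pos a0 in auto)
      show "(\<alpha>\<^sup>2 * vn) * g \<le> A * X" using H(6) E(2)
          by (rule mult_mono) (use pos in auto)
    qed (use e_pos in auto)
    also have "\<dots> = 72 * (e * (A * X))" by (simp add: algebra_simps)
    finally show "8 * \<alpha>\<^sup>2 * cmod T3 \<le> 72 * (e * (A * X))" .
    have "d / 2 * (vw * wt) = e / 2 * ((\<alpha> * vw) * wt)" by (simp add: da)
    also have "\<dots> \<le> e / 2 * ((4 * A) * X)"
      using mult_mono[OF vwA E(3)] pos e_pos by (intro mult_left_mono) auto
    finally show "cmod T4 \<le> 2 * (e * (A * X))" using t4 by (simp add: mult_ac)
    have "d / 2 * (vn * p) = e / 2 * ((\<alpha> * vn) * p)" by (simp add: da)
    also have "\<dots> \<le> e / 2 * (A * X)"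
      using mult_mono[OF H(5) E(1)] pos e_pos by (intro mult_left_mono) auto
    finally show "cmod T5 \<le> e / 2 * (A * X)" using t5 by linarith
  qed
  also have "\<dots> = 127 * e * A * X" by (simp add: algebra_simps)
  finally show ?thesis unfolding X_def .
qed

text \<open>The L2 part follows from n \<le> d/2 and d |v| = e \<alpha> |v|. In the gradient the
  term with grad n dominates: its square is controlled by d \<alpha>^2 |v|^2 = e (\<alpha> |v|)
  (\<alpha>^2 |v|) and d |grad v|^2, of order e rather than e^2. The constant 6 covers 5/2 + 22 + 4
  \<le> 36.\<close>

lemma corrected_close:
  assumes v: "v \<in> test_functions" and J: "finite J" and e1: "e < 1"
    and b: "b = 8 * (d / e)\<^sup>2 * (pi / 6) + 1"
  defines "A \<equiv> L2_norm (\<lambda>x. - laplacian v x + of_real b * v x)"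
  shows "L2_norm (\<lambda>x. v x - corrected J v x) \<le> e * A"
    and "grd2 (\<lambda>x. v x - corrected J v x) \<le> (6 * sqrt e * A)\<^sup>2"
proof -
  define \<alpha> where "\<alpha> = d / e"
  have d0: "0 \<le> d" and a0: "0 \<le> \<alpha>" and da: "d = \<alpha> * e" using d_pos e_pos
      by (auto simp: \<alpha>_def)
  note vc = C1c_test[OF v]
  define vn vg where "vn = sqrt (nrm2 v)" and "vg = sqrt (grd2 v)"
  have b1: "1 + \<alpha>\<^sup>2 \<le> b"
  proof -
    have "3 * \<alpha>\<^sup>2 \<le> pi * \<alpha>\<^sup>2" using pi_gt3
        by (intro mult_right_mono) auto
    moreover have "b = 4 / 3 * (pi * \<alpha>\<^sup>2) + 1" by (simp add: b \<alpha>_def)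
    ultimately show ?thesis using zero_le_power2[of \<alpha>] by linarith
  qed
  have H: "vg \<le> A" "\<alpha> * vg \<le> A" "vn \<le> A" "\<alpha> * vn
      \<le> A" "\<alpha>\<^sup>2 * vn \<le> A"
    using H2_bounds[OF v a0 b1] by (simp_all add: A_def vg_def vn_def)
  have pos: "0 \<le> vn" "0 \<le> vg" "0 \<le> A"
      by (auto simp: vn_def vg_def A_def nrm2_nonneg grd2_nonneg)
  define n where "n = (\<lambda>x. complex_of_real (corr_sum J x))"
  have nc: "C1c n" unfolding n_def by (rule C1c_corr_sum(1)[OF J])
  have nn: "cmod (n x) \<le> d / 2" for x using corr_sum_bounds[OF J, of x] by (simp add: n_def)
  have eq: "(\<lambda>x. v x - corrected J v x) = (\<lambda>x. n x * v x)"
      by (simp add: corrected_def n_def)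
  have "L2_norm (\<lambda>x. n x * v x) \<le> d / 2 * L2_norm v"
    by (rule L2_weight(2)[OF C1c_L2(1)[OF vc] continuous_lebesgue[OF C1c_continuous[OF nc]] nn])
  also have "\<dots> = e / 2 * (\<alpha> * vn)" by (simp add: da vn_def nrm2_L2_norm)
  also have "\<dots> \<le> e / 2 * A" using H e_pos by (intro mult_left_mono) auto
  also have "\<dots> \<le> e * A" using e_pos pos by simp
  finally show "L2_norm (\<lambda>x. v x - corrected J v x) \<le> e * A" unfolding eq .
  have nvc: "C1c (\<lambda>x. n x * v x)" by (rule C1c_mult[OF vc nc])
  have pt: "gsq (\<lambda>x. n x * v x) x \<le> 2 * (d / 2)\<^sup>2 * gsq v x
      + 2 * (gsq n x * sq v x)" for x
  proof -
    have "gsq (\<lambda>x. n x * v x) x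
        \<le> (\<Sum>i\<in>UNIV. 2 * (d / 2)\<^sup>2 * (cmod (partial_deriv i v x))\<^sup>2 + 2 *
        ((cmod (partial_deriv i n x))\<^sup>2 * sq v x))"
      unfolding gsq_def
    proof (rule sum_mono)
      fix i
      let ?a = "cmod (partial_deriv i n x * v x)" and ?b = "cmod (n x * partial_deriv i v x)"
      have "cmod (partial_deriv i (\<lambda>x. n x * v x) x) \<le> ?a + ?b"
        unfolding partial_deriv_mult[OF C1c_differentiable[OF nc] C1c_differentiable[OF vc]]
            by (rule norm_triangle_ineq)
      then have "(cmod (partial_deriv i (\<lambda>x. n x * v x) x))\<^sup>2 \<le> (?a + ?b)\<^sup>2"
          by (rule power_mono) simp
      also have "\<dots> \<le> 2 * ?b\<^sup>2 + 2 * ?a\<^sup>2" using zero_le_power2[of "?a - ?b"]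
          by (simp add: power2_sum power2_diff)
      also have "\<dots> \<le> 2 * ((d / 2)\<^sup>2 * (cmod (partial_deriv i v x))\<^sup>2)
          + 2 * ((cmod (partial_deriv i n x))\<^sup>2 * sq v x)"
        unfolding norm_mult power_mult_distrib sq_def using nn[of x]
        by (intro add_mono mult_left_mono mult_right_mono power_mono order_refl) auto
      finally show "(cmod (partial_deriv i (\<lambda>x. n x * v x) x))\<^sup>2
          \<le> 2 * (d / 2)\<^sup>2 * (cmod (partial_deriv i v x))\<^sup>2 + 2 *
          ((cmod (partial_deriv i n x))\<^sup>2 * sq v x)"
        by simp
    qed
    also have "\<dots> = 2 * (d / 2)\<^sup>2 * gsq v x + 2 * (gsq n x * sq v x)"
      unfolding gsq_def by (simp add: sum.distrib sum_distrib_left sum_distrib_right)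
    finally show ?thesis .
  qed
  have i1: "integrable lebesgue (gsq v)" by (rule integrable_gsq[OF vc])
  have i2: "integrable lebesgue (\<lambda>x. gsq n x * sq v x)"
  proof -
    have "continuous_on UNIV (\<lambda>x. gsq n x * sq v x)"
        by (intro continuous_on_mult C1c_gsq C1c_sq nc vc)
    moreover have "bounded {x. gsq n x * sq v x \<noteq> 0}"
        by (rule bounded_subset[OF C1c_sq(2)[OF vc]]) auto
    ultimately show ?thesis using integrable_weighted_real[of "\<lambda>_. 1" 1] by simp
  qed
  have "grd2 (\<lambda>x. n x * v x) \<le> (LINT x|lebesgue. 2 * (d / 2)\<^sup>2 * gsq v x
      + 2 * (gsq n x * sq v x))"
    unfolding grd2_def
    by (rule integral_mono[OF integrable_gsq[OF nvc] _ pt])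
        (intro Bochner_Integration.integrable_add integrable_mult_right i1 i2)
  also have "\<dots> = 2 * (d / 2)\<^sup>2 * grd2 v + 2 * (LINT x|lebesgue. gsq n x * sq v x)"
    unfolding grd2_def using i1 i2 by (subst Bochner_Integration.integral_add) auto
  also have "\<dots> \<le> 2 * (d / 2)\<^sup>2 * grd2 v
      + 2 * (d * (11 * \<alpha>\<^sup>2 * nrm2 v + 2 * grd2 v) + d\<^sup>2 * grd2 v)"
    using corr_grad_sum[OF J vc] by (simp add: n_def \<alpha>_def)
  also have "\<dots> = 5 / 2 * e\<^sup>2 * (\<alpha> * vg)\<^sup>2
      + 22 * e * ((\<alpha> * vn) * (\<alpha>\<^sup>2 * vn)) + 4 * e * ((\<alpha> * vg) * vg)"
  proof -
    have "grd2 v = vg * vg" "nrm2 v = vn * vn"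
        by (simp_all add: vg_def vn_def grd2_nonneg nrm2_nonneg)
    then show ?thesis unfolding da by (simp add: power2_eq_square algebra_simps)
  qed
  also have "\<dots> \<le> 5 / 2 * e * A\<^sup>2 + 22 * e * (A * A) + 4 * e * (A * A)"
  proof (intro add_mono mult_mono mult_left_mono power_mono)
    show "e\<^sup>2 \<le> e" using e_pos e1 by (simp add: power2_eq_square)
  qed (use H pos a0 e_pos in auto)
  also have "\<dots> \<le> (6 * sqrt e * A)\<^sup>2"
    using e_pos mult_nonneg_nonneg[of e "A * A"] pos
        by (simp add: power_mult_distrib power2_eq_square)
  finally show "grd2 (\<lambda>x. v x - corrected J v x) \<le> (6 * sqrt e * A)\<^sup>2"
      unfolding eq .
qed

end

text \<open>Unites both cases. For d = 0 the weight \<open>wtot\<close> is zero and v itself serves,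
  with residual zero; for d > 0 it is the corrected function for a finite set of cells covering the
  support of v.\<close>

lemma corrector_exists:
  assumes e: "0 < e" "e < 1" and d: "0 \<le> d" "d \<le> 1/2" and v: "v \<in> test_functions"
    and b: "b = 4 / 3 * pi * (d / e)\<^sup>2 + 1"
  defines "F \<equiv> \<lambda>x. - laplacian v x + of_real b * v x"
  shows "\<exists>Y. C1c Y \<and> L2_norm (\<lambda>x. v x - Y x) \<le> e * L2_norm F
      \<and> grd2 (\<lambda>x. v x - Y x) \<le> (6 * sqrt e * L2_norm F)\<^sup>2 \<and>
    (\<forall>w. C1c w \<longrightarrow> cmod (residual d e F Y w) \<le> 127 * e * L2_norm F * sqrt
        (energy d e w))"
proof (cases "d = 0")
  case True
  have z: "partial_deriv i (\<lambda>x. 0) x = 0" for i x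
    by (rule has_derivative_imp_partial_deriv[OF has_derivative_const])
  have g0: "gsq (\<lambda>x. 0) = (\<lambda>x. 0)" by (auto simp: gsq_def z)
  have "residual d e F v w = 0" if "C1c w" for w
    using effective_weak[OF v that, of b] True by (simp add: residual_def F_def b wtot_def)
  moreover have "0 \<le> e * L2_norm F" using e by simp
  moreover have "0 \<le> energy d e w" for w using energy_parts(1)[OF e(1) d(1)] .
  ultimately show ?thesis using e
    by (intro exI[of _ v]) (auto simp: C1c_test[OF v] L2_norm_def grd2_def g0)
next
  case False
  then interpret hole d e by unfold_locales (use e d in auto)
  obtain J where J: "covers e J v" using covers_exists[OF e(1) C1c_bounded[OF C1c_test[OF v]]]
      by blast
  then have fJ: "finite J" by (simp add: covers_def)
  have b': "b = 8 * (d / e)\<^sup>2 * (pi / 6) + 1" unfolding b by simp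
  have "C1c (corrected J v)" unfolding corrected_def[abs_def]
    by (intro C1c_diff C1c_mult[OF C1c_test[OF v] C1c_corr_sum(1)[OF fJ]] C1c_test v)
  with residual_bound[OF v _ J b'] corrected_close[OF v fJ e(2) b'] show ?thesis
    unfolding F_def by blast
qed

subsection \<open>Passage to H1\<close>

lemma C1c_weak_gradient:
  assumes "C1c Y" shows "has_L2_weak_gradient Y (\<lambda>x. \<chi> i. partial_deriv i Y x)"
  unfolding has_L2_weak_gradient_def
proof (intro conjI allI ballI)
  show "(\<lambda>x. (\<chi> i. partial_deriv i Y x) $ i) \<in> L2" for i using C1c_L2(2)[OF assms]
      by simp
  fix \<phi> i assume "\<phi> \<in> test_functions"
  then have "C_k 1 \<phi>" using C1c_test C1c_def by blast
  from integration_by_parts[OF assms this, of i]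
  show "(LINT x|lebesgue. Y x * partial_deriv i \<phi> x)
      = - (LINT x|lebesgue. (\<chi> i. partial_deriv i Y x) $ i * \<phi> x)" by simp
qed

lemma weak_gradient_diff:
  assumes u: "u \<in> L2" "has_L2_weak_gradient u G" and v: "v \<in> L2" "has_L2_weak_gradient v H"
  shows "has_L2_weak_gradient (\<lambda>x. u x - v x) (\<lambda>x. \<chi> i. G x $ i - H x $ i)"
  unfolding has_L2_weak_gradient_def
proof (intro conjI allI ballI)
  have GL: "(\<lambda>x. G x $ i) \<in> L2" and HL: "(\<lambda>x. H x $ i) \<in> L2" for i
    using u v by (auto simp: has_L2_weak_gradient_def)
  show "(\<lambda>x. (\<chi> i. G x $ i - H x $ i) $ i) \<in> L2" for i using L2_diff[OF GL HL]
      by simp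
  fix \<phi> i assume p: "\<phi> \<in> test_functions"
  have pL: "\<phi> \<in> L2" "partial_deriv i \<phi> \<in> L2" using C1c_L2[OF C1c_test[OF p]]
      by auto
  have "(LINT x|lebesgue. u x * partial_deriv i \<phi> x) = - (LINT x|lebesgue. G x $ i * \<phi> x)"
    "(LINT x|lebesgue. v x * partial_deriv i \<phi> x) = - (LINT x|lebesgue. H x $ i * \<phi> x)"
    using u v p by (auto simp: has_L2_weak_gradient_def)
  then show "(LINT x|lebesgue. (u x - v x) * partial_deriv i \<phi> x)
      = - (LINT x|lebesgue. (\<chi> i. G x $ i - H x $ i) $ i * \<phi> x)"
    using L2_prod_integrable[OF u(1) pL(2)] L2_prod_integrable[OF v(1) pL(2)] L2_prod_integrable[OF
        GL pL(1)] L2_prod_integrable[OF HL pL(1)]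
    by (simp add: left_diff_distrib)
qed

lemma H1_weak_grad: "u \<in> H1 \<Longrightarrow> has_L2_weak_gradient u (weak_grad u)"
  using someI_ex[of "has_L2_weak_gradient u"] by (simp add: H1_def weak_grad_def)

lemma H1I: "u \<in> L2 \<Longrightarrow> has_L2_weak_gradient u G \<Longrightarrow> u \<in> H1"
  by (auto simp: H1_def)

lemma weak_grad_AE:
  assumes "u \<in> L2" "has_L2_weak_gradient u G"
  shows "AE x in lebesgue. \<forall>i. weak_grad u x $ i = G x $ i"
  using weak_gradient_unique[OF H1_weak_grad[OF H1I[OF assms]] assms(2)]
      by (simp add: AE_all_countable)

lemma weak_grad_L2: "has_L2_weak_gradient u G \<Longrightarrow> (\<lambda>x. G x $ i) \<in> L2"
  by (simp add: has_L2_weak_gradient_def)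

text \<open>The gradient is a separate argument because a weak gradient is fixed only up to null
  sets. The energy can thus be followed along L2 limits of functions and gradients, and it agrees
  with \<open>energy\<close> on \<open>C1c\<close>. \<open>wresidual\<close> is arranged in the same
  way.\<close>

definition wenergy :: "real \<Rightarrow> real \<Rightarrow> (real^3 \<Rightarrow> complex)
    \<Rightarrow> (real^3 \<Rightarrow> complex^3) \<Rightarrow> real" where
  "wenergy d e u G = (\<Sum>i\<in>UNIV. (L2_norm (\<lambda>x. G x $ i))\<^sup>2)
      + (L2_norm (\<lambda>x. of_real (sqrt (wtot d e x)) * u x))\<^sup>2 + (L2_norm u)\<^sup>2"

lemma sqrt_wtot:
  assumes "0 < e" "0 \<le> d"
  shows "(\<lambda>x. complex_of_real (sqrt (wtot d e x))) \<in> borel_measurable lebesgue"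
    and "cmod (complex_of_real (sqrt (wtot d e x))) \<le> sqrt (1 / (e\<^sup>2 * d))"
proof -
  note [measurable] = wtot_measurable[of d e]
  show "(\<lambda>x. complex_of_real (sqrt (wtot d e x))) \<in> borel_measurable lebesgue"
      by measurable
  show "cmod (complex_of_real (sqrt (wtot d e x))) \<le> sqrt (1 / (e\<^sup>2 * d))"
    unfolding norm_of_real using wtot_bounds[OF assms, of x]
        by (simp only: abs_of_nonneg real_sqrt_ge_zero real_sqrt_le_mono)
qed

lemma wtot_complex:
  assumes "0 < e" "0 \<le> d"
  shows "(\<lambda>x. complex_of_real (wtot d e x)) \<in> borel_measurable lebesgue"
    and "cmod (complex_of_real (wtot d e x)) \<le> 1 / (e\<^sup>2 * d)"
proof -
  note [measurable] = wtot_measurable[of d e]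
  show "(\<lambda>x. complex_of_real (wtot d e x)) \<in> borel_measurable lebesgue" by measurable
  show "cmod (complex_of_real (wtot d e x)) \<le> 1 / (e\<^sup>2 * d)"
    unfolding norm_of_real using wtot_bounds[OF assms, of x] by (simp only: abs_of_nonneg)
qed

lemma wenergy_C1c:
  assumes e: "0 < e" "0 \<le> d" and w: "C1c w"
  shows "wenergy d e w (\<lambda>x. \<chi> i. partial_deriv i w x) = energy d e w"
proof -
  have "(cmod (of_real (sqrt (wtot d e x)) * w x))\<^sup>2 = wtot d e x * sq w x" for x
    using wtot_bounds(1)[OF e, of x] by (simp add: norm_mult power_mult_distrib sq_def)
  then have "(L2_norm (\<lambda>x. of_real (sqrt (wtot d e x)) * w x))\<^sup>2 = wgt2 d e w"
    unfolding L2_norm_square wgt2_def by simp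
  then show ?thesis
    by (simp add: wenergy_def energy_def integral_gsq[OF w] grd2_def nrm2_L2_norm)
qed

lemma wenergy_lim:
  assumes e: "0 < e" "0 \<le> d" and u: "L2_lim s u"
      and G: "\<And>i. L2_lim (\<lambda>n x. S n x $ i) (\<lambda>x. G x $ i)"
  shows "(\<lambda>n. wenergy d e (s n) (S n)) \<longlonglongrightarrow> wenergy d e u G"
  unfolding wenergy_def
  by (intro tendsto_add tendsto_sum tendsto_power L2_lim_norm u G L2_lim_weight[OF u sqrt_wtot(1)[OF
      e] sqrt_wtot(2)[OF e]])

definition wresidual :: "real \<Rightarrow> real \<Rightarrow> (real^3 \<Rightarrow> complex)
    \<Rightarrow> (real^3 \<Rightarrow> complex) \<Rightarrow> (real^3 \<Rightarrow> complex)
    \<Rightarrow> (real^3 \<Rightarrow> complex^3) \<Rightarrow> complex" where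
  "wresidual d e F Y u G = (LINT x|lebesgue. F x * cnj (u x))
     - (\<Sum>i\<in>UNIV. LINT x|lebesgue. partial_deriv i Y x * cnj (G x $ i))
     - (LINT x|lebesgue. (of_real (wtot d e x) * Y x) * cnj (u x)) - (LINT x|lebesgue. Y x * cnj
         (u x))"

lemma wresidual_C1c:
  assumes Y: "C1c Y" and w: "C1c w"
  shows "wresidual d e F Y w (\<lambda>x. \<chi> i. partial_deriv i w x) = residual d e F Y w"
proof -
  have "(LINT x|lebesgue. (\<Sum>i\<in>UNIV. partial_deriv i Y x * cnj (partial_deriv i w x)))
      = (\<Sum>i\<in>UNIV. LINT x|lebesgue. partial_deriv i Y x * cnj (partial_deriv i w x))"
    by (intro Bochner_Integration.integral_sum L2_prod_integrable L2_cnj C1c_L2 Y w)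
  then show ?thesis by (simp add: wresidual_def residual_def mult.assoc)
qed

lemma wresidual_lim:
  assumes e: "0 < e" "0 \<le> d" and F: "F \<in> L2" and Y: "C1c Y"
    and u: "L2_lim s u" and G: "\<And>i. L2_lim (\<lambda>n x. S n x $ i) (\<lambda>x. G x $ i)"
  shows "(\<lambda>n. wresidual d e F Y (s n) (S n))
      \<longlonglongrightarrow> wresidual d e F Y u G"
  unfolding wresidual_def
  by (intro tendsto_diff tendsto_sum L2_lim_prod L2_lim_cnj u G F C1c_L2 Y L2_weight(1)[OF _
      wtot_complex(1)[OF e] wtot_complex(2)[OF e]])

text \<open>Both sides are continuous under L2 convergence of the function and its gradient, and
  \<open>approx\<close> supplies test functions for which the inequality is known.\<close>

lemma wresidual_bound:
  assumes e: "0 < e" "0 \<le> d" and F: "F \<in> L2" and Y: "C1c Y"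
    and bound: "\<And>w. C1c w \<Longrightarrow> cmod (residual d e F Y w)
        \<le> K * sqrt (energy d e w)"
    and u: "u \<in> L2" and G: "has_L2_weak_gradient u G"
  shows "cmod (wresidual d e F Y u G) \<le> K * sqrt (wenergy d e u G)"
proof (rule LIMSEQ_le)
  let ?s = "\<lambda>n. approx u n"
      and ?S = "\<lambda>n x. \<chi> i. partial_deriv i (approx u n) x"
  have l: "L2_lim ?s u" "L2_lim (\<lambda>n x. ?S n x $ i) (\<lambda>x. G x $ i)" for i
    using approx_lim[OF u] approx_grad_lim[OF u G] by auto
  show "(\<lambda>n. cmod (wresidual d e F Y (?s n) (?S n)))
      \<longlonglongrightarrow> cmod (wresidual d e F Y u G)"
    by (intro tendsto_norm wresidual_lim e F Y l)
  show "(\<lambda>n. K * sqrt (wenergy d e (?s n) (?S n)))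
      \<longlonglongrightarrow> K * sqrt (wenergy d e u G)"
    by (intro tendsto_mult tendsto_const tendsto_real_sqrt wenergy_lim e l)
  show "\<exists>N. \<forall>n\<ge>N. cmod (wresidual d e F Y (?s n) (?S n))
      \<le> K * sqrt (wenergy d e (?s n) (?S n))"
    using bound[OF C1c_test[OF approx_test[OF u]]]
    by (simp add: wresidual_C1c[OF Y C1c_test[OF approx_test[OF u]]] wenergy_C1c[OF e C1c_test[OF
        approx_test[OF u]]])
qed

text \<open>The equation for U with an arbitrary weak gradient R of the test function in place of
  the chosen one, and with the penalty written as an integral.\<close>

lemma penalised_identity:
  assumes e: "0 < e" and d: "0 \<le> d" "d \<le> 1/2" and U: "solves_penalised e d F U"
    and r: "r \<in> L2" and R: "has_L2_weak_gradient r R"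
  shows "(\<Sum>i\<in>UNIV. LINT x|lebesgue. weak_grad U x $ i * cnj (R x $ i))
      + (LINT x|lebesgue. (of_real (wtot d e x) * U x) * cnj (r x))
    + (LINT x|lebesgue. U x * cnj (r x)) = (LINT x|lebesgue. F x * cnj (r x))"
proof -
  have UH: "U \<in> H1" using U by (simp add: solves_penalised_def)
  have UL: "U \<in> L2" using UH by (simp add: H1_def)
  note GL = weak_grad_L2[OF H1_weak_grad[OF UH]] and RL = weak_grad_L2[OF R]
  have rH: "r \<in> H1" by (rule H1I[OF r R])
  note rL = weak_grad_L2[OF H1_weak_grad[OF rH]]
  have "(LINT x|lebesgue. (\<Sum>i\<in>UNIV. weak_grad U x $ i * cnj (weak_grad r x $ i)))
      = (LINT x|lebesgue. (\<Sum>i\<in>UNIV. weak_grad U x $ i * cnj (R x $ i)))"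
  proof (rule integral_cong_AE)
    show "(\<lambda>x. \<Sum>i\<in>UNIV. weak_grad U x $ i * cnj (weak_grad r x $ i)) \<in>
        borel_measurable lebesgue"
      "(\<lambda>x. \<Sum>i\<in>UNIV. weak_grad U x $ i * cnj (R x $ i)) \<in> borel_measurable
          lebesgue"
      by (intro borel_measurable_sum borel_measurable_times L2_measurable GL L2_cnj rL RL)+
    show "AE x in lebesgue. (\<Sum>i\<in>UNIV. weak_grad U x $ i * cnj (weak_grad r x $ i))
        = (\<Sum>i\<in>UNIV. weak_grad U x $ i * cnj (R x $ i))"
      using weak_grad_AE[OF r R] by eventually_elim simp
  qed
  also have "\<dots> = (\<Sum>i\<in>UNIV. LINT x|lebesgue. weak_grad U x $ i * cnj (R x $ i))"
    by (intro Bochner_Integration.integral_sum L2_prod_integrable GL L2_cnj RL)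
  finally have 1: "(LINT x|lebesgue. (\<Sum>i\<in>UNIV. weak_grad U x $ i * cnj
      (weak_grad r x $ i))) = (\<Sum>i\<in>UNIV. LINT x|lebesgue. weak_grad U x $ i * cnj
      (R x $ i))" .
  have 2: "penalty e d U r = (LINT x|lebesgue. (of_real (wtot d e x) * U x) * cnj (r x))"
    using penalty_eq[OF e d L2_prod_integrable[OF UL L2_cnj[OF r]]] by (simp add: mult.assoc)
  show ?thesis using U rH unfolding solves_penalised_def 1[symmetric] 2[symmetric] by blast
qed

text \<open>The equation for U is tested with the difference r = U - Y: the energy of r equals the
  integral of (F - F') times the conjugate of r plus the residual of Y at r. Both are at most a
  constant times the square root of that energy, which is divided out. F' stands beside F because Y
  is built from an approximation of the effective solution.\<close>

lemma energy_estimate: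
  assumes e: "0 < e" and d: "0 \<le> d" "d \<le> 1/2" and U: "solves_penalised e d F U"
    and F: "F \<in> L2" "F' \<in> L2" and Y: "C1c Y" and K: "0 \<le> K"
    and bound: "\<And>w. C1c w \<Longrightarrow> cmod (residual d e F' Y w)
        \<le> K * sqrt (energy d e w)"
  defines "r \<equiv> \<lambda>x. U x - Y x"
      and "R \<equiv> \<lambda>x. \<chi> i. weak_grad U x $ i - partial_deriv i Y x"
  shows "sqrt (wenergy d e r R) \<le> L2_norm (\<lambda>x. F x - F' x) + K"
proof -
  have UH: "U \<in> H1" using U by (simp add: solves_penalised_def)
  have UL: "U \<in> L2" using UH by (simp add: H1_def)
  note YL = C1c_L2[OF Y]
  have rL: "r \<in> L2" unfolding r_def by (rule L2_diff[OF UL YL(1)])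
  have R: "has_L2_weak_gradient r R"
    using weak_gradient_diff[OF UL H1_weak_grad[OF UH] YL(1) C1c_weak_gradient[OF Y]]
        by (simp add: r_def R_def)
  note RL = weak_grad_L2[OF R] and GL = weak_grad_L2[OF H1_weak_grad[OF UH]]
  define W where "W x = complex_of_real (wtot d e x)" for x
  have WL: "(\<lambda>x. W x * u x) \<in> L2" if "u \<in> L2" for u
    unfolding W_def by (rule L2_weight(1)[OF that wtot_complex(1)[OF e d(1)] wtot_complex(2)[OF e
        d(1)]])
  define n where "n = L2_norm r"
  define E where "E = wenergy d e r R"
  have sqi: "complex_of_real ((L2_norm u)\<^sup>2) = (LINT x|lebesgue. u x * cnj (u x))" for u
    unfolding L2_norm_sq sq_eq by simp
  have wq: "complex_of_real ((L2_norm (\<lambda>x. of_real (sqrt (wtot d e x)) * r x))\<^sup>2)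
      = (LINT x|lebesgue. (W x * r x) * cnj (r x))"
  proof -
    have "(of_real (sqrt (wtot d e x)) * r x) * cnj (of_real (sqrt (wtot d e x)) * r x)
        = (W x * r x) * cnj (r x)" for x
    proof -
      have "complex_of_real (sqrt (wtot d e x)) * of_real (sqrt (wtot d e x)) = W x"
        unfolding W_def of_real_mult[symmetric] using wtot_bounds(1)[OF e d(1), of x] by simp
      then show ?thesis by (simp add: mult_ac)
    qed
    then show ?thesis unfolding sqi by (simp only:)
  qed
  have "complex_of_real E = (\<Sum>i\<in>UNIV. LINT x|lebesgue. R x $ i * cnj (R x $ i))
      + (LINT x|lebesgue. (W x * r x) * cnj (r x)) + (LINT x|lebesgue. r x * cnj (r x))"
    unfolding E_def wenergy_def of_real_add of_real_sum wq unfolding sqi ..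
  also have "(\<Sum>i\<in>UNIV. LINT x|lebesgue. R x $ i * cnj (R x $ i))
      = (\<Sum>i\<in>UNIV. LINT x|lebesgue. weak_grad U x $ i * cnj (R x $ i)) -
      (\<Sum>i\<in>UNIV. LINT x|lebesgue. partial_deriv i Y x * cnj (R x $ i))"
  proof -
    have "(LINT x|lebesgue. R x $ i * cnj (R x $ i))
        = (LINT x|lebesgue. weak_grad U x $ i * cnj (R x $ i)) - (LINT x|lebesgue. partial_deriv i Y
        x * cnj (R x $ i))" for i
    proof -
      have "(LINT x|lebesgue. R x $ i * cnj (R x $ i))
          = (LINT x|lebesgue. weak_grad U x $ i * cnj (R x $ i) - partial_deriv i Y x * cnj
          (R x $ i))"
        by (rule Bochner_Integration.integral_cong[OF refl]) (simp add: R_def algebra_simps)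
      also have "\<dots> = (LINT x|lebesgue. weak_grad U x $ i * cnj (R x $ i))
          - (LINT x|lebesgue. partial_deriv i Y x * cnj (R x $ i))"
        by (intro Bochner_Integration.integral_diff L2_prod_integrable GL YL L2_cnj RL)
      finally show ?thesis .
    qed
    then show ?thesis by (simp add: sum_subtractf)
  qed
  also have "(LINT x|lebesgue. (W x * r x) * cnj (r x)) = (LINT x|lebesgue. (W x * U x) * cnj (r x))
      - (LINT x|lebesgue. (W x * Y x) * cnj (r x))"
  proof -
    have "(LINT x|lebesgue. (W x * r x) * cnj (r x))
        = (LINT x|lebesgue. (W x * U x) * cnj (r x) - (W x * Y x) * cnj (r x))"
      by (rule Bochner_Integration.integral_cong[OF refl]) (simp add: r_def algebra_simps)
    also have "\<dots> = (LINT x|lebesgue. (W x * U x) * cnj (r x))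
        - (LINT x|lebesgue. (W x * Y x) * cnj (r x))"
      by (intro Bochner_Integration.integral_diff L2_prod_integrable WL UL YL L2_cnj rL)
    finally show ?thesis .
  qed
  also have "(LINT x|lebesgue. r x * cnj (r x)) = (LINT x|lebesgue. U x * cnj (r x))
      - (LINT x|lebesgue. Y x * cnj (r x))"
  proof -
    have "(LINT x|lebesgue. r x * cnj (r x)) = (LINT x|lebesgue. U x * cnj (r x) - Y x * cnj (r x))"
      by (rule Bochner_Integration.integral_cong[OF refl]) (simp add: r_def algebra_simps)
    also have "\<dots> = (LINT x|lebesgue. U x * cnj (r x)) - (LINT x|lebesgue. Y x * cnj (r x))"
      by (intro Bochner_Integration.integral_diff L2_prod_integrable UL YL L2_cnj rL)
    finally show ?thesis .
  qed
  finally have "complex_of_real E = (LINT x|lebesgue. F x * cnj (r x))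
      - (LINT x|lebesgue. F' x * cnj (r x)) + wresidual d e F' Y r R"
    unfolding penalised_identity[OF e d U rL R, symmetric] wresidual_def W_def
        by (simp add: algebra_simps)
  also have "(LINT x|lebesgue. F x * cnj (r x)) - (LINT x|lebesgue. F' x * cnj (r x))
      = (LINT x|lebesgue. (F x - F' x) * cnj (r x))"
    unfolding left_diff_distrib
    by (intro Bochner_Integration.integral_diff[symmetric] L2_prod_integrable F L2_cnj rL)
  finally have "cmod (complex_of_real E) \<le> cmod (LINT x|lebesgue. (F x - F' x) * cnj (r x))
      + cmod (wresidual d e F' Y r R)"
    by (simp only: norm_triangle_ineq)
  also have "\<dots> \<le> L2_norm (\<lambda>x. F x - F' x) * n + K * sqrt E"
    unfolding n_def E_def using L2_prod_bound[OF L2_diff[OF F] L2_cnj[OF rL]]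
    by (intro add_mono wresidual_bound e d F Y bound rL R) simp_all
  also have "n \<le> sqrt E"
  proof -
    have "n\<^sup>2 \<le> E" unfolding n_def E_def wenergy_def by (simp add: sum_nonneg)
    then show ?thesis by (rule real_le_rsqrt)
  qed
  then have "L2_norm (\<lambda>x. F x - F' x) * n + K * sqrt E
      \<le> L2_norm (\<lambda>x. F x - F' x) * sqrt E + K * sqrt E"
    by (intro add_mono mult_left_mono order_refl) auto
  finally have main: "E \<le> (L2_norm (\<lambda>x. F x - F' x) + K) * sqrt E"
      by (simp add: distrib_right)
  have E0: "0 \<le> E" unfolding E_def wenergy_def by (simp add: sum_nonneg)
  show ?thesis
  proof (cases "E = 0")
    case True then show ?thesis using K unfolding E_def by simp
  next
    case False
    then have "0 < sqrt E" using E0 by simp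
    moreover have "sqrt E * sqrt E \<le> (L2_norm (\<lambda>x. F x - F' x) + K) * sqrt E"
        using main E0 by simp
    ultimately show ?thesis unfolding E_def[symmetric] by (simp only: mult_le_cancel_right_pos)
  qed
qed

lemma wenergy_parts:
  shows "L2_norm u \<le> sqrt (wenergy d e u G)" "L2_norm (\<lambda>x. G x $ i)
      \<le> sqrt (wenergy d e u G)"
proof -
  show "L2_norm u \<le> sqrt (wenergy d e u G)"
    by (rule real_le_rsqrt) (simp add: wenergy_def sum_nonneg)
  have "(L2_norm (\<lambda>x. G x $ i))\<^sup>2
      \<le> (\<Sum>i\<in>UNIV. (L2_norm (\<lambda>x. G x $ i))\<^sup>2)"
    by (rule member_le_sum) auto
  then show "L2_norm (\<lambda>x. G x $ i) \<le> sqrt (wenergy d e u G)"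
    by (intro real_le_rsqrt) (simp add: wenergy_def add_increasing2)
qed

text \<open>V is approximated by test functions \<open>v n\<close>, whose corrections are
  \<open>Y n\<close>. Along the chain U, \<open>Y n\<close>, \<open>v n\<close>, V the residual
  contributes 127 e, the correction e in L2 and 6 sqrt e in the gradient, and the remaining terms
  vanish as n grows. Hence 128 = 127 + 1 and, by e \<le> sqrt e, 133 = 127 + 6.\<close>

lemma difference_estimate:
  assumes e: "0 < e" "e < 1" and d: "0 \<le> d" "d \<le> 1/2" and F: "F \<in> L2"
    and U: "solves_penalised e d F U" and V: "solves_effective (d / e) F V"
  shows "L2_norm (\<lambda>x. U x - V x) \<le> 128 * e * L2_norm F"
    and "L2_norm (\<lambda>x. weak_grad U x $ i - weak_grad V x $ i) \<le> 133 * sqrt e * L2_norm F"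
proof -
  define b where "b = 4 / 3 * pi * (d / e)\<^sup>2 + 1"
  have UH: "U \<in> H1" and VH: "V \<in> H1" using U V
      by (auto simp: solves_penalised_def solves_effective_def)
  have UL: "U \<in> L2" and VL: "V \<in> L2" using UH VH by (auto simp: H1_def)
  note GU = H1_weak_grad[OF UH] and GV = H1_weak_grad[OF VH]
  define v where "v = approx V"
  define Fn where "Fn n x = - laplacian (v n) x + of_real b * v n x" for n x
  have vt: "v n \<in> test_functions" for n unfolding v_def by (rule approx_test[OF VL])
  note vL = C1c_L2[OF C1c_test[OF vt]]
  have lv: "L2_lim v V" and lg: "L2_lim (\<lambda>n. partial_deriv i (v n)) (\<lambda>x. weak_grad V
      x $ i)" for i
    unfolding v_def by (rule approx_lim[OF VL] approx_grad_lim[OF VL GV])+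
  have lF: "L2_lim Fn F" unfolding Fn_def[abs_def] v_def b_def
      by (rule approx_effective_lim[OF V F])
  then have FnL: "Fn n \<in> L2" for n by (simp add: L2_lim_def)
  define P where "P n Y \<longleftrightarrow> C1c Y \<and> L2_norm (\<lambda>x. v n x - Y x)
      \<le> e * L2_norm (Fn n) \<and> grd2 (\<lambda>x. v n x - Y x) \<le>
      (6 * sqrt e * L2_norm (Fn n))\<^sup>2 \<and>
    (\<forall>w. C1c w \<longrightarrow> cmod (residual d e (Fn n) Y w) \<le> 127 * e * L2_norm
        (Fn n) * sqrt (energy d e w))" for n Y
  have "\<exists>Y. P n Y" for n
    unfolding P_def Fn_def[abs_def] using corrector_exists[OF e d vt b_def] by blast
  then obtain Y where PY: "\<And>n. P n (Y n)" by metis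
  have Y: "\<And>n. C1c (Y n)" "\<And>n. L2_norm (\<lambda>x. v n x - Y n x)
      \<le> e * L2_norm (Fn n)"
    "\<And>n. grd2 (\<lambda>x. v n x - Y n x) \<le> (6 * sqrt e * L2_norm (Fn n))\<^sup>2"
    "\<And>n w. C1c w \<Longrightarrow> cmod (residual d e (Fn n) (Y n) w)
        \<le> 127 * e * L2_norm (Fn n) * sqrt (energy d e w)"
    using PY unfolding P_def by blast+
  note YL = C1c_L2[OF Y(1)]
  have est: "sqrt (wenergy d e (\<lambda>x. U x - Y n x) (\<lambda>x. \<chi> i. weak_grad U x $ i
      - partial_deriv i (Y n) x))
      \<le> L2_norm (\<lambda>x. F x - Fn n x) + 127 * e * L2_norm (Fn n)" for n
    by (rule energy_estimate[OF e(1) d U F FnL Y(1) _ Y(4)]) (use e in auto)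
  have l1: "(\<lambda>n. L2_norm (\<lambda>x. F x - Fn n x)) \<longlonglongrightarrow> 0"
    unfolding L2_norm_minus_commute[of F] using lF by (simp add: L2_lim_def)
  have l2: "(\<lambda>n. L2_norm (Fn n)) \<longlonglongrightarrow> L2_norm F"
      by (rule L2_lim_norm[OF lF])
  have l3: "(\<lambda>n. L2_norm (\<lambda>x. v n x - V x)) \<longlonglongrightarrow> 0" using lv
      by (simp add: L2_lim_def)
  have l4: "(\<lambda>n. L2_norm (\<lambda>x. partial_deriv i (v n) x - weak_grad V x $ i))
      \<longlonglongrightarrow> 0" using lg[of i] by (simp add: L2_lim_def)
  have b1: "L2_norm (\<lambda>x. U x - V x)
      \<le> (L2_norm (\<lambda>x. F x - Fn n x) + 127 * e * L2_norm (Fn n)) +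
      (e * L2_norm (Fn n) + L2_norm (\<lambda>x. v n x - V x))" for n
  proof -
    have "L2_norm (\<lambda>x. U x - V x) \<le> L2_norm (\<lambda>x. U x - Y n x)
        + L2_norm (\<lambda>x. Y n x - V x)"
      by (rule L2_triangle_diff[OF UL YL(1) VL])
    also have "L2_norm (\<lambda>x. Y n x - V x) \<le> L2_norm (\<lambda>x. Y n x - v n x)
        + L2_norm (\<lambda>x. v n x - V x)"
      by (rule L2_triangle_diff[OF YL(1) vL(1) VL])
    finally show ?thesis
      using order_trans[OF wenergy_parts(1) est[of n]] Y(2)[of n] L2_norm_minus_commute[of "Y n"
          "v n"] by linarith
  qed
  have b2: "L2_norm (\<lambda>x. weak_grad U x $ i - weak_grad V x $ i)
    \<le> (L2_norm (\<lambda>x. F x - Fn n x) + 127 * e * L2_norm (Fn n)) +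
        (6 * sqrt e * L2_norm (Fn n) + L2_norm (\<lambda>x. partial_deriv i (v n) x - weak_grad V x
        $ i))" for n
  proof -
    note GUL = weak_grad_L2[OF GU, of i] and GVL = weak_grad_L2[OF GV, of i]
    have 1: "L2_norm (\<lambda>x. weak_grad U x $ i - weak_grad V x $ i)
        \<le> L2_norm (\<lambda>x. weak_grad U x $ i - partial_deriv i (Y n) x) + L2_norm
        (\<lambda>x. partial_deriv i (Y n) x - weak_grad V x $ i)"
      by (rule L2_triangle_diff[OF GUL YL(2) GVL])
    have 2: "L2_norm (\<lambda>x. partial_deriv i (Y n) x - weak_grad V x $ i)
        \<le> L2_norm (\<lambda>x. partial_deriv i (Y n) x - partial_deriv i (v n) x) + L2_norm
        (\<lambda>x. partial_deriv i (v n) x - weak_grad V x $ i)"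
      by (rule L2_triangle_diff[OF YL(2) vL(2) GVL])
    have 3: "L2_norm (\<lambda>x. weak_grad U x $ i - partial_deriv i (Y n) x)
        \<le> L2_norm (\<lambda>x. F x - Fn n x) + 127 * e * L2_norm (Fn n)"
      using order_trans[OF wenergy_parts(2)[of "\<lambda>x. \<chi> i. weak_grad U x $ i
          - partial_deriv i (Y n) x" i] est[of n]] by simp
    have 4: "L2_norm (\<lambda>x. partial_deriv i (Y n) x - partial_deriv i (v n) x)
        \<le> 6 * sqrt e * L2_norm (Fn n)"
    proof (rule power2_le_imp_le)
      have dc: "C1c (\<lambda>x. v n x - Y n x)" by (rule C1c_diff[OF C1c_test[OF vt] Y(1)])
      have "partial_deriv i (\<lambda>x. v n x - Y n x)
          = (\<lambda>x. partial_deriv i (v n) x - partial_deriv i (Y n) x)"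
        by (intro ext partial_deriv_diff C1c_differentiable C1c_test vt Y(1))
      then have "(L2_norm (\<lambda>x. partial_deriv i (v n) x - partial_deriv i (Y n) x))\<^sup>2
          \<le> grd2 (\<lambda>x. v n x - Y n x)"
        unfolding grd2_def integral_gsq[OF dc]
        using member_le_sum[of i UNIV
            "\<lambda>i. (L2_norm (partial_deriv i (\<lambda>x. v n x - Y n x)))\<^sup>2"] by simp
      then show "(L2_norm (\<lambda>x. partial_deriv i (Y n) x - partial_deriv i (v n) x))\<^sup>2
          \<le> (6 * sqrt e * L2_norm (Fn n))\<^sup>2"
        unfolding L2_norm_minus_commute[of "partial_deriv i (Y n)"] using Y(3)[of n] by linarith
    qed (use e in simp)
    show ?thesis using 1 2 3 4 by linarith
  qed
  have "L2_norm (\<lambda>x. U x - V x) \<le> (0 + 127 * e * L2_norm F) + (e * L2_norm F + 0)"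
  proof (rule LIMSEQ_le_const)
    show "(\<lambda>n. (L2_norm (\<lambda>x. F x - Fn n x) + 127 * e * L2_norm (Fn n))
        + (e * L2_norm (Fn n) + L2_norm (\<lambda>x. v n x - V x))) \<longlonglongrightarrow>
        (0 + 127 * e * L2_norm F) + (e * L2_norm F + 0)"
      by (intro tendsto_add tendsto_mult tendsto_const l1 l2 l3)
  qed (use b1 in blast)
  then show "L2_norm (\<lambda>x. U x - V x) \<le> 128 * e * L2_norm F" by simp
  have "L2_norm (\<lambda>x. weak_grad U x $ i - weak_grad V x $ i) \<le> (0 + 127 * e * L2_norm F)
      + (6 * sqrt e * L2_norm F + 0)"
  proof (rule LIMSEQ_le_const)
    show "(\<lambda>n. (L2_norm (\<lambda>x. F x - Fn n x) + 127 * e * L2_norm (Fn n))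
        + (6 * sqrt e * L2_norm (Fn n) + L2_norm (\<lambda>x. partial_deriv i (v n) x - weak_grad V
        x $ i))) \<longlonglongrightarrow> (0 + 127 * e * L2_norm F) + (6 * sqrt e * L2_norm F + 0)"
      by (intro tendsto_add tendsto_mult tendsto_const l1 l2 l4)
  qed (use b2 in blast)
  also have "\<dots> \<le> 127 * sqrt e * L2_norm F + 6 * sqrt e * L2_norm F"
  proof -
    have "e * e \<le> e * 1" using e by (intro mult_left_mono) auto
    then have "e \<le> sqrt e" using e by (intro real_le_rsqrt) (simp add: power2_eq_square)
    then have "127 * e * L2_norm F \<le> 127 * sqrt e * L2_norm F" by (intro mult_right_mono) auto
    then show ?thesis by linarith
  qed
  finally show "L2_norm (\<lambda>x. weak_grad U x $ i - weak_grad V x $ i)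
      \<le> 133 * sqrt e * L2_norm F" by linarith
qed

theorem theorem7p26:
  "\<exists>c::real. c > 0 \<and>
     (\<forall>\<epsilon> \<delta> :: real. \<forall>F U V :: real^3 \<Rightarrow> complex.
        0 < \<epsilon> \<longrightarrow> \<epsilon> < 1 \<longrightarrow> 0 \<le> \<delta> \<longrightarrow> \<delta> \<le> 1/2 \<longrightarrow> F \<in> L2 \<longrightarrow>
        solves_penalised \<epsilon> \<delta> F U \<longrightarrow> solves_effective (\<delta> / \<epsilon>) F V \<longrightarrow>
        H1_norm (\<lambda>x. U x - V x) \<le> c * \<epsilon> powr (1/2) * L2_norm F \<and>
        L2_norm (\<lambda>x. U x - V x) \<le> c * \<epsilon> * L2_norm F)"
\<comment> \<open>A generous value: the H1 norm combines four L2 norms, each at most 133 sqrt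
  \<epsilon> times the norm of F, so already 266 = 2 * 133 would do.\<close>
proof (intro exI[of _ "1000 :: real"] conjI allI impI)
  fix \<epsilon> \<delta> :: real and F U V :: "real^3 \<Rightarrow> complex"
  assume e: "0 < \<epsilon>" "\<epsilon> < 1" and d: "0 \<le> \<delta>" "\<delta> \<le> 1/2"
      and F: "F \<in> L2"
    and U: "solves_penalised \<epsilon> \<delta> F U"
        and V: "solves_effective (\<delta> / \<epsilon>) F V"
  note D = difference_estimate[OF e d F U V]
  have "128 * \<epsilon> * L2_norm F \<le> 1000 * \<epsilon> * L2_norm F" using e
      by (intro mult_right_mono) auto
  with D(1) show "L2_norm (\<lambda>x. U x - V x) \<le> 1000 * \<epsilon> * L2_norm F" by linarith
  have UH: "U \<in> H1" and VH: "V \<in> H1" using U V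
      by (auto simp: solves_penalised_def solves_effective_def)
  then have UL: "U \<in> L2" and VL: "V \<in> L2" by (auto simp: H1_def)
  note G = weak_gradient_diff[OF UL H1_weak_grad[OF UH] VL H1_weak_grad[OF VH]]
  define K where "K = sqrt \<epsilon> * L2_norm F"
  have K0: "0 \<le> K" using e by (simp add: K_def)
  have g: "L2_norm (\<lambda>x. weak_grad (\<lambda>x. U x - V x) x $ i) \<le> 133 * K" for i
  proof -
    have "L2_norm (\<lambda>x. weak_grad (\<lambda>x. U x - V x) x $ i)
        = L2_norm (\<lambda>x. weak_grad U x $ i - weak_grad V x $ i)"
    proof (rule L2_norm_cong_AE)
      show "AE x in lebesgue. weak_grad (\<lambda>x. U x - V x) x $ i
          = weak_grad U x $ i - weak_grad V x $ i"
        using weak_grad_AE[OF L2_diff[OF UL VL] G] by eventually_elim simp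
      show "(\<lambda>x. weak_grad (\<lambda>x. U x - V x) x $ i) \<in> borel_measurable lebesgue"
        by (rule L2_measurable[OF weak_grad_L2[OF H1_weak_grad[OF H1I[OF L2_diff[OF UL VL] G]]]])
      show "(\<lambda>x. weak_grad U x $ i - weak_grad V x $ i) \<in> borel_measurable lebesgue"
        by (intro L2_measurable L2_diff weak_grad_L2[OF H1_weak_grad[OF UH]] weak_grad_L2[OF
            H1_weak_grad[OF VH]])
    qed
    then show ?thesis using D(2)[of i] by (simp add: K_def)
  qed
  have l: "L2_norm (\<lambda>x. U x - V x) \<le> 133 * K"
  proof -
    have "\<epsilon> * \<epsilon> \<le> \<epsilon> * 1" using e by (intro mult_left_mono) auto
    then have "\<epsilon> \<le> sqrt \<epsilon>" using e
        by (intro real_le_rsqrt) (simp add: power2_eq_square)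
    then have "128 * \<epsilon> * L2_norm F \<le> 133 * sqrt \<epsilon> * L2_norm F" using e
        by (intro mult_right_mono) auto
    then show ?thesis using D(1) by (simp add: K_def)
  qed
  have "H1_norm (\<lambda>x. U x - V x) \<le> 1000 * K"
    unfolding H1_norm_def
  proof (rule real_le_lsqrt)
    have "(L2_norm (\<lambda>x. U x - V x))\<^sup>2
        + (\<Sum>i\<in>UNIV. (L2_norm (\<lambda>x. weak_grad (\<lambda>x. U x - V x) x $
        i))\<^sup>2) \<le> (133 * K)\<^sup>2 + (\<Sum>i\<in>(UNIV :: 3 set). (133 * K)\<^sup>2)"
      by (intro add_mono sum_mono power_mono l g) auto
    also have "\<dots> \<le> (1000 * K)\<^sup>2" by (simp add: power_mult_distrib)
    finally show "(L2_norm (\<lambda>x. U x - V x))\<^sup>2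
        + (\<Sum>i\<in>UNIV. (L2_norm (\<lambda>x. weak_grad (\<lambda>x. U x - V x) x $
        i))\<^sup>2) \<le> (1000 * K)\<^sup>2" .
  qed (use K0 in auto)
  then show "H1_norm (\<lambda>x. U x - V x) \<le> 1000 * \<epsilon> powr (1/2) * L2_norm F"
    using e by (simp add: K_def powr_half_sqrt)
qed simp

end
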